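(* Assume that $\gamma_+<\gamma_-$. Let $0<T<\infty$ and let $I_f(\tau,T)$, $\tau>0$, be the indicator function defined in the context. Then $$\lim_{\tau\to\infty}e^{\tau T}I_f(\tau,T)=\begin{cases}0, & \text{if } T<2l(D,B),\\ \infty, & \text{if } T>2l(D,B)\text{ and }\gamma\text{ satisfies (A1)},\\ -\infty, & \text{if } T>2l(D,B)\text{ and }\gamma\text{ satisfies (A2)},\end{cases}$$ where (A1) and (A2) are the following conditions: (A1) there exists a constant $C'>0$ such that $-h(x)\xi\cdot\xi\ge C'|\xi|^2$ for all $\xi\in\mathbb{R}^3$ and a.e. $x\in D$; (A2) there exists a constant $C'>0$ such that $h(x)\xi\cdot\xi\ge C'|\xi|^2$ for all $\xi\in\mathbb{R}^3$ and a.e. $x\in D$. Moreover, if $\gamma$ satisfies (A1) or (A2), then for all $T>2l(D,B)$ $$\lim_{\tau\to\infty}\frac1\tau\log|I_f(\tau,T)|=-2l(D,B).$$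
   Context: Let $\mathbb{R}^3_\pm=\{x=(x_1,x_2,x_3)\in\mathbb{R}^3: \pm x_3>0\}$. Let $\gamma_+,\gamma_->0$ be constants and $\gamma_0(x)=\gamma_+$ if $x_3>0$, $\gamma_0(x)=\gamma_-$ if $x_3<0$. Let $D$ be a nonempty bounded open subset of $\mathbb{R}^3_-$ with $C^2$-boundary and $\overline D\subset\mathbb{R}^3_-$. Let $\gamma(x)=\gamma_0(x)I_3$ for $x\in\mathbb{R}^3\setminus D$ and $\gamma(x)=\gamma_0(x)I_3+h(x)$ for $x\in D$, where $h$ is a real symmetric $3\times3$-matrix valued function on $D$ with essentially bounded components such that, for some constant $C>0$, $(\gamma_0(x)I_3+h(x))\xi\cdot\xi\ge C|\xi|^2$ for all $\xi\in\mathbb{R}^3$ and a.e. $x\in D$. Let $B$ be an open ball with $\overline B\subset\mathbb{R}^3_+$. Let $f\in L^2(\mathbb{R}^3)$ be real-valued with $\mathrm{supp}\,f\subset\overline B$ and such that there is a constant $C_0>0$ with either $f(x)\ge C_0$ for a.e. $x\in B$ or $-f(x)\ge C_0$ for a.e. $x\in B$. For $0<T<\infty$ let $u=u_f(x,t)$ be the weak solution of $(\partial_t^2-\nabla\cdot\gamma\nabla)u=0$ in $\mathbb{R}^3\times(0,T)$, $u(x,0)=0$, $\partial_tu(x,0)=f(x)$ on $\mathbb{R}^3$ (weak solution in the standard energy class: $u\in L^2(0,T;H^1(\mathbb{R}^3))$, $\partial_tu\in L^2(0,T;L^2(\mathbb{R}^3))$, $\partial_t^2u\in L^2(0,T;H^1(\mathbb{R}^3)')$,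 with $\langle\partial_t^2u(t),\varphi\rangle+\int_{\mathbb{R}^3}\gamma\nabla u(t)\cdot\nabla\varphi\,dx=0$ for all $\varphi\in H^1(\mathbb{R}^3)$ and a.e. $t$; then $u\in C([0,T];H^1(\mathbb{R}^3))\cap C^1([0,T];L^2(\mathbb{R}^3))$). For $\tau>0$ let $w(x)=w_f(x,\tau)=\int_0^Te^{-\tau t}u(x,t)\,dt$, and let $v=v(\cdot,\tau)\in H^1(\mathbb{R}^3)$ be the weak solution of $(\nabla\cdot\gamma_0\nabla-\tau^2)v+f=0$ in $\mathbb{R}^3$. The indicator function is $I_f(\tau,T)=\int_{\mathbb{R}^3}f(w-v)\,dx$. Optical distance: for $x\in\mathbb{R}^3_-$, $y\in\mathbb{R}^3_+$ and $z'=(z_1,z_2)\in\mathbb{R}^2$, $\tilde z'=(z_1,z_2,0)$, put $l_{x,y}(z')=\frac{1}{\sqrt{\gamma_-}}|\tilde z'-x|+\frac{1}{\sqrt{\gamma_+}}|\tilde z'-y|$, $l(x,y)=\inf_{z'\in\mathbb{R}^2}l_{x,y}(z')$, and $l(D,B)=\inf_{x\in D,\,y\in B}l(x,y)$. *)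

theory Defs
  imports "HOL-Analysis.Analysis"
begin

section \<open>Smooth functions and domains with $C^2$ boundary\<close>

primrec Ck :: "nat \<Rightarrow> ('a::euclidean_space \<Rightarrow> real) \<Rightarrow> bool" where
  "Ck 0 f \<longleftrightarrow> continuous_on UNIV f"
| "Ck (Suc k) f \<longleftrightarrow> (\<forall>x. f differentiable at x) \<and>
     (\<forall>b\<in>Basis. Ck k (\<lambda>x. frechet_derivative f (at x) b))"

definition test_functions :: "'a::euclidean_space set \<Rightarrow> ('a \<Rightarrow> real) set" where
  "test_functions \<Omega> = {\<phi>. (\<forall>k. Ck k \<phi>) \<and>
     compact (closure {x. \<phi> x \<noteq> 0}) \<and> closure {x. \<phi> x \<noteq> 0} \<subseteq> \<Omega>}"

text \<open>Near each boundary point the set is, in suitable orthonormal coordinates,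
  the part of a ball lying above the graph of a $C^2$ function of two variables.\<close>

definition C2_boundary :: "(real^3) set \<Rightarrow> bool" where
  "C2_boundary D \<longleftrightarrow> (\<forall>p\<in>frontier D.
     \<exists>r>0. \<exists>R :: real^3 \<Rightarrow> real^3. \<exists>g :: real^2 \<Rightarrow> real.
       orthogonal_transformation R \<and> Ck 2 g \<and>
       D \<inter> ball p r = {x \<in> ball p r. R x $ 3 > g (vector [R x $ 1, R x $ 2])})"


section \<open>$L^2$, $H^1$ and the dual of $H^1$\<close>

text \<open>Elements of these spaces are represented by functions on the whole space, not by
  classes modulo almost-everywhere equality, so the norms below are only seminorms.\<close>

definition square_integrable :: "(real^3 \<Rightarrow> 'b::euclidean_space) \<Rightarrow> bool" where
  "square_integrable g \<longleftrightarrow>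
     g \<in> borel_measurable lebesgue \<and> integrable lebesgue (\<lambda>x. (norm (g x))\<^sup>2)"

definition L2 :: "(real^3 \<Rightarrow> real) set" where
  "L2 = {g. square_integrable g}"

definition L2_norm :: "(real^3 \<Rightarrow> real) \<Rightarrow> real" where
  "L2_norm g = sqrt (LINT x|lebesgue. (g x)\<^sup>2)"

text \<open>Support of a function defined only up to null sets.\<close>

definition ess_support :: "(real^3 \<Rightarrow> real) \<Rightarrow> (real^3) set" where
  "ess_support g =
     {x. \<forall>U. open U \<longrightarrow> x \<in> U \<longrightarrow> \<not> (AE y in lebesgue. y \<in> U \<longrightarrow> g y = 0)}"

definition is_weak_gradient :: "(real^3 \<Rightarrow> real) \<Rightarrow> (real^3 \<Rightarrow> real^3) \<Rightarrow> bool" where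
  "is_weak_gradient u G \<longleftrightarrow> (\<forall>\<phi>\<in>test_functions UNIV. \<forall>i.
     (LINT x|lebesgue. u x * frechet_derivative \<phi> (at x) (axis i 1))
       = - (LINT x|lebesgue. G x $ i * \<phi> x))"

definition H1 :: "(real^3 \<Rightarrow> real) set" where
  "H1 = {u \<in> L2. \<exists>G. square_integrable G \<and> is_weak_gradient u G}"

text \<open>The weak gradient is unique up to a null set; any choice will do.\<close>

definition weak_gradient :: "(real^3 \<Rightarrow> real) \<Rightarrow> real^3 \<Rightarrow> real^3" where
  "weak_gradient u = (SOME G. square_integrable G \<and> is_weak_gradient u G)"

definition H1_norm :: "(real^3 \<Rightarrow> real) \<Rightarrow> real" where
  "H1_norm u = sqrt ((LINT x|lebesgue. (u x)\<^sup>2) + (LINT x|lebesgue. (norm (weak_gradient u x))\<^sup>2))"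

definition H1_dual :: "((real^3 \<Rightarrow> real) \<Rightarrow> real) set" where
  "H1_dual = {l.
     (\<forall>\<phi>\<in>H1. \<forall>\<psi>\<in>H1. \<forall>a b. l (\<lambda>x. a * \<phi> x + b * \<psi> x) = a * l \<phi> + b * l \<psi>) \<and>
     (\<exists>C. \<forall>\<phi>\<in>H1. \<bar>l \<phi>\<bar> \<le> C * H1_norm \<phi>)}"

definition H1_dual_norm :: "((real^3 \<Rightarrow> real) \<Rightarrow> real) \<Rightarrow> real" where
  "H1_dual_norm l = (SUP \<phi>\<in>{\<phi>\<in>H1. H1_norm \<phi> \<le> 1}. \<bar>l \<phi>\<bar>)"

definition L2_to_H1_dual :: "(real^3 \<Rightarrow> real) \<Rightarrow> (real^3 \<Rightarrow> real) \<Rightarrow> real" where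
  "L2_to_H1_dual g = (\<lambda>\<phi>. LINT x|lebesgue. g x * \<phi> x)"


section \<open>Bochner spaces over the time interval $(0,T)$\<close>

text \<open>A target space is given by a set \<open>X\<close> of real-valued functions, closed under the
  pointwise vector space operations, and a seminorm \<open>N\<close> on it. The index type is
  \<open>real^3\<close> for $L^2$ and $H^1$, and the type of functions on \<open>real^3\<close> for the dual of
  $H^1$.\<close>

definition simple_on :: "real \<Rightarrow> ('i \<Rightarrow> real) set \<Rightarrow> (real \<Rightarrow> 'i \<Rightarrow> real) \<Rightarrow> bool" where
  "simple_on T X s \<longleftrightarrow> (\<exists>(n::nat) E a.
     (\<forall>k<n. E k \<in> sets (lebesgue_on {0<..<T}) \<and> a k \<in> X) \<and>
     s = (\<lambda>t y. \<Sum>k<n. indicator (E k) t * a k y))"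

definition strongly_measurable ::
    "real \<Rightarrow> ('i \<Rightarrow> real) set \<Rightarrow> (('i \<Rightarrow> real) \<Rightarrow> real) \<Rightarrow> (real \<Rightarrow> 'i \<Rightarrow> real) \<Rightarrow> bool" where
  "strongly_measurable T X N u \<longleftrightarrow>
     (AE t in lebesgue_on {0<..<T}. u t \<in> X) \<and>
     (\<exists>s. (\<forall>n. simple_on T X (s n)) \<and>
       (AE t in lebesgue_on {0<..<T}. (\<lambda>n. N (\<lambda>y. s n t y - u t y)) \<longlonglongrightarrow> 0))"

definition Bochner_L2 ::
    "real \<Rightarrow> ('i \<Rightarrow> real) set \<Rightarrow> (('i \<Rightarrow> real) \<Rightarrow> real) \<Rightarrow> (real \<Rightarrow> 'i \<Rightarrow> real) set" where
  "Bochner_L2 T X N = {u. strongly_measurable T X N u \<and>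
     integrable (lebesgue_on {0<..<T}) (\<lambda>t. (N (u t))\<^sup>2)}"

text \<open>\<open>has_Bochner_integral_on T X N u J\<close>: the \<open>X\<close>-valued integral of \<open>u\<close> over $(0,T)$ is
  \<open>J\<close>. For a simple function the \<open>X\<close>-valued integral can be computed pointwise.\<close>

definition has_Bochner_integral_on ::
    "real \<Rightarrow> ('i \<Rightarrow> real) set \<Rightarrow> (('i \<Rightarrow> real) \<Rightarrow> real) \<Rightarrow> (real \<Rightarrow> 'i \<Rightarrow> real) \<Rightarrow> ('i \<Rightarrow> real) \<Rightarrow> bool"
  where
  "has_Bochner_integral_on T X N u J \<longleftrightarrow>
     strongly_measurable T X N u \<and> J \<in> X \<and>
     (\<exists>s. (\<forall>n. simple_on T X (s n)) \<and>
       (\<lambda>n. \<integral>\<^sup>+t. ennreal (N (\<lambda>y. s n t y - u t y)) \<partial>lebesgue_on {0<..<T}) \<longlonglongrightarrow> 0 \<and>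
       (\<lambda>n. N (\<lambda>y. (LINT t|lebesgue_on {0<..<T}. s n t y) - J y)) \<longlonglongrightarrow> 0)"

text \<open>$\int_0^T \psi' u\,dt = -\int_0^T \psi v\,dt$ in \<open>X\<close> for all test functions on $(0,T)$.\<close>

definition has_weak_time_derivative ::
    "real \<Rightarrow> ('i \<Rightarrow> real) set \<Rightarrow> (('i \<Rightarrow> real) \<Rightarrow> real) \<Rightarrow>
      (real \<Rightarrow> 'i \<Rightarrow> real) \<Rightarrow> (real \<Rightarrow> 'i \<Rightarrow> real) \<Rightarrow> bool" where
  "has_weak_time_derivative T X N u v \<longleftrightarrow> (\<forall>\<psi>\<in>test_functions {0<..<T}. \<exists>J.
     has_Bochner_integral_on T X N (\<lambda>t y. deriv \<psi> t * u t y) J \<and>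
     has_Bochner_integral_on T X N (\<lambda>t y. - (\<psi> t * v t y)) J)"

text \<open>The initial value of an almost-everywhere defined \<open>u\<close> is the value at $0$ of its
  representative in $C([0,T];X)$.\<close>

definition has_initial_value ::
    "real \<Rightarrow> ('i \<Rightarrow> real) set \<Rightarrow> (('i \<Rightarrow> real) \<Rightarrow> real) \<Rightarrow> (real \<Rightarrow> 'i \<Rightarrow> real) \<Rightarrow> ('i \<Rightarrow> real) \<Rightarrow> bool"
  where
  "has_initial_value T X N u g \<longleftrightarrow> (\<exists>U.
     (\<forall>t\<in>{0..T}. U t \<in> X \<and> ((\<lambda>s. N (\<lambda>y. U s y - U t y)) \<longlongrightarrow> 0) (at t within {0..T})) \<and>
     (AE t in lebesgue_on {0<..<T}. N (\<lambda>y. u t y - U t y) = 0) \<and>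
     N (\<lambda>y. U 0 y - g y) = 0)"


section \<open>The transmission problem\<close>

text \<open>The value on the null set $x_3 = 0$ is irrelevant.\<close>

definition gamma0 :: "real \<Rightarrow> real \<Rightarrow> real^3 \<Rightarrow> real" where
  "gamma0 \<gamma>p \<gamma>m x = (if x $ 3 > 0 then \<gamma>p else \<gamma>m)"

definition gamma :: "real \<Rightarrow> real \<Rightarrow> (real^3) set \<Rightarrow> (real^3 \<Rightarrow> real^3^3) \<Rightarrow> real^3 \<Rightarrow> real^3^3" where
  "gamma \<gamma>p \<gamma>m D h x = (if x \<in> D then mat (gamma0 \<gamma>p \<gamma>m x) + h x else mat (gamma0 \<gamma>p \<gamma>m x))"

definition A1 :: "(real^3) set \<Rightarrow> (real^3 \<Rightarrow> real^3^3) \<Rightarrow> bool" where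
  "A1 D h \<longleftrightarrow> (\<exists>C'>0. AE x in lebesgue. x \<in> D \<longrightarrow> (\<forall>\<xi>. - ((h x *v \<xi>) \<bullet> \<xi>) \<ge> C' * (norm \<xi>)\<^sup>2))"

definition A2 :: "(real^3) set \<Rightarrow> (real^3 \<Rightarrow> real^3^3) \<Rightarrow> bool" where
  "A2 D h \<longleftrightarrow> (\<exists>C'>0. AE x in lebesgue. x \<in> D \<longrightarrow> (\<forall>\<xi>. (h x *v \<xi>) \<bullet> \<xi> \<ge> C' * (norm \<xi>)\<^sup>2))"

text \<open>Weak solution of $(\partial_t^2 - \nabla\cdot A\nabla)u = 0$ in
  $\mathbf{R}^3\times(0,T)$ with $u(0) = 0$ and $\partial_t u(0) = f$;
  \<open>u t x\<close> stands for $u(x,t)$.\<close>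

definition wave_weak_solution ::
    "(real^3 \<Rightarrow> real^3^3) \<Rightarrow> real \<Rightarrow> (real^3 \<Rightarrow> real) \<Rightarrow> (real \<Rightarrow> real^3 \<Rightarrow> real) \<Rightarrow> bool" where
  "wave_weak_solution A T f u \<longleftrightarrow> (\<exists>u' u''.
     u \<in> Bochner_L2 T H1 H1_norm \<and>
     u' \<in> Bochner_L2 T L2 L2_norm \<and>
     u'' \<in> Bochner_L2 T H1_dual H1_dual_norm \<and>
     has_weak_time_derivative T L2 L2_norm u u' \<and>
     has_weak_time_derivative T H1_dual H1_dual_norm (\<lambda>t. L2_to_H1_dual (u' t)) u'' \<and>
     (\<forall>\<phi>\<in>H1. AE t in lebesgue_on {0<..<T}.
        u'' t \<phi> + (LINT x|lebesgue. (A x *v weak_gradient (u t) x) \<bullet> weak_gradient \<phi> x) = 0) \<and>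
     has_initial_value T H1 H1_norm u (\<lambda>x. 0) \<and>
     has_initial_value T L2 L2_norm u' f)"

text \<open>Weak solution in $H^1$ of $(\nabla\cdot a\nabla - \tau^2)v + f = 0$ for a scalar
  coefficient \<open>a\<close>.\<close>

definition elliptic_weak_solution ::
    "(real^3 \<Rightarrow> real) \<Rightarrow> real \<Rightarrow> (real^3 \<Rightarrow> real) \<Rightarrow> (real^3 \<Rightarrow> real) \<Rightarrow> bool" where
  "elliptic_weak_solution a \<tau> f v \<longleftrightarrow> v \<in> H1 \<and> (\<forall>\<phi>\<in>H1.
     (LINT x|lebesgue. a x * (weak_gradient v x \<bullet> weak_gradient \<phi> x))
       + \<tau>\<^sup>2 * (LINT x|lebesgue. v x * \<phi> x) = (LINT x|lebesgue. f x * \<phi> x))"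

text \<open>\<open>w\<close> is $\int_0^T e^{-\tau t}u(\cdot,t)\,dt$, as an $L^2$-valued integral. Since each
  \<open>u t\<close> is only determined up to a null set depending on \<open>t\<close>, a pointwise integral would
  depend on the representatives; for a jointly measurable representative the two agree
  almost everywhere.\<close>

definition is_time_transform ::
    "real \<Rightarrow> real \<Rightarrow> (real \<Rightarrow> real^3 \<Rightarrow> real) \<Rightarrow> (real^3 \<Rightarrow> real) \<Rightarrow> bool" where
  "is_time_transform T \<tau> u w \<longleftrightarrow>
     has_Bochner_integral_on T L2 L2_norm (\<lambda>t x. exp (- \<tau> * t) * u t x) w"

definition indicator_function ::
    "(real^3 \<Rightarrow> real) \<Rightarrow> (real^3 \<Rightarrow> real) \<Rightarrow> (real^3 \<Rightarrow> real) \<Rightarrow> real" where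
  "indicator_function f w v = (LINT x|lebesgue. f x * (w x - v x))"


section \<open>Optical distance\<close>

definition optical_length :: "real \<Rightarrow> real \<Rightarrow> real^3 \<Rightarrow> real^3 \<Rightarrow> real^2 \<Rightarrow> real" where
  "optical_length \<gamma>p \<gamma>m x y z =
     1 / sqrt \<gamma>m * norm (vector [z $ 1, z $ 2, 0] - x)
     + 1 / sqrt \<gamma>p * norm (vector [z $ 1, z $ 2, 0] - y)"

definition optical_distance :: "real \<Rightarrow> real \<Rightarrow> real^3 \<Rightarrow> real^3 \<Rightarrow> real" where
  "optical_distance \<gamma>p \<gamma>m x y = (INF z. optical_length \<gamma>p \<gamma>m x y z)"

definition optical_set_distance :: "real \<Rightarrow> real \<Rightarrow> (real^3) set \<Rightarrow> (real^3) set \<Rightarrow> real" where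
  "optical_set_distance \<gamma>p \<gamma>m D B = (INF (x, y)\<in>D \<times> B. optical_distance \<gamma>p \<gamma>m x y)"

end

theory Submission
  imports Defs
begin

text \<open>In the Laplace variable $\tau$ the transform $w$ solves the elliptic equation with coefficient
 $\gamma$ up to a residual of order $\tau e^{-\tau T}$. Comparing its energy with that of $v$ places
 $I_f$ between multiples of $\|\nabla v\|^2_{L^2(D)}$, up to $O(e^{-\tau T}/\tau)$, with the sign given by
 (A1) or (A2). Since $w$ is only an $L^2$-valued integral, it is replaced in this argument by the
 transform of a simple function close to $u$ in $L^1(0,T;H^1)$.

 It remains to see that $\|\nabla v\|_{L^2(D)} = e^{-\tau(l(D,B)+o(1))}$. The upper bound is an energy
 estimate with an exponential weight, a soft minimum of plane phases refracted at $x_3 = 0$ according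
 to Snell's law; such phases solve the eikonal equation in both half spaces and are continuous across
 the interface. For the lower bound, exponential lower bounds for $v$ are propagated from $B$ to a point of
 $D$ along a nearly shortest optical path by the comparison principle on many small balls, with
 logistic barriers that are stretched in $x_3$ below the interface in order to cross it.\<close>

text \<open>The threshold 2 l(D,B) is decided by a race between the squared norm of the gradient of
  v on D, of size e^{-2 \<tau> l}, and the residual e^{-\<tau> T}/\<tau>. All spatial estimates are
  needed only up to factors e^{\<epsilon> \<tau>}, and this slack replaces any formula for the
  fundamental solution of the layered operator. It pays for finite nets of B and D in the upper
  bound and for barriers of imperfect cost in the lower one: a step of length d from a ball of
  radius \<rho> is too expensive by the factor 1 + d/(2\<rho>), and a crossing of the interface with
  balls of radius \<zeta> costs O(\<zeta>); both losses vanish in the limit. The order of the two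
  coefficients is used at the crossing, where the stretching factor is then below 1.

  The H^1 calculus rests on difference quotients. Translation invariance moves them across a
  pairing, and weak limits then give integration by parts for pairs of H^1 functions and the chain
  and product rules that make truncations and weights admissible in test functions. In time, every
  vector-valued statement is first paired with a fixed spatial function, so that only scalar
  integrals remain.\<close>

abbreviation lebesgue_integral :: "('a::euclidean_space \<Rightarrow> real) \<Rightarrow> real" (binder "LI " [60] 60) where
 "lebesgue_integral f \<equiv> integral\<^sup>L lebesgue f"

section \<open>Smooth functions\<close>

definition smooth :: "('a::euclidean_space \<Rightarrow> real) \<Rightarrow> bool" where
 "smooth f \<longleftrightarrow> (\<forall>k. Ck k f)"

lemma Ck_SucD: "Ck (Suc k) f \<Longrightarrow> Ck k f"
proof (induction k arbitrary: f)
 case 0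
 then show ?case by (auto simp: continuous_on_eq_continuous_at differentiable_imp_continuous_within)
next
 case (Suc k)
 from Suc.prems have d: "\<forall>x. f differentiable at x"
  and c: "\<And>b. b \<in> Basis \<Longrightarrow> Ck (Suc k) (\<lambda>x. frechet_derivative f (at x) b)" using Ck.simps(2)[of "Suc k" f] by blast+
 show ?case using d Suc.IH[OF c] by simp
qed

text \<open>\<open>Ck\<close> is stated with the chosen \<open>frechet_derivative\<close>;
  uniqueness of the derivative allows an explicit candidate \<open>f'\<close> to be used instead,
  which is how the closure rules below are obtained.\<close>

lemma Ck_SucI:
 assumes "\<And>x. (f has_derivative f' x) (at x)" "\<And>b. b \<in> Basis \<Longrightarrow> Ck k (\<lambda>x. f' x b)"
 shows "Ck (Suc k) f"
proof -
 have "frechet_derivative f (at x) = f' x" for x using assms(1) frechet_derivative_at by metis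
 moreover have "f differentiable at x" for x using assms(1) differentiable_def by blast
 ultimately show ?thesis using assms(2) by simp
qed

lemma Ck_has_derivative: "Ck (Suc k) f \<Longrightarrow> (f has_derivative frechet_derivative f (at x)) (at x)" using frechet_derivative_works by auto

lemma Ck_const [simp]: "Ck k (\<lambda>x. c)"
proof (induction k arbitrary: c)
 case (Suc k)
 show ?case by (rule Ck_SucI[where f' = "\<lambda>x b. 0"]) (use Suc in \<open>auto intro: has_derivative_const\<close>)
qed simp

lemma Ck_add: "Ck k f \<Longrightarrow> Ck k g \<Longrightarrow> Ck k (\<lambda>x. f x + g x)"
proof (induction k arbitrary: f g)
 case (Suc k)
 show ?case
 proof (rule Ck_SucI)
  show "((\<lambda>x. f x + g x) has_derivative
    (\<lambda>b. frechet_derivative f (at x) b + frechet_derivative g (at x) b)) (at x)" for x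
   using Suc.prems by (intro has_derivative_add Ck_has_derivative)
 qed (use Suc in auto)
qed (auto intro: continuous_intros)

lemma Ck_mult: "Ck k f \<Longrightarrow> Ck k g \<Longrightarrow> Ck k (\<lambda>x. f x * g x)"
proof (induction k arbitrary: f g)
 case (Suc k)
 show ?case
 proof (rule Ck_SucI)
  show "((\<lambda>x. f x * g x) has_derivative
    (\<lambda>b. f x * frechet_derivative g (at x) b + frechet_derivative f (at x) b * g x)) (at x)" for x
   using Suc.prems by (intro has_derivative_mult Ck_has_derivative)
  have "Ck k f" "Ck k g" using Suc.prems Ck_SucD by blast+
  then show "Ck k (\<lambda>x. f x * frechet_derivative g (at x) b + frechet_derivative f (at x) b * g x)"
   if "b \<in> Basis" for b using Suc.IH Suc.prems that by (intro Ck_add) auto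
 qed
qed (auto intro: continuous_intros)

lemma Ck_inverse: "Ck k f \<Longrightarrow> (\<And>x. f x \<noteq> 0) \<Longrightarrow> Ck k (\<lambda>x. inverse (f x))"
proof (induction k arbitrary: f)
 case (Suc k)
 show ?case
 proof (rule Ck_SucI)
  show "((\<lambda>x. inverse (f x)) has_derivative
    (\<lambda>b. - (inverse (f x) * frechet_derivative f (at x) b * inverse (f x)))) (at x)" for x
   using Suc.prems by (intro Deriv.has_derivative_inverse Ck_has_derivative) auto
  have "Ck k (\<lambda>x. inverse (f x))" using Suc.prems Ck_SucD by (intro Suc.IH) blast+
  moreover have "Ck k (\<lambda>x. frechet_derivative f (at x) b)" if "b \<in> Basis" for b using Suc.prems(1) that by simp
  ultimately have "Ck k (\<lambda>x. (-1) * (inverse (f x) * frechet_derivative f (at x) b * inverse (f x)))"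
   if "b \<in> Basis" for b using that by (intro Ck_mult) auto
  then show "Ck k (\<lambda>x. - (inverse (f x) * frechet_derivative f (at x) b * inverse (f x)))"
   if "b \<in> Basis" for b using that by simp
 qed
qed (auto intro: continuous_intros)

text \<open>Bumps are built as products of one-variable profiles of the coordinates, so composition
  with an affine functional is the relevant chain rule. The derivative is again a profile of the
  same functional times a constant, and the induction closes.\<close>

lemma Ck_affine_functional:
 fixes g :: "real \<Rightarrow> real" and L :: "'a::euclidean_space \<Rightarrow> real"
 assumes L: "bounded_linear L"
 shows "Ck k g \<Longrightarrow> Ck k (\<lambda>x. g (L x + c))"
proof (induction k arbitrary: g)
 case 0
 have "continuous_on UNIV L" using L linear_continuous_on by blast
 with 0 show ?case by (auto intro!: continuous_on_compose2[of UNIV g] continuous_intros)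
next
 case (Suc k)
 let ?g' = "\<lambda>x. frechet_derivative g (at x) 1"
 have d: "(g has_real_derivative ?g' x) (at x)" for x
 proof -
  have "(g has_derivative frechet_derivative g (at x)) (at x)" using Suc.prems Ck_has_derivative by blast
  moreover have "frechet_derivative g (at x) = (\<lambda>h. ?g' x * h)"
  proof
   fix h
   have "linear (frechet_derivative g (at x))" using calculation has_derivative_linear by blast
   then show "frechet_derivative g (at x) h = ?g' x * h"
    using linear_cmul[of "frechet_derivative g (at x)" h 1] by (simp add: mult.commute)
  qed
  ultimately show ?thesis by (simp add: has_field_derivative_def)
 qed
 have dL: "((\<lambda>x. L x + c) has_derivative L) (at x)" for x using L by (auto intro!: derivative_eq_intros bounded_linear_imp_has_derivative)
 show ?case
 proof (rule Ck_SucI)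
  show "((\<lambda>x. g (L x + c)) has_derivative (\<lambda>b. ?g' (L x + c) * L b)) (at x)" for x
   using has_derivative_compose[OF dL, of g "(*) (?g' (L x + c))" x] d[of "L x + c"] by (simp add: has_field_derivative_def)
  have "Ck k ?g'" using Suc.prems by simp
  then show "Ck k (\<lambda>x. ?g' (L x + c) * L b)" for b using Suc.IH by (intro Ck_mult) auto
 qed
qed

lemma Ck_translate: "Ck k f \<Longrightarrow> Ck k (\<lambda>x. f (x + a))"
proof (induction k arbitrary: f)
 case 0
 then show ?case by (auto intro!: continuous_on_compose2[of UNIV f] continuous_intros)
next
 case (Suc k)
 show ?case
 proof (rule Ck_SucI)
  show "((\<lambda>x. f (x + a)) has_derivative frechet_derivative f (at (x + a))) (at x)" for x
  proof -
   have "((\<lambda>x. x + a) has_derivative (\<lambda>h. h)) (at x)" by (auto intro!: derivative_eq_intros)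
   from has_derivative_compose[OF this Ck_has_derivative[OF Suc.prems]] show ?thesis .
  qed
  show "Ck k (\<lambda>x. frechet_derivative f (at (x + a)) b)" if "b \<in> Basis" for b
   using Suc.IH[of "\<lambda>x. frechet_derivative f (at x) b"] Suc.prems that by simp
 qed
qed

lemma smooth_const [simp]: "smooth (\<lambda>x. c)"
 and smooth_add: "smooth f \<Longrightarrow> smooth g \<Longrightarrow> smooth (\<lambda>x. f x + g x)"
 and smooth_mult: "smooth f \<Longrightarrow> smooth g \<Longrightarrow> smooth (\<lambda>x. f x * g x)"
 and smooth_inverse: "smooth f \<Longrightarrow> (\<And>x. f x \<noteq> 0) \<Longrightarrow> smooth (\<lambda>x. inverse (f x))"
 and smooth_translate: "smooth f \<Longrightarrow> smooth (\<lambda>x. f (x + a))" by (auto simp: smooth_def intro: Ck_add Ck_mult Ck_inverse Ck_translate)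

lemma smooth_affine_functional:
 fixes g :: "real \<Rightarrow> real"
 shows "bounded_linear L \<Longrightarrow> smooth g \<Longrightarrow> smooth (\<lambda>x. g (L x + c))" unfolding smooth_def by (intro allI Ck_affine_functional) auto

lemma smooth_diff: "smooth f \<Longrightarrow> smooth g \<Longrightarrow> smooth (\<lambda>x. f x - g x)" using smooth_add[of f "\<lambda>x. (-1) * g x"] smooth_mult[of "\<lambda>x. -1" g] by simp

lemma smooth_prod: "(\<And>i. i \<in> S \<Longrightarrow> smooth (f i)) \<Longrightarrow> smooth (\<lambda>x. \<Prod>i\<in>S. f i x)"
 by (induction S rule: infinite_finite_induct) (auto intro: smooth_mult)

lemma smooth_continuous: "smooth f \<Longrightarrow> continuous_on UNIV f" using Ck.simps(1) smooth_def by blast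

lemma smooth_has_derivative: "smooth f \<Longrightarrow> (f has_derivative frechet_derivative f (at x)) (at x)" using Ck_has_derivative smooth_def by blast

lemma smooth_frechet: "smooth f \<Longrightarrow> b \<in> Basis \<Longrightarrow> smooth (\<lambda>x. frechet_derivative f (at x) b)" using Ck.simps(2) unfolding smooth_def by blast

section \<open>A smooth transition function\<close>

definition flat_exp :: "nat \<Rightarrow> real \<Rightarrow> real" where
 "flat_exp n x = (if x > 0 then exp (- 1 / x) / x ^ n else 0)"

lemma flat_exp_tendsto_0: "((\<lambda>x. exp (- 1 / x) / x ^ n) \<longlongrightarrow> (0::real)) (at_right 0)"
proof -
 have "((\<lambda>x. inverse x ^ n / exp (inverse x)) \<longlongrightarrow> (0::real)) (at_right 0)"
  using filterlim_compose[OF tendsto_power_div_exp_0 filterlim_inverse_at_top_right] .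
 then show ?thesis by (simp add: exp_minus field_simps)
qed

text \<open>The powers of \<open>x\<close> in the denominator belong to the family because
  differentiation of e^{-1/x} produces them: each derivative is a combination of two members with
  larger \<open>n\<close>, so smoothness of all of them follows by one induction. At 0 the right
  difference quotient is the member with exponent \<open>n + 1\<close>, which tends to 0.\<close>

lemma has_derivative_flat_exp:
 "(flat_exp n has_real_derivative (flat_exp (n + 2) x - real n * flat_exp (n + 1) x)) (at x)"
proof -
 consider "x > 0" | "x < 0" | "x = 0" by linarith
 then show ?thesis
 proof cases
  case 1
  have "((\<lambda>x. exp (- 1 / x) / x ^ n) has_real_derivative
    (flat_exp (n + 2) x - real n * flat_exp (n + 1) x)) (at x)"
  proof (cases n)
   case 0
   then show ?thesis using 1 by (auto intro!: derivative_eq_intros simp: flat_exp_def field_simps power2_eq_square)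
  next
   case (Suc m)
   have "x ^ m * x ^ m = x * (x ^ m * x ^ (m - 1))" if "m \<noteq> 0" using that by (cases m) auto
   then show ?thesis using 1 Suc by (cases "m = 0") (auto intro!: derivative_eq_intros simp: flat_exp_def field_simps power2_eq_square)
  qed
  then show ?thesis by (rule has_field_derivative_transform_within_open[where S = "{0<..}"]) (use 1 in \<open>auto simp: flat_exp_def\<close>)
 next
  case 2
  have "((\<lambda>x. 0) has_real_derivative (flat_exp (n + 2) x - real n * flat_exp (n + 1) x)) (at x)" using 2 by (auto simp: flat_exp_def)
  then show ?thesis by (rule has_field_derivative_transform_within_open[where S = "{..<0}"]) (use 2 in \<open>auto simp: flat_exp_def\<close>)
 next
  case 3
  have "((\<lambda>h. flat_exp n h / h) \<longlongrightarrow> 0) (at_right 0)" using flat_exp_tendsto_0[of "Suc n"] by (rule Lim_transform_eventually)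
    (auto simp: flat_exp_def eventually_at_filter field_simps)
  moreover have "((\<lambda>h. flat_exp n h / h) \<longlongrightarrow> 0) (at_left 0)" by (rule Lim_transform_eventually[where f = "\<lambda>_. 0"])
    (auto simp: flat_exp_def eventually_at_filter)
  ultimately have "((\<lambda>h. flat_exp n h / h) \<longlongrightarrow> 0) (at 0)" using filterlim_split_at by blast
  then show ?thesis using 3 by (simp add: DERIV_def flat_exp_def)
 qed
qed

lemma Ck_flat_exp: "Ck k (flat_exp n)"
proof (induction k arbitrary: n)
 case 0
 show ?case using DERIV_isCont[OF has_derivative_flat_exp] by (simp add: continuous_on_eq_continuous_at)
next
 case (Suc k)
 show ?case
 proof (rule Ck_SucI)
  show "(flat_exp n has_derivative (\<lambda>h. (flat_exp (n + 2) x - real n * flat_exp (n + 1) x) * h)) (at x)" for x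
   using has_derivative_flat_exp[of n x] by (metis (no_types, lifting) has_field_derivative_def)
  have "Ck k (\<lambda>x. (flat_exp (n + 2) x + (- real n) * flat_exp (n + 1) x) * b)" for b by (intro Ck_mult Ck_add Suc.IH Ck_const)
  then show "Ck k (\<lambda>x. (flat_exp (n + 2) x - real n * flat_exp (n + 1) x) * b)" for b by simp
 qed
qed

definition smooth_step :: "real \<Rightarrow> real" where
 "smooth_step x = flat_exp 0 x * inverse (flat_exp 0 x + flat_exp 0 (1 - x))"

lemma flat_exp_0: "flat_exp 0 x \<ge> 0" "flat_exp 0 x > 0 \<longleftrightarrow> x > 0" "flat_exp 0 x = 0 \<longleftrightarrow> x \<le> 0" by (auto simp: flat_exp_def)

lemma smooth_step_denominator_pos: "flat_exp 0 x + flat_exp 0 (1 - x) > 0"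
 using flat_exp_0(1,2)[of x] flat_exp_0(1,2)[of "1 - x"] by (smt (verit))

lemma smooth_smooth_step: "smooth smooth_step"
proof -
 have a: "smooth (flat_exp 0)" by (simp add: smooth_def Ck_flat_exp)
 have b: "smooth (\<lambda>x. flat_exp 0 (1 - x))" using smooth_affine_functional[OF bounded_linear_minus[OF bounded_linear_ident] a, of 1]
  by (simp add: add.commute)
 have "smooth (\<lambda>x. flat_exp 0 x * inverse (flat_exp 0 x + flat_exp 0 (1 - x)))"
  by (intro smooth_mult smooth_inverse smooth_add a b) (metis smooth_step_denominator_pos less_irrefl)
 then show ?thesis unfolding smooth_step_def .
qed

lemma smooth_step_bounds: "0 \<le> smooth_step x" "smooth_step x \<le> 1"
 using smooth_step_denominator_pos[of x] flat_exp_0(1)[of x] flat_exp_0(1)[of "1 - x"] by (auto simp: smooth_step_def field_simps)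

lemma smooth_step_eq_0: "x \<le> 0 \<Longrightarrow> smooth_step x = 0" by (simp add: smooth_step_def flat_exp_def)

lemma smooth_step_eq_1: "x \<ge> 1 \<Longrightarrow> smooth_step x = 1" using smooth_step_denominator_pos[of x] by (simp add: smooth_step_def flat_exp_def)

section \<open>Test functions\<close>

lemma test_functionsI:
 assumes "smooth \<phi>" "\<And>x. \<phi> x \<noteq> 0 \<Longrightarrow> x \<in> K" "compact K" "K \<subseteq> \<Omega>"
 shows "\<phi> \<in> test_functions \<Omega>"
proof -
 have "closure {x. \<phi> x \<noteq> 0} \<subseteq> K" using assms by (intro closure_minimal) (auto intro: compact_imp_closed)
 moreover from this have "compact (closure {x. \<phi> x \<noteq> 0})" using assms(3) by (metis closed_closure closed_Int_compact inf.absorb_iff1)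
 ultimately show ?thesis using assms by (auto simp: test_functions_def smooth_def)
qed

lemma test_functions_smooth: "\<phi> \<in> test_functions \<Omega> \<Longrightarrow> smooth \<phi>" by (simp add: test_functions_def smooth_def)

lemma test_functions_support:
 "\<phi> \<in> test_functions \<Omega> \<Longrightarrow> \<exists>K. compact K \<and> K \<subseteq> \<Omega> \<and> (\<forall>x. x \<notin> K \<longrightarrow> \<phi> x = 0)" using closure_subset[of "{x. \<phi> x \<noteq> 0}"]
 by (intro exI[of _ "closure {x. \<phi> x \<noteq> 0}"]) (auto simp: test_functions_def)

lemma test_functions_lincomb:
 assumes "\<phi> \<in> test_functions \<Omega>" "\<psi> \<in> test_functions \<Omega>"
 shows "(\<lambda>x. a * \<phi> x + b * \<psi> x) \<in> test_functions \<Omega>"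
proof -
 obtain K L where "compact K" "K \<subseteq> \<Omega>" "\<forall>x. x \<notin> K \<longrightarrow> \<phi> x = 0" "compact L" "L \<subseteq> \<Omega>" "\<forall>x. x \<notin> L \<longrightarrow> \<psi> x = 0"
  using assms[THEN test_functions_support] by blast
 then show ?thesis using assms[THEN test_functions_smooth]
  by (intro test_functionsI[where K = "K \<union> L"] smooth_add smooth_mult smooth_const) auto
qed

lemma test_functions_translate:
 assumes "\<phi> \<in> test_functions UNIV"
 shows "(\<lambda>x. \<phi> (x + a)) \<in> test_functions UNIV"
proof -
 obtain K where K: "compact K" "\<forall>x. x \<notin> K \<longrightarrow> \<phi> x = 0" using assms[THEN test_functions_support] by blast
 have "x \<in> (\<lambda>y. - a + y) ` K" if "\<phi> (x + a) \<noteq> 0" for x using K that by (intro image_eqI[where x = "x + a"]) auto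
 then show ?thesis using assms[THEN test_functions_smooth] K(1)
  by (intro test_functionsI[where K = "(\<lambda>y. - a + y) ` K"] smooth_translate compact_translation) auto
qed

text \<open>Equal to 1 on the cube of half width \<open>d\<close> about \<open>a\<close> and to 0 off the one of half width \<open>2 d\<close>.\<close>

definition cube_bump :: "'a::euclidean_space \<Rightarrow> real \<Rightarrow> 'a \<Rightarrow> real" where
 "cube_bump a d x = (\<Prod>b\<in>Basis. smooth_step (2 + ((x - a) \<bullet> b) / d) * smooth_step (2 - ((x - a) \<bullet> b) / d))"

lemma smooth_cube_bump: "smooth (cube_bump a d :: 'a::euclidean_space \<Rightarrow> real)"
proof -
 have eq: "2 + ((x - a) \<bullet> b) / d = (x \<bullet> b) / d + (2 - (a \<bullet> b) / d)"
  "2 - ((x - a) \<bullet> b) / d = - ((x \<bullet> b) / d) + (2 + (a \<bullet> b) / d)" for x b :: 'a by (auto simp: inner_diff_left diff_divide_distrib)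
 have 1: "bounded_linear (\<lambda>x. (x \<bullet> b) / d)" for b :: 'a using bounded_linear_compose[OF bounded_linear_divide bounded_linear_inner_left] .
 then have 2: "bounded_linear (\<lambda>x. - ((x \<bullet> b) / d))" for b :: 'a by (rule bounded_linear_minus)
 show ?thesis unfolding cube_bump_def[abs_def] eq
  by (intro smooth_prod smooth_mult smooth_affine_functional[OF 1] smooth_affine_functional[OF 2] smooth_smooth_step)
qed

lemma cube_bump_bounds: "0 \<le> cube_bump a d x" "cube_bump a d x \<le> 1" unfolding cube_bump_def
 by (auto intro!: prod_nonneg prod_le_1 mult_nonneg_nonneg mult_le_one smooth_step_bounds)

lemma cube_bump_eq_1:
 assumes "d > 0" "\<And>b. b \<in> Basis \<Longrightarrow> \<bar>(x - a) \<bullet> b\<bar> \<le> d"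
 shows "cube_bump a d x = 1" unfolding cube_bump_def
proof (rule prod.neutral, rule ballI)
 fix b :: 'a assume "b \<in> Basis"
 then have "\<bar>((x - a) \<bullet> b) / d\<bar> \<le> 1" using assms by simp
 then have "- 1 \<le> ((x - a) \<bullet> b) / d" "((x - a) \<bullet> b) / d \<le> 1" unfolding abs_le_iff by linarith+
 then show "smooth_step (2 + ((x - a) \<bullet> b) / d) * smooth_step (2 - ((x - a) \<bullet> b) / d) = 1" by (subst (1 2) smooth_step_eq_1) auto
qed

lemma cube_bump_nonzeroD:
 assumes "d > 0" "cube_bump a d x \<noteq> 0" "b \<in> Basis"
 shows "\<bar>(x - a) \<bullet> b\<bar> < 2 * d"
proof (rule ccontr)
 assume "\<not> ?thesis"
 then have "\<bar>((x - a) \<bullet> b) / d\<bar> \<ge> 2" using assms by (simp add: abs_divide field_simps)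
 then have "2 + ((x - a) \<bullet> b) / d \<le> 0 \<or> 2 - ((x - a) \<bullet> b) / d \<le> 0" by linarith
 then have "smooth_step (2 + ((x - a) \<bullet> b) / d) * smooth_step (2 - ((x - a) \<bullet> b) / d) = 0" using smooth_step_eq_0 by auto
 then show False using assms by (auto simp: cube_bump_def)
qed

lemma cube_bump_support:
 fixes x a :: "'a::euclidean_space"
 assumes "d > 0" "cube_bump a d x \<noteq> 0"
 shows "dist x a \<le> 2 * d * DIM('a)"
proof -
 have "norm (x - a) \<le> (\<Sum>b\<in>Basis. \<bar>(x - a) \<bullet> b\<bar>)" by (rule norm_le_l1)
 also have "\<dots> \<le> (\<Sum>b\<in>(Basis::'a set). 2 * d)" using cube_bump_nonzeroD[OF assms] by (intro sum_mono) (auto intro: less_imp_le)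
 finally show ?thesis by (simp add: dist_norm mult.commute)
qed

lemma test_function_bump_in_ball:
 fixes x :: "'a::euclidean_space"
 assumes "e > 0"
 obtains \<phi> d where "\<phi> \<in> test_functions (ball x e)" "\<And>y. 0 \<le> \<phi> y" "\<And>y. \<phi> y \<le> 1"
  "d > 0" "\<And>y. y \<in> ball x d \<Longrightarrow> \<phi> y = 1" "\<And>y. \<phi> y \<noteq> 0 \<Longrightarrow> y \<in> ball x e"
proof
 \<comment> \<open>The l^1 bound places the cube of half width 2 d within distance 2 d DIM of its
   centre; this is e/2, so the closed support stays inside the open ball.\<close>
 define d where "d = e / (4 * DIM('a))"
 show d: "d > 0" using assms by (simp add: d_def)
 have e: "2 * d * DIM('a) < e" using assms by (simp add: d_def)
 show "cube_bump x d \<in> test_functions (ball x e)"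
 proof (rule test_functionsI[OF smooth_cube_bump])
  show "compact (cball x (2 * d * DIM('a)))" "cball x (2 * d * DIM('a)) \<subseteq> ball x e" using e by (auto simp: subset_iff)
  show "y \<in> cball x (2 * d * DIM('a))" if "cube_bump x d y \<noteq> 0" for y using cube_bump_support[OF d that] by (simp add: dist_commute)
 qed
 show "y \<in> ball x e" if "cube_bump x d y \<noteq> 0" for y using cube_bump_support[OF d that] e by (auto simp: dist_commute)
 show "cube_bump x d y = 1" if "y \<in> ball x d" for y
 proof (rule cube_bump_eq_1[OF d])
  show "\<bar>(y - x) \<bullet> b\<bar> \<le> d" if "b \<in> Basis" for b
   using Basis_le_norm[OF that, of "y - x"] \<open>y \<in> ball x d\<close> by (simp add: dist_norm norm_minus_commute)
 qed
qed (auto simp: cube_bump_bounds)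

text \<open>Finitely many bumps cover \<open>K\<close>. The combination 1 - prod (1 - \<beta>)
  equals 1 wherever a single bump does and never leaves [0,1], so no normalisation as for a sum is
  required.\<close>

lemma smooth_Urysohn:
 fixes K U :: "'a::euclidean_space set"
 assumes "compact K" "open U" "K \<subseteq> U"
 obtains \<phi> where "\<phi> \<in> test_functions U" "\<And>y. 0 \<le> \<phi> y" "\<And>y. \<phi> y \<le> 1" "\<And>y. y \<in> K \<Longrightarrow> \<phi> y = 1"
  "\<And>y. \<phi> y \<noteq> 0 \<Longrightarrow> y \<in> U"
proof -
 have "\<forall>x\<in>K. \<exists>\<phi> d. \<phi> \<in> test_functions U \<and> (\<forall>y. 0 \<le> \<phi> y \<and> \<phi> y \<le> 1) \<and> d > 0 \<and> (\<forall>y\<in>ball x d. \<phi> y = 1)"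
 proof
  fix x assume "x \<in> K"
  then obtain e where e: "e > 0" "ball x e \<subseteq> U" using assms openE by (metis subsetD)
  obtain \<phi> d where "\<phi> \<in> test_functions (ball x e)" "\<And>y. 0 \<le> \<phi> y" "\<And>y. \<phi> y \<le> 1"
   "d > 0" "\<And>y. y \<in> ball x d \<Longrightarrow> \<phi> y = 1" using test_function_bump_in_ball[OF e(1), of x] by metis
  with e(2) show "\<exists>\<phi> d. \<phi> \<in> test_functions U \<and> (\<forall>y. 0 \<le> \<phi> y \<and> \<phi> y \<le> 1) \<and> d > 0 \<and> (\<forall>y\<in>ball x d. \<phi> y = 1)"
   by (intro exI[of _ \<phi>] exI[of _ d]) (auto simp: test_functions_def)
 qed
 then obtain \<beta> d where \<beta>: "\<And>x. x \<in> K \<Longrightarrow> \<beta> x \<in> test_functions U"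
  "\<And>x y. x \<in> K \<Longrightarrow> 0 \<le> \<beta> x y \<and> \<beta> x y \<le> 1" "\<And>x. x \<in> K \<Longrightarrow> d x > 0"
  "\<And>x y. x \<in> K \<Longrightarrow> y \<in> ball x (d x) \<Longrightarrow> \<beta> x y = (1::real)" by metis
 have "K \<subseteq> (\<Union>x\<in>K. ball x (d x))" using \<beta>(3) by auto
 then obtain F where F: "F \<subseteq> K" "finite F" "K \<subseteq> (\<Union>x\<in>F. ball x (d x))" using compactE_image[OF assms(1), of K "\<lambda>x. ball x (d x)"] by auto
 define \<phi> where "\<phi> y = 1 - (\<Prod>x\<in>F. 1 - \<beta> x y)" for y
 obtain C where C: "\<And>x. x \<in> F \<Longrightarrow> compact (C x) \<and> C x \<subseteq> U \<and> (\<forall>y. y \<notin> C x \<longrightarrow> \<beta> x y = 0)"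
  using \<beta>(1)[THEN test_functions_support] F(1) by (metis subsetD)
 have supp: "y \<in> (\<Union>x\<in>F. C x)" if "\<phi> y \<noteq> 0" for y
 proof (rule ccontr)
  assume "\<not> ?thesis"
  then have "(\<Prod>x\<in>F. 1 - \<beta> x y) = 1" using C by (intro prod.neutral) auto
  with that show False by (simp add: \<phi>_def)
 qed
 show thesis
 proof
  show "\<phi> \<in> test_functions U"
  proof (rule test_functionsI)
   show "smooth \<phi>" unfolding \<phi>_def[abs_def] using \<beta>(1)[THEN test_functions_smooth] F(1)
    by (intro smooth_diff smooth_prod smooth_const) auto
   show "compact (\<Union>x\<in>F. C x)" "(\<Union>x\<in>F. C x) \<subseteq> U" using C F(2) by (auto intro!: compact_UN)
  qed (use supp in auto)
  show "0 \<le> \<phi> y" "\<phi> y \<le> 1" for y using \<beta>(2) F(1) by (auto simp: \<phi>_def subset_iff intro!: prod_le_1 prod_nonneg)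
  show "y \<in> U" if "\<phi> y \<noteq> 0" for y using supp[OF that] C by auto
  show "\<phi> y = 1" if "y \<in> K" for y
  proof -
   obtain x where "x \<in> F" "y \<in> ball x (d x)" using F(3) \<open>y \<in> K\<close> by auto
   then have "(\<Prod>x\<in>F. 1 - \<beta> x y) = 0" using \<beta>(4) F(1,2) by (intro prod_zero) auto
   then show ?thesis by (simp add: \<phi>_def)
  qed
 qed
qed

section \<open>Square integrable functions\<close>

type_synonym space = "real^3"

definition l2norm :: "(space \<Rightarrow> 'b::euclidean_space) \<Rightarrow> real" where
 "l2norm g = sqrt (LI x. (norm (g x))^2)"

lemma l2norm_power2: "(l2norm g)^2 = (LI x. (norm (g x))^2)" by (simp add: l2norm_def)

lemma l2norm_nonneg [simp]: "0 \<le> l2norm g" by (simp add: l2norm_def)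

lemma L2_norm_eq_l2norm: "L2_norm g = l2norm g" by (simp add: L2_norm_def l2norm_def)

lemma square_integrableD:
 assumes "square_integrable g"
 shows "g \<in> borel_measurable lebesgue" "integrable lebesgue (\<lambda>x. (norm (g x))^2)" using assms by (auto simp: square_integrable_def)

lemma square_integrable_bound:
 fixes f :: "space \<Rightarrow> 'b::euclidean_space" and g :: "space \<Rightarrow> 'c::euclidean_space"
 assumes "f \<in> borel_measurable lebesgue" "square_integrable g" "AE x in lebesgue. norm (f x) \<le> norm (g x)"
 shows "square_integrable f"
proof -
 have "integrable lebesgue (\<lambda>x. (norm (f x))^2)" by (rule Bochner_Integration.integrable_bound[OF square_integrableD(2)[OF assms(2)]])
   (use assms in \<open>auto intro: power_mono\<close>)
 then show ?thesis using assms by (simp add: square_integrable_def)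
qed

lemma l2norm_mono:
 fixes f :: "space \<Rightarrow> 'b::euclidean_space" and g :: "space \<Rightarrow> 'c::euclidean_space"
 assumes "f \<in> borel_measurable lebesgue" "square_integrable g" "AE x in lebesgue. norm (f x) \<le> norm (g x)"
 shows "l2norm f \<le> l2norm g" unfolding l2norm_def
 using square_integrableD(2)[OF square_integrable_bound[OF assms]] square_integrableD(2)[OF assms(2)] assms(3)
 by (auto intro!: integral_mono_AE power_mono)

lemma square_integrable_scaleR:
 "square_integrable g \<Longrightarrow> square_integrable (\<lambda>x. c *\<^sub>R g x)"
 by (auto simp: square_integrable_def power_mult_distrib intro: borel_measurable_scaleR)

lemma square_integrable_cmult:
 fixes g :: "space \<Rightarrow> real"
 shows "square_integrable g \<Longrightarrow> square_integrable (\<lambda>x. c * g x)" using square_integrable_scaleR[of g c] by simp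

lemma square_integrable_minus: "square_integrable g \<Longrightarrow> square_integrable (\<lambda>x. - g x)" by (simp add: square_integrable_def)

lemma square_integrable_zero [simp]: "square_integrable (\<lambda>x. 0)" by (simp add: square_integrable_def)

lemma square_integrable_add:
 assumes "square_integrable f" "square_integrable g"
 shows "square_integrable (\<lambda>x. f x + g x)"
proof -
 have "integrable lebesgue (\<lambda>x. (norm (f x + g x))^2)"
 proof (rule Bochner_Integration.integrable_bound)
  show "integrable lebesgue (\<lambda>x. 2 * (norm (f x))^2 + 2 * (norm (g x))^2)" using assms by (auto simp: square_integrable_def)
  have "(norm (f x + g x))^2 \<le> 2 * (norm (f x))^2 + 2 * (norm (g x))^2" for x
  proof -
   have "(norm (f x + g x))^2 \<le> (norm (f x) + norm (g x))^2" by (intro power_mono norm_triangle_ineq) auto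
   also have "\<dots> \<le> 2 * (norm (f x))^2 + 2 * (norm (g x))^2"
    using sum_squares_bound[of "norm (f x)" "norm (g x)"] by (simp add: power2_sum)
   finally show ?thesis .
  qed
  then show "AE x in lebesgue. norm ((norm (f x + g x))^2) \<le> norm (2 * (norm (f x))^2 + 2 * (norm (g x))^2)" by auto
 qed (use assms in \<open>auto simp: square_integrable_def\<close>)
 then show ?thesis using assms by (auto simp: square_integrable_def)
qed

lemma square_integrable_diff:
 "square_integrable f \<Longrightarrow> square_integrable g \<Longrightarrow> square_integrable (\<lambda>x. f x - g x)"
 using square_integrable_add[of f "\<lambda>x. - g x"] by (simp add: square_integrable_minus)

lemma integrable_inner:
 assumes "square_integrable f" "square_integrable g"
 shows "integrable lebesgue (\<lambda>x. f x \<bullet> g x)"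
proof (rule Bochner_Integration.integrable_bound)
 show "integrable lebesgue (\<lambda>x. (norm (f x))^2 + (norm (g x))^2)" using assms by (auto simp: square_integrable_def)
 have "\<bar>f x \<bullet> g x\<bar> \<le> (norm (f x))^2 + (norm (g x))^2" for x
 proof -
  have "\<bar>f x \<bullet> g x\<bar> \<le> norm (f x) * norm (g x)" by (rule Cauchy_Schwarz_ineq2)
  also have "\<dots> \<le> (norm (f x))^2 + (norm (g x))^2"
   using sum_squares_bound[of "norm (f x)" "norm (g x)"] zero_le_power2[of "norm (f x)"] zero_le_power2[of "norm (g x)"] by linarith
  finally show ?thesis .
 qed
 then show "AE x in lebesgue. norm (f x \<bullet> g x) \<le> norm ((norm (f x))^2 + (norm (g x))^2)" by auto
qed (use assms in \<open>auto simp: square_integrable_def\<close>)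

lemma integrable_times:
 fixes f g :: "space \<Rightarrow> real"
 shows "square_integrable f \<Longrightarrow> square_integrable g \<Longrightarrow> integrable lebesgue (\<lambda>x. f x * g x)" using integrable_inner[of f g] by simp

lemma quadratic_nonneg_imp_discriminant:
 fixes a b c :: real
 assumes "\<And>t. 0 \<le> a - 2 * t * b + t^2 * c" "0 \<le> c"
 shows "b^2 \<le> a * c"
proof (cases "c = 0")
 case True
 have "b = 0"
 proof (rule ccontr)
  assume "b \<noteq> 0"
  then show False using assms(1)[of "(a + 1) / (2 * b)"] True by simp
 qed
 then show ?thesis using True by simp
next
 case False
 then show ?thesis using assms(1)[of "b / c"] assms(2) by (simp add: power2_eq_square field_simps)
qed

lemma norm_diff_scale_power2:
 "(norm (x - t *\<^sub>R y))^2 = (norm x)^2 - 2 * t * (x \<bullet> y) + t^2 * (norm y)^2"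
 unfolding power2_norm_eq_inner by (simp add: algebra_simps inner_commute power2_eq_square)

lemma l2_Cauchy_Schwarz:
 assumes "square_integrable f" "square_integrable g"
 shows "\<bar>LI x. f x \<bullet> g x\<bar> \<le> l2norm f * l2norm g"
proof -
 have "(LI x. f x \<bullet> g x)^2 \<le> (l2norm f)^2 * (l2norm g)^2"
 proof (rule quadratic_nonneg_imp_discriminant)
  fix t :: real
  have "0 \<le> (LI x. (norm (f x - t *\<^sub>R g x))^2)" by simp
  also have "\<dots> = (LI x. (norm (f x))^2 - 2 * t * (f x \<bullet> g x) + t^2 * (norm (g x))^2)" by (simp add: norm_diff_scale_power2)
  also have "\<dots> = (l2norm f)^2 - 2 * t * (LI x. f x \<bullet> g x) + t^2 * (l2norm g)^2"
   using assms integrable_inner[OF assms] by (simp add: l2norm_power2 square_integrable_def)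
  finally show "0 \<le> (l2norm f)^2 - 2 * t * (LI x. f x \<bullet> g x) + t^2 * (l2norm g)^2" .
 qed simp
 then have "\<bar>LI x. f x \<bullet> g x\<bar>^2 \<le> (l2norm f * l2norm g)^2" by (simp add: power_mult_distrib)
 then show ?thesis by (rule power2_le_imp_le) simp
qed

lemma l2_Cauchy_Schwarz_real:
 fixes f g :: "space \<Rightarrow> real"
 assumes "square_integrable f" "square_integrable g"
 shows "\<bar>LI x. f x * g x\<bar> \<le> l2norm f * l2norm g" using l2_Cauchy_Schwarz[OF assms] by simp

lemma l2norm_scaleR: "l2norm (\<lambda>x. c *\<^sub>R g x) = \<bar>c\<bar> * l2norm g" by (simp add: l2norm_def power_mult_distrib real_sqrt_mult)

lemma l2norm_cmult: "l2norm (\<lambda>x. c * g x :: real) = \<bar>c\<bar> * l2norm g" using l2norm_scaleR[of c g] by simp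

lemma l2norm_minus: "l2norm (\<lambda>x. - g x) = l2norm g" by (simp add: l2norm_def)

lemma l2norm_zero [simp]: "l2norm (\<lambda>x. 0) = 0" by (simp add: l2norm_def)

lemma l2norm_add_power2:
 assumes "square_integrable f" "square_integrable g"
 shows "(l2norm (\<lambda>x. f x + g x))^2 = (l2norm f)^2 + 2 * (LI x. f x \<bullet> g x) + (l2norm g)^2"
proof -
 have "(norm (f x + g x))^2 = (norm (f x))^2 + 2 * (f x \<bullet> g x) + (norm (g x))^2" for x
  using norm_diff_scale_power2[of "f x" "-1" "g x"] by simp
 then show ?thesis using assms integrable_inner[OF assms] by (simp add: l2norm_power2 square_integrable_def)
qed

lemma l2norm_triangle:
 assumes "square_integrable f" "square_integrable g"
 shows "l2norm (\<lambda>x. f x + g x) \<le> l2norm f + l2norm g"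
proof (rule power2_le_imp_le)
 show "(l2norm (\<lambda>x. f x + g x))^2 \<le> (l2norm f + l2norm g)^2"
  using l2norm_add_power2[OF assms] l2_Cauchy_Schwarz[OF assms] by (simp add: power2_sum)
qed simp

lemma l2norm_triangle_diff:
 assumes "square_integrable f" "square_integrable g"
 shows "l2norm (\<lambda>x. f x - g x) \<le> l2norm f + l2norm g"
 using l2norm_triangle[OF assms(1) square_integrable_minus[OF assms(2)]] by (simp add: l2norm_minus)

lemma l2norm_cong_AE:
 fixes f g :: "space \<Rightarrow> 'b::euclidean_space"
 assumes "f \<in> borel_measurable lebesgue" "g \<in> borel_measurable lebesgue" "AE x in lebesgue. f x = g x"
 shows "l2norm f = l2norm g"
proof -
 have "(LI x. (norm (f x))^2) = (LI x. (norm (g x))^2)" using assms by (intro integral_cong_AE) auto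
 then show ?thesis by (simp add: l2norm_def)
qed

lemma l2norm_eq_0_iff:
 fixes g :: "space \<Rightarrow> 'b::euclidean_space"
 assumes "square_integrable g"
 shows "l2norm g = 0 \<longleftrightarrow> (AE x in lebesgue. g x = 0)"
 using integral_nonneg_eq_0_iff_AE[OF square_integrableD(2)[OF assms]] by (simp add: l2norm_def)

lemma square_integrable_component:
 fixes G :: "space \<Rightarrow> space"
 assumes "square_integrable G"
 shows "square_integrable (\<lambda>x. G x $ i)"
proof (rule square_integrable_bound[OF _ assms])
 have "(\<lambda>x. G x \<bullet> axis i 1) \<in> borel_measurable lebesgue" using square_integrableD(1)[OF assms] by (intro borel_measurable_inner) auto
 then show "(\<lambda>x. G x $ i) \<in> borel_measurable lebesgue" by (simp add: inner_axis)
qed (auto simp: component_le_norm_cart)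

lemma borel_measurable_vec3:
 fixes G :: "'a \<Rightarrow> space"
 assumes "\<And>i. (\<lambda>x. G x $ i) \<in> borel_measurable M"
 shows "G \<in> borel_measurable M"
proof (rule borel_measurable_euclidean_space[THEN iffD2], rule ballI)
 fix b :: space assume "b \<in> Basis"
 then obtain i where "b = axis i 1" by (auto simp: Basis_vec_def)
 then show "(\<lambda>x. G x \<bullet> b) \<in> borel_measurable M" using assms by (simp add: inner_axis)
qed

lemma square_integrable_vec3:
 fixes G :: "space \<Rightarrow> space"
 assumes "\<And>i. square_integrable (\<lambda>x. G x $ i)"
 shows "square_integrable G"
proof -
 have eq: "(norm (G x))^2 = (\<Sum>i\<in>UNIV. (norm (G x $ i))^2)" for x by (simp add: norm_vec_def L2_set_def sum_nonneg)
 have "integrable lebesgue (\<lambda>x. (norm (G x))^2)"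
  unfolding eq using assms by (intro Bochner_Integration.integrable_sum) (auto simp: square_integrable_def)
 moreover have "G \<in> borel_measurable lebesgue" using assms by (intro borel_measurable_vec3) (auto simp: square_integrable_def)
 ultimately show ?thesis by (simp add: square_integrable_def)
qed

lemma square_integrable_compact_support:
 fixes f :: "space \<Rightarrow> real"
 assumes "f \<in> borel_measurable lebesgue" "compact K" "\<And>x. \<bar>f x\<bar> \<le> M" "\<And>x. x \<notin> K \<Longrightarrow> f x = 0"
 shows "integrable lebesgue f" "square_integrable f"
proof -
 have K: "K \<in> sets lebesgue" "emeasure lebesgue K < \<infinity>" using assms(2) emeasure_compact_finite[OF assms(2)] by (auto simp: borel_compact)
 show "integrable lebesgue f" by (rule integrableI_bounded_set[OF K(1) _ K(2), where B = M]) (use assms in auto)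
 have "integrable lebesgue (\<lambda>x. (norm (f x))^2)" by (rule integrableI_bounded_set[OF K(1) _ K(2), where B = "M^2"])
   (use assms in \<open>auto simp flip: abs_le_square_iff intro: order_trans[OF _ abs_ge_self]\<close>)
 then show "square_integrable f" using assms by (simp add: square_integrable_def)
qed

lemma continuous_borel_measurable_lebesgue:
 fixes f :: "'a::euclidean_space \<Rightarrow> 'b::euclidean_space"
 shows "continuous_on UNIV f \<Longrightarrow> f \<in> borel_measurable lebesgue" using continuous_imp_measurable_on_sets_lebesgue[of UNIV f] by simp

lemma continuous_compact_support_bounded:
 fixes f :: "'a::euclidean_space \<Rightarrow> real"
 assumes "continuous_on UNIV f" "compact K" "\<And>x. x \<notin> K \<Longrightarrow> f x = 0"
 obtains M where "M \<ge> 0" "\<And>x. \<bar>f x\<bar> \<le> M"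
proof -
 have "bounded (f ` K)" using assms by (meson compact_continuous_image compact_imp_bounded continuous_on_subset subset_UNIV)
 then obtain M where "\<And>x. x \<in> K \<Longrightarrow> \<bar>f x\<bar> \<le> M" by (auto simp: bounded_iff)
 then have "\<bar>f x\<bar> \<le> max M 0" for x using assms(3)[of x] by (cases "x \<in> K") (auto simp: le_max_iff_disj)
 then show thesis using that[of "max M 0"] by simp
qed

lemma frechet_derivative_outside_support:
 fixes \<phi> :: "'a::euclidean_space \<Rightarrow> real"
 assumes "compact K" "\<And>x. x \<notin> K \<Longrightarrow> \<phi> x = 0" "x \<notin> K"
 shows "frechet_derivative \<phi> (at x) = (\<lambda>b. 0)"
proof -
 have "open (- K)" using assms(1) compact_imp_closed by blast
 then have "(\<phi> has_derivative (\<lambda>b. 0)) (at x)"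
  by (rule has_derivative_transform_within_open[OF has_derivative_const[of 0]]) (use assms in auto)
 then show ?thesis using frechet_derivative_at by metis
qed

lemma test_functions_frechet:
 assumes "\<phi> \<in> test_functions \<Omega>" "b \<in> Basis"
 shows "(\<lambda>x. frechet_derivative \<phi> (at x) b) \<in> test_functions \<Omega>"
proof -
 obtain K where K: "compact K" "K \<subseteq> \<Omega>" "\<And>x. x \<notin> K \<Longrightarrow> \<phi> x = 0" using test_functions_support[OF assms(1)] by blast
 show ?thesis
 proof (rule test_functionsI[OF smooth_frechet _ K(1,2)])
  show "x \<in> K" if "frechet_derivative \<phi> (at x) b \<noteq> 0" for x using frechet_derivative_outside_support[OF K(1,3)] that by fastforce
 qed (use assms test_functions_smooth in auto)
qed

lemma test_functions_props:
 fixes \<phi> :: "space \<Rightarrow> real"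
 assumes "\<phi> \<in> test_functions \<Omega>"
 shows "continuous_on UNIV \<phi>" "\<phi> \<in> borel_measurable lebesgue" "integrable lebesgue \<phi>" "square_integrable \<phi>"
  "\<exists>M\<ge>0. \<forall>x. \<bar>\<phi> x\<bar> \<le> M"
proof -
 obtain K where K: "compact K" "K \<subseteq> \<Omega>" "\<And>x. x \<notin> K \<Longrightarrow> \<phi> x = 0" using test_functions_support[OF assms(1)] by blast
 show c: "continuous_on UNIV \<phi>" using assms smooth_continuous test_functions_smooth by blast
 then show m: "\<phi> \<in> borel_measurable lebesgue" by (rule continuous_borel_measurable_lebesgue)
 obtain M where "M \<ge> 0" "\<And>x. \<bar>\<phi> x\<bar> \<le> M" using continuous_compact_support_bounded[OF c K(1,3)] by blast
 then show "integrable lebesgue \<phi>" "square_integrable \<phi>" "\<exists>M\<ge>0. \<forall>x. \<bar>\<phi> x\<bar> \<le> M"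
  using square_integrable_compact_support[OF m K(1) _ K(3)] by blast+
qed

section \<open>Translations\<close>

lemma lebesgue_translation:
 fixes a :: "'a::euclidean_space"
 shows "(\<lambda>x. x + a) \<in> lebesgue \<rightarrow>\<^sub>M lebesgue" "distr lebesgue lebesgue (\<lambda>x. x + a) = lebesgue"
proof -
 have eq: "(\<lambda>x. a + (\<Sum>j\<in>Basis. (1 * (x \<bullet> j)) *\<^sub>R j)) = (\<lambda>x. x + a)" by (simp add: euclidean_representation add.commute)
 show "(\<lambda>x. x + a) \<in> lebesgue \<rightarrow>\<^sub>M lebesgue" using lebesgue_affine_measurable[of "\<lambda>_. 1" a] unfolding eq by simp
 show "distr lebesgue lebesgue (\<lambda>x. x + a) = lebesgue" using lebesgue_affine_euclidean[of "\<lambda>_. 1" a] unfolding eq by (simp add: density_1)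
qed

lemma borel_measurable_translate:
 fixes f :: "'a::euclidean_space \<Rightarrow> 'b::topological_space"
 shows "f \<in> borel_measurable lebesgue \<Longrightarrow> (\<lambda>x. f (x + a)) \<in> borel_measurable lebesgue"
 using measurable_compose[OF lebesgue_translation(1)] by blast

lemma integral_translate:
 fixes f :: "'a::euclidean_space \<Rightarrow> real"
 assumes "f \<in> borel_measurable lebesgue"
 shows "(LI x. f (x + a)) = (LI x. f x)"
 using integral_distr[OF lebesgue_translation(1), of f a] assms by (simp add: lebesgue_translation(2))

lemma integrable_translate:
 fixes f :: "'a::euclidean_space \<Rightarrow> real"
 assumes "integrable lebesgue f"
 shows "integrable lebesgue (\<lambda>x. f (x + a))"
 using integrable_distr_eq[OF lebesgue_translation(1), of f a] assms by (simp add: lebesgue_translation(2))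

lemma square_integrable_translate: "square_integrable g \<Longrightarrow> square_integrable (\<lambda>x. g (x + a))"
 using integrable_translate[of "\<lambda>x. (norm (g x))^2" a] by (simp add: square_integrable_def borel_measurable_translate)

lemma l2norm_translate:
 assumes "square_integrable g"
 shows "l2norm (\<lambda>x. g (x + a)) = l2norm g"
proof -
 have "(\<lambda>x. (norm (g x))^2) \<in> borel_measurable lebesgue" using assms by (auto simp: square_integrable_def)
 then show ?thesis using integral_translate[of "\<lambda>x. (norm (g x))^2" a] by (simp add: l2norm_def)
qed

section \<open>Density of test functions\<close>

definition test_approx :: "(space \<Rightarrow> real) \<Rightarrow> bool" where
 "test_approx g \<longleftrightarrow> square_integrable g \<and> (\<forall>e>0. \<exists>\<phi>\<in>test_functions UNIV. l2norm (\<lambda>x. g x - \<phi> x) < e)"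

lemma test_approx_zero: "test_approx (\<lambda>x. 0)" unfolding test_approx_def
proof (intro conjI allI impI)
 fix e :: real assume "e > 0"
 have "(\<lambda>x. 0) \<in> test_functions (UNIV :: space set)" by (rule test_functionsI[where K = "{}"]) auto
 then show "\<exists>\<phi>\<in>test_functions UNIV. l2norm (\<lambda>x::space. 0 - \<phi> x) < e" using \<open>e > 0\<close> by (intro bexI[of _ "\<lambda>x. 0"]) auto
qed simp

lemma test_approx_add:
 assumes "test_approx f" "test_approx g"
 shows "test_approx (\<lambda>x. f x + g x)" unfolding test_approx_def
proof (intro conjI allI impI)
 fix e :: real assume "e > 0"
 then have "e / 2 > 0" by simp
 then obtain \<phi> \<psi> where *: "\<phi> \<in> test_functions UNIV" "l2norm (\<lambda>x. f x - \<phi> x) < e / 2"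
  "\<psi> \<in> test_functions UNIV" "l2norm (\<lambda>x. g x - \<psi> x) < e / 2" using assms unfolding test_approx_def by blast
 have "l2norm (\<lambda>x. (f x - \<phi> x) + (g x - \<psi> x)) \<le> l2norm (\<lambda>x. f x - \<phi> x) + l2norm (\<lambda>x. g x - \<psi> x)"
  using assms * by (intro l2norm_triangle square_integrable_diff) (auto simp: test_approx_def test_functions_props)
 then have "l2norm (\<lambda>x. (f x + g x) - (1 * \<phi> x + 1 * \<psi> x)) < e" using * by (simp add: algebra_simps)
 then show "\<exists>\<phi>\<in>test_functions UNIV. l2norm (\<lambda>x. (f x + g x) - \<phi> x) < e"
  using test_functions_lincomb[OF *(1,3)] by (intro bexI[of _ "\<lambda>x. 1 * \<phi> x + 1 * \<psi> x"])
qed (use assms in \<open>auto simp: test_approx_def intro: square_integrable_add\<close>)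

lemma test_approx_cmult:
 assumes "test_approx f"
 shows "test_approx (\<lambda>x. c * f x)" unfolding test_approx_def
proof (intro conjI allI impI)
 fix e :: real assume "e > 0"
 then have "e / (\<bar>c\<bar> + 1) > 0" by (simp add: add_nonneg_pos)
 then obtain \<phi> where *: "\<phi> \<in> test_functions UNIV" "l2norm (\<lambda>x. f x - \<phi> x) < e / (\<bar>c\<bar> + 1)" using assms unfolding test_approx_def by blast
 have "l2norm (\<lambda>x. c * (f x - \<phi> x)) = \<bar>c\<bar> * l2norm (\<lambda>x. f x - \<phi> x)" by (rule l2norm_cmult)
 also have "\<dots> \<le> \<bar>c\<bar> * (e / (\<bar>c\<bar> + 1))" using *(2) by (intro mult_left_mono) auto
 also have "\<dots> < e" using \<open>e > 0\<close> by (simp add: field_simps)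
 finally have "l2norm (\<lambda>x. c * f x - (c * \<phi> x + 0 * \<phi> x)) < e" by (simp add: algebra_simps)
 then show "\<exists>\<phi>\<in>test_functions UNIV. l2norm (\<lambda>x. c * f x - \<phi> x) < e"
  using test_functions_lincomb[OF *(1,1)] by (intro bexI[of _ "\<lambda>x. c * \<phi> x + 0 * \<phi> x"])
qed (use assms in \<open>auto simp: test_approx_def intro: square_integrable_cmult\<close>)

lemma test_approx_sum:
 "(\<And>i. i \<in> S \<Longrightarrow> test_approx (f i)) \<Longrightarrow> test_approx (\<lambda>x. \<Sum>i\<in>S. f i x)"
 by (induction S rule: infinite_finite_induct) (auto intro: test_approx_add test_approx_zero)

lemma test_approx_limit:
 assumes "square_integrable g" "\<And>n. test_approx (f n)" "(\<lambda>n. l2norm (\<lambda>x. g x - f n x)) \<longlonglongrightarrow> 0"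
 shows "test_approx g" unfolding test_approx_def
proof (intro conjI allI impI)
 fix e :: real assume "e > 0"
 then have "\<forall>\<^sub>F n in sequentially. l2norm (\<lambda>x. g x - f n x) < e / 2" by (intro order_tendstoD(2)[OF assms(3)]) auto
 then obtain n where n: "l2norm (\<lambda>x. g x - f n x) < e / 2" by (auto simp: eventually_sequentially)
 have "e / 2 > 0" using \<open>e > 0\<close> by simp
 then obtain \<phi> where *: "\<phi> \<in> test_functions UNIV" "l2norm (\<lambda>x. f n x - \<phi> x) < e / 2"
  using assms(2)[of n] unfolding test_approx_def by blast
 have "l2norm (\<lambda>x. (g x - f n x) + (f n x - \<phi> x)) \<le> l2norm (\<lambda>x. g x - f n x) + l2norm (\<lambda>x. f n x - \<phi> x)"
  using assms(1) assms(2)[of n] * by (intro l2norm_triangle square_integrable_diff) (auto simp: test_approx_def test_functions_props)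
 then show "\<exists>\<phi>\<in>test_functions UNIV. l2norm (\<lambda>x. g x - \<phi> x) < e" using n * by (intro bexI[of _ \<phi>]) auto
qed (fact assms(1))

text \<open>Regularity of the measure places a compact \<open>K\<close> inside and an open
  \<open>V\<close> around \<open>A\<close>; a bump equal to 1 on \<open>K\<close> and supported in
  \<open>V\<close> can differ from the indicator only on a set \<open>E\<close> of small measure.
  The inner closed set becomes compact after intersection with a large ball; the part cut off is
  \<open>W n\<close>.\<close>

lemma test_approx_indicator:
 assumes A: "A \<in> sets lebesgue" "emeasure lebesgue A < \<infinity>"
 shows "test_approx (indicator A)" unfolding test_approx_def
proof (intro conjI allI impI)
 show sq: "square_integrable (indicator A :: space \<Rightarrow> real)"
 proof -
  have "integrable lebesgue (\<lambda>x. (norm (indicator A x :: real))^2)"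
   using A by (intro integrableI_bounded_set[where A = A and B = 1]) (auto simp: indicator_def)
  then show ?thesis using A by (simp add: square_integrable_def)
 qed
 fix e :: real assume "e > 0"
 \<comment> \<open>The squared error is at most the measure of \<open>E\<close>, which consists of
   three pieces of measure below \<open>d\<close>; 3 d < 4 d = e^2.\<close>
 define d where "d = e^2 / 4"
 have d: "d > 0" using \<open>e > 0\<close> by (simp add: d_def)
 obtain V where V: "open V" "A \<subseteq> V" "V - A \<in> lmeasurable" "emeasure lebesgue (V - A) < ennreal d"
  using sets_lebesgue_outer_open[OF A(1) d] by blast
 obtain C where C: "closed C" "C \<subseteq> A" "A - C \<in> lmeasurable" "emeasure lebesgue (A - C) < ennreal d"
  using sets_lebesgue_inner_closed[OF A(1) d] by blast
 define W where "W n = C - cball 0 (real n)" for n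
 have Wsets: "W n \<in> sets lebesgue" for n using C(1) by (auto simp: W_def intro: borel_closed)
 have "(\<lambda>n. emeasure lebesgue (W n)) \<longlonglongrightarrow> emeasure lebesgue (\<Inter>n. W n)"
 proof (rule Lim_emeasure_decseq)
  show "decseq W" by (auto simp: decseq_def W_def)
  have "emeasure lebesgue (W i) \<le> emeasure lebesgue A" for i using C A by (intro emeasure_mono) (auto simp: W_def)
  then show "emeasure lebesgue (W i) \<noteq> \<infinity>" for i using A(2) by (metis infinity_ennreal_def leD top.not_eq_extremum)
 qed (use Wsets in auto)
 moreover have "(\<Inter>n. W n) = {}" by (auto simp: W_def) (meson norm_ge_zero real_arch_simple)
 ultimately have "(\<lambda>n. emeasure lebesgue (W n)) \<longlonglongrightarrow> 0" by simp
 then have "\<forall>\<^sub>F n in sequentially. emeasure lebesgue (W n) < ennreal d" using d by (intro order_tendstoD(2)) auto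
 then obtain n where n: "emeasure lebesgue (W n) < ennreal d" by (auto simp: eventually_sequentially)
 define K where "K = C \<inter> cball 0 (real n)"
 have K: "compact K" "K \<subseteq> V" using C V by (auto simp: K_def intro: closed_Int_compact)
 obtain \<phi> where \<phi>: "\<phi> \<in> test_functions V" "\<And>y. 0 \<le> \<phi> y" "\<And>y. \<phi> y \<le> 1" "\<And>y. y \<in> K \<Longrightarrow> \<phi> y = 1"
  "\<And>y. \<phi> y \<noteq> 0 \<Longrightarrow> y \<in> V" using smooth_Urysohn[OF K(1) V(1) K(2)] by metis
 have \<phi>': "\<phi> \<in> test_functions UNIV" using \<phi>(1) by (auto simp: test_functions_def)
 define E where "E = (V - A) \<union> (A - C) \<union> W n"
 have E: "E \<in> lmeasurable" unfolding E_def using V C Wsets n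
  by (intro fmeasurable.Un) (auto intro!: fmeasurableI intro: order.strict_trans)
 have "measure lebesgue (V - A) < d" "measure lebesgue (A - C) < d" "measure lebesgue (W n) < d" using V(3,4) C(3,4) n d
  by (auto simp: measure_def fmeasurable_def enn2real_less_iff order.strict_trans[OF _ ennreal_less_top])
 then have mE: "measure lebesgue E < 3 * d"
  unfolding E_def using measure_Un_le[of "(V - A) \<union> (A - C)" lebesgue "W n"] measure_Un_le[of "V - A" lebesgue "A - C"]
   V(3) C(3) Wsets by (auto simp: fmeasurableD)
 have le: "\<bar>indicator A x - \<phi> x\<bar> \<le> indicator E x" for x
 proof (cases "x \<in> E")
  case True
  then show ?thesis using \<phi>(2,3)[of x] by (auto simp: indicator_def)
 next
  case False
  then have "x \<in> K \<or> x \<notin> V" by (auto simp: E_def K_def W_def)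
  then show ?thesis
  proof
   assume "x \<in> K"
   then have "x \<in> A" "\<phi> x = 1" using C(2) \<phi>(4) by (auto simp: K_def)
   then show ?thesis by simp
  next
   assume "x \<notin> V"
   then have "x \<notin> A" "\<phi> x = 0" using V(2) \<phi>(5) by auto
   then show ?thesis by simp
  qed
 qed
 have "(l2norm (\<lambda>x. indicator A x - \<phi> x))^2 \<le> (LI x. indicator E x)" unfolding l2norm_power2
 proof (rule integral_mono)
  show "integrable lebesgue (\<lambda>x. (norm (indicator A x - \<phi> x))^2)"
   using square_integrable_diff[OF sq test_functions_props(4)[OF \<phi>']] by (simp add: square_integrable_def)
  show "(norm (indicator A x - \<phi> x))^2 \<le> indicator E x" for x
   using power_mono[OF le[of x], of 2] by (auto simp: indicator_def split: if_splits)
 qed (use E in \<open>auto simp: fmeasurable_def\<close>)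
 also have "\<dots> = measure lebesgue E" by simp
 also have "\<dots> < 4 * d" using mE d by linarith
 also have "\<dots> = e^2" by (simp add: d_def)
 finally have "l2norm (\<lambda>x. indicator A x - \<phi> x) < e" using \<open>e > 0\<close> by (simp add: power2_less_imp_less)
 with \<phi>' show "\<exists>\<phi>\<in>test_functions UNIV. l2norm (\<lambda>x. indicator A x - \<phi> x) < e" by blast
qed

lemma test_functions_dense:
 fixes g :: "space \<Rightarrow> real"
 assumes g: "square_integrable g"
 shows "test_approx g"
proof -
 \<comment> \<open>Approximation relative to the point 0 yields the bound by 2 |g|. It gives the
   nonzero level sets of the simple functions finite measure and supplies the dominating function 9
   g^2 below.\<close>
 obtain F where F: "\<And>i. simple_function lebesgue (F i)" "\<And>x. (\<lambda>i. F i x) \<longlonglongrightarrow> g x"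
  "\<And>i x. \<bar>F i x\<bar> \<le> 2 * \<bar>g x\<bar>" using borel_measurable_implies_sequence_metric[OF square_integrableD(1)[OF g], of 0] by auto
 have Fsq: "square_integrable (F i)" for i using F(1,3) square_integrable_cmult[OF g, of 2]
  by (elim square_integrable_bound[rotated]) (auto intro: borel_measurable_simple_function simp: abs_mult)
 have Fapprox: "test_approx (F i)" for i
 proof -
  have fin: "finite (range (F i))" using simple_functionD(1)[OF F(1)[of i]] by simp
  have eq: "F i = (\<lambda>x. \<Sum>y\<in>range (F i). y * indicator (F i -` {y}) x)"
  proof
   fix x
   have "(\<Sum>y\<in>range (F i). y * indicator (F i -` {y}) x) = (\<Sum>y\<in>range (F i). if y = F i x then y else 0)"
    by (intro sum.cong) (auto simp: indicator_def)
   also have "\<dots> = F i x" using fin by (subst sum.delta) auto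
   finally show "F i x = (\<Sum>y\<in>range (F i). y * indicator (F i -` {y}) x)" by simp
  qed
  have "test_approx (\<lambda>x. y * indicator (F i -` {y}) x)" for y
  proof (cases "y = 0")
   case True
   then show ?thesis using test_approx_zero by simp
  next
   case False
   have S: "F i -` {y} \<in> sets lebesgue" using simple_functionD(2)[OF F(1)[of i], of "{y}"] by simp
   have "integrable lebesgue (\<lambda>x. indicator (F i -` {y}) x * y^2)"
   proof (rule Bochner_Integration.integrable_bound[OF square_integrableD(2)[OF Fsq[of i]]])
    show "(\<lambda>x. indicator (F i -` {y}) x * y^2) \<in> borel_measurable lebesgue" using S by measurable
   qed (auto simp: indicator_def)
   then have "integrable lebesgue (\<lambda>x. indicator (F i -` {y}) x :: real)" using False by simp
   then have "emeasure lebesgue (F i -` {y}) < \<infinity>" using S by (simp add: integrable_indicator_iff)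
   then show ?thesis using S by (intro test_approx_cmult test_approx_indicator)
  qed
  then have "test_approx (\<lambda>x. \<Sum>y\<in>range (F i). y * indicator (F i -` {y}) x)" by (rule test_approx_sum)
  then show ?thesis using eq by simp
 qed
 have "(\<lambda>n. LI x. (norm (g x - F n x))^2) \<longlonglongrightarrow> (LINT x|(lebesgue :: space measure). 0)"
 proof (rule integral_dominated_convergence[where w = "\<lambda>x. 9 * (norm (g x))^2"])
  show "AE x in lebesgue. (\<lambda>n. (norm (g x - F n x))^2) \<longlonglongrightarrow> 0"
  proof (rule AE_I2)
   fix x
   have "(\<lambda>n. (norm (g x - F n x))^2) \<longlonglongrightarrow> (norm (g x - g x))^2" by (intro tendsto_intros F(2))
   then show "(\<lambda>n. (norm (g x - F n x))^2) \<longlonglongrightarrow> 0" by simp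
  qed
  have "(norm (g x - F n x))^2 \<le> (3 * norm (g x))^2" for n x using F(3)[of n x] by (intro power_mono) auto
  then show "AE x in lebesgue. norm ((norm (g x - F n x))^2) \<le> 9 * (norm (g x))^2" for n by (auto simp: power_mult_distrib)
 qed (use g Fsq square_integrable_diff[OF g Fsq] in \<open>auto simp: square_integrable_def\<close>)
 then have "(\<lambda>n. sqrt (LI x. (norm (g x - F n x))^2)) \<longlonglongrightarrow> sqrt 0" by (intro tendsto_intros) simp
 then have "(\<lambda>n. l2norm (\<lambda>x. g x - F n x)) \<longlonglongrightarrow> 0" by (simp add: l2norm_def)
 then show ?thesis by (rule test_approx_limit[where f = F, OF g Fapprox])
qed

section \<open>Weak derivatives through difference quotients\<close>

text \<open>One direction of \<open>is_weak_gradient\<close>, with square integrability included.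
  Difference quotients act along a single axis, so the calculus is developed for this relation and
  assembled into \<open>has_gradient\<close> afterwards.\<close>

definition weak_deriv :: "3 \<Rightarrow> (space \<Rightarrow> real) \<Rightarrow> (space \<Rightarrow> real) \<Rightarrow> bool" where
 "weak_deriv i u g \<longleftrightarrow> square_integrable u \<and> square_integrable g \<and>
   (\<forall>\<phi>\<in>test_functions UNIV. (LI x. u x * frechet_derivative \<phi> (at x) (axis i 1)) = - (LI x. g x * \<phi> x))"

definition has_gradient :: "(space \<Rightarrow> real) \<Rightarrow> (space \<Rightarrow> space) \<Rightarrow> bool" where
 "has_gradient u G \<longleftrightarrow> (\<forall>i. weak_deriv i u (\<lambda>x. G x $ i))"

lemma weak_derivD:
 "weak_deriv i u g \<Longrightarrow> square_integrable u" "weak_deriv i u g \<Longrightarrow> square_integrable g" by (auto simp: weak_deriv_def)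

lemma has_gradient_iff:
 "has_gradient u G \<longleftrightarrow> square_integrable u \<and> square_integrable G \<and> is_weak_gradient u G"
 using square_integrable_vec3[of G] square_integrable_component[of G] by (auto simp: has_gradient_def weak_deriv_def is_weak_gradient_def)

lemma has_gradientD:
 assumes "has_gradient u G"
 shows "square_integrable u" "square_integrable G" "weak_deriv i u (\<lambda>x. G x $ i)" using assms has_gradient_iff has_gradient_def by blast+

lemma axis_Basis [simp]: "axis i 1 \<in> (Basis :: space set)" by (auto simp: Basis_vec_def)

lemma test_function_line_derivative:
 assumes "smooth \<phi>"
 shows "((\<lambda>s. \<phi> (x + s *\<^sub>R e)) has_real_derivative frechet_derivative \<phi> (at (x + s *\<^sub>R e)) e) (at s)"
proof -
 have "((\<lambda>s. x + s *\<^sub>R e) has_derivative (\<lambda>k. k *\<^sub>R e)) (at s)" by (auto intro!: derivative_eq_intros)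
 from has_derivative_compose[OF this smooth_has_derivative[OF assms]]
 have "((\<lambda>s. \<phi> (x + s *\<^sub>R e)) has_derivative (\<lambda>k. frechet_derivative \<phi> (at (x + s *\<^sub>R e)) (k *\<^sub>R e))) (at s)" .
 moreover have "linear (frechet_derivative \<phi> (at (x + s *\<^sub>R e)))" using smooth_has_derivative[OF assms] has_derivative_linear by blast
 ultimately show ?thesis by (simp add: has_field_derivative_def linear_cmul mult.commute[of _ "frechet_derivative \<phi> (at (x + s *\<^sub>R e)) e"])
qed

lemma frechet_derivative_translate:
 assumes "smooth \<phi>"
 shows "frechet_derivative (\<lambda>x. \<phi> (x + a)) (at x) = frechet_derivative \<phi> (at (x + a))"
proof -
 have "((\<lambda>x. x + a) has_derivative (\<lambda>k. k)) (at x)" by (auto intro!: derivative_eq_intros)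
 from has_derivative_compose[OF this smooth_has_derivative[OF assms]]
 show ?thesis using frechet_derivative_at by metis
qed

lemma lipschitz_of_bounded_derivative:
 fixes f :: "real \<Rightarrow> real"
 assumes "\<And>s. (f has_real_derivative f' s) (at s)" "\<And>s. \<bar>f' s\<bar> \<le> M"
 shows "\<bar>f a - f b\<bar> \<le> M * \<bar>a - b\<bar>" using field_differentiable_bound[of UNIV f f' M a b] assms by simp

lemma test_function_lipschitz:
 fixes \<phi> :: "space \<Rightarrow> real"
 assumes "\<phi> \<in> test_functions UNIV"
 obtains M where "M \<ge> 0" "\<And>x h. \<bar>\<phi> (x + h *\<^sub>R axis i 1) - \<phi> x\<bar> \<le> M * \<bar>h\<bar>"
  "\<And>x. \<bar>frechet_derivative \<phi> (at x) (axis i 1)\<bar> \<le> M"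
proof -
 obtain M where M: "M \<ge> 0" "\<And>x. \<bar>frechet_derivative \<phi> (at x) (axis i 1)\<bar> \<le> M"
  using test_functions_props(5)[OF test_functions_frechet[OF assms axis_Basis]] by metis
 have "\<bar>\<phi> (x + h *\<^sub>R axis i 1) - \<phi> x\<bar> \<le> M * \<bar>h\<bar>" for x h
  using lipschitz_of_bounded_derivative[where f = "\<lambda>s. \<phi> (x + s *\<^sub>R axis i 1)" and a = h and b = 0,
    OF test_function_line_derivative[OF test_functions_smooth[OF assms]] M(2)] by simp
 with M show thesis using that by blast
qed

text \<open>Only the smooth factor is shifted, so its difference quotients converge pointwise. They
  are bounded by a Lipschitz constant and live on a common compact set, and dominated convergence
  applies.\<close>

lemma shift_pairing_derivative_0:
 assumes u: "square_integrable u" and \<phi>: "\<phi> \<in> test_functions UNIV"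
 shows "((\<lambda>s. LI x. u x * \<phi> (x - s *\<^sub>R axis i 1)) has_real_derivative
  - (LI x. u x * frechet_derivative \<phi> (at x) (axis i 1))) (at 0)"
proof -
 define e :: space where "e = axis i 1"
 obtain K where K: "compact K" "\<And>x. x \<notin> K \<Longrightarrow> \<phi> x = 0" using test_functions_support[OF \<phi>] by blast
 obtain M where M: "M \<ge> 0" "\<And>x h. \<bar>\<phi> (x + h *\<^sub>R e) - \<phi> x\<bar> \<le> M * \<bar>h\<bar>" using test_function_lipschitz[OF \<phi>, of i] unfolding e_def by metis
 have sq: "square_integrable (\<lambda>x. \<phi> (x - s *\<^sub>R e))" for s
  using square_integrable_translate[OF test_functions_props(4)[OF \<phi>], of "- s *\<^sub>R e"] by simp
 have eq: "((LI x. u x * \<phi> (x - s *\<^sub>R e)) - (LI x. u x * \<phi> x)) / s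
   = (LI x. u x * ((\<phi> (x - s *\<^sub>R e) - \<phi> x) / s))" for s
 proof -
  have "(LI x. u x * \<phi> (x - s *\<^sub>R e)) - (LI x. u x * \<phi> x)
    = (LI x. u x * \<phi> (x - s *\<^sub>R e) - u x * \<phi> x)"
   using integrable_times[OF u sq] integrable_times[OF u sq[of 0]] by (subst Bochner_Integration.integral_diff) auto
  also have "\<dots> = (LI x. u x * (\<phi> (x - s *\<^sub>R e) - \<phi> x))" by (simp add: algebra_simps)
  finally show ?thesis by (simp flip: integral_divide_zero)
 qed
 have "(\<lambda>n. LI x. u x * ((\<phi> (x - X n *\<^sub>R e) - \<phi> x) / X n)) \<longlonglongrightarrow>
   (LI x. - (u x * frechet_derivative \<phi> (at x) e))"
  if X: "\<And>n. X n \<noteq> 0" "X \<longlonglongrightarrow> 0" for X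
 proof -
  obtain S where S: "\<And>n. \<bar>X n\<bar> \<le> S" using convergent_imp_Bseq[OF convergentI[OF X(2)]] by (auto simp: Bseq_def)
  \<comment> \<open>The support of \<phi> swept along the axis by all shifts up to the bound
    \<open>S\<close> of the sequence; outside it every difference quotient vanishes.\<close>
  define K' where "K' = (\<lambda>(x, s). x + s *\<^sub>R e) ` (K \<times> {-S..S}) \<union> K"
  have K': "compact K'" unfolding K'_def case_prod_beta
   by (intro compact_Un compact_continuous_image compact_Times continuous_intros K) auto
  have sqK': "square_integrable (\<lambda>x. M * indicator K' x :: real)" by (rule square_integrable_compact_support(2)[OF _ K', where M = M])
    (use K' M in \<open>auto simp: abs_mult borel_compact intro!: borel_measurable_times borel_measurable_indicator split: split_indicator\<close>)
  show ?thesis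
  proof (rule integral_dominated_convergence[where w = "\<lambda>x. \<bar>u x * (M * indicator K' x)\<bar>"])
   have "(\<lambda>n. (\<phi> (x - X n *\<^sub>R e) - \<phi> x) / X n) \<longlonglongrightarrow> - frechet_derivative \<phi> (at x) e" for x
   proof -
    have "((\<lambda>s. \<phi> (x + s *\<^sub>R e)) has_real_derivative frechet_derivative \<phi> (at x) e) (at 0)"
     using test_function_line_derivative[OF test_functions_smooth[OF \<phi>], of x e 0] by simp
    then have "((\<lambda>h. (\<phi> (x + h *\<^sub>R e) - \<phi> x) / h) \<longlongrightarrow> frechet_derivative \<phi> (at x) e) (at 0)" by (simp add: DERIV_def)
    moreover have "filterlim (\<lambda>n. - X n) (at 0) sequentially" using X tendsto_minus[OF X(2)] by (auto simp: filterlim_at)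
    ultimately have "(\<lambda>n. (\<phi> (x + (- X n) *\<^sub>R e) - \<phi> x) / (- X n)) \<longlonglongrightarrow> frechet_derivative \<phi> (at x) e" by (rule filterlim_compose)
    from tendsto_minus[OF this] show ?thesis by simp
   qed
   then have "(\<lambda>n. u x * ((\<phi> (x - X n *\<^sub>R e) - \<phi> x) / X n)) \<longlonglongrightarrow> u x * (- frechet_derivative \<phi> (at x) e)" for x by (rule tendsto_mult_left)
   then show "AE x in lebesgue. (\<lambda>n. u x * ((\<phi> (x - X n *\<^sub>R e) - \<phi> x) / X n)) \<longlonglongrightarrow>
     - (u x * frechet_derivative \<phi> (at x) e)" by (intro AE_I2) simp
   have "\<bar>(\<phi> (x - X n *\<^sub>R e) - \<phi> x) / X n\<bar> \<le> M * indicator K' x" for n x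
   proof (cases "x \<in> K'")
    case True
    then show ?thesis using M(2)[of x "- X n"] X(1)[of n] by (simp add: abs_divide field_simps)
   next
    case False
    have "x - X n *\<^sub>R e \<notin> K"
    proof
     assume "x - X n *\<^sub>R e \<in> K"
     then have "x \<in> (\<lambda>(x, s). x + s *\<^sub>R e) ` (K \<times> {-S..S})"
      using S[of n] by (intro image_eqI[where x = "(x - X n *\<^sub>R e, X n)"]) (auto simp: abs_le_iff)
     with False show False by (simp add: K'_def)
    qed
    moreover have "x \<notin> K" using False by (simp add: K'_def)
    ultimately show ?thesis using K(2) False by simp
   qed
   then have "\<bar>u x\<bar> * \<bar>(\<phi> (x - X n *\<^sub>R e) - \<phi> x) / X n\<bar> \<le> \<bar>u x\<bar> * (M * indicator K' x)" for n x by (intro mult_left_mono) auto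
   then show "AE x in lebesgue. norm (u x * ((\<phi> (x - X n *\<^sub>R e) - \<phi> x) / X n)) \<le> \<bar>u x * (M * indicator K' x)\<bar>" for n
    using M by (intro AE_I2) (simp add: abs_mult)
   show "integrable lebesgue (\<lambda>x. \<bar>u x * (M * indicator K' x)\<bar>)" using integrable_times[OF u sqK'] by (rule integrable_abs)
   have "square_integrable (\<lambda>x. frechet_derivative \<phi> (at x) e)"
    unfolding e_def by (rule test_functions_props(4)[OF test_functions_frechet[OF \<phi> axis_Basis]])
   then show "(\<lambda>x. - (u x * frechet_derivative \<phi> (at x) e)) \<in> borel_measurable lebesgue"
    using u square_integrableD(1) by (intro borel_measurable_uminus borel_measurable_times) auto
   show "(\<lambda>x. u x * ((\<phi> (x - X n *\<^sub>R e) - \<phi> x) / X n)) \<in> borel_measurable lebesgue" for n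
    using u sq[THEN square_integrableD(1)] test_functions_props(2)[OF \<phi>]
    by (intro borel_measurable_times borel_measurable_divide borel_measurable_diff) (auto simp: square_integrableD)
  qed
 qed
 then have "((\<lambda>s. LI x. u x * ((\<phi> (x - s *\<^sub>R e) - \<phi> x) / s)) \<longlongrightarrow>
   (LI x. - (u x * frechet_derivative \<phi> (at x) e))) (at 0)" by (auto simp: tendsto_at_iff_sequentially o_def)
 then have "((\<lambda>s. ((LI x. u x * \<phi> (x - s *\<^sub>R e)) - (LI x. u x * \<phi> x)) / s) \<longlongrightarrow>
   - (LI x. u x * frechet_derivative \<phi> (at x) e)) (at 0)" unfolding eq by simp
 then show ?thesis by (simp add: DERIV_def e_def)
qed

lemma shift_pairing_derivative:
 assumes u: "square_integrable u" and \<phi>: "\<phi> \<in> test_functions UNIV"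
 shows "((\<lambda>s. LI x. u x * \<phi> (x - s *\<^sub>R axis i 1)) has_real_derivative
  - (LI x. u x * frechet_derivative \<phi> (at (x - s *\<^sub>R axis i 1)) (axis i 1))) (at s)"
proof -
 let ?\<psi> = "\<lambda>x. \<phi> (x + (- s) *\<^sub>R axis i 1)"
 have \<psi>: "?\<psi> \<in> test_functions UNIV" by (rule test_functions_translate[OF \<phi>])
 have "((\<lambda>t. LI x. u x * ?\<psi> (x - t *\<^sub>R axis i 1)) has_real_derivative
  - (LI x. u x * frechet_derivative ?\<psi> (at x) (axis i 1))) (at 0)" by (rule shift_pairing_derivative_0[OF u \<psi>])
 then have "((\<lambda>t. LI x. u x * \<phi> (x - (t + s) *\<^sub>R axis i 1)) has_real_derivative
  - (LI x. u x * frechet_derivative \<phi> (at (x - s *\<^sub>R axis i 1)) (axis i 1))) (at 0)"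
  unfolding frechet_derivative_translate[OF test_functions_smooth[OF \<phi>]] by (simp add: algebra_simps)
 then show ?thesis using DERIV_shift[of "\<lambda>s. LI x. u x * \<phi> (x - s *\<^sub>R axis i 1)" _ 0 s] by simp
qed

section \<open>Difference quotients and their weak limits\<close>

definition diffq :: "3 \<Rightarrow> real \<Rightarrow> (space \<Rightarrow> real) \<Rightarrow> space \<Rightarrow> real" where
 "diffq i h u x = (u (x + h *\<^sub>R axis i 1) - u x) / h"

lemma square_integrable_diffq: "square_integrable u \<Longrightarrow> square_integrable (diffq i h u)"
 using square_integrable_cmult[OF square_integrable_diff[OF square_integrable_translate[of u "h *\<^sub>R axis i 1"]], of u "1 / h"]
 by (simp add: diffq_def[abs_def])

lemma diffq_pairing:
 assumes u: "square_integrable u" and k: "square_integrable k"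
 shows "(LI x. diffq i h u x * k x) = (LI x. u x * ((k (x - h *\<^sub>R axis i 1) - k x) / h))"
proof -
 let ?e = "h *\<^sub>R axis i 1 :: space"
 have ut: "square_integrable (\<lambda>x. u (x + ?e))" and kt: "square_integrable (\<lambda>x. k (x - ?e))"
  using square_integrable_translate[OF u, of ?e] square_integrable_translate[OF k, of "- ?e"] by auto
 have "(LI x. u (x + ?e) * k x) = (LI x. u (x + ?e) * k ((x + ?e) - ?e))" by simp
 also have "\<dots> = (LI x. u x * k (x - ?e))" using integral_translate[of "\<lambda>x. u x * k (x - ?e)" ?e] integrable_times[OF u kt] by auto
 finally have eq: "(LI x. u (x + ?e) * k x) = (LI x. u x * k (x - ?e))" .
 have "(LI x. diffq i h u x * k x) = (LI x. (u (x + ?e) * k x - u x * k x) / h)" by (simp add: diffq_def algebra_simps)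
 also have "\<dots> = ((LI x. u (x + ?e) * k x) - (LI x. u x * k x)) / h" using integrable_times[OF ut k] integrable_times[OF u k] by simp
 also have "\<dots> = ((LI x. u x * k (x - ?e)) - (LI x. u x * k x)) / h" using eq by simp
 also have "\<dots> = (LI x. (u x * k (x - ?e) - u x * k x) / h)" using integrable_times[OF u kt] integrable_times[OF u k] by simp
 also have "\<dots> = (LI x. u x * ((k (x - ?e) - k x) / h))" by (simp add: algebra_simps)
 finally show ?thesis .
qed

lemma diffq_pairing_flip:
 assumes "square_integrable u" "square_integrable k"
 shows "(LI x. diffq i h u x * k x) = - (LI x. u x * diffq i (- h) k x)"
proof -
 have "u x * ((k (x - h *\<^sub>R axis i 1) - k x) / h) = - (u x * diffq i (- h) k x)" for x by (simp add: diffq_def)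
 then show ?thesis unfolding diffq_pairing[OF assms] by (simp only: Bochner_Integration.integral_minus)
qed

lemma diffq_pairing_test_function:
 assumes u: "square_integrable u" and \<phi>: "\<phi> \<in> test_functions UNIV"
  and h: "\<And>n. h n \<noteq> 0" "h \<longlonglongrightarrow> (0::real)"
 shows "(\<lambda>n. LI x. diffq i (h n) u x * \<phi> x) \<longlonglongrightarrow>
  - (LI x. u x * frechet_derivative \<phi> (at x) (axis i 1))"
proof -
 have "filterlim h (at 0) sequentially" using h by (auto simp: filterlim_at)
 from filterlim_compose[OF shift_pairing_derivative_0[OF u \<phi>, of i, unfolded DERIV_def] this]
 have "(\<lambda>n. ((LI x. u x * \<phi> (x - h n *\<^sub>R axis i 1)) - (LI x. u x * \<phi> x)) / h n) \<longlonglongrightarrow>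
   - (LI x. u x * frechet_derivative \<phi> (at x) (axis i 1))" by simp
 moreover have "((LI x. u x * \<phi> (x - s *\<^sub>R axis i 1)) - (LI x. u x * \<phi> x)) / s
   = (LI x. diffq i s u x * \<phi> x)" for s
 proof -
  have "integrable lebesgue (\<lambda>x. u x * \<phi> (x - s *\<^sub>R axis i 1))"
   using integrable_times[OF u square_integrable_translate[OF test_functions_props(4)[OF \<phi>], of "- s *\<^sub>R axis i 1"]] by simp
  then show ?thesis unfolding diffq_pairing[OF u test_functions_props(4)[OF \<phi>]] using integrable_times[OF u test_functions_props(4)[OF \<phi>]]
   by (simp add: right_diff_distrib diff_divide_distrib)
 qed
 ultimately show ?thesis by simp
qed

text \<open>Test functions approximating \<open>d\<close> itself turn the bound on the pairing into
  ||d||^2 \<le> C ||d|| + e for every e > 0.\<close>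

lemma l2norm_le_dual:
 assumes d: "square_integrable d" and C: "C \<ge> 0"
  and le: "\<And>\<phi>. \<phi> \<in> test_functions UNIV \<Longrightarrow> \<bar>LI x. d x * \<phi> x\<bar> \<le> C * l2norm \<phi>"
 shows "l2norm d \<le> C"
proof -
 have "(l2norm d)^2 \<le> C * l2norm d + e" if "e > 0" for e
 proof -
  define \<delta> where "\<delta> = e / (C + l2norm d + 1)"
  have pos: "C + l2norm d + 1 > 0" using C l2norm_nonneg[of d] by linarith
  then have \<delta>: "\<delta> > 0" "\<delta> * (C + l2norm d) \<le> e" using that by (auto simp: \<delta>_def field_simps)
  obtain \<phi> where \<phi>: "\<phi> \<in> test_functions UNIV" "l2norm (\<lambda>x. d x - \<phi> x) < \<delta>"
   using test_functions_dense[OF d] \<delta>(1) unfolding test_approx_def by blast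
  note sq = test_functions_props(4)[OF \<phi>(1)] square_integrable_diff[OF d test_functions_props(4)[OF \<phi>(1)]]
  have "(l2norm d)^2 = (LI x. d x * \<phi> x + d x * (d x - \<phi> x))"
   unfolding l2norm_power2 by (intro Bochner_Integration.integral_cong) (auto simp: power2_eq_square algebra_simps)
  also have "\<dots> = (LI x. d x * \<phi> x) + (LI x. d x * (d x - \<phi> x))" using integrable_times[OF d sq(1)] integrable_times[OF d sq(2)] by simp
  also have "\<dots> \<le> C * l2norm \<phi> + l2norm d * l2norm (\<lambda>x. d x - \<phi> x)" using le[OF \<phi>(1)] l2_Cauchy_Schwarz_real[OF d sq(2)] by linarith
  also have "l2norm \<phi> \<le> l2norm d + \<delta>" using l2norm_triangle_diff[OF d sq(2)] \<phi>(2) by simp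
  also have "C * (l2norm d + \<delta>) + l2norm d * l2norm (\<lambda>x. d x - \<phi> x) \<le> C * (l2norm d + \<delta>) + l2norm d * \<delta>"
   using \<phi>(2) by (intro add_left_mono mult_left_mono) auto
  also have "\<dots> \<le> C * l2norm d + e" using \<delta>(2) by (simp add: algebra_simps)
  finally show ?thesis using C by (simp add: mult_left_mono)
 qed
 then have "(l2norm d)^2 \<le> C * l2norm d" by (rule field_le_epsilon)
 then show ?thesis using l2norm_nonneg[of d] C by (cases "l2norm d = 0") (auto simp: power2_eq_square)
qed

text \<open>The common bound \<open>C\<close> on the norms makes the error of replacing
  \<open>k\<close> by a nearby test function uniform in \<open>n\<close>, so convergence on a dense
  set extends to all of L^2.\<close>

lemma weak_limit_by_density:
 assumes a: "\<And>n. square_integrable (a n)" "\<And>n. l2norm (a n) \<le> C" and g: "square_integrable g"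
  and lim: "\<And>\<phi>. \<phi> \<in> test_functions UNIV \<Longrightarrow> (\<lambda>n. LI x. a n x * \<phi> x) \<longlonglongrightarrow> (LI x. g x * \<phi> x)"
  and k: "square_integrable (k :: space \<Rightarrow> real)"
 shows "(\<lambda>n. LI x. a n x * k x) \<longlonglongrightarrow> (LI x. g x * k x)"
proof (rule LIMSEQ_I)
 fix e :: real assume "e > 0"
 have C: "C \<ge> 0" using a(2)[of 0] l2norm_nonneg order_trans by blast
 define \<delta> where "\<delta> = e / (2 * (C + l2norm g + 1))"
 have pos: "C + l2norm g + 1 > 0" using C l2norm_nonneg[of g] by linarith
 then have \<delta>: "\<delta> > 0" "\<delta> * (C + l2norm g) < e / 2" using \<open>e > 0\<close> by (auto simp: \<delta>_def field_simps)
 obtain \<phi> where \<phi>: "\<phi> \<in> test_functions UNIV" "l2norm (\<lambda>x. k x - \<phi> x) < \<delta>"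
  using test_functions_dense[OF k] \<delta>(1) unfolding test_approx_def by blast
 note sq = test_functions_props(4)[OF \<phi>(1)] square_integrable_diff[OF k test_functions_props(4)[OF \<phi>(1)]]
 obtain N where N: "\<And>n. n \<ge> N \<Longrightarrow> \<bar>(LI x. a n x * \<phi> x) - (LI x. g x * \<phi> x)\<bar> < e / 2"
  using LIMSEQ_D[OF lim[OF \<phi>(1)], of "e / 2"] \<open>e > 0\<close> by auto
 have split: "(LI x. b x * k x) = (LI x. b x * \<phi> x) + (LI x. b x * (k x - \<phi> x))"
  if "square_integrable b" for b using integrable_times[OF that sq(1)] integrable_times[OF that sq(2)]
  by (subst Bochner_Integration.integral_add[symmetric]) (auto simp: algebra_simps)
 have rest: "\<bar>LI x. b x * (k x - \<phi> x)\<bar> \<le> l2norm b * \<delta>" if "square_integrable b" for b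
  using l2_Cauchy_Schwarz_real[OF that sq(2)] mult_left_mono[OF less_imp_le[OF \<phi>(2)], of "l2norm b"] by simp
 have "norm ((LI x. a n x * k x) - (LI x. g x * k x)) < e" if "n \<ge> N" for n
 proof -
  have "\<bar>LI x. a n x * (k x - \<phi> x)\<bar> \<le> C * \<delta>" using rest[OF a(1)[of n]] mult_right_mono[OF a(2)[of n], of \<delta>] \<delta>(1) by linarith
  then show ?thesis using N[OF that] rest[OF g] \<delta>(2) unfolding split[OF a(1)[of n]] split[OF g]
   by (simp add: algebra_simps abs_if split: if_splits)
 qed
 then show "\<exists>N. \<forall>n\<ge>N. norm ((LI x. a n x * k x) - (LI x. g x * k x)) < e" by blast
qed

text \<open>By duality it suffices to pair the increment with a test function. Moving the shift onto
  the test function makes the pairing a function of the step whose derivative is the pairing of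
  \<open>g\<close> with a translate, hence bounded by ||g|| ||\<phi>||; the mean value theorem
  supplies the factor |h|.\<close>

lemma weak_deriv_shift_bound:
 assumes "weak_deriv i u g"
 shows "l2norm (\<lambda>x. u (x + h *\<^sub>R axis i 1) - u x) \<le> \<bar>h\<bar> * l2norm g"
proof (rule l2norm_le_dual)
 note sq = weak_derivD[OF assms]
 show "square_integrable (\<lambda>x. u (x + h *\<^sub>R axis i 1) - u x)" by (intro square_integrable_diff square_integrable_translate sq)
 fix \<phi> :: "space \<Rightarrow> real" assume \<phi>: "\<phi> \<in> test_functions UNIV"
 let ?m = "\<lambda>s. LI x. u x * \<phi> (x - s *\<^sub>R axis i 1)"
 have d: "(?m has_real_derivative (LI x. g x * \<phi> (x - s *\<^sub>R axis i 1))) (at s)" for s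
 proof -
  have t: "(\<lambda>x. \<phi> (x + (- s) *\<^sub>R axis i 1)) \<in> test_functions UNIV" by (rule test_functions_translate[OF \<phi>])
  have "(LI x. u x * frechet_derivative (\<lambda>x. \<phi> (x + (- s) *\<^sub>R axis i 1)) (at x) (axis i 1))
    = - (LI x. g x * \<phi> (x + (- s) *\<^sub>R axis i 1))" using assms t unfolding weak_deriv_def by blast
  then show ?thesis using shift_pairing_derivative[OF sq(1) \<phi>, of i s]
   unfolding frechet_derivative_translate[OF test_functions_smooth[OF \<phi>]] by simp
 qed
 have b: "\<bar>LI x. g x * \<phi> (x - s *\<^sub>R axis i 1)\<bar> \<le> l2norm g * l2norm \<phi>" for s
  using l2_Cauchy_Schwarz_real[OF sq(2) square_integrable_translate[OF test_functions_props(4)[OF \<phi>], of "- s *\<^sub>R axis i 1"]]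
   l2norm_translate[OF test_functions_props(4)[OF \<phi>], of "- s *\<^sub>R axis i 1"] by simp
 have "\<bar>?m h - ?m 0\<bar> \<le> l2norm g * l2norm \<phi> * \<bar>h - 0\<bar>" by (rule lipschitz_of_bounded_derivative[OF d b])
 moreover have "?m h - ?m 0 = (LI x. (u (x + h *\<^sub>R axis i 1) - u x) * \<phi> x)"
 proof (cases "h = 0")
  case False
  have i1: "integrable lebesgue (\<lambda>x. u x * \<phi> (x - h *\<^sub>R axis i 1))"
   using integrable_times[OF sq(1) square_integrable_translate[OF test_functions_props(4)[OF \<phi>], of "- h *\<^sub>R axis i 1"]] by simp
  have "?m h - ?m 0 = (LI x. u x * \<phi> (x - h *\<^sub>R axis i 1) - u x * \<phi> x)" using i1 integrable_times[OF sq(1) test_functions_props(4)[OF \<phi>]]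
   by (subst Bochner_Integration.integral_diff) auto
  also have "\<dots> = (LI x. h * (u x * ((\<phi> (x - h *\<^sub>R axis i 1) - \<phi> x) / h)))"
   using False by (intro Bochner_Integration.integral_cong) (simp_all flip: right_diff_distrib)
  also have "\<dots> = h * (LI x. u x * ((\<phi> (x - h *\<^sub>R axis i 1) - \<phi> x) / h))" by (rule integral_mult_right_zero)
  also have "\<dots> = h * (LI x. diffq i h u x * \<phi> x)" using diffq_pairing[OF sq(1) test_functions_props(4)[OF \<phi>]] by simp
  also have "\<dots> = (LI x. h * (diffq i h u x * \<phi> x))" by (rule integral_mult_right_zero[symmetric])
  finally show ?thesis using False by (simp add: diffq_def)
 qed simp
 ultimately show "\<bar>LI x. (u (x + h *\<^sub>R axis i 1) - u x) * \<phi> x\<bar> \<le> \<bar>h\<bar> * l2norm g * l2norm \<phi>" by (simp add: algebra_simps)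
qed simp

lemma weak_deriv_diffq_bound:
 assumes "weak_deriv i u g"
 shows "l2norm (diffq i h u) \<le> l2norm g"
proof (cases "h = 0")
 case False
 have "l2norm (diffq i h u) = \<bar>1 / h\<bar> * l2norm (\<lambda>x. u (x + h *\<^sub>R axis i 1) - u x)"
  using l2norm_cmult[of "1 / h" "\<lambda>x. u (x + h *\<^sub>R axis i 1) - u x"] by (simp add: diffq_def[abs_def])
 also have "\<dots> \<le> \<bar>1 / h\<bar> * (\<bar>h\<bar> * l2norm g)" by (intro mult_left_mono weak_deriv_shift_bound assms) auto
 finally show ?thesis using False by simp
qed (simp add: diffq_def[abs_def])

lemma weak_deriv_diffq_weak_limit:
 assumes "weak_deriv i u g" "square_integrable k" "\<And>n. h n \<noteq> 0" "h \<longlonglongrightarrow> (0::real)"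
 shows "(\<lambda>n. LI x. diffq i (h n) u x * k x) \<longlonglongrightarrow> (LI x. g x * k x)"
proof (rule weak_limit_by_density)
 show "(\<lambda>n. LI x. diffq i (h n) u x * \<phi> x) \<longlonglongrightarrow> (LI x. g x * \<phi> x)"
  if "\<phi> \<in> test_functions UNIV" for \<phi> using diffq_pairing_test_function[OF weak_derivD(1)[OF assms(1)] that assms(3,4), of i] assms(1) that
  unfolding weak_deriv_def by simp
qed (use assms in \<open>auto intro: square_integrable_diffq weak_derivD weak_deriv_diffq_bound\<close>)

lemma inverse_Suc_seq: "inverse (real (Suc n)) \<noteq> 0" "(\<lambda>n. inverse (real (Suc n))) \<longlonglongrightarrow> 0" using LIMSEQ_inverse_real_of_nat by auto

text \<open>The definition allows only smooth test functions; here both factors are in the weak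
  class. A difference quotient moves from one factor to the other by translation invariance, with
  the step reversed, and both sides have weak limits.\<close>

lemma weak_deriv_by_parts:
 assumes u: "weak_deriv i u g" and p: "weak_deriv i p q"
 shows "(LI x. u x * q x) = - (LI x. g x * p x)"
proof -
 let ?h = "\<lambda>n. inverse (real (Suc n))"
 note sq = weak_derivD[OF u] weak_derivD[OF p]
 have 1: "(\<lambda>n. LI x. diffq i (?h n) p x * u x) \<longlonglongrightarrow> (LI x. q x * u x)" by (rule weak_deriv_diffq_weak_limit[OF p sq(1) inverse_Suc_seq])
 have "(\<lambda>n. LI x. diffq i (- ?h n) u x * p x) \<longlonglongrightarrow> (LI x. g x * p x)"
  by (rule weak_deriv_diffq_weak_limit[OF u sq(3)]) (use tendsto_minus[OF inverse_Suc_seq(2)] in auto)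
 from tendsto_minus[OF this]
 have "(\<lambda>n. LI x. diffq i (?h n) p x * u x) \<longlonglongrightarrow> - (LI x. g x * p x)" using diffq_pairing_flip[OF sq(3,1), of i] by (simp add: mult.commute)
 with 1 show ?thesis using LIMSEQ_unique by (fastforce simp: mult.commute)
qed

lemma weak_deriv_unique:
 assumes "weak_deriv i u g" "weak_deriv i u g'"
 shows "AE x in lebesgue. g x = g' x"
proof -
 note sq = weak_derivD(2)[OF assms(1)] weak_derivD(2)[OF assms(2)]
 have "l2norm (\<lambda>x. g x - g' x) \<le> 0"
 proof (rule l2norm_le_dual[OF square_integrable_diff[OF sq]])
  fix \<phi> :: "space \<Rightarrow> real" assume \<phi>: "\<phi> \<in> test_functions UNIV"
  have "(LI x. (g x - g' x) * \<phi> x) = (LI x. g x * \<phi> x) - (LI x. g' x * \<phi> x)"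
   using integrable_times[OF sq(1) test_functions_props(4)[OF \<phi>]] integrable_times[OF sq(2) test_functions_props(4)[OF \<phi>]]
   by (simp add: left_diff_distrib)
  also have "\<dots> = 0"
  proof -
   have "(LI x. u x * frechet_derivative \<phi> (at x) (axis i 1)) = - (LI x. g x * \<phi> x)"
    "(LI x. u x * frechet_derivative \<phi> (at x) (axis i 1)) = - (LI x. g' x * \<phi> x)" using assms \<phi> unfolding weak_deriv_def by blast+
   then show ?thesis by linarith
  qed
  finally show "\<bar>LI x. (g x - g' x) * \<phi> x\<bar> \<le> 0 * l2norm \<phi>" by simp
 qed simp
 then have "l2norm (\<lambda>x. g x - g' x) = 0" using l2norm_nonneg order_antisym by blast
 then show ?thesis using l2norm_eq_0_iff[OF square_integrable_diff[OF sq]] by simp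
qed

lemma weak_deriv_lincomb:
 assumes "weak_deriv i u g" "weak_deriv i p q"
 shows "weak_deriv i (\<lambda>x. a * u x + b * p x) (\<lambda>x. a * g x + b * q x)" unfolding weak_deriv_def
proof (intro conjI ballI)
 note sq = weak_derivD[OF assms(1)] weak_derivD[OF assms(2)]
 show "square_integrable (\<lambda>x. a * u x + b * p x)" "square_integrable (\<lambda>x. a * g x + b * q x)"
  using sq by (auto intro!: square_integrable_add square_integrable_cmult)
 fix \<phi> :: "space \<Rightarrow> real" assume \<phi>: "\<phi> \<in> test_functions UNIV"
 note s = test_functions_props(4)[OF \<phi>] test_functions_props(4)[OF test_functions_frechet[OF \<phi> axis_Basis[of i]]]
 show "(LI x. (a * u x + b * p x) * frechet_derivative \<phi> (at x) (axis i 1)) =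
   - (LI x. (a * g x + b * q x) * \<phi> x)" using assms \<phi> integrable_times[OF sq(1) s(2)] integrable_times[OF sq(2) s(1)]
   integrable_times[OF sq(3) s(2)] integrable_times[OF sq(4) s(1)] by (simp add: weak_deriv_def distrib_right mult.assoc)
qed

text \<open>The L^2 norms of the increments are of order 1/(n+1), so their squares tend to 0 in L^1
  and a subsequence converges almost everywhere. The chain rule needs such pointwise
  convergence.\<close>

lemma weak_deriv_AE_subseq:
 assumes "weak_deriv i u g"
 obtains r :: "nat \<Rightarrow> nat" where "strict_mono r"
  "AE x in lebesgue. (\<lambda>n. u (x + inverse (real (Suc (r n))) *\<^sub>R axis i 1)) \<longlonglongrightarrow> u x"
proof -
 let ?h = "\<lambda>n. inverse (real (Suc n))"
 let ?d = "\<lambda>n x. u (x + ?h n *\<^sub>R axis i 1) - u x"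
 note sq = weak_derivD[OF assms]
 have sqd: "square_integrable (?d n)" for n by (intro square_integrable_diff square_integrable_translate sq)
 have le: "(LI x. norm ((?d n x)^2)) \<le> (?h n * l2norm g)^2" for n
 proof -
  have "(LI x. norm ((?d n x)^2)) = (l2norm (?d n))^2" by (simp add: l2norm_power2)
  also have "\<dots> \<le> (?h n * l2norm g)^2" using weak_deriv_shift_bound[OF assms, of "?h n"] by (intro power_mono) auto
  finally show ?thesis .
 qed
 have lim: "(\<lambda>n. (?h n * l2norm g)^2) \<longlonglongrightarrow> 0"
  using tendsto_power[OF tendsto_mult_left_zero[OF inverse_Suc_seq(2), of "l2norm g"], of 2] by simp
 have "(\<lambda>n. LI x. norm ((?d n x)^2)) \<longlonglongrightarrow> 0" by (rule tendsto_sandwich[OF _ _ tendsto_const lim]) (use le in auto)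
 moreover have "integrable lebesgue (\<lambda>x. (?d n x)^2)" for n using square_integrableD(2)[OF sqd[of n]] by simp
 ultimately obtain r where r: "strict_mono r" "AE x in lebesgue. (\<lambda>n. (?d (r n) x)^2) \<longlonglongrightarrow> 0"
  using tendsto_L1_AE_subseq[of lebesgue "\<lambda>n x. (?d n x)^2"] by blast
 have "(\<lambda>n. u (x + ?h (r n) *\<^sub>R axis i 1)) \<longlonglongrightarrow> u x" if "(\<lambda>n. (?d (r n) x)^2) \<longlonglongrightarrow> 0" for x
 proof -
  have "(\<lambda>n. sqrt ((?d (r n) x)^2)) \<longlonglongrightarrow> sqrt 0" by (intro tendsto_intros that)
  then show ?thesis by (simp add: tendsto_rabs_zero_iff LIM_zero_iff)
 qed
 with r show thesis by (intro that[of r]) auto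
qed

text \<open>The difference quotient of \<open>j \<circ> u\<close> is that of \<open>u\<close>, which converges weakly, times a bounded
 factor converging almost everywhere along a subsequence.\<close>

lemma weak_deriv_chain:
 assumes u: "weak_deriv i u g"
  and j: "\<And>y. (j has_real_derivative j' y) (at y)" "\<And>y. \<bar>j' y\<bar> \<le> 1" "continuous_on UNIV j'" "j 0 = 0"
 shows "weak_deriv i (\<lambda>x. j (u x)) (\<lambda>x. j' (u x) * g x)"
proof -
 note sq = weak_derivD[OF u]
 have lip: "\<bar>j a - j b\<bar> \<le> \<bar>a - b\<bar>" for a b using lipschitz_of_bounded_derivative[OF j(1,2), of a b] by simp
 have jm: "j \<in> borel_measurable borel" "j' \<in> borel_measurable borel" using j(3) DERIV_isCont[OF j(1)]
  by (auto intro!: borel_measurable_continuous_onI simp: continuous_on_eq_continuous_at)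
 have jum: "(\<lambda>x. j (u x)) \<in> borel_measurable lebesgue" "(\<lambda>x. j' (u x)) \<in> borel_measurable lebesgue"
  using measurable_compose[OF square_integrableD(1)[OF sq(1)]] jm by blast+
 have ju: "square_integrable (\<lambda>x. j (u x))" using lip[of _ 0] j(4) by (intro square_integrable_bound[OF jum(1) sq(1)]) auto
 have jg: "square_integrable (\<lambda>x. j' (u x) * k x)" if "square_integrable k" for k
  using mult_left_le_one_le[OF abs_ge_zero abs_ge_zero j(2)]
  by (intro square_integrable_bound[OF _ that] borel_measurable_times jum square_integrableD(1)[OF that])
   (auto simp: abs_mult)
 obtain r where r: "strict_mono r" "AE x in lebesgue. (\<lambda>n. u (x + inverse (real (Suc (r n))) *\<^sub>R axis i 1)) \<longlonglongrightarrow> u x"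
  using weak_deriv_AE_subseq[OF u] by blast
 define h where "h n = inverse (real (Suc (r n)))" for n
 have h: "\<And>n. h n \<noteq> 0" "h \<longlonglongrightarrow> 0" using LIMSEQ_subseq_LIMSEQ[OF inverse_Suc_seq(2) r(1)] by (auto simp: h_def[abs_def] o_def)
 \<comment> \<open>Where the increment of \<open>u\<close> vanishes, the quotient is given the value
   of \<open>j'\<close> at \<open>u x\<close>. This makes \<Theta> the shifted \<open>u\<close>
   inserted into a function continuous at \<open>u x\<close>, and the factorisation
   \<open>dq\<close> still holds because both of its sides are then 0.\<close>
 define \<Theta> where "\<Theta> n x = (if u (x + h n *\<^sub>R axis i 1) = u x then j' (u x)
   else (j (u (x + h n *\<^sub>R axis i 1)) - j (u x)) / (u (x + h n *\<^sub>R axis i 1) - u x))" for n x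
 have utm: "(\<lambda>x. u (x + h n *\<^sub>R axis i 1)) \<in> borel_measurable lebesgue" for n
  by (intro borel_measurable_translate square_integrableD(1) sq)
 have \<Theta>m: "\<Theta> n \<in> borel_measurable lebesgue" for n unfolding \<Theta>_def[abs_def]
  using utm[of n] jum measurable_compose[OF utm[of n] jm(1)] square_integrableD(1)[OF sq(1)] by measurable
 have \<Theta>1: "\<bar>\<Theta> n x\<bar> \<le> 1" for n x using j(2) lip by (auto simp: \<Theta>_def abs_divide divide_le_eq_1)
 have \<Theta>lim: "(\<lambda>n. \<Theta> n x) \<longlonglongrightarrow> j' (u x)" if "(\<lambda>n. u (x + h n *\<^sub>R axis i 1)) \<longlonglongrightarrow> u x" for x
 proof -
  define q where "q y = (if y = u x then j' (u x) else (j y - j (u x)) / (y - u x))" for y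
  have "((\<lambda>y. (j y - j (u x)) / (y - u x)) \<longlongrightarrow> j' (u x)) (at (u x))" using j(1)[of "u x"] unfolding has_field_derivative_iff .
  moreover have "\<forall>\<^sub>F y in at (u x). (j y - j (u x)) / (y - u x) = q y" by (auto simp: q_def eventually_at_filter)
  ultimately have "(q \<longlongrightarrow> j' (u x)) (at (u x))" by (rule Lim_transform_eventually)
  then have "(q \<longlongrightarrow> q (u x)) (at (u x))" by (simp add: q_def)
  then have "isCont q (u x)" by (simp add: isCont_def)
  then have "(\<lambda>n. q (u (x + h n *\<^sub>R axis i 1))) \<longlonglongrightarrow> q (u x)" by (rule isCont_tendsto_compose[OF _ that])
  then show ?thesis by (simp add: q_def \<Theta>_def[abs_def])
 qed
 have dq: "diffq i (h n) (\<lambda>x. j (u x)) x = diffq i (h n) u x * \<Theta> n x" for n x by (simp add: diffq_def \<Theta>_def)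
 have "(LI x. j (u x) * frechet_derivative \<phi> (at x) (axis i 1)) = - (LI x. (j' (u x) * g x) * \<phi> x)"
  if \<phi>: "\<phi> \<in> test_functions UNIV" for \<phi>
 proof -
  note s\<phi> = test_functions_props(4)[OF \<phi>]
  have bd: "\<bar>\<Theta> n x - j' (u x)\<bar> \<le> 2" for n x using \<Theta>1[of n x] j(2)[of "u x"] by linarith
  have em: "(\<lambda>x. (\<Theta> n x - j' (u x)) * \<phi> x) \<in> borel_measurable lebesgue" for n
   using \<Theta>m jum test_functions_props(2)[OF \<phi>] by (intro borel_measurable_times borel_measurable_diff)
  have bd': "\<bar>(\<Theta> n x - j' (u x)) * \<phi> x\<bar> \<le> 2 * \<bar>\<phi> x\<bar>" for n x unfolding abs_mult by (intro mult_right_mono bd) auto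
  have esq: "square_integrable (\<lambda>x. (\<Theta> n x - j' (u x)) * \<phi> x)" for n
   by (rule square_integrable_bound[OF em square_integrable_cmult[OF s\<phi>, of 2]]) (use bd' in \<open>auto simp: abs_mult\<close>)
  have "(\<lambda>n. LI x. (norm ((\<Theta> n x - j' (u x)) * \<phi> x))^2) \<longlonglongrightarrow> (LINT x|(lebesgue::space measure). 0)"
  proof (rule integral_dominated_convergence[where w = "\<lambda>x. 4 * (norm (\<phi> x))^2"])
   show "integrable lebesgue (\<lambda>x. 4 * (norm (\<phi> x))^2)" using square_integrableD(2)[OF s\<phi>] by simp
   show "(\<lambda>x. (norm ((\<Theta> n x - j' (u x)) * \<phi> x))^2) \<in> borel_measurable lebesgue" for n using square_integrableD(2)[OF esq] by auto
   have "(norm ((\<Theta> n x - j' (u x)) * \<phi> x))^2 \<le> (2 * \<bar>\<phi> x\<bar>)^2" for n x using bd' by (intro power_mono) auto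
   then show "AE x in lebesgue. norm ((norm ((\<Theta> n x - j' (u x)) * \<phi> x))^2) \<le> 4 * (norm (\<phi> x))^2" for n by (auto simp: power_mult_distrib)
   show "AE x in lebesgue. (\<lambda>n. (norm ((\<Theta> n x - j' (u x)) * \<phi> x))^2) \<longlonglongrightarrow> 0" using r(2)
   proof eventually_elim
    case (elim x)
    then have "(\<lambda>n. \<Theta> n x) \<longlonglongrightarrow> j' (u x)" by (intro \<Theta>lim) (simp add: h_def)
    then have "(\<lambda>n. (norm ((\<Theta> n x - j' (u x)) * \<phi> x))^2) \<longlonglongrightarrow> (norm ((j' (u x) - j' (u x)) * \<phi> x))^2" by (intro tendsto_intros)
    then show ?case by simp
   qed
  qed simp
  then have "(\<lambda>n. sqrt (LI x. (norm ((\<Theta> n x - j' (u x)) * \<phi> x))^2)) \<longlonglongrightarrow> sqrt 0" by (intro tendsto_intros) simp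
  then have e0: "(\<lambda>n. l2norm g * l2norm (\<lambda>x. (\<Theta> n x - j' (u x)) * \<phi> x)) \<longlonglongrightarrow> 0" by (intro tendsto_mult_right_zero) (simp add: l2norm_def)
  have "(\<lambda>n. LI x. diffq i (h n) u x * ((\<Theta> n x - j' (u x)) * \<phi> x)) \<longlonglongrightarrow> 0"
  proof (rule tendsto_rabs_zero_cancel, rule tendsto_sandwich[OF _ _ tendsto_const e0])
   have "\<bar>LI x. diffq i (h n) u x * ((\<Theta> n x - j' (u x)) * \<phi> x)\<bar> \<le> l2norm g * l2norm (\<lambda>x. (\<Theta> n x - j' (u x)) * \<phi> x)" for n
    using l2_Cauchy_Schwarz_real[OF square_integrable_diffq[OF sq(1)] esq, of i "h n" n]
     mult_right_mono[OF weak_deriv_diffq_bound[OF u, of "h n"], of "l2norm (\<lambda>x. (\<Theta> n x - j' (u x)) * \<phi> x)"] by simp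
   then show "\<forall>\<^sub>F n in sequentially. \<bar>LI x. diffq i (h n) u x * ((\<Theta> n x - j' (u x)) * \<phi> x)\<bar> \<le> l2norm g * l2norm (\<lambda>x. (\<Theta> n x - j' (u x)) * \<phi> x)"
    by simp
  qed simp
  moreover have "(\<lambda>n. LI x. diffq i (h n) u x * (j' (u x) * \<phi> x)) \<longlonglongrightarrow> (LI x. g x * (j' (u x) * \<phi> x))"
   by (rule weak_deriv_diffq_weak_limit[OF u jg[OF s\<phi>] h])
  ultimately have "(\<lambda>n. (LI x. diffq i (h n) u x * ((\<Theta> n x - j' (u x)) * \<phi> x)) +
    (LI x. diffq i (h n) u x * (j' (u x) * \<phi> x))) \<longlonglongrightarrow> 0 + (LI x. g x * (j' (u x) * \<phi> x))" by (rule tendsto_add)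
  moreover have "(LI x. diffq i (h n) u x * ((\<Theta> n x - j' (u x)) * \<phi> x)) +
    (LI x. diffq i (h n) u x * (j' (u x) * \<phi> x)) = (LI x. diffq i (h n) (\<lambda>x. j (u x)) x * \<phi> x)" for n
   using integrable_times[OF square_integrable_diffq[OF sq(1)] esq, of i "h n" n] integrable_times[OF square_integrable_diffq[OF sq(1)] jg[OF s\<phi>], of i "h n"]
   by (subst Bochner_Integration.integral_add[symmetric]) (auto simp: dq algebra_simps)
  ultimately have "(\<lambda>n. LI x. diffq i (h n) (\<lambda>x. j (u x)) x * \<phi> x) \<longlonglongrightarrow> (LI x. g x * (j' (u x) * \<phi> x))" by simp
  moreover have "(\<lambda>n. LI x. diffq i (h n) (\<lambda>x. j (u x)) x * \<phi> x) \<longlonglongrightarrow>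
    - (LI x. j (u x) * frechet_derivative \<phi> (at x) (axis i 1))" by (rule diffq_pairing_test_function[OF ju \<phi> h])
  ultimately have "(LI x. g x * (j' (u x) * \<phi> x)) = - (LI x. j (u x) * frechet_derivative \<phi> (at x) (axis i 1))"
   using LIMSEQ_unique by blast
  then show ?thesis by (simp add: mult_ac)
 qed
 then show ?thesis using ju jg[OF sq(2)] by (simp add: weak_deriv_def)
qed

text \<open>The difference quotients of \<open>F\<close> are bounded by \<open>L\<close> and
  converge almost everywhere to \<open>g\<close>, so dominated convergence identifies
  \<open>g\<close> as the weak derivative. In this form the rule covers functions with a kink at the
  interface, as the barriers and weights below are.\<close>

lemma weak_deriv_lipschitz:
 assumes F: "square_integrable F" and g: "square_integrable g"
  and lip: "\<And>x h. \<bar>F (x + h *\<^sub>R axis i 1) - F x\<bar> \<le> L * \<bar>h\<bar>"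
  and der: "AE x in lebesgue. ((\<lambda>s. F (x + s *\<^sub>R axis i 1)) has_real_derivative g x) (at 0)"
 shows "weak_deriv i F g" unfolding weak_deriv_def
proof (intro conjI ballI F g)
 fix \<phi> :: "space \<Rightarrow> real" assume \<phi>: "\<phi> \<in> test_functions UNIV"
 let ?h = "\<lambda>n. inverse (real (Suc n))"
 note s\<phi> = test_functions_props(4)[OF \<phi>]
 have L: "L \<ge> 0" using lip[of 0 1] by (auto intro: order_trans[OF abs_ge_zero])
 have "(\<lambda>n. LI x. diffq i (?h n) F x * \<phi> x) \<longlonglongrightarrow> (LI x. g x * \<phi> x)"
 proof (rule integral_dominated_convergence[where w = "\<lambda>x. L * \<bar>\<phi> x\<bar>"])
  show "integrable lebesgue (\<lambda>x. L * \<bar>\<phi> x\<bar>)" using test_functions_props(3)[OF \<phi>] by simp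
  show "(\<lambda>x. g x * \<phi> x) \<in> borel_measurable lebesgue" using integrable_times[OF g s\<phi>] by auto
  show "(\<lambda>x. diffq i (?h n) F x * \<phi> x) \<in> borel_measurable lebesgue" for n
   using integrable_times[OF square_integrable_diffq[OF F] s\<phi>] by auto
  have "\<bar>diffq i (?h n) F x\<bar> \<le> L" for n x
  proof -
   have "\<bar>diffq i (?h n) F x\<bar> = \<bar>F (x + ?h n *\<^sub>R axis i 1) - F x\<bar> / ?h n" unfolding diffq_def abs_divide by simp
   also have "\<dots> \<le> (L * ?h n) / ?h n" using lip[of x "?h n"] by (intro divide_right_mono) auto
   finally show ?thesis by simp
  qed
  then show "AE x in lebesgue. norm (diffq i (?h n) F x * \<phi> x) \<le> L * \<bar>\<phi> x\<bar>" for n by (auto simp: abs_mult intro!: mult_right_mono)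
  show "AE x in lebesgue. (\<lambda>n. diffq i (?h n) F x * \<phi> x) \<longlonglongrightarrow> g x * \<phi> x" using der
  proof eventually_elim
   case (elim x)
   have "filterlim ?h (at 0) sequentially" using inverse_Suc_seq by (auto simp: filterlim_at)
   from filterlim_compose[OF elim[unfolded DERIV_def] this]
   have "(\<lambda>n. diffq i (?h n) F x) \<longlonglongrightarrow> g x" by (simp add: diffq_def)
   then show ?case by (intro tendsto_intros)
  qed
 qed
 with diffq_pairing_test_function[OF F \<phi> inverse_Suc_seq, of i]
 have "(LI x. g x * \<phi> x) = - (LI x. F x * frechet_derivative \<phi> (at x) (axis i 1))" using LIMSEQ_unique by blast
 then show "(LI x. F x * frechet_derivative \<phi> (at x) (axis i 1)) = - (LI x. g x * \<phi> x)" by simp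
qed

lemma weak_deriv_test_function:
 assumes "\<phi> \<in> test_functions UNIV"
 shows "weak_deriv i \<phi> (\<lambda>x. frechet_derivative \<phi> (at x) (axis i 1))"
proof -
 obtain M where M: "\<And>x h. \<bar>\<phi> (x + h *\<^sub>R axis i 1) - \<phi> x\<bar> \<le> M * \<bar>h\<bar>" using test_function_lipschitz[OF assms, of i] by metis
 show ?thesis by (rule weak_deriv_lipschitz[where L = M])
   (use M test_functions_props(4)[OF assms] test_functions_props(4)[OF test_functions_frechet[OF assms axis_Basis]]
    test_function_line_derivative[OF test_functions_smooth[OF assms], of _ _ 0] in auto)
qed

text \<open>The factor \<eta> is moved onto the test function: \<eta> \<phi> has a weak derivative
  by \<open>weak_deriv_lipschitz\<close>, and \<open>weak_deriv_by_parts\<close> applies to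
  \<open>v\<close> and this product. Thus \<eta> may have kinks.\<close>

lemma weak_deriv_product:
 assumes v: "weak_deriv i v g"
  and m: "\<eta> \<in> borel_measurable lebesgue" "\<eta>' \<in> borel_measurable lebesgue"
  and bd: "\<And>x. \<bar>\<eta> x\<bar> \<le> M" "\<And>x. \<bar>\<eta>' x\<bar> \<le> L"
  and lip: "\<And>x h. \<bar>\<eta> (x + h *\<^sub>R axis i 1) - \<eta> x\<bar> \<le> L * \<bar>h\<bar>"
  and der: "AE x in lebesgue. ((\<lambda>s. \<eta> (x + s *\<^sub>R axis i 1)) has_real_derivative \<eta>' x) (at 0)"
 shows "weak_deriv i (\<lambda>x. \<eta> x * v x) (\<lambda>x. \<eta> x * g x + \<eta>' x * v x)"
proof -
 note sq = weak_derivD[OF v]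
 have M: "M \<ge> 0" and L: "L \<ge> 0" using bd[of 0] by linarith+
 have sq1: "square_integrable (\<lambda>x. \<eta> x * k x)" if "square_integrable k" for k
  by (rule square_integrable_bound[OF _ square_integrable_cmult[OF that, of M]])
   (use bd M m that in \<open>auto simp: abs_mult dest: square_integrableD(1) intro!: mult_right_mono\<close>)
 have sq2: "square_integrable (\<lambda>x. \<eta>' x * k x)" if "square_integrable k" for k
  by (rule square_integrable_bound[OF _ square_integrable_cmult[OF that, of L]])
   (use bd L m that in \<open>auto simp: abs_mult dest: square_integrableD(1) intro!: mult_right_mono\<close>)
 have "(LI x. (\<eta> x * v x) * frechet_derivative \<phi> (at x) (axis i 1)) = - (LI x. (\<eta> x * g x + \<eta>' x * v x) * \<phi> x)"
  if \<phi>: "\<phi> \<in> test_functions UNIV" for \<phi>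
 proof -
  note s\<phi> = test_functions_props(4)[OF \<phi>] test_functions_props(4)[OF test_functions_frechet[OF \<phi> axis_Basis[of i]]]
  obtain P where P: "P \<ge> 0" "\<And>x. \<bar>\<phi> x\<bar> \<le> P" using test_functions_props(5)[OF \<phi>] by blast
  obtain Q where Q: "Q \<ge> 0" "\<And>x h. \<bar>\<phi> (x + h *\<^sub>R axis i 1) - \<phi> x\<bar> \<le> Q * \<bar>h\<bar>" using test_function_lipschitz[OF \<phi>, of i] by metis
  have "weak_deriv i (\<lambda>x. \<eta> x * \<phi> x) (\<lambda>x. \<eta> x * frechet_derivative \<phi> (at x) (axis i 1) + \<eta>' x * \<phi> x)"
  proof (rule weak_deriv_lipschitz[where L = "M * Q + L * P"])
   show "\<bar>\<eta> (x + h *\<^sub>R axis i 1) * \<phi> (x + h *\<^sub>R axis i 1) - \<eta> x * \<phi> x\<bar> \<le> (M * Q + L * P) * \<bar>h\<bar>" for x h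
   proof -
    let ?y = "x + h *\<^sub>R axis i 1"
    have "\<bar>\<eta> ?y * \<phi> ?y - \<eta> x * \<phi> x\<bar> = \<bar>\<eta> ?y * (\<phi> ?y - \<phi> x) + (\<eta> ?y - \<eta> x) * \<phi> x\<bar>" by (simp add: algebra_simps)
    also have "\<dots> \<le> \<bar>\<eta> ?y\<bar> * \<bar>\<phi> ?y - \<phi> x\<bar> + \<bar>\<eta> ?y - \<eta> x\<bar> * \<bar>\<phi> x\<bar>" using abs_triangle_ineq by (simp flip: abs_mult)
    also have "\<dots> \<le> M * (Q * \<bar>h\<bar>) + (L * \<bar>h\<bar>) * P" using bd lip P Q L M by (intro add_mono mult_mono) auto
    finally show ?thesis by (simp add: algebra_simps)
   qed
   show "AE x in lebesgue. ((\<lambda>s. \<eta> (x + s *\<^sub>R axis i 1) * \<phi> (x + s *\<^sub>R axis i 1)) has_real_derivative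
     (\<eta> x * frechet_derivative \<phi> (at x) (axis i 1) + \<eta>' x * \<phi> x)) (at 0)" using der
   proof eventually_elim
    case (elim x)
    from DERIV_mult[OF elim test_function_line_derivative[OF test_functions_smooth[OF \<phi>], of x "axis i 1" 0]]
    show ?case by (simp add: mult.commute add.commute)
   qed
  qed (intro square_integrable_add sq1 sq2 s\<phi>)+
  from weak_deriv_by_parts[OF v this]
  have "(LI x. v x * (\<eta> x * frechet_derivative \<phi> (at x) (axis i 1) + \<eta>' x * \<phi> x)) = - (LI x. g x * (\<eta> x * \<phi> x))" .
  moreover have "(LI x. v x * (\<eta> x * frechet_derivative \<phi> (at x) (axis i 1) + \<eta>' x * \<phi> x)) =
    (LI x. (\<eta> x * v x) * frechet_derivative \<phi> (at x) (axis i 1)) + (LI x. (\<eta>' x * v x) * \<phi> x)"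
   using integrable_times[OF sq1[OF sq(1)] s\<phi>(2)] integrable_times[OF sq2[OF sq(1)] s\<phi>(1)]
   by (subst Bochner_Integration.integral_add[symmetric]) (auto simp: algebra_simps)
  moreover have "(LI x. (\<eta> x * g x + \<eta>' x * v x) * \<phi> x) =
    (LI x. g x * (\<eta> x * \<phi> x)) + (LI x. (\<eta>' x * v x) * \<phi> x)"
   using integrable_times[OF sq1[OF sq(2)] s\<phi>(1)] integrable_times[OF sq2[OF sq(1)] s\<phi>(1)]
   by (subst Bochner_Integration.integral_add[symmetric]) (auto simp: algebra_simps)
  ultimately show ?thesis by linarith
 qed
 then show ?thesis using sq1 sq2 sq by (auto simp: weak_deriv_def intro!: square_integrable_add)
qed

section \<open>Gradients\<close>

lemma has_gradient_lincomb:
 assumes "has_gradient u G" "has_gradient p P"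
 shows "has_gradient (\<lambda>x. a * u x + b * p x) (\<lambda>x. a *\<^sub>R G x + b *\<^sub>R P x)" using assms weak_deriv_lincomb by (simp add: has_gradient_def)

lemma has_gradient_diff:
 assumes "has_gradient u G" "has_gradient p P"
 shows "has_gradient (\<lambda>x. u x - p x) (\<lambda>x. G x - P x)" using has_gradient_lincomb[OF assms, of 1 "-1"] by simp

lemma has_gradient_zero: "has_gradient (\<lambda>x. 0) (\<lambda>x. 0)" by (simp add: has_gradient_iff is_weak_gradient_def)

lemma has_gradient_unique:
 assumes "has_gradient u G" "has_gradient u G'"
 shows "AE x in lebesgue. G x = G' x"
proof -
 have "AE x in lebesgue. G x $ i = G' x $ i" for i using assms weak_deriv_unique[of i u] unfolding has_gradient_def by blast
 then have "AE x in lebesgue. \<forall>i. G x $ i = G' x $ i" by (simp add: AE_all_countable)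
 then show ?thesis by eventually_elim (simp add: vec_eq_iff)
qed

lemma has_gradient_imp_H1: "has_gradient u G \<Longrightarrow> u \<in> H1" by (auto simp: H1_def L2_def has_gradient_iff)

lemma H1_has_gradient: "u \<in> H1 \<Longrightarrow> has_gradient u (weak_gradient u)" using someI_ex[of "\<lambda>G. square_integrable G \<and> is_weak_gradient u G"]
 unfolding has_gradient_iff weak_gradient_def H1_def L2_def by blast

lemma weak_gradient_eq_AE: "has_gradient u G \<Longrightarrow> AE x in lebesgue. weak_gradient u x = G x"
 using has_gradient_unique H1_has_gradient has_gradient_imp_H1 by blast

lemma has_gradient_test_function:
 assumes "\<phi> \<in> test_functions UNIV"
 shows "has_gradient \<phi> (\<lambda>x. \<chi> i. frechet_derivative \<phi> (at x) (axis i 1))"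
 using weak_deriv_test_function[OF assms] by (simp add: has_gradient_def)

section \<open>Comparison for the layered elliptic equation\<close>

lemma borel_imp_lebesgue_measurable: "f \<in> borel_measurable borel \<Longrightarrow> f \<in> borel_measurable lebesgue" by (simp add: measurable_completion)

lemma borel_measurable_component [measurable]: "(\<lambda>x::space. x $ i) \<in> borel_measurable borel"
 by (intro borel_measurable_continuous_onI continuous_intros)

lemma borel_measurable_gamma0 [measurable]: "gamma0 \<alpha> \<beta> \<in> borel_measurable borel" unfolding gamma0_def[abs_def] by measurable

lemma borel_measurable_gamma0_lebesgue: "gamma0 \<alpha> \<beta> \<in> borel_measurable lebesgue"
 by (intro borel_imp_lebesgue_measurable borel_measurable_gamma0)

lemma gamma0_bounds:
 assumes "\<alpha> > 0" "\<beta> > 0"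
 shows "0 < gamma0 \<alpha> \<beta> x" "min \<alpha> \<beta> \<le> gamma0 \<alpha> \<beta> x" "gamma0 \<alpha> \<beta> x \<le> max \<alpha> \<beta>" using assms by (auto simp: gamma0_def)

lemma square_integrable_gamma0_scaleR:
 assumes "\<alpha> > 0" "\<beta> > 0" "square_integrable V"
 shows "square_integrable (\<lambda>x. gamma0 \<alpha> \<beta> x *\<^sub>R V x)"
proof (rule square_integrable_bound[OF _ square_integrable_scaleR[OF assms(3), of "max \<alpha> \<beta>"]])
 show "(\<lambda>x. gamma0 \<alpha> \<beta> x *\<^sub>R V x) \<in> borel_measurable lebesgue"
  using assms(3) by (intro borel_measurable_scaleR borel_measurable_gamma0_lebesgue square_integrableD)
 show "AE x in lebesgue. norm (gamma0 \<alpha> \<beta> x *\<^sub>R V x) \<le> norm (max \<alpha> \<beta> *\<^sub>R V x)" using gamma0_bounds[OF assms(1,2)] assms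
  by (intro AE_I2) (auto simp: abs_of_pos intro!: mult_right_mono order_trans[OF _ abs_ge_self])
qed

text \<open>The weak equation with an explicit gradient for the solution and for every test
  function. Gradients computed by hand can be inserted directly, without returning each time to the
  arbitrary choice made by \<open>weak_gradient\<close>.\<close>

definition layered_solution ::
 "real \<Rightarrow> real \<Rightarrow> real \<Rightarrow> (space \<Rightarrow> real) \<Rightarrow> (space \<Rightarrow> real) \<Rightarrow> (space \<Rightarrow> space) \<Rightarrow> bool" where
 "layered_solution gp gm \<tau> f v V \<longleftrightarrow> has_gradient v V \<and> (\<forall>\<phi> \<Phi>. has_gradient \<phi> \<Phi> \<longrightarrow>
   (LI x. gamma0 gp gm x * (V x \<bullet> \<Phi> x)) + \<tau>^2 * (LI x. v x * \<phi> x) = (LI x. f x * \<phi> x))"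

lemma layered_solutionD:
 assumes "layered_solution gp gm \<tau> f v V"
 shows "has_gradient v V"
  "has_gradient \<phi> \<Phi> \<Longrightarrow> (LI x. gamma0 gp gm x * (V x \<bullet> \<Phi> x)) + \<tau>^2 * (LI x. v x * \<phi> x) = (LI x. f x * \<phi> x)"
 using assms by (auto simp: layered_solution_def)

lemma layered_solution_minus:
 assumes "layered_solution gp gm \<tau> f v V"
 shows "layered_solution gp gm \<tau> (\<lambda>x. - f x) (\<lambda>x. - v x) (\<lambda>x. - V x)" unfolding layered_solution_def
proof (intro conjI allI impI)
 show "has_gradient (\<lambda>x. - v x) (\<lambda>x. - V x)"
  using has_gradient_lincomb[OF layered_solutionD(1)[OF assms] has_gradient_zero, of "-1" 0] by simp
 show "(LI x. gamma0 gp gm x * (- V x \<bullet> \<Phi> x)) + \<tau>^2 * (LI x. - v x * \<phi> x) = (LI x. - f x * \<phi> x)"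
  if "has_gradient \<phi> \<Phi>" for \<phi> \<Phi> using layered_solutionD(2)[OF assms that] by simp
qed

lemma elliptic_imp_layered_solution:
 assumes "elliptic_weak_solution (gamma0 gp gm) \<tau> f v" "gp > 0" "gm > 0"
 shows "layered_solution gp gm \<tau> f v (weak_gradient v)" unfolding layered_solution_def
proof (intro conjI allI impI)
 show g: "has_gradient v (weak_gradient v)" using assms(1) H1_has_gradient by (auto simp: elliptic_weak_solution_def)
 fix \<phi> \<Phi> assume \<phi>: "has_gradient \<phi> \<Phi>"
 then have H: "\<phi> \<in> H1" by (rule has_gradient_imp_H1)
 note sq = has_gradientD(2)[OF g] has_gradientD(2)[OF \<phi>] has_gradientD(2)[OF H1_has_gradient[OF H]]
 have "(LI x. gamma0 gp gm x * (weak_gradient v x \<bullet> weak_gradient \<phi> x)) =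
   (LI x. gamma0 gp gm x * (weak_gradient v x \<bullet> \<Phi> x))" using weak_gradient_eq_AE[OF \<phi>] sq[THEN square_integrableD(1)]
  by (intro integral_cong_AE borel_measurable_times borel_measurable_inner borel_measurable_gamma0_lebesgue)
   (auto elim: eventually_mono)
 then show "(LI x. gamma0 gp gm x * (weak_gradient v x \<bullet> \<Phi> x)) + \<tau>^2 * (LI x. v x * \<phi> x) = (LI x. f x * \<phi> x)"
  using assms(1) H by (auto simp: elliptic_weak_solution_def)
qed

text \<open>A C^1 substitute for the positive part of t - k: for t > k it is (t-k) - 1 +
  1/(1+(t-k)), so its derivative is continuous with values in [0,1). That is what
  \<open>weak_deriv_chain\<close> asks of the outer function.\<close>

definition soft_excess :: "real \<Rightarrow> real \<Rightarrow> real" where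
 "soft_excess k t = (if t \<le> k then 0 else (t - k)^2 / (1 + (t - k)))"

lemma has_derivative_soft_excess:
 "(soft_excess k has_real_derivative (1 - 1 / (1 + max (t - k) 0)^2)) (at t)"
proof -
 consider "t > k" | "t < k" | "t = k" by linarith
 then show ?thesis
 proof cases
  case 1
  have "((\<lambda>t. (t - k) - 1 + 1 / (1 + (t - k))) has_real_derivative (1 - 1 / (1 + max (t - k) 0)^2)) (at t)"
   using 1 by (auto intro!: derivative_eq_intros simp: max_def power2_eq_square)
  moreover have "(s - k) - 1 + 1 / (1 + (s - k)) = soft_excess k s" if "s > k" for s
   using that by (simp add: soft_excess_def field_simps power2_eq_square)
  ultimately show ?thesis using has_field_derivative_transform_within_open[of _ _ t "{k<..}" "soft_excess k"] 1 by auto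
 next
  case 2
  have "((\<lambda>t. 0) has_real_derivative (1 - 1 / (1 + max (t - k) 0)^2)) (at t)" using 2 by (auto simp: max_def)
  then show ?thesis by (rule has_field_derivative_transform_within_open[where S = "{..<k}"]) (use 2 in \<open>auto simp: soft_excess_def\<close>)
 next
  case 3
  have "((\<lambda>h. soft_excess k (k + h) / h) \<longlongrightarrow> 0) (at 0)"
  proof (rule tendsto_rabs_zero_cancel, rule tendsto_sandwich[OF _ _ tendsto_const])
   show "((\<lambda>h::real. \<bar>h\<bar>) \<longlongrightarrow> 0) (at 0)" using tendsto_rabs_zero[OF tendsto_ident_at[of 0 UNIV]] by simp
   have "\<bar>soft_excess k (k + h) / h\<bar> \<le> \<bar>h\<bar>" for h
   proof (cases "h > 0")
    case True
    have "soft_excess k (k + h) / h = h / (1 + h)" using True by (simp add: soft_excess_def power2_eq_square)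
    moreover have "h / (1 + h) \<le> h" using True by (simp add: divide_le_eq distrib_left)
    ultimately show ?thesis using True by simp
   qed (simp add: soft_excess_def)
   then show "\<forall>\<^sub>F h in at 0. \<bar>soft_excess k (k + h) / h\<bar> \<le> \<bar>h\<bar>" by simp
  qed simp
  then show ?thesis using 3 by (simp add: DERIV_def soft_excess_def)
 qed
qed

lemma soft_excess_props:
 "soft_excess k t \<ge> 0" "t \<le> k \<Longrightarrow> soft_excess k t = 0" "t > k \<Longrightarrow> soft_excess k t > 0" by (auto simp: soft_excess_def)

lemma soft_excess_deriv_bounds:
 "0 \<le> 1 - 1 / (1 + max (t - k) 0)^2" "1 - 1 / (1 + max (t - k) 0)^2 \<le> (1::real)"
proof -
 have "1 \<le> (1 + max (t - k) 0)^2" by (rule one_le_power) auto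
 then show "0 \<le> 1 - 1 / (1 + max (t - k) 0)^2" by simp
qed simp

lemma has_gradient_soft_excess:
 assumes "has_gradient d G" "k \<ge> 0"
 shows "has_gradient (\<lambda>x. soft_excess k (d x)) (\<lambda>x. (1 - 1 / (1 + max (d x - k) 0)^2) *\<^sub>R G x)" unfolding has_gradient_def
proof
 fix i
 have "continuous_on UNIV (\<lambda>t. 1 - 1 / (1 + max (t - k) 0)^2)" by (intro continuous_intros) (auto simp: add_nonneg_eq_0_iff)
 then have "weak_deriv i (\<lambda>x. soft_excess k (d x)) (\<lambda>x. (1 - 1 / (1 + max (d x - k) 0)^2) * G x $ i)" using soft_excess_deriv_bounds assms
  by (intro weak_deriv_chain[where j = "soft_excess k" and j' = "\<lambda>t. 1 - 1 / (1 + max (t - k) 0)^2"]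
    has_derivative_soft_excess has_gradientD) (auto simp: soft_excess_def)
 then show "weak_deriv i (\<lambda>x. soft_excess k (d x)) (\<lambda>x. ((1 - 1 / (1 + max (d x - k) 0)^2) *\<^sub>R G x) $ i)" by simp
qed

text \<open>Test the equation with a function of \<open>s - v\<close> that vanishes where \<open>s - v \<le> k\<close>. The flux
 \<open>F\<close> only has to agree with that of \<open>s\<close> on the set \<open>U\<close> carrying the test function.\<close>

lemma layered_comparison:
 assumes sol: "layered_solution gp gm \<tau> f v V" and pos: "gp > 0" "gm > 0" "\<tau> > 0" "k \<ge> 0"
  and f: "square_integrable f"
  and s: "has_gradient s S" and Fg: "\<And>i. weak_deriv i (F i) (g i)"
  and off: "AE x in lebesgue. x \<notin> U \<longrightarrow> s x - v x \<le> k"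
  and flux: "AE x in lebesgue. x \<in> U \<longrightarrow> (\<forall>i. gamma0 gp gm x * S x $ i = F i x)"
  and sub: "AE x in lebesgue. x \<in> U \<longrightarrow> \<tau>^2 * s x \<le> (\<Sum>i\<in>UNIV. g i x) + f x"
 shows "AE x in lebesgue. s x - v x \<le> k"
proof -
 let ?a = "gamma0 gp gm"
 define d where "d x = s x - v x" for x
 define D where "D x = S x - V x" for x
 define c where "c x = 1 - 1 / (1 + max (d x - k) 0)^2" for x
 define \<phi> where "\<phi> x = soft_excess k (d x)" for x
 define \<Phi> where "\<Phi> x = c x *\<^sub>R D x" for x
 note v = layered_solutionD(1)[OF sol]
 have gd: "has_gradient d D" unfolding d_def[abs_def] D_def[abs_def] by (rule has_gradient_diff[OF s v])
 have g\<phi>: "has_gradient \<phi> \<Phi>" unfolding \<phi>_def[abs_def] \<Phi>_def[abs_def] c_def by (rule has_gradient_soft_excess[OF gd pos(4)])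
 have c: "0 \<le> c x" for x unfolding c_def by (rule soft_excess_deriv_bounds)
 have zero: "\<phi> x = 0 \<and> \<Phi> x = 0" if "d x \<le> k" for x using that by (simp add: \<phi>_def \<Phi>_def c_def soft_excess_props)
 note sq = has_gradientD(1,2)[OF g\<phi>] has_gradientD(1,2)[OF v] has_gradientD(1,2)[OF s] has_gradientD(1,2)[OF gd]
 note aS = square_integrable_gamma0_scaleR[OF pos(1,2) sq(6)]
 note aV = square_integrable_gamma0_scaleR[OF pos(1,2) sq(4)]
 note aD = square_integrable_gamma0_scaleR[OF pos(1,2) sq(8)]
 have i1: "integrable lebesgue (\<lambda>x. ?a x * (S x \<bullet> \<Phi> x))" "integrable lebesgue (\<lambda>x. ?a x * (V x \<bullet> \<Phi> x))"
   "integrable lebesgue (\<lambda>x. ?a x * (D x \<bullet> \<Phi> x))"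
  using integrable_inner[OF aS sq(2)] integrable_inner[OF aV sq(2)] integrable_inner[OF aD sq(2)] by simp_all
 have iF: "integrable lebesgue (\<lambda>x. F i x * \<Phi> x $ i)" for i by (intro integrable_times weak_derivD[OF Fg] square_integrable_component sq)
 have ig: "integrable lebesgue (\<lambda>x. g i x * \<phi> x)" for i by (intro integrable_times weak_derivD[OF Fg] sq)
 \<comment> \<open>Outside \<open>U\<close> the truncation and its gradient vanish, so the flux of
   \<open>s\<close> can be exchanged for \<open>F\<close> under the integral. \<open>F\<close> has
   weak derivatives on the whole space and can be integrated by parts although the coefficient
   jumps.\<close>
 have "(LI x. ?a x * (S x \<bullet> \<Phi> x)) = (LI x. (\<Sum>i\<in>UNIV. F i x * \<Phi> x $ i))"
 proof (rule integral_cong_AE)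
  show "(\<lambda>x. ?a x * (S x \<bullet> \<Phi> x)) \<in> borel_measurable lebesgue" using i1(1) by auto
  show "(\<lambda>x. \<Sum>i\<in>UNIV. F i x * \<Phi> x $ i) \<in> borel_measurable lebesgue" using iF by (intro borel_measurable_sum) auto
  show "AE x in lebesgue. ?a x * (S x \<bullet> \<Phi> x) = (\<Sum>i\<in>UNIV. F i x * \<Phi> x $ i)" using off flux
  proof eventually_elim
   case (elim x)
   show ?case
   proof (cases "x \<in> U")
    case True
    then have "?a x * (S x \<bullet> \<Phi> x) = (\<Sum>i\<in>UNIV. (?a x * S x $ i) * \<Phi> x $ i)" by (simp add: inner_vec_def sum_distrib_left mult.assoc)
    also have "\<dots> = (\<Sum>i\<in>UNIV. F i x * \<Phi> x $ i)" using elim(2) True by (intro sum.cong) auto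
    finally show ?thesis .
   next
    case False
    then show ?thesis using elim(1) zero[of x] by (simp add: d_def)
   qed
  qed
 qed
 also have "\<dots> = (\<Sum>i\<in>UNIV. (LI x. F i x * \<Phi> x $ i))" by (rule Bochner_Integration.integral_sum) (rule iF)
 also have "\<dots> = (\<Sum>i\<in>UNIV. - (LI x. g i x * \<phi> x))" by (intro sum.cong refl weak_deriv_by_parts[OF Fg has_gradientD(3)[OF g\<phi>]])
 also have "\<dots> = - (LI x. (\<Sum>i\<in>UNIV. g i x * \<phi> x))" by (subst Bochner_Integration.integral_sum) (auto simp: ig sum_negf)
 finally have e1: "(LI x. ?a x * (S x \<bullet> \<Phi> x)) = - (LI x. (\<Sum>i\<in>UNIV. g i x * \<phi> x))" .
 have e2: "(LI x. ?a x * (V x \<bullet> \<Phi> x)) + \<tau>^2 * (LI x. v x * \<phi> x) = (LI x. f x * \<phi> x)" by (rule layered_solutionD(2)[OF sol g\<phi>])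
 have is\<phi>: "integrable lebesgue (\<lambda>x. s x * \<phi> x)" "integrable lebesgue (\<lambda>x. v x * \<phi> x)" "integrable lebesgue (\<lambda>x. f x * \<phi> x)"
  "integrable lebesgue (\<lambda>x. d x * \<phi> x)" by (intro integrable_times sq f)+
 have "(LI x. ?a x * (D x \<bullet> \<Phi> x)) + \<tau>^2 * (LI x. d x * \<phi> x)
   = (LI x. ?a x * (S x \<bullet> \<Phi> x)) - (LI x. ?a x * (V x \<bullet> \<Phi> x))
   + \<tau>^2 * ((LI x. s x * \<phi> x) - (LI x. v x * \<phi> x))"
  using i1 is\<phi> by (simp add: D_def d_def inner_diff_left left_diff_distrib right_diff_distrib)
 also have "\<dots> = \<tau>^2 * (LI x. s x * \<phi> x) - (LI x. (\<Sum>i\<in>UNIV. g i x * \<phi> x)) - (LI x. f x * \<phi> x)" using e1 e2 by (simp add: algebra_simps)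
 also have "\<dots> = (LI x. \<tau>^2 * (s x * \<phi> x) - (\<Sum>i\<in>UNIV. g i x * \<phi> x) - f x * \<phi> x)" using is\<phi> ig by simp
 also have "\<dots> \<le> (LINT x|(lebesgue::space measure). 0)"
 proof (rule integral_mono_AE)
  show "integrable lebesgue (\<lambda>x. \<tau>^2 * (s x * \<phi> x) - (\<Sum>i\<in>UNIV. g i x * \<phi> x) - f x * \<phi> x)" using is\<phi> ig by simp
  show "AE x in lebesgue. \<tau>^2 * (s x * \<phi> x) - (\<Sum>i\<in>UNIV. g i x * \<phi> x) - f x * \<phi> x \<le> 0" using off sub
  proof eventually_elim
   case (elim x)
   have "\<tau>^2 * (s x * \<phi> x) - (\<Sum>i\<in>UNIV. g i x * \<phi> x) - f x * \<phi> x = (\<tau>^2 * s x - (\<Sum>i\<in>UNIV. g i x) - f x) * \<phi> x"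
    by (simp add: algebra_simps sum_distrib_left)
   also have "\<dots> \<le> 0"
   proof (cases "x \<in> U")
    case True
    then show ?thesis using elim soft_excess_props(1) by (intro mult_nonpos_nonneg) (auto simp: \<phi>_def)
   next
    case False
    then show ?thesis using elim(1) zero[of x] by (simp add: d_def)
   qed
   finally show ?case .
  qed
 qed simp
 finally have le: "(LI x. ?a x * (D x \<bullet> \<Phi> x)) + \<tau>^2 * (LI x. d x * \<phi> x) \<le> 0" by simp
 \<comment> \<open>\<Phi> is a nonnegative multiple of \<open>D\<close>, so the gradient term may be
   dropped. The integral of the nonnegative function d \<phi> must then vanish, while \<phi> is
   positive where d > k.\<close>
 have "0 \<le> (LI x. ?a x * (D x \<bullet> \<Phi> x))"
 proof (rule Bochner_Integration.integral_nonneg)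
  show "0 \<le> ?a x * (D x \<bullet> \<Phi> x)" for x using c[of x] less_imp_le[OF gamma0_bounds(1)[OF pos(1,2)], of x] by (simp add: \<Phi>_def)
 qed
 then have "\<tau>^2 * (LI x. d x * \<phi> x) \<le> 0" using le by linarith
 then have "(LI x. d x * \<phi> x) \<le> 0" using pos(3) by (simp add: mult_le_0_iff)
 moreover have nn: "0 \<le> d x * \<phi> x" for x using zero[of x] pos(4) soft_excess_props(1)[of k "d x"] by (cases "d x \<le> k") (auto simp: \<phi>_def)
 ultimately have "(LI x. d x * \<phi> x) = 0"
  using Bochner_Integration.integral_nonneg[of lebesgue "\<lambda>x. d x * \<phi> x"] by (simp add: order_antisym)
 then have "AE x in lebesgue. d x * \<phi> x = 0" using integral_nonneg_eq_0_iff_AE[OF is\<phi>(4)] nn by simp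
 then show ?thesis
 proof eventually_elim
  case (elim x)
  show ?case
  proof (rule ccontr)
   assume "\<not> s x - v x \<le> k"
   then have "d x > k" "\<phi> x > 0" by (auto simp: d_def \<phi>_def intro: soft_excess_props)
   then show False using elim pos(4) by simp
  qed
 qed
qed

lemma layered_solution_nonneg:
 assumes sol: "layered_solution gp gm \<tau> f v V" and pos: "gp > 0" "gm > 0" "\<tau> > 0"
  and f: "square_integrable f" "AE x in lebesgue. f x \<ge> 0"
 shows "AE x in lebesgue. v x \<ge> 0"
proof -
 have z: "weak_deriv i (\<lambda>x. 0) (\<lambda>x. 0)" for i by (simp add: weak_deriv_def)
 have "AE x in lebesgue. (\<lambda>x. 0) x - v x \<le> 0"
  by (rule layered_comparison[where U = UNIV and F = "\<lambda>i x. 0" and g = "\<lambda>i x. 0" and s = "\<lambda>x. 0", OF sol pos _ f(1) has_gradient_zero z])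
   (use f(2) in auto)
 then show ?thesis by eventually_elim simp
qed

section \<open>Logistic barriers\<close>

lemma nn_integral_inverse_1_plus_square: "(\<integral>\<^sup>+t. ennreal (1 / (1 + t^2)) \<partial>lborel) < \<infinity>"
proof -
 have half: "(\<integral>\<^sup>+t. ennreal (1 / (1 + t^2)) * indicator {0..} t \<partial>lborel) = ennreal (pi / 2 - arctan 0)"
  by (rule nn_integral_FTC_atLeast) (auto intro!: derivative_eq_intros tendsto_arctan_at_top simp: inverse_eq_divide)
 have "(\<integral>\<^sup>+t. ennreal (1 / (1 + t^2)) * indicator {..0} t \<partial>lborel) =
   (\<integral>\<^sup>+t. ennreal (1 / (1 + t^2)) * indicator {0..} t \<partial>lborel)" by (subst nn_integral_real_affine[where c = "-1" and t = 0])
   (auto intro!: nn_integral_cong simp: indicator_def)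
 with half have half': "(\<integral>\<^sup>+t. ennreal (1 / (1 + t^2)) * indicator {..0} t \<partial>lborel) = ennreal (pi / 2)" by simp
 have "(\<integral>\<^sup>+t. ennreal (1 / (1 + t^2)) \<partial>lborel) \<le>
  (\<integral>\<^sup>+t. ennreal (1 / (1 + t^2)) * indicator {0..} t + ennreal (1 / (1 + t^2)) * indicator {..0} t \<partial>lborel)"
  by (intro nn_integral_mono) (auto simp: indicator_def)
 also have "\<dots> = ennreal (pi / 2) + ennreal (pi / 2)" using half half' by (subst nn_integral_add) auto
 also have "\<dots> < \<infinity>" by (simp add: ennreal_plus[symmetric] del: ennreal_plus)
 finally show ?thesis .
qed

text \<open>A majorant for Gaussians, in product form so that integrability reduces to the
  arctangent in one variable; the values lie in (0,1], so the square is integrable too.\<close>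

lemma square_integrable_rational_decay:
 "square_integrable (\<lambda>x::space. \<Prod>i\<in>UNIV. 1 / (1 + (x $ i)^2))"
proof -
 let ?w = "\<lambda>x::space. \<Prod>i\<in>UNIV. 1 / (1 + (x $ i)^2)"
 have pos: "0 < 1 / (1 + t^2)" "1 / (1 + t^2) \<le> 1" for t :: real by (auto simp: add_pos_nonneg)
 have w: "0 \<le> ?w x" "?w x \<le> 1" for x using pos by (intro prod_nonneg prod_le_1; auto intro: less_imp_le)+
 have m: "?w \<in> borel_measurable borel" by measurable
 have eq: "?w x = (\<Prod>b\<in>Basis. 1 / (1 + (x \<bullet> b)^2))" for x
 proof -
  have B: "(Basis :: space set) = (\<lambda>i. axis i 1) ` UNIV" by (auto simp: Basis_vec_def)
  have "inj (\<lambda>i. axis i (1::real) :: space)" by (auto simp: inj_on_def axis_eq_axis)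
  then show ?thesis unfolding B by (subst prod.reindex) (auto simp: inner_axis)
 qed
 have "(\<integral>\<^sup>+x. ennreal (?w x) \<partial>lborel) = (\<integral>\<^sup>+x. (\<Prod>b\<in>Basis. ennreal (1 / (1 + (x \<bullet> b)^2))) \<partial>(lborel :: space measure))"
  unfolding eq using pos by (intro nn_integral_cong prod_ennreal[symmetric]) (auto intro: less_imp_le)
 also have "\<dots> = (\<Prod>b\<in>(Basis :: space set). (\<integral>\<^sup>+t. ennreal (1 / (1 + t^2)) \<partial>lborel))" by (rule nn_integral_lborel_prod) auto
 also have "\<dots> < \<infinity>" using nn_integral_inverse_1_plus_square by (simp add: power_less_top_ennreal)
 finally have "(\<integral>\<^sup>+x. ennreal (?w x) \<partial>lborel) < \<infinity>" .
 then have "integrable lborel ?w" using w m by (intro integrableI_nonneg) auto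
 then have i: "integrable lebesgue ?w" using m by (subst integrable_completion) auto
 have "integrable lebesgue (\<lambda>x. (norm (?w x))^2)"
 proof (rule Bochner_Integration.integrable_bound[OF i])
  show "(\<lambda>x. (norm (?w x))^2) \<in> borel_measurable lebesgue" by (intro borel_imp_lebesgue_measurable) measurable
  have "(?w x)^2 \<le> ?w x" for x using w[of x] by (simp add: power2_eq_square mult_left_le)
  then show "AE x in lebesgue. norm ((norm (?w x))^2) \<le> norm (?w x)" using w by (intro AE_I2) (simp add: abs_of_nonneg)
 qed
 then show ?thesis using borel_imp_lebesgue_measurable[OF m] by (simp add: square_integrable_def)
qed

text \<open>Comparable to e^{-t} for t \<ge> 0 but bounded by 1 on the whole line, so that a radial
  barrier needs no cutoff at its centre. Its first two derivatives, \<open>logistic1\<close> and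
  \<open>logistic2\<close>, are polynomials in the function itself and are bounded by it.\<close>

definition logistic :: "real \<Rightarrow> real" where
 "logistic t = 1 / (1 + exp t)"

definition logistic1 :: "real \<Rightarrow> real" where
 "logistic1 t = - (logistic t * (1 - logistic t))"

definition logistic2 :: "real \<Rightarrow> real" where
 "logistic2 t = logistic t * (1 - logistic t) * (1 - 2 * logistic t)"

lemma logistic_bounds: "0 < logistic t" "logistic t < 1" "logistic t \<le> exp (- t)" "t \<ge> 0 \<Longrightarrow> exp (- t) / 2 \<le> logistic t"
proof -
 show "0 < logistic t" "logistic t < 1" by (auto simp: logistic_def add_pos_pos)
 show "logistic t \<le> exp (- t)" by (simp add: logistic_def exp_minus field_simps add_pos_pos)
 show "exp (- t) / 2 \<le> logistic t" if "t \<ge> 0" using that by (simp add: logistic_def exp_minus field_simps add_pos_pos)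
qed

lemma logistic_antimono: "s \<le> t \<Longrightarrow> logistic t \<le> logistic s" by (simp add: logistic_def frac_le add_pos_pos)

lemma DERIV_logistic: "(logistic has_real_derivative logistic1 t) (at t)"
proof -
 have "1 + exp t \<noteq> 0" using exp_gt_zero[of t] by linarith
 then show ?thesis unfolding logistic_def[abs_def] logistic1_def logistic_def
  by (auto intro!: derivative_eq_intros simp: field_simps power2_eq_square)
qed

lemma DERIV_logistic1: "(logistic1 has_real_derivative logistic2 t) (at t)" unfolding logistic1_def[abs_def] logistic2_def
 by (auto intro!: derivative_eq_intros DERIV_logistic simp: logistic1_def algebra_simps)

lemmas DERIV_logistic_chain = DERIV_chain2[OF DERIV_logistic] DERIV_chain2[OF DERIV_logistic1]

lemma logistic_deriv_bounds: "\<bar>logistic1 t\<bar> \<le> logistic t" "\<bar>logistic2 t\<bar> \<le> logistic t"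
proof -
 have 1: "\<bar>1 - logistic t\<bar> \<le> 1" "\<bar>1 - 2 * logistic t\<bar> \<le> 1" "\<bar>logistic t\<bar> = logistic t" using logistic_bounds(1,2)[of t] by auto
 show "\<bar>logistic1 t\<bar> \<le> logistic t" unfolding logistic1_def abs_minus abs_mult 1(3)
  using 1 logistic_bounds(1)[of t] by (intro mult_left_le) auto
 have "\<bar>1 - logistic t\<bar> * \<bar>1 - 2 * logistic t\<bar> \<le> 1" using 1 by (intro mult_le_one) auto
 then show "\<bar>logistic2 t\<bar> \<le> logistic t" unfolding logistic2_def abs_mult 1(3) mult.assoc
  using logistic_bounds(1)[of t] by (intro mult_left_le) auto
qed

lemma borel_measurable_logistic [measurable]:
 "logistic \<in> borel_measurable borel" "logistic1 \<in> borel_measurable borel" "logistic2 \<in> borel_measurable borel"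
 unfolding logistic1_def[abs_def] logistic2_def[abs_def] logistic_def[abs_def] by measurable

text \<open>The third coordinate is stretched by \<open>\<alpha> / \<beta>\<close> below the interface, which makes the flux
 \<open>gamma0 \<alpha> \<beta> * \<partial>\<^sub>3 s\<close> of a function of the stretched coordinates continuous.\<close>

definition stretched :: "real \<Rightarrow> real \<Rightarrow> space \<Rightarrow> 3 \<Rightarrow> space \<Rightarrow> real" where
 "stretched \<alpha> \<beta> z i x = (if i = 3 \<and> x $ 3 \<le> 0 then \<alpha> / \<beta> * x $ 3 else x $ i) - z $ i"

definition slope :: "real \<Rightarrow> real \<Rightarrow> 3 \<Rightarrow> space \<Rightarrow> real" where
 "slope \<alpha> \<beta> i x = (if i = 3 \<and> x $ 3 \<le> 0 then \<alpha> / \<beta> else 1)"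

text \<open>The product of \<open>gamma0\<close> and \<open>slope\<close>. It does not change along
  axis i: in direction 3 the two jumps compensate to give \<alpha> on both sides, and in the other
  directions the interface is not crossed.\<close>

definition flux_coeff :: "real \<Rightarrow> real \<Rightarrow> 3 \<Rightarrow> space \<Rightarrow> real" where
 "flux_coeff \<alpha> \<beta> i x = (if i = 3 then \<alpha> else gamma0 \<alpha> \<beta> x)"

definition sqdist :: "real \<Rightarrow> real \<Rightarrow> space \<Rightarrow> space \<Rightarrow> real" where
 "sqdist \<alpha> \<beta> z x = (\<Sum>i\<in>UNIV. (stretched \<alpha> \<beta> z i x)^2)"

lemma stretched_other: "j \<noteq> i \<Longrightarrow> stretched \<alpha> \<beta> z j (x + h *\<^sub>R axis i 1) = stretched \<alpha> \<beta> z j x" by (auto simp: stretched_def axis_def)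

lemma flux_coeff_shift: "flux_coeff \<alpha> \<beta> i (x + h *\<^sub>R axis i 1) = flux_coeff \<alpha> \<beta> i x" by (auto simp: flux_coeff_def gamma0_def axis_def)

lemma sqdist_shift:
 "sqdist \<alpha> \<beta> z (x + h *\<^sub>R axis i 1) = (\<Sum>j\<in>UNIV - {i}. (stretched \<alpha> \<beta> z j x)^2) + (stretched \<alpha> \<beta> z i (x + h *\<^sub>R axis i 1))^2"
proof -
 have "(\<Sum>j\<in>UNIV - {i}. (stretched \<alpha> \<beta> z j (x + h *\<^sub>R axis i 1))^2) = (\<Sum>j\<in>UNIV - {i}. (stretched \<alpha> \<beta> z j x)^2)"
  by (intro sum.cong) (auto simp: stretched_other)
 then show ?thesis unfolding sqdist_def by (subst sum.remove[of _ i]) auto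
qed

lemma stretched_le_sqdist: "(stretched \<alpha> \<beta> z i x)^2 \<le> sqdist \<alpha> \<beta> z x"
 unfolding sqdist_def by (rule member_le_sum[where f = "\<lambda>i. (stretched \<alpha> \<beta> z i x)^2"]) auto

lemma sqdist_homogeneous: "\<alpha> > 0 \<Longrightarrow> sqdist \<alpha> \<alpha> z x = (dist x z)^2"
 by (auto simp: sqdist_def stretched_def dist_norm norm_vec_def L2_set_def sum_nonneg intro!: sum.cong)

lemma borel_measurable_stretched [measurable]:
 "stretched \<alpha> \<beta> z i \<in> borel_measurable borel" "slope \<alpha> \<beta> i \<in> borel_measurable borel"
 "flux_coeff \<alpha> \<beta> i \<in> borel_measurable borel" "sqdist \<alpha> \<beta> z \<in> borel_measurable borel"
proof -
 show [measurable]: "stretched \<alpha> \<beta> z i \<in> borel_measurable borel" for i unfolding stretched_def[abs_def] by measurable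
 show "slope \<alpha> \<beta> i \<in> borel_measurable borel" "flux_coeff \<alpha> \<beta> i \<in> borel_measurable borel"
  unfolding slope_def[abs_def] flux_coeff_def[abs_def] by measurable
 show "sqdist \<alpha> \<beta> z \<in> borel_measurable borel" unfolding sqdist_def[abs_def] by measurable
qed

lemma linear_le_gaussian:
 fixes y \<mu> :: real
 assumes "\<mu> > 0" and that: "y \<ge> 0"
 shows "(1 + y) * exp (- \<mu> * y) \<le> (1 + 2 / \<mu>) * exp (- (\<mu> / 2) * y)"
proof -
 have "1 + y \<le> (1 + 2 / \<mu>) * (1 + \<mu> / 2 * y)" using assms that by (simp add: field_simps)
 also have "\<dots> \<le> (1 + 2 / \<mu>) * exp (\<mu> / 2 * y)" using assms exp_ge_add_one_self[of "\<mu> / 2 * y"] by (intro mult_left_mono) auto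
 finally have "(1 + y) * exp (- \<mu> * y) \<le> (1 + 2 / \<mu>) * exp (\<mu> / 2 * y) * exp (- \<mu> * y)" by (intro mult_right_mono) auto
 also have "\<dots> = (1 + 2 / \<mu>) * exp (\<mu> / 2 * y + - \<mu> * y)" by (simp only: exp_add mult.assoc)
 also have "\<mu> / 2 * y + - \<mu> * y = - (\<mu> / 2) * y" by simp
 finally show ?thesis .
qed

context
 fixes \<alpha> \<beta> :: real and z :: space
 assumes ab: "0 < \<alpha>" "\<alpha> \<le> \<beta>"
begin

lemma slope_bounds: "0 < slope \<alpha> \<beta> i x" "slope \<alpha> \<beta> i x \<le> 1" using ab by (auto simp: slope_def)

lemma flux_coeff_bounds: "0 < flux_coeff \<alpha> \<beta> i x" "flux_coeff \<alpha> \<beta> i x \<le> \<beta>" using ab by (auto simp: flux_coeff_def gamma0_def)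

text \<open>The minimum \<alpha>^2 / \<beta> occurs in direction 3 below the interface, where
  \<alpha> meets the slope \<alpha> / \<beta>. A barrier in stretched coordinates propagates at the
  rate allowed by this worst value; for \<alpha> = \<beta> it is the coefficient itself.\<close>

lemma flux_coeff_slope_bounds:
 "\<alpha>^2 / \<beta> \<le> flux_coeff \<alpha> \<beta> i x * slope \<alpha> \<beta> i x" "flux_coeff \<alpha> \<beta> i x * slope \<alpha> \<beta> i x \<le> \<beta>"
proof -
 have "\<alpha> * \<alpha> \<le> \<alpha> * \<beta>" "\<alpha> * \<alpha> \<le> \<beta> * \<beta>" "\<alpha> * \<alpha> \<le> \<beta> * \<beta>" using ab by (auto intro: mult_mono mult_left_mono)
 then show "\<alpha>^2 / \<beta> \<le> flux_coeff \<alpha> \<beta> i x * slope \<alpha> \<beta> i x" "flux_coeff \<alpha> \<beta> i x * slope \<alpha> \<beta> i x \<le> \<beta>"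
  using ab by (auto simp: flux_coeff_def gamma0_def slope_def power2_eq_square field_simps)
qed

lemma gamma0_slope: "gamma0 \<alpha> \<beta> x * slope \<alpha> \<beta> i x = flux_coeff \<alpha> \<beta> i x" using ab by (auto simp: flux_coeff_def gamma0_def slope_def)

lemma stretched_lipschitz: "\<bar>stretched \<alpha> \<beta> z i (x + h *\<^sub>R axis i 1) - stretched \<alpha> \<beta> z i x\<bar> \<le> \<bar>h\<bar>"
proof (cases "i = 3")
 case False
 then show ?thesis by (simp add: stretched_def)
next
 case True
 define \<sigma> where "\<sigma> t = (if t \<le> 0 then \<alpha> / \<beta> * t else t)" for t :: real
 have r: "0 < \<alpha> / \<beta>" "\<alpha> / \<beta> \<le> 1" using ab by auto
 have lip: "\<bar>\<sigma> s - \<sigma> t\<bar> \<le> \<bar>s - t\<bar>" if "t \<le> s" for s t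
 proof -
  have 1: "\<alpha> / \<beta> * (s - t) \<le> s - t" using that r by (intro mult_left_le_one_le) auto
  have 2: "0 \<le> \<alpha> / \<beta> * (s - t)" using that r by (intro mult_nonneg_nonneg) auto
  have 3: "\<alpha> / \<beta> * t \<le> 0" "t \<le> \<alpha> / \<beta> * t" if "t \<le> 0"
   using mult_nonneg_nonpos[OF less_imp_le[OF r(1)] that] mult_right_mono_neg[OF r(2) that] by simp_all
  show ?thesis using that 1 2 3 by (auto simp: \<sigma>_def right_diff_distrib abs_if)
 qed
 have "\<bar>\<sigma> s - \<sigma> t\<bar> \<le> \<bar>s - t\<bar>" for s t using lip[of s t] lip[of t s] by (cases "t \<le> s") (auto simp: abs_minus_commute)
 from this[of "x $ 3 + h" "x $ 3"] have "\<bar>\<sigma> (x $ 3 + h) - \<sigma> (x $ 3)\<bar> \<le> \<bar>h\<bar>" by simp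
 moreover have "stretched \<alpha> \<beta> z i (x + h *\<^sub>R axis i 1) = \<sigma> (x $ 3 + h) - z $ 3" "stretched \<alpha> \<beta> z i x = \<sigma> (x $ 3) - z $ 3"
  using True by (simp_all add: stretched_def \<sigma>_def)
 ultimately show ?thesis by simp
qed

lemma stretched_DERIV:
 "AE x in lebesgue. ((\<lambda>s. stretched \<alpha> \<beta> z i (x + s *\<^sub>R axis i 1)) has_real_derivative slope \<alpha> \<beta> i x) (at 0)"
proof -
 have "negligible {x::space. x $ 3 = 0}" using negligible_hyperplane[of "axis 3 1 :: space" 0] by (simp add: inner_axis')
 then have "AE x::space in lebesgue. x $ 3 \<noteq> 0" by (auto simp: negligible_iff_null_sets eventually_ae_filter)
 then show ?thesis
 proof eventually_elim
  case (elim x)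
  consider "i \<noteq> 3 \<or> x $ 3 > 0" | "i = 3" "x $ 3 < 0" using elim by linarith
  then show ?case
  proof cases
   case 1
   have "((\<lambda>s. x $ i + s - z $ i) has_real_derivative slope \<alpha> \<beta> i x) (at 0)"
    using 1 by (auto intro!: derivative_eq_intros simp: slope_def)
   moreover have "open {s. i \<noteq> 3 \<or> x $ 3 + s > 0}" by (cases "i = 3") (auto intro!: open_Collect_less continuous_intros)
   ultimately show ?thesis by (rule has_field_derivative_transform_within_open) (use 1 in \<open>auto simp: stretched_def\<close>)
  next
   case 2
   have "((\<lambda>s. \<alpha> / \<beta> * (x $ 3 + s) - z $ 3) has_real_derivative slope \<alpha> \<beta> i x) (at 0)"
    using 2 ab by (auto intro!: derivative_eq_intros simp: slope_def)
   moreover have "open {s. x $ 3 + s < 0}" by (intro open_Collect_less continuous_intros)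
   ultimately show ?thesis by (rule has_field_derivative_transform_within_open) (use 2 ab in \<open>auto simp: stretched_def\<close>)
  qed
 qed
qed

lemma square_integrable_gaussian_bound:
 assumes f: "f \<in> borel_measurable borel" and \<mu>: "\<mu> > 0"
  and le: "\<And>x. \<bar>f x\<bar> \<le> C * exp (- \<mu> * sqdist \<alpha> \<beta> z x)"
 shows "square_integrable (f :: space \<Rightarrow> real)"
proof -
 define r where "r = \<alpha> / \<beta>"
 have r: "0 < r" "r \<le> 1" using ab by (auto simp: r_def)
 \<comment> \<open>With y the stretched coordinate, r |x_i| \<le> |y| + |z| leads to 1 + x_i^2 \<le>
   B (1 + \<mu> y^2) \<le> B e^{\<mu> y^2}; the three summands of \<open>B\<close> collect the terms
   of this estimate.\<close>
 define B where "B = 1 + 2 * (norm z)^2 / r^2 + 2 / (r^2 * \<mu>)"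
 have B: "B > 0" using r \<mu> by (auto simp: B_def intro!: add_pos_nonneg)
 have one: "exp (- \<mu> * (stretched \<alpha> \<beta> z i x)^2) \<le> B * (1 / (1 + (x $ i)^2))" for i x
 proof -
  let ?y = "stretched \<alpha> \<beta> z i x"
  have "r * \<bar>x $ i\<bar> \<le> \<bar>?y + z $ i\<bar>"
  proof -
   have "?y + z $ i = r * x $ i \<or> ?y + z $ i = x $ i" by (auto simp: stretched_def r_def)
   moreover have "\<bar>r * x $ i\<bar> = r * \<bar>x $ i\<bar>" "r * \<bar>x $ i\<bar> \<le> \<bar>x $ i\<bar>" using r by (auto simp: abs_mult intro: mult_left_le_one_le)
   ultimately show ?thesis by auto
  qed
  also have "\<dots> \<le> \<bar>?y\<bar> + norm z" using component_le_norm_cart[of z i] by linarith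
  finally have "(r * \<bar>x $ i\<bar>)^2 \<le> (\<bar>?y\<bar> + norm z)^2" using r by (intro power_mono) auto
  also have "\<dots> \<le> 2 * ?y^2 + 2 * (norm z)^2" using sum_squares_bound[of "\<bar>?y\<bar>" "norm z"] by (simp add: power2_sum)
  finally have "(x $ i)^2 \<le> (2 * ?y^2 + 2 * (norm z)^2) / r^2" using r by (simp add: power_mult_distrib field_simps)
  then have "1 + (x $ i)^2 \<le> 1 + 2 * (norm z)^2 / r^2 + 2 / (r^2 * \<mu>) * (\<mu> * ?y^2)" using r \<mu> by (simp add: add_divide_distrib)
  also have "\<dots> \<le> B * 1 + B * (\<mu> * ?y^2)" using r \<mu> by (intro add_mono mult_right_mono) (auto simp: B_def)
  also have "\<dots> = B * (1 + \<mu> * ?y^2)" by (simp add: algebra_simps)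
  also have "\<dots> \<le> B * exp (\<mu> * ?y^2)" using B exp_ge_add_one_self[of "\<mu> * ?y^2"] by (intro mult_left_mono) auto
  finally have "1 + (x $ i)^2 \<le> B * exp (\<mu> * ?y^2)" .
  moreover have "1 + (x $ i)^2 > 0" by (simp add: add_pos_nonneg)
  ultimately show ?thesis by (simp add: exp_minus field_simps)
 qed
 have C: "C \<ge> 0" using le[of 0] by (smt (verit) exp_gt_zero mult_neg_pos)
 have bound: "\<bar>f x\<bar> \<le> C * (B ^ 3 * (\<Prod>i\<in>UNIV. 1 / (1 + (x $ i)^2)))" for x
 proof -
  have "exp (- \<mu> * sqdist \<alpha> \<beta> z x) = (\<Prod>i\<in>UNIV. exp (- \<mu> * (stretched \<alpha> \<beta> z i x)^2))"
   by (simp add: sqdist_def sum_distrib_left exp_sum flip: sum_negf)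
  also have "\<dots> \<le> (\<Prod>i\<in>UNIV. B * (1 / (1 + (x $ i)^2)))" by (intro prod_mono) (use one in auto)
  also have "\<dots> = B ^ 3 * (\<Prod>i\<in>UNIV. 1 / (1 + (x $ i)^2))" by (simp only: prod.distrib) simp
  finally show ?thesis using C le[of x] by (meson mult_left_mono order_trans)
 qed
 show ?thesis by (rule square_integrable_bound[OF borel_imp_lebesgue_measurable[OF f]
     square_integrable_cmult[OF square_integrable_cmult[OF square_integrable_rational_decay, of "B ^ 3"], of C]])
   (use bound in \<open>auto intro: order_trans[OF _ abs_ge_self]\<close>)
qed

end

text \<open>A radial profile in the stretched distance, at most \<open>M\<close> and decaying like
  e^{-\<mu> q} in the squared distance q beyond radius \<rho>; \<mu> will be proportional to \<tau>
  in the propagation steps. The offset \<open>t0\<close> makes the logistic value small outside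
  radius \<rho>, where the profile is then almost exactly exponential. \<open>barrier_flux\<close>
  and \<open>barrier_div\<close> are the components of its flux and their derivatives along the
  respective axes.\<close>

definition barrier :: "real \<Rightarrow> real \<Rightarrow> space \<Rightarrow> real \<Rightarrow> real \<Rightarrow> real \<Rightarrow> real \<Rightarrow> space \<Rightarrow> real" where
 "barrier \<alpha> \<beta> z \<mu> \<rho> t0 M x = M * logistic (\<mu> * (sqdist \<alpha> \<beta> z x - \<rho>^2) + t0)"

definition barrier_grad :: "real \<Rightarrow> real \<Rightarrow> space \<Rightarrow> real \<Rightarrow> real \<Rightarrow> real \<Rightarrow> real \<Rightarrow> space \<Rightarrow> space" where
 "barrier_grad \<alpha> \<beta> z \<mu> \<rho> t0 M x = (\<chi> i. M * (logistic1 (\<mu> * (sqdist \<alpha> \<beta> z x - \<rho>^2) + t0) *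
   (\<mu> * 2 * stretched \<alpha> \<beta> z i x)) * slope \<alpha> \<beta> i x)"

definition barrier_flux :: "real \<Rightarrow> real \<Rightarrow> space \<Rightarrow> real \<Rightarrow> real \<Rightarrow> real \<Rightarrow> real \<Rightarrow> 3 \<Rightarrow> space \<Rightarrow> real" where
 "barrier_flux \<alpha> \<beta> z \<mu> \<rho> t0 M i x = flux_coeff \<alpha> \<beta> i x * (M * (logistic1 (\<mu> * (sqdist \<alpha> \<beta> z x - \<rho>^2) + t0) *
   (\<mu> * 2 * stretched \<alpha> \<beta> z i x)))"

definition barrier_div :: "real \<Rightarrow> real \<Rightarrow> space \<Rightarrow> real \<Rightarrow> real \<Rightarrow> real \<Rightarrow> real \<Rightarrow> 3 \<Rightarrow> space \<Rightarrow> real" where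
 "barrier_div \<alpha> \<beta> z \<mu> \<rho> t0 M i x = flux_coeff \<alpha> \<beta> i x * (M * (logistic2 (\<mu> * (sqdist \<alpha> \<beta> z x - \<rho>^2) + t0) *
   (\<mu> * 2 * stretched \<alpha> \<beta> z i x)^2 + logistic1 (\<mu> * (sqdist \<alpha> \<beta> z x - \<rho>^2) + t0) * (\<mu> * 2)) * slope \<alpha> \<beta> i x)"

lemma logistic_gaussian_bound:
 assumes "\<mu> > 0" "q \<ge> 0"
 shows "logistic (\<mu> * (q - \<rho>^2) + t0) * (1 + q) \<le> exp (\<mu> * \<rho>^2 - t0) * (1 + 2 / \<mu>) * exp (- (\<mu> / 2) * q)"
proof -
 have "logistic (\<mu> * (q - \<rho>^2) + t0) * (1 + q) \<le> exp (- (\<mu> * (q - \<rho>^2) + t0)) * (1 + q)"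
  using assms by (intro mult_right_mono logistic_bounds(3)) auto
 also have "- (\<mu> * (q - \<rho>^2) + t0) = (\<mu> * \<rho>^2 - t0) + - \<mu> * q" by (simp add: algebra_simps)
 also have "exp ((\<mu> * \<rho>^2 - t0) + - \<mu> * q) * (1 + q) = exp (\<mu> * \<rho>^2 - t0) * ((1 + q) * exp (- \<mu> * q))" by (simp only: exp_add mult_ac)
 also have "\<dots> \<le> exp (\<mu> * \<rho>^2 - t0) * ((1 + 2 / \<mu>) * exp (- (\<mu> / 2) * q))" using linear_le_gaussian[OF assms] by (intro mult_left_mono) auto
 finally show ?thesis by (simp add: mult.assoc)
qed

lemma abs_le_1_plus_square: "\<bar>y\<bar> \<le> 1 + y^2" for y :: real using sum_squares_bound[of "\<bar>y\<bar>" 1] zero_le_power2[of y] by simp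

context
 fixes \<alpha> \<beta> :: real and z :: space and \<mu> \<rho> t0 M :: real
 assumes ab: "0 < \<alpha>" "\<alpha> \<le> \<beta>" and mu: "\<mu> > 0"
begin

private abbreviation "brr \<equiv> barrier \<alpha> \<beta> z \<mu> \<rho> t0 M"
private abbreviation "bgrad \<equiv> barrier_grad \<alpha> \<beta> z \<mu> \<rho> t0 M"
private abbreviation "flux \<equiv> barrier_flux \<alpha> \<beta> z \<mu> \<rho> t0 M"
private abbreviation "bdiv \<equiv> barrier_div \<alpha> \<beta> z \<mu> \<rho> t0 M"
private abbreviation "sd \<equiv> sqdist \<alpha> \<beta> z"
private abbreviation "str \<equiv> stretched \<alpha> \<beta> z"
private abbreviation "slp \<equiv> slope \<alpha> \<beta>"
private abbreviation "fc \<equiv> flux_coeff \<alpha> \<beta>"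

private lemma logistic_weighted:
 assumes "q \<ge> y^2"
 defines "L \<equiv> logistic (\<mu> * (q - \<rho>^2) + t0)"
 defines "B \<equiv> exp (\<mu> * \<rho>^2 - t0) * (1 + 2 / \<mu>)"
 shows "L \<le> B * exp (- (\<mu> / 2) * q)" "L * \<bar>y\<bar> \<le> B * exp (- (\<mu> / 2) * q)" "L * y^2 \<le> B * exp (- (\<mu> / 2) * q)"
  "B * exp (- (\<mu> / 2) * q) \<le> B"
proof -
 have q: "q \<ge> 0" using assms(1) zero_le_power2 order_trans by blast
 note b = logistic_gaussian_bound[OF mu q, of \<rho> t0, folded L_def B_def]
 have L: "0 \<le> L" using logistic_bounds(1) by (simp add: L_def less_imp_le)
 have "L * 1 \<le> L * (1 + q)" "L * \<bar>y\<bar> \<le> L * (1 + q)" "L * y^2 \<le> L * (1 + q)"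
  using q assms(1) abs_le_1_plus_square[of y] by (intro mult_left_mono L; linarith)+
 then show "L \<le> B * exp (- (\<mu> / 2) * q)" "L * \<bar>y\<bar> \<le> B * exp (- (\<mu> / 2) * q)" "L * y^2 \<le> B * exp (- (\<mu> / 2) * q)" using b by linarith+
 have "0 \<le> B" using mu by (simp add: B_def)
 then show "B * exp (- (\<mu> / 2) * q) \<le> B" using q mu by (intro mult_left_le) auto
qed

private lemma profile_bounds:
 fixes y q :: real
 assumes "q \<ge> y^2"
 defines "T \<equiv> \<mu> * (q - \<rho>^2) + t0"
 defines "B \<equiv> exp (\<mu> * \<rho>^2 - t0) * (1 + 2 / \<mu>)"
 shows "\<bar>M * logistic T\<bar> \<le> \<bar>M\<bar> * B * exp (- (\<mu> / 2) * q)"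
  "\<bar>M * (logistic1 T * (\<mu> * 2 * y))\<bar> \<le> (\<bar>M\<bar> * (\<mu> * 2) * B) * exp (- (\<mu> / 2) * q)"
  "\<bar>M * (logistic2 T * (\<mu> * 2 * y)^2 + logistic1 T * (\<mu> * 2))\<bar> \<le> (\<bar>M\<bar> * ((\<mu> * 2)^2 + \<mu> * 2) * B) * exp (- (\<mu> / 2) * q)"
  "(\<bar>M\<bar> * (\<mu> * 2) * B) * exp (- (\<mu> / 2) * q) \<le> \<bar>M\<bar> * (\<mu> * 2) * B"
  "(\<bar>M\<bar> * ((\<mu> * 2)^2 + \<mu> * 2) * B) * exp (- (\<mu> / 2) * q) \<le> \<bar>M\<bar> * ((\<mu> * 2)^2 + \<mu> * 2) * B"
proof -
 note w = logistic_weighted[OF assms(1), folded T_def B_def]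
 let ?E = "B * exp (- (\<mu> / 2) * q)"
 have L: "0 < logistic T" "\<bar>logistic1 T\<bar> \<le> logistic T" "\<bar>logistic2 T\<bar> \<le> logistic T" using logistic_bounds(1) logistic_deriv_bounds by auto
 show "\<bar>M * logistic T\<bar> \<le> \<bar>M\<bar> * B * exp (- (\<mu> / 2) * q)" using mult_left_mono[OF w(1), of "\<bar>M\<bar>"] L by (simp add: abs_mult mult.assoc)
 have "\<bar>logistic1 T\<bar> * \<bar>y\<bar> \<le> ?E" using mult_right_mono[OF L(2), of "\<bar>y\<bar>"] w(2) by simp
 from mult_left_mono[OF this, of "\<bar>M\<bar> * (\<mu> * 2)"]
 show "\<bar>M * (logistic1 T * (\<mu> * 2 * y))\<bar> \<le> (\<bar>M\<bar> * (\<mu> * 2) * B) * exp (- (\<mu> / 2) * q)" using mu by (simp add: abs_mult mult_ac)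
 have "\<bar>logistic2 T * (\<mu> * 2 * y)^2 + logistic1 T * (\<mu> * 2)\<bar> \<le> \<bar>logistic2 T\<bar> * (\<mu> * 2 * y)^2 + \<bar>logistic1 T\<bar> * (\<mu> * 2)"
  using mu abs_triangle_ineq[of "logistic2 T * (\<mu> * 2 * y)^2" "logistic1 T * (\<mu> * 2)"] by (simp add: abs_mult)
 also have "\<dots> \<le> logistic T * (\<mu> * 2 * y)^2 + logistic T * (\<mu> * 2)" using L mu by (intro add_mono mult_right_mono) auto
 also have "\<dots> = (\<mu> * 2)^2 * (logistic T * y^2) + (\<mu> * 2) * logistic T" by (simp add: power_mult_distrib algebra_simps)
 also have "\<dots> \<le> (\<mu> * 2)^2 * ?E + (\<mu> * 2) * ?E" using w(1,3) mu by (intro add_mono mult_left_mono) auto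
 also have "\<dots> = ((\<mu> * 2)^2 + \<mu> * 2) * ?E" by (simp add: distrib_right)
 finally have "\<bar>M\<bar> * \<bar>logistic2 T * (\<mu> * 2 * y)^2 + logistic1 T * (\<mu> * 2)\<bar> \<le> \<bar>M\<bar> * (((\<mu> * 2)^2 + \<mu> * 2) * ?E)"
  by (intro mult_left_mono) auto
 then show "\<bar>M * (logistic2 T * (\<mu> * 2 * y)^2 + logistic1 T * (\<mu> * 2))\<bar> \<le> (\<bar>M\<bar> * ((\<mu> * 2)^2 + \<mu> * 2) * B) * exp (- (\<mu> / 2) * q)"
  unfolding abs_mult by (simp add: mult.assoc)
 show "(\<bar>M\<bar> * (\<mu> * 2) * B) * exp (- (\<mu> / 2) * q) \<le> \<bar>M\<bar> * (\<mu> * 2) * B"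
  "(\<bar>M\<bar> * ((\<mu> * 2)^2 + \<mu> * 2) * B) * exp (- (\<mu> / 2) * q) \<le> \<bar>M\<bar> * ((\<mu> * 2)^2 + \<mu> * 2) * B"
  using mult_left_mono[OF w(4), of "\<bar>M\<bar> * (\<mu> * 2)"] mult_left_mono[OF w(4), of "\<bar>M\<bar> * ((\<mu> * 2)^2 + \<mu> * 2)"] mu
  by (simp_all add: mult.assoc)
qed

text \<open>Along axis i only the stretched coordinate i varies; the other two enter the squared
  distance through the constant \<open>c\<close>. The barrier and its flux are therefore
  one-variable functions of that coordinate, with Lipschitz constants independent of
  \<open>c\<close>.\<close>

private lemma profile_lipschitz:
 assumes "c \<ge> 0"
 defines "B \<equiv> exp (\<mu> * \<rho>^2 - t0) * (1 + 2 / \<mu>)"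
 shows "\<bar>M * logistic (\<mu> * (c + Y^2 - \<rho>^2) + t0) - M * logistic (\<mu> * (c + X^2 - \<rho>^2) + t0)\<bar> \<le> (\<bar>M\<bar> * (\<mu> * 2) * B) * \<bar>Y - X\<bar>"
  "\<bar>M * (logistic1 (\<mu> * (c + Y^2 - \<rho>^2) + t0) * (\<mu> * 2 * Y)) - M * (logistic1 (\<mu> * (c + X^2 - \<rho>^2) + t0) * (\<mu> * 2 * X))\<bar>
    \<le> (\<bar>M\<bar> * ((\<mu> * 2)^2 + \<mu> * 2) * B) * \<bar>Y - X\<bar>"
proof -
 have q: "Y^2 \<le> c + Y^2" for Y using assms by simp
 note b = profile_bounds[OF q, folded B_def]
 show "\<bar>M * logistic (\<mu> * (c + Y^2 - \<rho>^2) + t0) - M * logistic (\<mu> * (c + X^2 - \<rho>^2) + t0)\<bar> \<le> (\<bar>M\<bar> * (\<mu> * 2) * B) * \<bar>Y - X\<bar>"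
 proof (rule lipschitz_of_bounded_derivative)
  show "((\<lambda>Y. M * logistic (\<mu> * (c + Y^2 - \<rho>^2) + t0)) has_real_derivative
    M * (logistic1 (\<mu> * (c + Y^2 - \<rho>^2) + t0) * (\<mu> * 2 * Y))) (at Y)" for Y by (auto intro!: derivative_eq_intros DERIV_logistic_chain)
 qed (rule order_trans[OF b(2,4)])
 show "\<bar>M * (logistic1 (\<mu> * (c + Y^2 - \<rho>^2) + t0) * (\<mu> * 2 * Y)) - M * (logistic1 (\<mu> * (c + X^2 - \<rho>^2) + t0) * (\<mu> * 2 * X))\<bar>
    \<le> (\<bar>M\<bar> * ((\<mu> * 2)^2 + \<mu> * 2) * B) * \<bar>Y - X\<bar>"
 proof (rule lipschitz_of_bounded_derivative)
  show "((\<lambda>Y. M * (logistic1 (\<mu> * (c + Y^2 - \<rho>^2) + t0) * (\<mu> * 2 * Y))) has_real_derivative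
    M * (logistic2 (\<mu> * (c + Y^2 - \<rho>^2) + t0) * (\<mu> * 2 * Y)^2 + logistic1 (\<mu> * (c + Y^2 - \<rho>^2) + t0) * (\<mu> * 2))) (at Y)" for Y
   by (auto intro!: derivative_eq_intros DERIV_logistic_chain simp: power2_eq_square)
 qed (rule order_trans[OF b(3,5)])
qed

lemma barrier_has_gradient: "has_gradient (brr) (bgrad)" unfolding has_gradient_def
proof
 fix i
 define B where "B = exp (\<mu> * \<rho>^2 - t0) * (1 + 2 / \<mu>)"
 note b = profile_bounds[OF stretched_le_sqdist, folded B_def]
 have gi: "bgrad x $ i = M * (logistic1 (\<mu> * (sd x - \<rho>^2) + t0) * (\<mu> * 2 * str i x)) * slp i x" for x by (simp add: barrier_grad_def)
 show "weak_deriv i (brr) (\<lambda>x. bgrad x $ i)"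
 proof (rule weak_deriv_lipschitz[where L = "\<bar>M\<bar> * (\<mu> * 2) * B"])
  show "square_integrable (brr)"
  proof (rule square_integrable_gaussian_bound[OF ab, where \<mu> = "\<mu> / 2"])
   show "brr \<in> borel_measurable borel" unfolding barrier_def[abs_def] by measurable
   show "\<bar>brr x\<bar> \<le> \<bar>M\<bar> * B * exp (- (\<mu> / 2) * sd x)" for x unfolding barrier_def by (rule b(1))
  qed (use mu in simp)
  show "square_integrable (\<lambda>x. bgrad x $ i)"
  proof (rule square_integrable_gaussian_bound[OF ab, where \<mu> = "\<mu> / 2"])
   show "(\<lambda>x. bgrad x $ i) \<in> borel_measurable borel" unfolding gi by measurable
   show "\<bar>bgrad x $ i\<bar> \<le> (\<bar>M\<bar> * (\<mu> * 2) * B) * exp (- (\<mu> / 2) * sd x)" for x unfolding gi abs_mult[of _ "slp i x"]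
    using b(2)[where x1 = x and i1 = i] slope_bounds[OF ab, of i x] by (intro order_trans[OF mult_left_le]) auto
  qed (use mu in simp)
  show "\<bar>brr (x + h *\<^sub>R axis i 1) - brr x\<bar> \<le> \<bar>M\<bar> * (\<mu> * 2) * B * \<bar>h\<bar>" for x h
  proof -
   let ?c = "\<Sum>j\<in>UNIV - {i}. (str j x)^2"
   have c: "?c \<ge> 0" by (simp add: sum_nonneg)
   have "\<bar>brr (x + h *\<^sub>R axis i 1) - brr x\<bar> \<le>
     (\<bar>M\<bar> * (\<mu> * 2) * B) * \<bar>str i (x + h *\<^sub>R axis i 1) - str i x\<bar>" unfolding barrier_def sqdist_shift using sqdist_shift[of \<alpha> \<beta> z x 0 i]
    by (simp add: profile_lipschitz(1)[OF c, folded B_def])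
   also have "\<dots> \<le> (\<bar>M\<bar> * (\<mu> * 2) * B) * \<bar>h\<bar>" using mu by (intro mult_left_mono stretched_lipschitz[OF ab]) (auto simp: B_def)
   finally show ?thesis .
  qed
  show "AE x in lebesgue. ((\<lambda>s. brr (x + s *\<^sub>R axis i 1)) has_real_derivative bgrad x $ i) (at 0)" using stretched_DERIV[OF ab, of z i]
  proof eventually_elim
   case (elim x)
   show ?case unfolding barrier_def sqdist_shift gi using sqdist_shift[of \<alpha> \<beta> z x 0 i]
    by (auto intro!: derivative_eq_intros DERIV_logistic_chain elim)
  qed
 qed
qed

lemma barrier_flux_weak_deriv:
 "weak_deriv i (flux i) (bdiv i)"
proof -
 define B where "B = exp (\<mu> * \<rho>^2 - t0) * (1 + 2 / \<mu>)"
 have B: "B \<ge> 0" using mu by (simp add: B_def)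
 note b = profile_bounds[OF stretched_le_sqdist, folded B_def]
 note fb = flux_coeff_bounds[OF ab]
 show ?thesis
 proof (rule weak_deriv_lipschitz[where L = "\<beta> * (\<bar>M\<bar> * ((\<mu> * 2)^2 + \<mu> * 2) * B)"])
  show "square_integrable (flux i)"
  proof (rule square_integrable_gaussian_bound[OF ab, where \<mu> = "\<mu> / 2"])
   show "flux i \<in> borel_measurable borel" unfolding barrier_flux_def[abs_def] by measurable
   show "\<bar>flux i x\<bar> \<le> (\<beta> * (\<bar>M\<bar> * (\<mu> * 2) * B)) * exp (- (\<mu> / 2) * sd x)" for x
    unfolding barrier_flux_def abs_mult[of "fc i x"] mult.assoc[of \<beta>]
    using b(2)[where x1 = x and i1 = i] fb[of i x] by (intro mult_mono) auto
  qed (use mu in simp)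
  show "square_integrable (bdiv i)"
  proof (rule square_integrable_gaussian_bound[OF ab, where \<mu> = "\<mu> / 2"])
   show "bdiv i \<in> borel_measurable borel" unfolding barrier_div_def[abs_def] by measurable
   show "\<bar>bdiv i x\<bar> \<le> (\<beta> * (\<bar>M\<bar> * ((\<mu> * 2)^2 + \<mu> * 2) * B)) * exp (- (\<mu> / 2) * sd x)" for x
    unfolding barrier_div_def abs_mult[of "fc i x"] abs_mult[of _ "slp i x"] mult.assoc[of \<beta>]
    using b(3)[where x1 = x and i1 = i] fb[of i x] slope_bounds[OF ab, of i x] by (intro mult_mono order_trans[OF mult_left_le]) auto
  qed (use mu in simp)
  show "\<bar>flux i (x + h *\<^sub>R axis i 1) - flux i x\<bar>
    \<le> \<beta> * (\<bar>M\<bar> * ((\<mu> * 2)^2 + \<mu> * 2) * B) * \<bar>h\<bar>" for x h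
  proof -
   let ?c = "\<Sum>j\<in>UNIV - {i}. (str j x)^2"
   have c: "?c \<ge> 0" by (simp add: sum_nonneg)
   let ?Q = "\<lambda>Y. M * (logistic1 (\<mu> * (?c + Y^2 - \<rho>^2) + t0) * (\<mu> * 2 * Y))"
   have "flux i (x + h *\<^sub>R axis i 1) = fc i x * ?Q (str i (x + h *\<^sub>R axis i 1))" for h
    unfolding barrier_flux_def sqdist_shift flux_coeff_shift by simp
   from this[of h] this[of 0]
   have "\<bar>flux i (x + h *\<^sub>R axis i 1) - flux i x\<bar>
    = fc i x * \<bar>?Q (str i (x + h *\<^sub>R axis i 1)) - ?Q (str i x)\<bar>" using fb[of i x] by (simp add: abs_mult flip: right_diff_distrib)
   also have "\<dots> \<le> \<beta> * ((\<bar>M\<bar> * ((\<mu> * 2)^2 + \<mu> * 2) * B) * \<bar>str i (x + h *\<^sub>R axis i 1) - str i x\<bar>)"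
    using fb[of i x] profile_lipschitz(2)[OF c, folded B_def] by (intro mult_mono) auto
   also have "\<dots> \<le> \<beta> * ((\<bar>M\<bar> * ((\<mu> * 2)^2 + \<mu> * 2) * B) * \<bar>h\<bar>)" using mu ab B by (intro mult_left_mono stretched_lipschitz[OF ab]) auto
   finally show ?thesis by (simp add: mult.assoc)
  qed
  show "AE x in lebesgue. ((\<lambda>s. flux i (x + s *\<^sub>R axis i 1)) has_real_derivative bdiv i x) (at 0)" using stretched_DERIV[OF ab, of z i]
  proof eventually_elim
   case (elim x)
   show ?case unfolding barrier_flux_def barrier_div_def sqdist_shift flux_coeff_shift using sqdist_shift[of \<alpha> \<beta> z x 0 i]
    by (auto intro!: derivative_eq_intros DERIV_logistic_chain elim simp: power2_eq_square algebra_simps)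
  qed
 qed
qed

lemma barrier_flux_eq: "gamma0 \<alpha> \<beta> x * bgrad x $ i = flux i x"
 using gamma0_slope[OF ab, of x i] by (simp add: barrier_grad_def barrier_flux_def mult_ac)

text \<open>By the logistic identities each direction contributes a second order term of size 4
  \<mu>^2 y^2 times L (1-L) (1-2L) and a first order loss of at most 2 \<mu> \<beta> times L. A
  nonnegative argument means L \<le> 1/2, so the first term has the favourable sign and the lower
  bound \<alpha>^2 / \<beta> may be inserted; the three losses add up to 6 \<mu> \<beta>.\<close>

lemma barrier_div_ge:
 assumes M: "M \<ge> 0" and T: "\<mu> * (sd x - \<rho>^2) + t0 \<ge> 0"
 defines "L \<equiv> logistic (\<mu> * (sd x - \<rho>^2) + t0)"
 shows "(\<Sum>i\<in>UNIV. bdiv i x) \<ge>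
  M * L * ((1 - L) * (1 - 2 * L) * (4 * \<mu>^2 * (\<alpha>^2 / \<beta>) * sd x) - 6 * \<mu> * \<beta>)"
proof -
 have L: "0 < L" "L < 1" "L \<le> 1 / 2" using logistic_bounds(1,2) logistic_antimono[OF T] by (auto simp: L_def) (simp add: logistic_def)
 let ?k = "\<lambda>i. fc i x * slp i x"
 let ?y = "\<lambda>i. str i x"
 have "M * L * ((1 - L) * (1 - 2 * L) * (4 * \<mu>^2 * (\<alpha>^2 / \<beta>) * (?y i)^2) - 2 * \<mu> * \<beta>) \<le> bdiv i x" for i
 proof -
  have eq: "bdiv i x = M * L * ((1 - L) * (1 - 2 * L) * (4 * \<mu>^2 * ?k i * (?y i)^2) - (1 - L) * (2 * \<mu> * ?k i))"
   unfolding barrier_div_def logistic1_def logistic2_def L_def[symmetric] by (simp add: power2_eq_square algebra_simps)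
  have k: "\<alpha>^2 / \<beta> \<le> ?k i" "?k i \<le> \<beta>" "0 < ?k i"
   using flux_coeff_slope_bounds[OF ab, of i x] flux_coeff_bounds(1)[OF ab] slope_bounds(1)[OF ab] by auto
  have "4 * \<mu>^2 * (\<alpha>^2 / \<beta>) * (?y i)^2 \<le> 4 * \<mu>^2 * ?k i * (?y i)^2" using k by (intro mult_right_mono mult_left_mono) auto
  then have "(1 - L) * (1 - 2 * L) * (4 * \<mu>^2 * (\<alpha>^2 / \<beta>) * (?y i)^2) \<le> (1 - L) * (1 - 2 * L) * (4 * \<mu>^2 * ?k i * (?y i)^2)"
   using L by (intro mult_left_mono) auto
  moreover have "(1 - L) * (2 * \<mu> * ?k i) \<le> 1 * (2 * \<mu> * \<beta>)" using L k mu by (intro mult_mono) auto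
  ultimately show ?thesis unfolding eq using M L by (intro mult_left_mono) auto
 qed
 then have "(\<Sum>i\<in>(UNIV::3 set). M * L * ((1 - L) * (1 - 2 * L) * (4 * \<mu>^2 * (\<alpha>^2 / \<beta>) * (?y i)^2) - 2 * \<mu> * \<beta>)) \<le> (\<Sum>i\<in>UNIV. bdiv i x)"
  by (rule sum_mono)
 moreover have "(\<Sum>i\<in>(UNIV::3 set). M * L * ((1 - L) * (1 - 2 * L) * (4 * \<mu>^2 * (\<alpha>^2 / \<beta>) * (?y i)^2) - 2 * \<mu> * \<beta>)) =
  M * L * ((1 - L) * (1 - 2 * L) * (4 * \<mu>^2 * (\<alpha>^2 / \<beta>) * sd x) - 6 * \<mu> * \<beta>)" unfolding sqdist_def sum_3 by (simp add: algebra_simps)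
 ultimately show ?thesis by simp
qed

end

section \<open>Propagation of exponential lower bounds\<close>

text \<open>\<open>E\<close> is a logarithmic rate. Constants and powers of \<tau> disappear in
  \<epsilon>, so the rates of successive propagation steps simply add up along a path.\<close>

definition lower_bounded :: "(real \<Rightarrow> space \<Rightarrow> real) \<Rightarrow> space set \<Rightarrow> real \<Rightarrow> bool" where
 "lower_bounded v S E \<longleftrightarrow> (\<forall>\<epsilon>>0. \<exists>\<tau>0>0. \<forall>\<tau>\<ge>\<tau>0. AE x in lebesgue. x \<in> S \<longrightarrow> exp (- \<tau> * (E + \<epsilon>)) \<le> v \<tau> x)"

lemma lower_bounded_mono:
 assumes "lower_bounded v S E" "S' \<subseteq> S" "E \<le> E'"
 shows "lower_bounded v S' E'" unfolding lower_bounded_def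
proof (intro allI impI)
 fix \<epsilon> :: real assume "\<epsilon> > 0"
 then obtain \<tau>0 where \<tau>0: "\<tau>0 > 0" "\<And>\<tau>. \<tau> \<ge> \<tau>0 \<Longrightarrow> AE x in lebesgue. x \<in> S \<longrightarrow> exp (- \<tau> * (E + \<epsilon>)) \<le> v \<tau> x"
  using assms(1) unfolding lower_bounded_def by blast
 have "AE x in lebesgue. x \<in> S' \<longrightarrow> exp (- \<tau> * (E' + \<epsilon>)) \<le> v \<tau> x" if "\<tau> \<ge> \<tau>0" for \<tau>
 proof -
  have "\<tau> * (E + \<epsilon>) \<le> \<tau> * (E' + \<epsilon>)" using that \<tau>0(1) assms(3) by (intro mult_left_mono) auto
  then have le: "exp (- \<tau> * (E' + \<epsilon>)) \<le> exp (- \<tau> * (E + \<epsilon>))" by simp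
  show ?thesis using \<tau>0(2)[OF that] by eventually_elim (meson assms(2) le order_trans subsetD)
 qed
 with \<tau>0(1) show "\<exists>\<tau>0>0. \<forall>\<tau>\<ge>\<tau>0. AE x in lebesgue. x \<in> S' \<longrightarrow> exp (- \<tau> * (E' + \<epsilon>)) \<le> v \<tau> x" by blast
qed

lemma lower_bounded_limit:
 assumes "\<And>e. e > 0 \<Longrightarrow> lower_bounded v S (E + e)"
 shows "lower_bounded v S E" unfolding lower_bounded_def
proof (intro allI impI)
 fix \<epsilon> :: real assume "\<epsilon> > 0"
 then have "lower_bounded v S (E + \<epsilon> / 2)" "\<epsilon> / 2 > 0" using assms by auto
 then have "\<exists>\<tau>0>0. \<forall>\<tau>\<ge>\<tau>0. AE x in lebesgue. x \<in> S \<longrightarrow> exp (- \<tau> * (E + \<epsilon> / 2 + \<epsilon> / 2)) \<le> v \<tau> x" unfolding lower_bounded_def by blast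
 then show "\<exists>\<tau>0>0. \<forall>\<tau>\<ge>\<tau>0. AE x in lebesgue. x \<in> S \<longrightarrow> exp (- \<tau> * (E + \<epsilon>)) \<le> v \<tau> x" by (simp add: add.assoc)
qed

text \<open>The source is normalised to be nonnegative; the opposite sign is reduced to this one by
  negating source and solution.\<close>

locale layered_family =
 fixes gp gm :: real and f :: "space \<Rightarrow> real" and v :: "real \<Rightarrow> space \<Rightarrow> real" and V :: "real \<Rightarrow> space \<Rightarrow> space"
 assumes gpos: "0 < gp" "gp < gm"
  and f_sq: "square_integrable f" and f_nonneg: "AE x in lebesgue. 0 \<le> f x"
  and sol: "\<And>\<tau>. \<tau> > 0 \<Longrightarrow> layered_solution gp gm \<tau> f (v \<tau>) (V \<tau>)"
begin

lemma gpos': "0 < gm" using gpos by linarith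

lemma v_nonneg: "\<tau> > 0 \<Longrightarrow> AE x in lebesgue. 0 \<le> v \<tau> x" using layered_solution_nonneg[OF sol gpos(1) gpos' _ f_sq f_nonneg] .

text \<open>For \<mu> = K \<tau> the barrier is a subsolution as soon as 4 \<mu>^2
  (\<alpha>^2/\<beta>) q exceeds \<tau>^2 by a small margin. The smallest squared distance q in the
  shell is \<rho>^2, which forces K slightly above 1 / (2 \<rho> sqrt (\<alpha>^2/\<beta>)), and the
  decay from \<rho> to \<open>\<rho>2\<close> costs K times the difference of the squared radii. The
  comparison is made on a larger shell up to \<open>R\<close>, so that the level of the barrier at
  the outer boundary is small against its value at \<open>\<rho>2\<close>.\<close>

lemma lower_bounded_barrier_step:
 assumes ab: "0 < \<alpha>" "\<alpha> \<le> \<beta>" and rad: "0 < \<rho>" "\<rho> < \<rho>2" "\<rho>2 < R"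
  and coeff: "\<And>x. \<rho>^2 \<le> sqdist \<alpha> \<beta> z x \<Longrightarrow> sqdist \<alpha> \<beta> z x < R^2 \<Longrightarrow> gamma0 gp gm x = gamma0 \<alpha> \<beta> x"
  and lb: "lower_bounded v {x. sqdist \<alpha> \<beta> z x < \<rho>^2} E"
 shows "lower_bounded v {x. sqdist \<alpha> \<beta> z x < \<rho>2^2} (E + (\<rho>2^2 - \<rho>^2) / (2 * \<rho> * sqrt (\<alpha>^2 / \<beta>)))" unfolding lower_bounded_def
proof (intro allI impI)
 fix \<epsilon> :: real assume \<epsilon>: "\<epsilon> > 0"
 let ?q = "sqdist \<alpha> \<beta> z"
 define m0 where "m0 = \<alpha>^2 / \<beta>"
 have m0: "m0 > 0" using ab by (simp add: m0_def)
 define \<kappa> where "\<kappa> = (\<rho>2^2 - \<rho>^2) / (2 * \<rho> * sqrt m0)"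
 have sq: "\<rho>^2 < \<rho>2^2" "\<rho>2^2 < R^2" using rad by (auto intro!: power_strict_mono)
 have \<kappa>: "\<kappa> > 0" using sq rad m0 by (simp add: \<kappa>_def)
 \<comment> \<open>The slack \<epsilon> is split into three equal parts: the bound on the inner
   ball, the steepness in excess of the ideal one, and the constants. The second part fixes \<eta>
   by \<eta> \<kappa> = \<epsilon> / 3.\<close>
 define \<eta> where "\<eta> = \<epsilon> / (3 * \<kappa>)"
 have \<eta>: "\<eta> > 0" "\<eta> * \<kappa> = \<epsilon> / 3" using \<epsilon> \<kappa> by (auto simp: \<eta>_def)
 define K where "K = (1 + \<eta>) / (2 * \<rho> * sqrt m0)"
 have K: "K > 0" "K * (\<rho>2^2 - \<rho>^2) = \<kappa> + \<epsilon> / 3" "4 * K^2 * m0 * \<rho>^2 = (1 + \<eta>)^2"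
 proof -
  show "K > 0" using \<eta> rad m0 by (simp add: K_def)
  have "K * (\<rho>2^2 - \<rho>^2) = (1 + \<eta>) * \<kappa>" by (simp add: K_def \<kappa>_def)
  then show "K * (\<rho>2^2 - \<rho>^2) = \<kappa> + \<epsilon> / 3" using \<eta>(2) by (simp add: distrib_right)
  have "K * (2 * \<rho> * sqrt m0) = 1 + \<eta>" using rad m0 by (simp add: K_def)
  moreover have "4 * K^2 * m0 * \<rho>^2 = (K * (2 * \<rho> * sqrt m0))^2" using m0 by (simp add: power_mult_distrib)
  ultimately show "4 * K^2 * m0 * \<rho>^2 = (1 + \<eta>)^2" by simp
 qed
 \<comment> \<open>With this offset 3 L \<le> \<eta> / (1 + \<eta>) outside radius \<rho>, hence (1
   - L) (1 - 2 L) \<ge> 1 - 3 L \<ge> 1 / (1 + \<eta>). This spends one of the two factors 1 +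
   \<eta> contained in K^2.\<close>
 define t0 where "t0 = ln (3 * (1 + \<eta>) / \<eta>)"
 have t0: "exp (- t0) = \<eta> / (3 * (1 + \<eta>))" "t0 > 0"
 proof -
  have "3 * (1 + \<eta>) / \<eta> > 1" using \<eta>(1) by simp
  then show "t0 > 0" unfolding t0_def by (rule ln_gt_zero)
  have "exp t0 = 3 * (1 + \<eta>) / \<eta>" using \<eta>(1) by (simp add: t0_def)
  then show "exp (- t0) = \<eta> / (3 * (1 + \<eta>))" by (simp add: exp_minus)
 qed
 have "\<epsilon> / 3 > 0" using \<epsilon> by simp
 with lb obtain \<tau>1 where \<tau>1: "\<tau>1 > 0" "\<And>\<tau>. \<tau> \<ge> \<tau>1 \<Longrightarrow> AE x in lebesgue. x \<in> {x. ?q x < \<rho>^2} \<longrightarrow> exp (- \<tau> * (E + \<epsilon> / 3)) \<le> v \<tau> x"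
  unfolding lower_bounded_def by blast
 \<comment> \<open>The four thresholds: the inner bound is available; the first order loss 6 \<mu>
   \<beta> is absorbed by the remaining factor 1 + \<eta>; the level \<open>k\<close> at
   \<open>R\<close> is at most half of the lower bound for the barrier at \<open>\<rho>2\<close>;
   the constant e^{-t0} / 4 exceeds e^{-\<epsilon> \<tau> / 3}.\<close>
 define \<tau>0 where "\<tau>0 = Max {\<tau>1, 6 * K * \<beta> / \<eta>, ln 4 / (K * (R^2 - \<rho>2^2)), 3 * (t0 + ln 4) / \<epsilon>}"
 have \<tau>0: "\<tau>0 \<ge> \<tau>1" "\<tau>0 \<ge> 6 * K * \<beta> / \<eta>" "\<tau>0 \<ge> ln 4 / (K * (R^2 - \<rho>2^2))" "\<tau>0 \<ge> 3 * (t0 + ln 4) / \<epsilon>" by (auto simp: \<tau>0_def)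
 have "AE x in lebesgue. x \<in> {x. ?q x < \<rho>2^2} \<longrightarrow> exp (- \<tau> * (E + \<kappa> + \<epsilon>)) \<le> v \<tau> x" if \<tau>: "\<tau> \<ge> \<tau>0" for \<tau>
 proof -
  have \<tau>': "\<tau> > 0" "\<tau> \<ge> \<tau>1" "6 * K * \<beta> \<le> \<eta> * \<tau>" "ln 4 \<le> K * (R^2 - \<rho>2^2) * \<tau>" "t0 + ln 4 \<le> \<epsilon> / 3 * \<tau>"
  proof -
   show "\<tau> > 0" "\<tau> \<ge> \<tau>1" using \<tau> \<tau>0(1) \<tau>1(1) by linarith+
   have "6 * K * \<beta> / \<eta> \<le> \<tau>" "ln 4 / (K * (R^2 - \<rho>2^2)) \<le> \<tau>" "3 * (t0 + ln 4) / \<epsilon> \<le> \<tau>" using \<tau> \<tau>0 by linarith+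
   moreover have "K * (R^2 - \<rho>2^2) > 0" using K(1) sq by simp
   ultimately show "6 * K * \<beta> \<le> \<eta> * \<tau>" "ln 4 \<le> K * (R^2 - \<rho>2^2) * \<tau>" "t0 + ln 4 \<le> \<epsilon> / 3 * \<tau>"
    using \<eta>(1) \<epsilon> by (simp_all add: pos_divide_le_eq mult.commute)
  qed
  define \<mu> where "\<mu> = K * \<tau>"
  have \<mu>: "\<mu> > 0" using K \<tau>' by (simp add: \<mu>_def)
  define M where "M = exp (- \<tau> * (E + \<epsilon> / 3))"
  have M: "M > 0" by (simp add: M_def)
  let ?s = "barrier \<alpha> \<beta> z \<mu> \<rho> t0 M"
  \<comment> \<open>The largest value of the barrier at stretched distance \<open>R\<close> or more.
    There the comparison uses v \<ge> 0, while inside radius \<rho> it uses that the barrier is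
    below \<open>M\<close>, the known lower bound for v.\<close>
  define k where "k = M * logistic (\<mu> * (R^2 - \<rho>^2) + t0)"
  have k: "k \<ge> 0" using M logistic_bounds(1) by (simp add: k_def less_imp_le)
  let ?U = "{x. \<rho>^2 \<le> ?q x \<and> ?q x < R^2}"
  have "AE x in lebesgue. ?s x - v \<tau> x \<le> k"
  proof (rule layered_comparison[where U = ?U, OF sol[OF \<tau>'(1)] gpos(1) gpos' \<tau>'(1) k f_sq
     barrier_has_gradient[OF ab \<mu>] barrier_flux_weak_deriv[OF ab \<mu>]])
   show "AE x in lebesgue. x \<notin> ?U \<longrightarrow> ?s x - v \<tau> x \<le> k" using \<tau>1(2)[OF \<tau>'(2)] v_nonneg[OF \<tau>'(1)]
   proof eventually_elim
    case (elim x)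
    show ?case
    proof (intro impI)
     assume "x \<notin> ?U"
     then consider "?q x < \<rho>^2" | "?q x \<ge> R^2" by auto
     then show "?s x - v \<tau> x \<le> k"
     proof cases
      case 1
      have "?s x \<le> M" unfolding barrier_def using logistic_bounds(2) M by (intro mult_left_le) (auto intro: less_imp_le)
      then show ?thesis using 1 elim(1) k by (simp add: M_def)
     next
      case 2
      have "?s x \<le> k" unfolding barrier_def k_def using 2 M \<mu> by (intro mult_left_mono logistic_antimono) auto
      then show ?thesis using elim(2) by simp
     qed
    qed
   qed
   show "AE x in lebesgue. x \<in> ?U \<longrightarrow> (\<forall>i. gamma0 gp gm x * barrier_grad \<alpha> \<beta> z \<mu> \<rho> t0 M x $ i = barrier_flux \<alpha> \<beta> z \<mu> \<rho> t0 M i x)"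
    using coeff barrier_flux_eq[OF ab \<mu>] by (intro AE_I2) auto
   have ineq: "\<tau>^2 * ?s x \<le> (\<Sum>i\<in>UNIV. barrier_div \<alpha> \<beta> z \<mu> \<rho> t0 M i x)" if x: "\<rho>^2 \<le> ?q x" for x
   proof -
    define L where "L = logistic (\<mu> * (?q x - \<rho>^2) + t0)"
    have T: "t0 \<le> \<mu> * (?q x - \<rho>^2) + t0" using x \<mu> by simp
    have "L \<le> logistic t0" "logistic t0 \<le> exp (- t0)" unfolding L_def by (intro logistic_antimono T logistic_bounds(3))+
    then have L: "0 < L" "L \<le> \<eta> / (3 * (1 + \<eta>))" using logistic_bounds(1) t0(1) by (auto simp: L_def)
    have d: "1 - 3 * L \<ge> 1 / (1 + \<eta>)"
    proof -
     have "3 * (\<eta> / (3 * (1 + \<eta>))) = \<eta> / (1 + \<eta>)" by (subst times_divide_eq_right, subst mult_divide_mult_cancel_left) auto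
     moreover have "3 * L \<le> 3 * (\<eta> / (3 * (1 + \<eta>)))" by (rule mult_left_mono[OF L(2)]) simp
     ultimately have "3 * L \<le> \<eta> / (1 + \<eta>)" by (simp only:)
     moreover have "1 / (1 + \<eta>) = 1 - \<eta> / (1 + \<eta>)" using \<eta>(1) by (simp add: field_simps)
     ultimately show ?thesis by linarith
    qed
    have "\<tau>^2 \<le> (1 + \<eta>) * \<tau>^2 - 6 * K * \<beta> * \<tau>" using mult_right_mono[OF \<tau>'(3), of \<tau>] \<tau>'(1) by (simp add: power2_eq_square algebra_simps)
    also have "(1 + \<eta>) * \<tau>^2 = 1 / (1 + \<eta>) * ((1 + \<eta>)^2 * \<tau>^2)" using \<eta>(1) by (simp add: power2_eq_square)
    also have "(1 + \<eta>)^2 * \<tau>^2 = 4 * \<mu>^2 * m0 * \<rho>^2" unfolding K(3)[symmetric] \<mu>_def by (simp add: power_mult_distrib)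
    also have "1 / (1 + \<eta>) * (4 * \<mu>^2 * m0 * \<rho>^2) \<le> (1 - L) * (1 - 2 * L) * (4 * \<mu>^2 * m0 * ?q x)"
    proof (rule mult_mono)
     have "1 - 3 * L \<le> (1 - L) * (1 - 2 * L)" by (simp add: algebra_simps)
     then show le: "1 / (1 + \<eta>) \<le> (1 - L) * (1 - 2 * L)" using d by linarith
     have "0 \<le> 1 / (1 + \<eta>)" using \<eta>(1) by simp
     then show "0 \<le> (1 - L) * (1 - 2 * L)" using le by (rule order_trans)
     show "4 * \<mu>^2 * m0 * \<rho>^2 \<le> 4 * \<mu>^2 * m0 * ?q x" "0 \<le> 4 * \<mu>^2 * m0 * \<rho>^2" using x m0 by (auto intro!: mult_left_mono)
    qed
    finally have "\<tau>^2 \<le> (1 - L) * (1 - 2 * L) * (4 * \<mu>^2 * m0 * ?q x) - 6 * \<mu> * \<beta>" by (simp add: \<mu>_def mult_ac)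
    then have "M * L * \<tau>^2 \<le> M * L * ((1 - L) * (1 - 2 * L) * (4 * \<mu>^2 * m0 * ?q x) - 6 * \<mu> * \<beta>)"
     using M L by (intro mult_left_mono) auto
    also have "\<dots> \<le> (\<Sum>i\<in>UNIV. barrier_div \<alpha> \<beta> z \<mu> \<rho> t0 M i x)"
     unfolding L_def m0_def using M T t0(2) by (intro barrier_div_ge[OF ab \<mu>]) auto
    finally show ?thesis by (simp add: barrier_def L_def mult_ac)
   qed
   show "AE x in lebesgue. x \<in> ?U \<longrightarrow> \<tau>^2 * ?s x \<le> (\<Sum>i\<in>UNIV. barrier_div \<alpha> \<beta> z \<mu> \<rho> t0 M i x) + f x"
    using f_nonneg by eventually_elim (use ineq in fastforce)
  qed
  then show ?thesis
  proof eventually_elim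
   case (elim x)
   show ?case
   proof (intro impI)
    assume "x \<in> {x. ?q x < \<rho>2^2}"
    then have x: "?q x < \<rho>2^2" by simp
    define X where "X = exp (- (\<mu> * (\<rho>2^2 - \<rho>^2) + t0))"
    have "X / 2 \<le> logistic (\<mu> * (\<rho>2^2 - \<rho>^2) + t0)" unfolding X_def using \<mu> sq t0(2) by (intro logistic_bounds(4)) auto
    also have "\<dots> \<le> logistic (\<mu> * (?q x - \<rho>^2) + t0)" using x \<mu> by (intro logistic_antimono) auto
    finally have 1: "M * (X / 2) \<le> ?s x" unfolding barrier_def using M by (intro mult_left_mono) auto
    have "logistic (\<mu> * (R^2 - \<rho>^2) + t0) \<le> exp (- (\<mu> * (R^2 - \<rho>^2) + t0))" by (rule logistic_bounds(3))
    also have "- (\<mu> * (R^2 - \<rho>^2) + t0) = - (\<mu> * (\<rho>2^2 - \<rho>^2) + t0) + - (K * (R^2 - \<rho>2^2) * \<tau>)" by (simp add: \<mu>_def algebra_simps)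
    also have "exp \<dots> = X * exp (- (K * (R^2 - \<rho>2^2) * \<tau>))" by (simp only: exp_add X_def)
    also have "\<dots> \<le> X * exp (- ln 4)" using \<tau>'(4) by (intro mult_left_mono) (auto simp: X_def)
    also have "\<dots> = X / 4" by (simp add: exp_minus)
    finally have 2: "k \<le> M * (X / 4)" unfolding k_def using M by (intro mult_left_mono) auto
    have "exp (- \<tau> * (E + \<kappa> + \<epsilon>)) = exp (- \<tau> * (E + \<epsilon> / 3)) * exp (- \<tau> * (\<kappa> + \<epsilon> / 3)) * exp (- (\<epsilon> / 3 * \<tau>))"
     unfolding exp_add[symmetric] by (simp add: algebra_simps)
    also have "\<dots> \<le> M * exp (- \<tau> * (\<kappa> + \<epsilon> / 3)) * exp (- (t0 + ln 4))" using \<tau>'(5) by (auto simp: M_def intro!: mult_left_mono)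
    also have "exp (- (t0 + ln 4)) = exp (- t0) / 4" unfolding minus_add_distrib exp_add by (simp add: exp_minus[of "ln 4"])
    also have "M * exp (- \<tau> * (\<kappa> + \<epsilon> / 3)) * (exp (- t0) / 4) = M * (exp (- \<tau> * (\<kappa> + \<epsilon> / 3)) * exp (- t0)) / 4" by simp
    also have "exp (- \<tau> * (\<kappa> + \<epsilon> / 3)) * exp (- t0) = X"
     unfolding X_def exp_add[symmetric] K(2)[symmetric] \<mu>_def by (simp add: algebra_simps)
    finally have "exp (- \<tau> * (E + \<kappa> + \<epsilon>)) \<le> M * X / 4" .
    then show "exp (- \<tau> * (E + \<kappa> + \<epsilon>)) \<le> v \<tau> x" using 1 2 elim by linarith
   qed
  qed
 qed
 moreover have "\<tau>0 > 0" using \<tau>0(1) \<tau>1(1) by linarith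
 ultimately show "\<exists>\<tau>0>0. \<forall>\<tau>\<ge>\<tau>0. AE x in lebesgue. x \<in> {x. ?q x < \<rho>2^2} \<longrightarrow>
   exp (- \<tau> * (E + (\<rho>2^2 - \<rho>^2) / (2 * \<rho> * sqrt (\<alpha>^2 / \<beta>)) + \<epsilon>)) \<le> v \<tau> x" unfolding \<kappa>_def m0_def by blast
qed

end

section \<open>From single barrier steps to optical paths\<close>

lemma square_integrable_restrict:
 fixes g :: "space \<Rightarrow> 'b::euclidean_space"
 assumes "A \<in> sets lebesgue" "square_integrable g"
 shows "square_integrable (\<lambda>x. indicator A x *\<^sub>R g x)"
proof (rule square_integrable_bound[OF _ assms(2)])
 show "(\<lambda>x. indicator A x *\<^sub>R g x) \<in> borel_measurable lebesgue"
  using assms by (intro borel_measurable_scaleR borel_measurable_indicator square_integrableD)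
 show "AE x in lebesgue. norm (indicator A x *\<^sub>R g x) \<le> norm (g x)" by (intro AE_I2) (simp add: indicator_def)
qed

lemma exp_minus_eventually_le_rational:
 fixes e K c :: real
 assumes "e > 0" "c > 0" "K > 0"
 obtains \<tau>0 where "\<tau>0 > 0" "\<And>\<tau>. \<tau> \<ge> \<tau>0 \<Longrightarrow> exp (- \<tau> * e) \<le> c / (\<tau>^2 + K)"
proof -
 \<comment> \<open>A cubic lower bound for the exponential suffices against the quadratic
   denominator: (\<tau> e / 3)^3 \<le> exp (\<tau> e), whence the factor 27.\<close>
 define \<tau>0 where "\<tau>0 = 27 * (1 + K) / (c * e ^ 3) + 1"
 have \<tau>0: "\<tau>0 \<ge> 1" using assms by (simp add: \<tau>0_def)
 have "exp (- \<tau> * e) \<le> c / (\<tau>^2 + K)" if "\<tau> \<ge> \<tau>0" for \<tau>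
 proof -
  have t: "\<tau> \<ge> 1" "27 * (1 + K) / (c * e ^ 3) \<le> \<tau>" using that \<tau>0 by (auto simp: \<tau>0_def)
  have t2: "27 * (1 + K) \<le> \<tau> * (c * e ^ 3)" using t(2) assms by (simp add: pos_divide_le_eq)
  have "(\<tau> * e / 3) ^ 3 \<le> (1 + \<tau> * e / real 3) ^ 3" using t assms by (intro power_mono) auto
  also have "\<dots> \<le> exp (\<tau> * e)" using t assms by (intro exp_ge_one_plus_x_over_n_power_n) (auto intro: order_trans[of _ 0])
  finally have 1: "(\<tau> * e / 3) ^ 3 \<le> exp (\<tau> * e)" .
  have "K * 1 \<le> K * \<tau>^2" using t(1) assms by (intro mult_left_mono one_le_power) auto
  then have "\<tau>^2 + K \<le> (1 + K) * \<tau>^2" by (simp add: distrib_right)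
  also have "\<dots> \<le> (\<tau> * (c * e ^ 3) / 27) * \<tau>^2" using t2 by (intro mult_right_mono) auto
  also have "\<dots> = c * (\<tau> * e / 3) ^ 3" by (simp add: power_mult_distrib power_divide power2_eq_square power3_eq_cube)
  also have "\<dots> \<le> c * exp (\<tau> * e)" using 1 assms by (intro mult_left_mono) auto
  finally have "\<tau>^2 + K \<le> c * exp (\<tau> * e)" .
  moreover have "\<tau>^2 + K > 0" using assms by (simp add: add_nonneg_pos)
  ultimately have "inverse (c * exp (\<tau> * e)) \<le> inverse (\<tau>^2 + K)" by (intro le_imp_inverse_le) auto
  then have "c * inverse (c * exp (\<tau> * e)) \<le> c * inverse (\<tau>^2 + K)" using assms by (intro mult_left_mono) auto
  moreover have "c * inverse (c * exp (\<tau> * e)) = exp (- \<tau> * e)" using assms by (simp add: exp_minus)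
  ultimately show ?thesis by (simp only: divide_inverse)
 qed
 then show thesis using \<tau>0 that[of \<tau>0] by simp
qed

context layered_family
begin

text \<open>The barrier step in a homogeneous region, with \<alpha> = \<beta> and outer radius
  \<rho> + d: the cost ((\<rho> + d)^2 - \<rho>^2) / (2 \<rho> sqrt \<alpha>) is d / sqrt \<alpha>
  times 1 + d / (2 \<rho>). The enlarged ball contains the ball of the original radius about any
  centre within distance d, so the step can be repeated.\<close>

lemma lower_bounded_ball_step:
 assumes a: "0 < \<alpha>" and d: "0 < d" "d < \<rho>" and xy: "dist x y \<le> d"
  and coeff: "\<And>w. w \<in> ball x (2 * \<rho>) \<Longrightarrow> gamma0 gp gm w = \<alpha>"
  and lb: "lower_bounded v (ball x \<rho>) E"
 shows "lower_bounded v (ball y \<rho>) (E + d / sqrt \<alpha> * (1 + d / (2 * \<rho>)))"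
proof -
 have \<rho>: "\<rho> > 0" using d by linarith
 have set: "{w. sqdist \<alpha> \<alpha> x w < s^2} = ball x s" if "s > 0" for s
  using that a by (auto simp: sqdist_homogeneous dist_commute power2_less_imp_less intro!: power_strict_mono)
 have g: "gamma0 \<alpha> \<alpha> w = \<alpha>" for w by (simp add: gamma0_def)
 have "lower_bounded v {w. sqdist \<alpha> \<alpha> x w < (\<rho> + d)^2} (E + ((\<rho> + d)^2 - \<rho>^2) / (2 * \<rho> * sqrt (\<alpha>^2 / \<alpha>)))"
 proof (rule lower_bounded_barrier_step[where R = "2 * \<rho>"])
  show "lower_bounded v {w. sqdist \<alpha> \<alpha> x w < \<rho>^2} E" using lb set[OF \<rho>] by simp
  show "gamma0 gp gm w = gamma0 \<alpha> \<alpha> w" if "sqdist \<alpha> \<alpha> x w < (2 * \<rho>)^2" for w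
  proof -
   have "w \<in> ball x (2 * \<rho>)" using set[of "2 * \<rho>"] that \<rho> by auto
   then show ?thesis unfolding g by (rule coeff)
  qed
 qed (use a d \<rho> in auto)
 moreover have "((\<rho> + d)^2 - \<rho>^2) / (2 * \<rho> * sqrt (\<alpha>^2 / \<alpha>)) = d / sqrt \<alpha> * (1 + d / (2 * \<rho>))"
  using a \<rho> by (simp add: power2_eq_square field_simps)
 moreover have "ball y \<rho> \<subseteq> {w. sqdist \<alpha> \<alpha> x w < (\<rho> + d)^2}"
 proof -
  have "ball y \<rho> \<subseteq> ball x (\<rho> + d)" using xy by (auto simp: subset_iff) (metis add.commute add_le_less_mono dist_triangle le_less_trans)
  then show ?thesis using set[of "\<rho> + d"] \<rho> d by simp
 qed
 ultimately show ?thesis using lower_bounded_mono by fastforce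
qed

text \<open>Many short steps along the segment: the excess \<open>d / (2 \<rho>)\<close> of a step of length \<open>d\<close>
 disappears in the limit.\<close>

lemma lower_bounded_segment:
 assumes a: "0 < \<alpha>" and \<rho>: "0 < \<rho>"
  and coeff: "\<And>t w. 0 \<le> t \<Longrightarrow> t \<le> 1 \<Longrightarrow> w \<in> ball (x + t *\<^sub>R (y - x)) (2 * \<rho>) \<Longrightarrow> gamma0 gp gm w = \<alpha>"
  and lb: "lower_bounded v (ball x \<rho>) E"
 shows "lower_bounded v (ball y \<rho>) (E + dist x y / sqrt \<alpha>)"
proof (rule lower_bounded_limit)
 fix e :: real assume e: "e > 0"
 define L where "L = dist x y"
 show "lower_bounded v (ball y \<rho>) (E + dist x y / sqrt \<alpha> + e)"
 proof (cases "L = 0")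
  case True
  then have "x = y" by (simp add: L_def)
  then show ?thesis using lower_bounded_mono[OF lb, of "ball y \<rho>" "E + dist x y / sqrt \<alpha> + e"] e by simp
 next
  case False
  then have L: "L > 0" by (simp add: L_def)
  \<comment> \<open>\<open>N\<close> steps of length L / N: the first bound makes the step shorter
    than \<rho>, the second makes the accumulated excess L^2 / (2 \<rho> sqrt \<alpha> N) less than
    e.\<close>
  obtain N :: nat where N: "max (L / \<rho>) (L / sqrt \<alpha> * L / (2 * \<rho>) / e) < real N" using reals_Archimedean2 by blast
  then have N1: "L / \<rho> < real N" "L / sqrt \<alpha> * L / (2 * \<rho>) / e < real N" by auto
  have N0: "real N > 0" using N1(1) L \<rho> by (smt (verit) divide_pos_pos)
  define d where "d = L / N"
  have d: "0 < d" "d < \<rho>" using L N0 N1(1) \<rho> by (auto simp: d_def field_simps)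
  define c where "c = d / sqrt \<alpha> * (1 + d / (2 * \<rho>))"
  define p where "p n = x + (real n / N) *\<^sub>R (y - x)" for n :: nat
  have "n \<le> N \<Longrightarrow> lower_bounded v (ball (p n) \<rho>) (E + real n * c)" for n
  proof (induction n)
   case 0
   then show ?case using lb by (simp add: p_def)
  next
   case (Suc n)
   have "lower_bounded v (ball (p (Suc n)) \<rho>) (E + real n * c + d / sqrt \<alpha> * (1 + d / (2 * \<rho>)))"
   proof (rule lower_bounded_ball_step[OF a d])
    have "p n - p (Suc n) = (real n / N - real (Suc n) / N) *\<^sub>R (y - x)" by (simp only: p_def scaleR_left_diff_distrib) simp
    also have "real n / N - real (Suc n) / N = - 1 / N" by (simp add: diff_divide_distrib[symmetric])
    finally have "p n - p (Suc n) = (- 1 / N) *\<^sub>R (y - x)" .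
    then show "dist (p n) (p (Suc n)) \<le> d" by (simp add: dist_norm d_def L_def norm_minus_commute)
    show "gamma0 gp gm w = \<alpha>" if "w \<in> ball (p n) (2 * \<rho>)" for w using coeff[of "real n / N" w] that Suc.prems N0 by (simp add: p_def)
    show "lower_bounded v (ball (p n) \<rho>) (E + real n * c)" using Suc by simp
   qed
   moreover have "E + real n * c + d / sqrt \<alpha> * (1 + d / (2 * \<rho>)) = E + real (Suc n) * c"
    unfolding c_def[symmetric] by (simp add: distrib_right)
   ultimately show ?case by (simp only:)
  qed
  then have "lower_bounded v (ball (p N) \<rho>) (E + real N * c)" by simp
  moreover have "p N = y" using N0 by (simp add: p_def)
  moreover have "real N * c \<le> dist x y / sqrt \<alpha> + e"
  proof -
   have "real N * c = L / sqrt \<alpha> + (L / sqrt \<alpha> * L / (2 * \<rho>)) / N"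
   proof -
    have "real N * d = L" using N0 by (simp add: d_def)
    then have "real N * c = L / sqrt \<alpha> * (1 + d / (2 * \<rho>))" by (simp add: c_def flip: times_divide_eq_left mult.assoc)
    then show ?thesis by (simp add: d_def distrib_left)
   qed
   also have "(L / sqrt \<alpha> * L / (2 * \<rho>)) / N \<le> e"
    using N1(2) unfolding pos_divide_less_eq[OF e] pos_divide_le_eq[OF N0] by (simp add: mult.commute)
   finally show ?thesis by (simp add: L_def)
  qed
  ultimately show ?thesis using lower_bounded_mono[of v "ball y \<rho>" "E + real N * c" "ball y \<rho>" "E + dist x y / sqrt \<alpha> + e"] by simp
 qed
qed

text \<open>One barrier centred at height 2 \<zeta> reaches across. Its inner ball of stretched
  radius \<zeta> lies in the upper half space and is Euclidean there, because points below are at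
  stretched distance at least 2 \<zeta>. Points of the ball about the mirror image have third
  stretched coordinate within 5 \<zeta> of the centre, so their squared distance is at most 26
  \<zeta>^2 < (6 \<zeta>)^2. The cost is not optimal but proportional to \<zeta>, which is
  arbitrary.\<close>

lemma lower_bounded_crossing:
 fixes z :: "real^2"
 assumes \<zeta>: "\<zeta> > 0" and lb: "lower_bounded v (ball (vector [z$1, z$2, 2 * \<zeta>]) \<zeta>) E"
 shows "lower_bounded v (ball (vector [z$1, z$2, - 2 * \<zeta>]) \<zeta>) (E + 35 * \<zeta> / (2 * sqrt (gp^2 / gm)))"
proof -
 let ?z = "vector [z$1, z$2, 2 * \<zeta>] :: space"
 let ?z' = "vector [z$1, z$2, - 2 * \<zeta>] :: space"
 have r: "0 < gp / gm" "gp / gm \<le> 1" using gpos gpos' by auto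
 have sd: "sqdist gp gm ?z x = (x$1 - z$1)^2 + (x$2 - z$2)^2 + ((if x$3 \<le> 0 then gp / gm * x$3 else x$3) - 2 * \<zeta>)^2" for x
  by (simp add: sqdist_def stretched_def sum_3)
 have ds: "(dist x (vector [z$1, z$2, c] :: space))^2 = (x$1 - z$1)^2 + (x$2 - z$2)^2 + (x$3 - c)^2" for x :: space and c
  by (simp add: dist_norm norm_vec_def L2_set_def sum_3)
 have "{x. sqdist gp gm ?z x < \<zeta>^2} \<subseteq> ball ?z \<zeta>"
 proof
  fix x assume "x \<in> {x. sqdist gp gm ?z x < \<zeta>^2}"
  then have x: "sqdist gp gm ?z x < \<zeta>^2" by simp
  have "x $ 3 > 0"
  proof (rule ccontr)
   assume n: "\<not> x $ 3 > 0"
   then have "gp / gm * x $ 3 \<le> 0" using r by (intro mult_nonneg_nonpos) auto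
   then have "\<zeta>^2 \<le> (2 * \<zeta> - gp / gm * x $ 3)^2" using \<zeta> by (intro power_mono) auto
   also have "\<dots> \<le> sqdist gp gm ?z x" using n unfolding sd by (simp add: power2_commute)
   finally show False using x by simp
  qed
  then have "(dist x ?z)^2 < \<zeta>^2" using x unfolding sd ds by simp
  then show "x \<in> ball ?z \<zeta>" using \<zeta> by (simp add: dist_commute power2_less_imp_less)
 qed
 then have "lower_bounded v {x. sqdist gp gm ?z x < \<zeta>^2} E" using lower_bounded_mono[OF lb] by simp
 then have "lower_bounded v {x. sqdist gp gm ?z x < (6 * \<zeta>)^2} (E + ((6 * \<zeta>)^2 - \<zeta>^2) / (2 * \<zeta> * sqrt (gp^2 / gm)))"
  using gpos \<zeta> by (intro lower_bounded_barrier_step[where R = "7 * \<zeta>"]) auto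
 moreover have "((6 * \<zeta>)^2 - \<zeta>^2) / (2 * \<zeta> * sqrt (gp^2 / gm)) = 35 * \<zeta> / (2 * sqrt (gp^2 / gm))" using \<zeta> by (simp add: power2_eq_square)
 moreover have "ball ?z' \<zeta> \<subseteq> {x. sqdist gp gm ?z x < (6 * \<zeta>)^2}"
 proof
  fix x assume "x \<in> ball ?z' \<zeta>"
  then have "(dist x ?z')^2 < \<zeta>^2" using \<zeta> by (intro power_strict_mono) (auto simp: dist_commute)
  then have *: "(x$1 - z$1)^2 + (x$2 - z$2)^2 + (x$3 + 2 * \<zeta>)^2 < \<zeta>^2" unfolding ds by simp
  then have "(x$3 + 2 * \<zeta>)^2 < \<zeta>^2" using zero_le_power2[of "x$1 - z$1"] zero_le_power2[of "x$2 - z$2"] by linarith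
  then have "\<bar>x$3 + 2 * \<zeta>\<bar> < \<zeta>" using \<zeta> power2_less_imp_less[of "\<bar>x$3 + 2 * \<zeta>\<bar>" \<zeta>] by simp
  then have x3: "- 3 * \<zeta> < x$3" "x$3 < 0" using \<zeta> by linarith+
  have "gp / gm * (- x$3) \<le> - x$3" "0 \<le> gp / gm * (- x$3)" using x3 r by (intro mult_left_le_one_le mult_nonneg_nonneg; simp)+
  then have "- 3 * \<zeta> < gp / gm * x$3" "gp / gm * x$3 \<le> 0" using x3 by simp_all
  then have "(2 * \<zeta> - gp / gm * x$3)^2 \<le> (5 * \<zeta>)^2" using \<zeta> by (intro power_mono; linarith)
  then have "(gp / gm * x$3 - 2 * \<zeta>)^2 \<le> 25 * \<zeta>^2" by (simp add: power2_commute power_mult_distrib)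
  then have "sqdist gp gm ?z x \<le> \<zeta>^2 + 25 * \<zeta>^2"
  proof -
   have "sqdist gp gm ?z x = (x$1 - z$1)^2 + (x$2 - z$2)^2 + (gp / gm * x$3 - 2 * \<zeta>)^2" using x3 unfolding sd by simp
   then show ?thesis using * \<open>(gp / gm * x$3 - 2 * \<zeta>)^2 \<le> 25 * \<zeta>^2\<close> zero_le_power2[of "x$3 + 2 * \<zeta>"] by linarith
  qed
  also have "\<dots> < (6 * \<zeta>)^2" using \<zeta> by (simp add: power_mult_distrib)
  finally show "x \<in> {x. sqdist gp gm ?z x < (6 * \<zeta>)^2}" by simp
 qed
 ultimately show ?thesis using lower_bounded_mono by fastforce
qed

text \<open>Inside the source region a barrier of fixed steepness 1 and height C0 / (\<tau>^2 + K)
  is a subsolution, as \<open>C0\<close> pays both for \<tau>^2 times the barrier and for its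
  divergence. The resulting lower bound is of order \<tau>^{-2}, that is, of rate 0.\<close>

lemma lower_bounded_source:
 assumes C0: "C0 > 0" and rad: "0 < \<rho>" "\<rho> < d"
  and upper: "\<And>x. x \<in> ball y d \<Longrightarrow> x $ 3 > 0"
  and f: "AE x in lebesgue. x \<in> ball y d \<longrightarrow> C0 \<le> f x"
 shows "lower_bounded v (ball y \<rho>) 0" unfolding lower_bounded_def
proof (intro allI impI)
 fix \<epsilon> :: real assume \<epsilon>: "\<epsilon> > 0"
 let ?q = "sqdist gp gp y"
 have d: "d > 0" using rad by linarith
 \<comment> \<open>Up to the margin 1, three times the bound for one directional term of the
   divergence on the ball of radius \<open>d\<close>, with the height \<open>M\<close> divided
   out.\<close>
 define K where "K = 3 * (gp * (4 * d^2 + 2)) + 1"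
 have K: "K > 0" using gpos by (auto simp: K_def intro!: add_nonneg_pos)
 \<comment> \<open>Within radius \<rho> the barrier is at least M / 2, while its level at radius
   \<open>d\<close> is M times the logistic value; the difference, freed of the factor 1 / (\<tau>^2
   + K), is \<open>c\<close>.\<close>
 define c where "c = C0 * (1 / 2 - logistic (d^2 - \<rho>^2))"
 have "\<rho>^2 < d^2" using rad by (intro power_strict_mono) auto
 then have "exp (d^2 - \<rho>^2) > 1" by simp
 then have "logistic (d^2 - \<rho>^2) < 1 / 2" unfolding logistic_def by (intro divide_strict_left_mono) (auto simp: add_pos_pos)
 then have c: "c > 0" using C0 by (simp add: c_def)
 obtain \<tau>0 where \<tau>0: "\<tau>0 > 0" "\<And>\<tau>. \<tau> \<ge> \<tau>0 \<Longrightarrow> exp (- \<tau> * \<epsilon>) \<le> c / (\<tau>^2 + K)" using exp_minus_eventually_le_rational[OF \<epsilon> c K] by blast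
 have "AE x in lebesgue. x \<in> ball y \<rho> \<longrightarrow> exp (- \<tau> * (0 + \<epsilon>)) \<le> v \<tau> x" if "\<tau> \<ge> \<tau>0" for \<tau>
 proof -
  have \<tau>: "\<tau> > 0" using that \<tau>0(1) by linarith
  define M where "M = C0 / (\<tau>^2 + K)"
  have den: "\<tau>^2 + K > 0" using K by (simp add: add_nonneg_pos)
  have M: "M > 0" using C0 den by (simp add: M_def)
  let ?s = "barrier gp gp y 1 \<rho> 0 M"
  define k where "k = M * logistic (d^2 - \<rho>^2)"
  have k: "k \<ge> 0" using M logistic_bounds(1) by (simp add: k_def less_imp_le)
  have ball: "x \<in> ball y s \<longleftrightarrow> ?q x < s^2" if "s > 0" for x s
   using that gpos by (auto simp: sqdist_homogeneous dist_commute power2_less_imp_less intro!: power_strict_mono)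
  have "AE x in lebesgue. ?s x - v \<tau> x \<le> k"
  proof (rule layered_comparison[where U = "ball y d", OF sol[OF \<tau>] gpos(1) gpos' \<tau> k f_sq
     barrier_has_gradient[OF gpos(1) order_refl zero_less_one] barrier_flux_weak_deriv[OF gpos(1) order_refl zero_less_one]])
   show "AE x in lebesgue. x \<notin> ball y d \<longrightarrow> ?s x - v \<tau> x \<le> k" using v_nonneg[OF \<tau>]
   proof eventually_elim
    case (elim x)
    have "?s x \<le> k" if "x \<notin> ball y d"
     unfolding barrier_def k_def using ball[OF d] that M by (intro mult_left_mono logistic_antimono) auto
    then show ?case using elim by auto
   qed
   show "AE x in lebesgue. x \<in> ball y d \<longrightarrow> (\<forall>i. gamma0 gp gm x * barrier_grad gp gp y 1 \<rho> 0 M x $ i = barrier_flux gp gp y 1 \<rho> 0 M i x)"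
   proof (intro AE_I2 impI allI)
    fix x i assume "x \<in> ball y d"
    then have "gamma0 gp gm x = gamma0 gp gp x" using upper[of x] by (simp add: gamma0_def)
    then show "gamma0 gp gm x * barrier_grad gp gp y 1 \<rho> 0 M x $ i = barrier_flux gp gp y 1 \<rho> 0 M i x"
     using barrier_flux_eq[OF gpos(1) order_refl zero_less_one] by simp
   qed
   have ineq: "\<tau>^2 * ?s x \<le> (\<Sum>i\<in>UNIV. barrier_div gp gp y 1 \<rho> 0 M i x) + C0" if x: "x \<in> ball y d" for x
   proof -
    have "- (M * (gp * (4 * d^2 + 2))) \<le> barrier_div gp gp y 1 \<rho> 0 M i x" for i
    proof -
     let ?T = "1 * (?q x - \<rho>^2) + 0" and ?y = "stretched gp gp y i x"
     have b: "\<bar>logistic2 ?T\<bar> \<le> 1" "\<bar>logistic1 ?T\<bar> \<le> 1" using logistic_deriv_bounds[of ?T] logistic_bounds(2)[of ?T] by linarith+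
     have y: "?y^2 \<le> d^2" using stretched_le_sqdist[of gp gp y i x] ball[OF d, of x] x by linarith
     have fc: "\<bar>flux_coeff gp gp i x\<bar> \<le> gp" "\<bar>slope gp gp i x\<bar> \<le> 1"
      using flux_coeff_bounds[OF gpos(1) order_refl, of i x] slope_bounds[OF gpos(1) order_refl, of i x] by auto
     have "\<bar>logistic2 ?T * (1 * 2 * ?y)^2 + logistic1 ?T * (1 * 2)\<bar> \<le> \<bar>logistic2 ?T\<bar> * (4 * ?y^2) + \<bar>logistic1 ?T\<bar> * 2"
      using abs_triangle_ineq[of "logistic2 ?T * (1 * 2 * ?y)^2" "logistic1 ?T * (1 * 2)"] by (simp add: abs_mult power_mult_distrib)
     also have "\<dots> \<le> 1 * (4 * d^2) + 1 * 2" using b y by (intro add_mono mult_mono) auto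
     finally have 1: "\<bar>logistic2 ?T * (1 * 2 * ?y)^2 + logistic1 ?T * (1 * 2)\<bar> \<le> 4 * d^2 + 2" by simp
     have "\<bar>barrier_div gp gp y 1 \<rho> 0 M i x\<bar> \<le> gp * (M * (4 * d^2 + 2) * 1)"
      unfolding barrier_div_def abs_mult[of "flux_coeff gp gp i x"] abs_mult[of _ "slope gp gp i x"] abs_mult[of M]
      using 1 fc M gpos by (intro mult_mono) auto
     then show ?thesis by (simp add: abs_le_iff algebra_simps)
    qed
    then have "(\<Sum>i\<in>(UNIV::3 set). - (M * (gp * (4 * d^2 + 2)))) \<le> (\<Sum>i\<in>UNIV. barrier_div gp gp y 1 \<rho> 0 M i x)" by (rule sum_mono)
    then have 1: "- (M * K) \<le> (\<Sum>i\<in>UNIV. barrier_div gp gp y 1 \<rho> 0 M i x)" using M by (simp add: K_def algebra_simps)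
    have "\<tau>^2 * ?s x \<le> \<tau>^2 * M"
     unfolding barrier_def using logistic_bounds(2) M by (intro mult_left_mono mult_left_le) (auto intro: less_imp_le)
    also have "\<dots> = C0 - M * K" using den by (simp add: M_def field_simps)
    finally show ?thesis using 1 by linarith
   qed
   show "AE x in lebesgue. x \<in> ball y d \<longrightarrow> \<tau>^2 * ?s x \<le> (\<Sum>i\<in>UNIV. barrier_div gp gp y 1 \<rho> 0 M i x) + f x" using f
   proof eventually_elim
    case (elim x)
    then show ?case using ineq[of x] by auto
   qed
  qed
  then show ?thesis
  proof eventually_elim
   case (elim x)
   show ?case
   proof
    assume "x \<in> ball y \<rho>"
    then have "logistic 0 \<le> logistic (1 * (?q x - \<rho>^2) + 0)" using ball[OF rad(1), of x] by (intro logistic_antimono) auto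
    then have "M * (1 / 2) \<le> ?s x" unfolding barrier_def using M by (intro mult_left_mono) (auto simp: logistic_def)
    then have "M * (1 / 2 - logistic (d^2 - \<rho>^2)) \<le> v \<tau> x" using elim by (simp add: k_def right_diff_distrib)
    moreover have "M * (1 / 2 - logistic (d^2 - \<rho>^2)) = c / (\<tau>^2 + K)" by (simp add: M_def c_def)
    ultimately show "exp (- \<tau> * (0 + \<epsilon>)) \<le> v \<tau> x" using \<tau>0(2)[OF that] by simp
   qed
  qed
 qed
 with \<tau>0(1) show "\<exists>\<tau>0>0. \<forall>\<tau>\<ge>\<tau>0. AE x in lebesgue. x \<in> ball y \<rho> \<longrightarrow> exp (- \<tau> * (0 + \<epsilon>)) \<le> v \<tau> x" by blast
qed

lemma component_ball: "w \<in> ball (x::space) s \<Longrightarrow> \<bar>w $ i - x $ i\<bar> < s"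
 using component_le_norm_cart[of "w - x" i] by (simp add: dist_norm norm_minus_commute)

text \<open>The path is followed from the source: the ball about \<open>y\<close>, a segment to
  height 2 \<zeta> above the point \<open>z\<close> of the interface, the crossing, and a segment to
  \<open>p\<close>. Moving the break point by 2 \<zeta> to either side and crossing the interface
  increase the length by at most C \<zeta>.\<close>

lemma lower_bounded_optical:
 assumes C0: "C0 > 0" and f: "AE x in lebesgue. x \<in> ball c r \<longrightarrow> C0 \<le> f x"
  and upper: "\<And>x. x \<in> ball c r \<Longrightarrow> x $ 3 > 0" and y: "y \<in> ball c r" and p: "p $ 3 < 0" and e: "e > 0"
 obtains \<zeta>0 where "\<zeta>0 > 0" "\<And>\<zeta>. 0 < \<zeta> \<Longrightarrow> \<zeta> < \<zeta>0 \<Longrightarrow> lower_bounded v (ball p \<zeta>) (optical_length gp gm p y z + e)"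
proof -
 obtain d where d: "d > 0" "ball y d \<subseteq> ball c r" using y openE[OF open_ball] by blast
 have y3: "y $ 3 > 0" using upper y by blast
 define C where "C = 2 / sqrt gp + 35 / (2 * sqrt (gp^2 / gm)) + 2 / sqrt gm"
 have C: "C > 0" using gpos gpos' by (simp add: C_def add_pos_pos)
 \<comment> \<open>The bounds by half the distances of \<open>y\<close> and \<open>p\<close> to the
   interface keep all balls of radius 2 \<zeta> along the two segments within one half space, where
   the coefficient is constant.\<close>
 define \<zeta>0 where "\<zeta>0 = min (min d (y $ 3 / 2)) (min (- p $ 3 / 2) (e / C))"
 have \<zeta>0: "\<zeta>0 > 0" using d(1) y3 p e C by (simp add: \<zeta>0_def)
 show thesis
 proof (rule that[OF \<zeta>0])
  fix \<zeta> assume \<zeta>: "0 < \<zeta>" "\<zeta> < \<zeta>0"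
  then have \<zeta>': "\<zeta> < d" "2 * \<zeta> < y $ 3" "2 * \<zeta> < - p $ 3" "\<zeta> < e / C" by (auto simp: \<zeta>0_def)
  then have \<zeta>e: "C * \<zeta> \<le> e" using C by (simp add: field_simps)
  let ?zp = "vector [z$1, z$2, 2 * \<zeta>] :: space" and ?zm = "vector [z$1, z$2, - 2 * \<zeta>] :: space" and ?z0 = "vector [z$1, z$2, 0] :: space"
  have "lower_bounded v (ball y \<zeta>) 0"
   using d upper \<zeta> \<zeta>'(1) f by (intro lower_bounded_source[OF C0, where d = d]) (auto elim!: eventually_mono)
  then have "lower_bounded v (ball ?zp \<zeta>) (0 + dist y ?zp / sqrt gp)"
  proof (rule lower_bounded_segment[OF gpos(1) \<zeta>(1), rotated])
   fix t w assume t: "0 \<le> t" "t \<le> 1" and w: "w \<in> ball (y + t *\<^sub>R (?zp - y)) (2 * \<zeta>)"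
   have "(1 - t) * (2 * \<zeta>) \<le> (1 - t) * y $ 3" using t \<zeta>'(2) by (intro mult_left_mono) auto
   then have "2 * \<zeta> \<le> (y + t *\<^sub>R (?zp - y)) $ 3" by (simp add: algebra_simps)
   then have "w $ 3 > 0" using component_ball[OF w, of 3] unfolding abs_less_iff by linarith
   then show "gamma0 gp gm w = gp" by (simp add: gamma0_def)
  qed
  from lower_bounded_crossing[OF \<zeta>(1) this]
  have "lower_bounded v (ball ?zm \<zeta>) (dist y ?zp / sqrt gp + 35 * \<zeta> / (2 * sqrt (gp^2 / gm)))" by simp
  then have lb: "lower_bounded v (ball p \<zeta>) (dist y ?zp / sqrt gp + 35 * \<zeta> / (2 * sqrt (gp^2 / gm)) + dist ?zm p / sqrt gm)"
  proof (rule lower_bounded_segment[OF gpos' \<zeta>(1), rotated])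
   fix t w assume t: "0 \<le> t" "t \<le> 1" and w: "w \<in> ball (?zm + t *\<^sub>R (p - ?zm)) (2 * \<zeta>)"
   have "t * (2 * \<zeta>) \<le> t * (- p $ 3)" using t \<zeta>'(3) by (intro mult_left_mono) auto
   then have "(?zm + t *\<^sub>R (p - ?zm)) $ 3 \<le> - 2 * \<zeta>" by (simp add: algebra_simps)
   then have "w $ 3 < 0" using component_ball[OF w, of 3] unfolding abs_less_iff by linarith
   then show "gamma0 gp gm w = gm" by (simp add: gamma0_def)
  qed
  have zz: "dist ?zp ?z0 = 2 * \<zeta>" "dist ?zm ?z0 = 2 * \<zeta>"
   using \<zeta>(1) by (simp_all add: dist_norm norm_vec_def L2_set_def sum_3 real_sqrt_mult)
  have 1: "dist y ?zp / sqrt gp \<le> (norm (?z0 - y) + 2 * \<zeta>) / sqrt gp"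
   using dist_triangle2[of y ?zp ?z0] zz gpos by (intro divide_right_mono) (auto simp: dist_norm norm_minus_commute)
  have 2: "dist ?zm p / sqrt gm \<le> (norm (?z0 - p) + 2 * \<zeta>) / sqrt gm"
   using dist_triangle[of ?zm p ?z0] zz gpos' by (intro divide_right_mono) (auto simp: dist_norm norm_minus_commute)
  have "dist y ?zp / sqrt gp + 35 * \<zeta> / (2 * sqrt (gp^2 / gm)) + dist ?zm p / sqrt gm \<le> optical_length gp gm p y z + C * \<zeta>"
   using 1 2 by (simp add: optical_length_def C_def add_divide_distrib algebra_simps)
  then show "lower_bounded v (ball p \<zeta>) (optical_length gp gm p y z + e)" using lower_bounded_mono[OF lb] \<zeta>e by simp
 qed
qed

text \<open>Testing the equation with a bump in \<open>D\<close>, where there is no source, turns a lower bound for \<open>v\<close>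
 into one for its gradient.\<close>

lemma gradient_lower_bound:
 assumes lb: "lower_bounded v (ball p \<zeta>) E" and \<zeta>: "\<zeta> > 0" and D: "ball p \<zeta> \<subseteq> D" "D \<in> sets lebesgue"
  and f0: "AE x in lebesgue. x \<in> D \<longrightarrow> f x = 0" and low: "\<And>x. x \<in> D \<Longrightarrow> x $ 3 < 0" and \<epsilon>: "\<epsilon> > 0"
 obtains c \<tau>0 where "c > 0" "\<tau>0 > 0"
  "\<And>\<tau>. \<tau> \<ge> \<tau>0 \<Longrightarrow> c * exp (- \<tau> * (E + \<epsilon>)) \<le> l2norm (\<lambda>x. indicator D x *\<^sub>R V \<tau> x)"
proof -
 obtain \<phi> d where \<phi>: "\<phi> \<in> test_functions (ball p \<zeta>)" "\<And>y. 0 \<le> \<phi> y" "\<And>y. \<phi> y \<le> 1"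
  "d > 0" "\<And>y. y \<in> ball p d \<Longrightarrow> \<phi> y = 1" "\<And>y. \<phi> y \<noteq> 0 \<Longrightarrow> y \<in> ball p \<zeta>" using test_function_bump_in_ball[OF \<zeta>, of p] by metis
 have \<phi>': "\<phi> \<in> test_functions UNIV" using \<phi>(1) by (auto simp: test_functions_def)
 define \<Phi> :: "space \<Rightarrow> space" where "\<Phi> x = (\<chi> i. frechet_derivative \<phi> (at x) (axis i 1))" for x
 have g: "has_gradient \<phi> \<Phi>" unfolding \<Phi>_def[abs_def] by (rule has_gradient_test_function[OF \<phi>'])
 note sq = has_gradientD(1,2)[OF g]
 obtain S where S: "compact S" "S \<subseteq> ball p \<zeta>" "\<And>x. x \<notin> S \<Longrightarrow> \<phi> x = 0" using test_functions_support[OF \<phi>(1)] by blast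
 have \<Phi>0: "\<Phi> x = 0" if "x \<notin> D" for x
 proof -
  have "x \<notin> S" using S(2) D that by auto
  then have "frechet_derivative \<phi> (at x) = (\<lambda>b. 0)" using frechet_derivative_outside_support[of S \<phi> x] S(1,3) by blast
  then show ?thesis by (simp add: \<Phi>_def vec_eq_iff)
 qed
 have int\<phi>: "integrable lebesgue \<phi>" by (rule test_functions_props(3)[OF \<phi>'])
 define A where "A = (LI x. \<phi> x)"
 have A: "A > 0"
 proof -
  have "measure lebesgue (ball p d) > 0" using \<phi>(4) content_ball_pos by simp
  moreover have "(LI x. indicator (ball p d) x) \<le> A" unfolding A_def
  proof (rule integral_mono[OF _ int\<phi>])
   have "ball p d \<in> lmeasurable" by simp
   then show "integrable lebesgue (\<lambda>x. indicator (ball p d) x :: real)" by (simp only: lmeasurable_iff_integrable)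
   show "indicator (ball p d) x \<le> \<phi> x" for x using \<phi>(2,5)[of x] by (simp add: indicator_def)
  qed
  moreover have "(LI x. indicator (ball p d) x) = measure lebesgue (ball p d)" by simp
  ultimately show ?thesis by linarith
 qed
 obtain \<tau>1 where \<tau>1: "\<tau>1 > 0" "\<And>\<tau>. \<tau> \<ge> \<tau>1 \<Longrightarrow> AE x in lebesgue. x \<in> ball p \<zeta> \<longrightarrow> exp (- \<tau> * (E + \<epsilon>)) \<le> v \<tau> x"
  using lb \<epsilon> unfolding lower_bounded_def by blast
 define c where "c = A / (gm * (l2norm \<Phi> + 1))"
 have c: "c > 0" using A gpos' by (simp add: c_def add_nonneg_pos)
 show thesis
 proof (rule that[OF c, of "max \<tau>1 1"])
  fix \<tau> assume "\<tau> \<ge> max \<tau>1 1"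
  then have \<tau>: "\<tau> \<ge> \<tau>1" "\<tau> \<ge> 1" "\<tau> > 0" by auto
  note v = layered_solutionD(1)[OF sol[OF \<tau>(3)]]
  note sqv = has_gradientD(1,2)[OF v]
  let ?m = "exp (- \<tau> * (E + \<epsilon>))"
  have DV: "square_integrable (\<lambda>x. indicator D x *\<^sub>R V \<tau> x)" by (rule square_integrable_restrict[OF D(2) sqv(2)])
  have "?m * A = (LI x. ?m * \<phi> x)" by (simp add: A_def)
  also have "\<dots> \<le> (LI x. v \<tau> x * \<phi> x)"
  proof (rule integral_mono_AE)
   show "integrable lebesgue (\<lambda>x. ?m * \<phi> x)" "integrable lebesgue (\<lambda>x. v \<tau> x * \<phi> x)" using int\<phi> integrable_times[OF sqv(1) sq(1)] by auto
   show "AE x in lebesgue. ?m * \<phi> x \<le> v \<tau> x * \<phi> x" using \<tau>1(2)[OF \<tau>(1)]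
   proof eventually_elim
    case (elim x)
    then show ?case using \<phi>(2,6)[of x] by (cases "\<phi> x = 0") (auto intro!: mult_right_mono)
   qed
  qed
  finally have 1: "?m * A \<le> (LI x. v \<tau> x * \<phi> x)" .
  have "(LI x. f x * \<phi> x) = (LINT x|(lebesgue::space measure). 0)"
  proof (rule integral_cong_AE)
   show "(\<lambda>x. f x * \<phi> x) \<in> borel_measurable lebesgue" using integrable_times[OF f_sq sq(1)] by auto
   show "AE x in lebesgue. f x * \<phi> x = 0" using f0 by eventually_elim (use \<phi>(6) D(1) in fastforce)
  qed simp
  then have "\<tau>^2 * (LI x. v \<tau> x * \<phi> x) = - (LI x. gamma0 gp gm x * (V \<tau> x \<bullet> \<Phi> x))" using layered_solutionD(2)[OF sol[OF \<tau>(3)] g] by simp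
  \<comment> \<open>The gradient of the bump vanishes outside \<open>D\<close>, so only the
    restriction of \<open>V\<close> to \<open>D\<close> enters, with constant coefficient.\<close>
  also have "(LI x. gamma0 gp gm x * (V \<tau> x \<bullet> \<Phi> x)) = (LI x. gm * ((indicator D x *\<^sub>R V \<tau> x) \<bullet> \<Phi> x))"
  proof (rule Bochner_Integration.integral_cong[OF refl])
   fix x
   show "gamma0 gp gm x * (V \<tau> x \<bullet> \<Phi> x) = gm * ((indicator D x *\<^sub>R V \<tau> x) \<bullet> \<Phi> x)"
    using \<Phi>0[of x] low[of x] by (cases "x \<in> D") (auto simp: gamma0_def)
  qed
  also have "\<dots> = gm * (LI x. (indicator D x *\<^sub>R V \<tau> x) \<bullet> \<Phi> x)" by (rule integral_mult_right_zero)
  finally have *: "\<tau>^2 * (LI x. v \<tau> x * \<phi> x) = - (gm * (LI x. (indicator D x *\<^sub>R V \<tau> x) \<bullet> \<Phi> x))" .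
  have "\<tau>^2 * (LI x. v \<tau> x * \<phi> x) \<le> gm * (l2norm (\<lambda>x. indicator D x *\<^sub>R V \<tau> x) * l2norm \<Phi>)"
  proof -
   have "- (LI x. (indicator D x *\<^sub>R V \<tau> x) \<bullet> \<Phi> x) \<le> l2norm (\<lambda>x. indicator D x *\<^sub>R V \<tau> x) * l2norm \<Phi>"
    using l2_Cauchy_Schwarz[OF DV sq(2)] by (simp only: abs_le_iff)
   from mult_left_mono[OF this less_imp_le[OF gpos']] * show ?thesis by (simp only: mult_minus_right)
  qed
  moreover have "(LI x. v \<tau> x * \<phi> x) \<le> \<tau>^2 * (LI x. v \<tau> x * \<phi> x)"
  proof -
   have "0 \<le> (LI x. v \<tau> x * \<phi> x)" using 1 A by (smt (verit) exp_gt_zero mult_pos_pos)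
   then show ?thesis using \<tau>(2) by (simp add: mult_le_cancel_right1)
  qed
  ultimately have "?m * A \<le> gm * (l2norm (\<lambda>x. indicator D x *\<^sub>R V \<tau> x) * l2norm \<Phi>)" using 1 by linarith
  also have "\<dots> \<le> gm * (l2norm (\<lambda>x. indicator D x *\<^sub>R V \<tau> x) * (l2norm \<Phi> + 1))" using gpos' by (intro mult_left_mono) auto
  finally have "?m * A \<le> l2norm (\<lambda>x. indicator D x *\<^sub>R V \<tau> x) * (gm * (l2norm \<Phi> + 1))" by (simp add: mult_ac)
  moreover have "gm * (l2norm \<Phi> + 1) > 0" using gpos' by (simp add: add_nonneg_pos)
  ultimately have "?m * A / (gm * (l2norm \<Phi> + 1)) \<le> l2norm (\<lambda>x. indicator D x *\<^sub>R V \<tau> x)" by (simp only: pos_divide_le_eq)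
  then show "c * ?m \<le> l2norm (\<lambda>x. indicator D x *\<^sub>R V \<tau> x)" by (simp add: c_def mult.commute)
 qed simp
qed

end

section \<open>Weighted energy estimate\<close>

text \<open>An Agmon type estimate: the equation is tested with W^2 v. The eikonal inequality bounds
  the cross term produced by the gradient of the weight by \<theta> times the sum of the two
  positive terms, and \<theta> < 1 leaves a fraction of both. \<open>G\<close> acts as the gradient
  of \<open>W\<close>; it is tied to it through the almost everywhere derivative of W^2, since the
  weights have kinks at the interface.\<close>

lemma weighted_energy_estimate:
 assumes sol: "layered_solution gp gm \<tau> f v V" and pos: "gp > 0" "gm > 0" "\<tau> > 0" and \<theta>: "0 < \<theta>" "\<theta> < 1"
  and f: "square_integrable f"
  and W: "W \<in> borel_measurable borel" "\<And>x. 0 < W x" "\<And>x. W x \<le> K"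
  and G: "\<And>i. (\<lambda>x. G x $ i) \<in> borel_measurable borel" "\<And>x i. \<bar>2 * W x * G x $ i\<bar> \<le> L"
  and lip: "\<And>x h i. \<bar>(W (x + h *\<^sub>R axis i 1))^2 - (W x)^2\<bar> \<le> L * \<bar>h\<bar>"
  and der: "\<And>i. AE x in lebesgue. ((\<lambda>s. (W (x + s *\<^sub>R axis i 1))^2) has_real_derivative 2 * W x * G x $ i) (at 0)"
  and eik: "\<And>x. sqrt (gamma0 gp gm x) * norm (G x) \<le> \<theta> * \<tau> * W x"
 shows "(1 - \<theta>)^2 * \<tau>^2 * (LI x. (W x)^2 * (gamma0 gp gm x * (norm (V x))^2)) \<le> (LI x. (W x * f x)^2)"
  "integrable lebesgue (\<lambda>x. (W x)^2 * (gamma0 gp gm x * (norm (V x))^2))"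
proof -
 let ?a = "gamma0 gp gm"
 note v = layered_solutionD(1)[OF sol]
 note sqv = has_gradientD(1,2)[OF v]
 have Wm: "W \<in> borel_measurable lebesgue" by (rule borel_imp_lebesgue_measurable[OF W(1)])
 define \<phi> where "\<phi> x = (W x)^2 * v x" for x
 define \<Phi> where "\<Phi> x = (W x)^2 *\<^sub>R V x + (2 * W x * v x) *\<^sub>R G x" for x
 have g: "has_gradient \<phi> \<Phi>" unfolding has_gradient_def
 proof
  fix i
  have "weak_deriv i (\<lambda>x. (W x)^2 * v x) (\<lambda>x. (W x)^2 * V x $ i + (2 * W x * G x $ i) * v x)"
  proof (rule weak_deriv_product[OF has_gradientD(3)[OF v], where M = "K^2" and L = L])
   show "(\<lambda>x. (W x)^2) \<in> borel_measurable lebesgue" "(\<lambda>x. 2 * W x * G x $ i) \<in> borel_measurable lebesgue"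
    using W(1) G(1)[of i] by (intro borel_imp_lebesgue_measurable; measurable)+
   show "\<bar>(W x)^2\<bar> \<le> K^2" for x using W(2,3)[of x] by (auto intro: power_mono)
  qed (use G(2) lip der in auto)
  then show "weak_deriv i \<phi> (\<lambda>x. \<Phi> x $ i)" by (simp add: \<phi>_def[abs_def] \<Phi>_def algebra_simps)
 qed
 note sq\<phi> = has_gradientD(1,2)[OF g]
 have sqW: "square_integrable (\<lambda>x. W x * k x)" if "square_integrable k" for k
 proof (rule square_integrable_bound[OF _ square_integrable_cmult[OF that, of K]])
  show "(\<lambda>x. W x * k x) \<in> borel_measurable lebesgue" using Wm square_integrableD(1)[OF that] by simp
  have "\<bar>W x * k x\<bar> \<le> \<bar>K * k x\<bar>" for x unfolding abs_mult using W(2,3)[of x] by (intro mult_right_mono) auto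
  then show "AE x in lebesgue. norm (W x * k x) \<le> norm (K * k x)" by simp
 qed
 have ipr: "integrable lebesgue (\<lambda>x. ?a x * (V x \<bullet> \<Phi> x))" "integrable lebesgue (\<lambda>x. v x * \<phi> x)" "integrable lebesgue (\<lambda>x. f x * \<phi> x)"
  using integrable_inner[OF square_integrable_gamma0_scaleR[OF pos(1,2) sqv(2)] sq\<phi>(2)]
   integrable_times[OF sqv(1) sq\<phi>(1)] integrable_times[OF f sq\<phi>(1)] by auto
 define X where "X x = (W x)^2 * (?a x * (norm (V x))^2)" for x
 define Z where "Z x = \<tau>^2 * (W x * v x)^2" for x
 have iZ: "integrable lebesgue Z" using square_integrableD(2)[OF sqW[OF sqv(1)]] by (simp add: Z_def[abs_def])
 have iX: "integrable lebesgue X"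
 proof (rule Bochner_Integration.integrable_bound)
  show "integrable lebesgue (\<lambda>x. (K^2 * max gp gm) * (norm (V x))^2)" using square_integrableD(2)[OF sqv(2)] by simp
  show "X \<in> borel_measurable lebesgue"
   unfolding X_def[abs_def] using Wm square_integrableD(1)[OF sqv(2)] borel_measurable_gamma0_lebesgue by measurable
  have "\<bar>X x\<bar> \<le> (K^2 * max gp gm) * (norm (V x))^2" for x
  proof -
   have "(W x)^2 \<le> K^2" using W(2,3)[of x] by (auto intro: power_mono)
   then have "(W x)^2 * (?a x * (norm (V x))^2) \<le> K^2 * (max gp gm * (norm (V x))^2)"
    using gamma0_bounds[OF pos(1,2), of x] by (intro mult_mono) auto
   moreover have "0 \<le> X x" using gamma0_bounds(1)[OF pos(1,2), of x] by (simp add: X_def)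
   ultimately show ?thesis by (simp add: X_def mult.assoc)
  qed
  then show "AE x in lebesgue. norm (X x) \<le> norm ((K^2 * max gp gm) * (norm (V x))^2)"
   by (intro AE_I2) (auto intro: order_trans[OF _ abs_ge_self])
 qed
 show "integrable lebesgue (\<lambda>x. (W x)^2 * (gamma0 gp gm x * (norm (V x))^2))" using iX by (simp add: X_def[abs_def])
 have iF: "integrable lebesgue (\<lambda>x. (W x * f x)^2)" using square_integrableD(2)[OF sqW[OF f]] by simp
 \<comment> \<open>With A = W sqrt(\<gamma>0) |V| and B = \<tau> W |v| the cross term is at most 2
   \<theta> A B, hence at most \<theta> (A^2 + B^2).\<close>
 have pt1: "(1 - \<theta>) * (X x + Z x) \<le> ?a x * (V x \<bullet> \<Phi> x) + \<tau>^2 * (v x * \<phi> x)" for x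
 proof -
  have a: "?a x > 0" by (rule gamma0_bounds(1)[OF pos(1,2)])
  define A where "A = W x * (sqrt (?a x) * norm (V x))"
  define B where "B = \<tau> * (W x * \<bar>v x\<bar>)"
  have AB: "A \<ge> 0" "B \<ge> 0" "A^2 = X x" "B^2 = Z x" using W(2)[of x] pos(3) a by (auto simp: A_def B_def X_def Z_def power_mult_distrib)
  have "\<bar>?a x * (2 * W x * v x * (V x \<bullet> G x))\<bar> = 2 * (W x * \<bar>v x\<bar>) * (?a x * \<bar>V x \<bullet> G x\<bar>)" using a W(2)[of x] by (simp add: abs_mult)
  also have "\<dots> \<le> 2 * (W x * \<bar>v x\<bar>) * (?a x * (norm (V x) * norm (G x)))"
   using a W(2)[of x] Cauchy_Schwarz_ineq2[of "V x" "G x"] by (intro mult_left_mono) auto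
  also have "?a x * (norm (V x) * norm (G x)) = (sqrt (?a x) * norm (V x)) * (sqrt (?a x) * norm (G x))" using a by (simp add: mult_ac)
  also have "2 * (W x * \<bar>v x\<bar>) * ((sqrt (?a x) * norm (V x)) * (sqrt (?a x) * norm (G x)))
   \<le> 2 * (W x * \<bar>v x\<bar>) * ((sqrt (?a x) * norm (V x)) * (\<theta> * \<tau> * W x))" using a W(2)[of x] eik[of x] by (intro mult_left_mono) auto
  also have "\<dots> = \<theta> * (2 * A * B)" by (simp add: A_def B_def)
  also have "\<dots> \<le> \<theta> * (A^2 + B^2)" using \<theta>(1) sum_squares_bound[of A B] by (intro mult_left_mono) auto
  finally have "\<bar>?a x * (2 * W x * v x * (V x \<bullet> G x))\<bar> \<le> \<theta> * (X x + Z x)" using AB by simp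
  then have "- (\<theta> * (X x + Z x)) \<le> ?a x * (2 * W x * v x * (V x \<bullet> G x))" by linarith
  moreover have "?a x * (V x \<bullet> \<Phi> x) + \<tau>^2 * (v x * \<phi> x) = X x + Z x + ?a x * (2 * W x * v x * (V x \<bullet> G x))"
   by (simp add: X_def Z_def \<Phi>_def \<phi>_def inner_add_right dot_square_norm algebra_simps power2_eq_square)
  ultimately show ?thesis by (simp add: algebra_simps)
 qed
 \<comment> \<open>Young's inequality with weight (1 - \<theta>) \<tau>^2, so that the part
   containing \<open>v\<close> is half of what the left side still holds.\<close>
 have pt2: "f x * \<phi> x \<le> (1 - \<theta>) / 2 * Z x + 1 / (2 * (1 - \<theta>) * \<tau>^2) * (W x * f x)^2" for x
 proof -
  define s where "s = (1 - \<theta>) * \<tau>^2"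
  have s: "s > 0" using \<theta> pos by (simp add: s_def)
  have "0 \<le> (s * (W x * v x) - W x * f x)^2 / (2 * s)" using s by simp
  also have "\<dots> = s / 2 * (W x * v x)^2 + 1 / (2 * s) * (W x * f x)^2 - (W x * f x) * (W x * v x)"
   using s by (simp add: power2_eq_square field_simps)
  finally show ?thesis by (simp add: s_def Z_def \<phi>_def power2_eq_square mult_ac)
 qed
 have "(1 - \<theta>) * ((LI x. X x) + (LI x. Z x)) = (LI x. (1 - \<theta>) * (X x + Z x))" using iX iZ by simp
 also have "\<dots> \<le> (LI x. ?a x * (V x \<bullet> \<Phi> x) + \<tau>^2 * (v x * \<phi> x))" using iX iZ ipr pt1 by (intro integral_mono) auto
 also have "\<dots> = (LI x. f x * \<phi> x)" using ipr layered_solutionD(2)[OF sol g] by simp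
 also have "\<dots> \<le> (LI x. (1 - \<theta>) / 2 * Z x + 1 / (2 * (1 - \<theta>) * \<tau>^2) * (W x * f x)^2)" using iZ ipr iF pt2 by (intro integral_mono) auto
 also have "\<dots> = (1 - \<theta>) / 2 * (LI x. Z x) + 1 / (2 * (1 - \<theta>) * \<tau>^2) * (LI x. (W x * f x)^2)" using iZ iF by simp
 finally have main: "(1 - \<theta>) * ((LI x. X x) + (LI x. Z x)) \<le>
  (1 - \<theta>) / 2 * (LI x. Z x) + 1 / (2 * (1 - \<theta>) * \<tau>^2) * (LI x. (W x * f x)^2)" .
 have nn: "0 \<le> (LI x. X x)" "0 \<le> (LI x. Z x)"
  using gamma0_bounds(1)[OF pos(1,2)] by (auto simp: X_def Z_def less_imp_le intro!: Bochner_Integration.integral_nonneg)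
 have "(1 - \<theta>) / 2 * (LI x. X x) \<le> 1 / (2 * (1 - \<theta>) * \<tau>^2) * (LI x. (W x * f x)^2)"
 proof -
  have "0 \<le> (1 - \<theta>) / 2 * (LI x. X x)" "0 \<le> (1 - \<theta>) / 2 * (LI x. Z x)" using nn \<theta> by auto
  moreover have "(1 - \<theta>) * ((LI x. X x) + (LI x. Z x)) = 2 * ((1 - \<theta>) / 2 * (LI x. X x)) + 2 * ((1 - \<theta>) / 2 * (LI x. Z x))"
   by (simp add: distrib_left)
  ultimately show ?thesis using main by linarith
 qed
 then have "(2 * (1 - \<theta>) * \<tau>^2) * ((1 - \<theta>) / 2 * (LI x. X x)) \<le> (2 * (1 - \<theta>) * \<tau>^2) * (1 / (2 * (1 - \<theta>) * \<tau>^2) * (LI x. (W x * f x)^2))"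
  using \<theta> by (intro mult_left_mono) auto
 also have "(2 * (1 - \<theta>) * \<tau>^2) * (1 / (2 * (1 - \<theta>) * \<tau>^2) * (LI x. (W x * f x)^2)) = (LI x. (W x * f x)^2)" using \<theta> pos by simp
 also have "(2 * (1 - \<theta>) * \<tau>^2) * ((1 - \<theta>) / 2 * (LI x. X x)) = (1 - \<theta>)^2 * \<tau>^2 * (LI x. X x)" by (simp add: power2_eq_square)
 finally show "(1 - \<theta>)^2 * \<tau>^2 * (LI x. (W x)^2 * (gamma0 gp gm x * (norm (V x))^2)) \<le> (LI x. (W x * f x)^2)" by (simp add: X_def)
qed

section \<open>Optical paths and refracted plane phases\<close>

definition lift0 :: "real^2 \<Rightarrow> space" where
 "lift0 z = vector [z$1, z$2, 0]"

lemma optical_length_lift0: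
 "optical_length gp gm x y z = dist (lift0 z) x / sqrt gm + dist (lift0 z) y / sqrt gp"
 by (simp add: optical_length_def lift0_def dist_norm)

lemma lift0_nth [simp]: "lift0 z $ 1 = z $ 1" "lift0 z $ 2 = z $ 2" "lift0 z $ 3 = 0" by (simp_all add: lift0_def)

lemma optical_length_nonneg: "gp > 0 \<Longrightarrow> gm > 0 \<Longrightarrow> 0 \<le> optical_length gp gm x y z" by (simp add: optical_length_lift0)

lemma optical_distance_le: "gp > 0 \<Longrightarrow> gm > 0 \<Longrightarrow> optical_distance gp gm x y \<le> optical_length gp gm x y z"
 unfolding optical_distance_def by (rule cINF_lower) (auto intro!: bdd_belowI2[of _ 0] optical_length_nonneg)

lemma optical_distance_nonneg: "gp > 0 \<Longrightarrow> gm > 0 \<Longrightarrow> 0 \<le> optical_distance gp gm x y"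
 unfolding optical_distance_def by (rule cINF_greatest) (auto intro: optical_length_nonneg)

lemma optical_set_distance_le:
 assumes "gp > 0" "gm > 0" "x \<in> D" "y \<in> B"
 shows "optical_set_distance gp gm D B \<le> optical_distance gp gm x y"
proof -
 have "bdd_below ((\<lambda>(x, y). optical_distance gp gm x y) ` (D \<times> B))"
  using assms by (intro bdd_belowI2[of _ 0]) (auto intro: optical_distance_nonneg)
 from cINF_lower[OF this, of "(x, y)"] show ?thesis using assms by (simp add: optical_set_distance_def)
qed

lemma optical_set_distance_nonneg:
 assumes "gp > 0" "gm > 0" "D \<noteq> {}" "B \<noteq> {}"
 shows "0 \<le> optical_set_distance gp gm D B" unfolding optical_set_distance_def
 using assms by (intro cINF_greatest) (auto intro: optical_distance_nonneg)

lemma optical_set_distance_approx: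
 assumes "gp > 0" "gm > 0" "D \<noteq> {}" "B \<noteq> {}" "e > 0"
 obtains x y z where "x \<in> D" "y \<in> B" "optical_length gp gm x y z < optical_set_distance gp gm D B + e"
proof -
 have "bdd_below ((\<lambda>(x, y). optical_distance gp gm x y) ` (D \<times> B))"
  using assms by (intro bdd_belowI2[of _ 0]) (auto intro: optical_distance_nonneg)
 then obtain x y where xy: "x \<in> D" "y \<in> B" "optical_distance gp gm x y < optical_set_distance gp gm D B + e"
  using cINF_less_iff[of "D \<times> B" "\<lambda>(x, y). optical_distance gp gm x y" "optical_set_distance gp gm D B + e"] assms
  unfolding optical_set_distance_def by auto
 have "bdd_below (range (optical_length gp gm x y))" using assms by (intro bdd_belowI2[of _ 0]) (auto intro: optical_length_nonneg)
 then obtain z where "optical_length gp gm x y z < optical_set_distance gp gm D B + e"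
  using cINF_less_iff[of UNIV "optical_length gp gm x y" "optical_set_distance gp gm D B + e"] xy(3)
  unfolding optical_distance_def by auto
 with xy show thesis using that by blast
qed

lemma optical_length_attains_inf:
 assumes "gp > 0" "gm > 0"
 obtains z where "\<And>z'. optical_length gp gm x y z \<le> optical_length gp gm x y z'"
proof -
 have eq: "lift0 z = z$1 *\<^sub>R axis 1 1 + z$2 *\<^sub>R axis 2 1" for z by (simp add: vec_eq_iff forall_3 axis_def)
 have cont: "continuous_on S (optical_length gp gm x y)" for S
  unfolding optical_length_lift0[abs_def] eq by (intro continuous_intros) (use assms in auto)
 have nz: "norm (lift0 z) = norm z" for z by (simp add: norm_vec_def L2_set_def sum_3 sum_2)
 \<comment> \<open>Beyond this radius the leg to \<open>x\<close> alone is already at least as long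
   as the path through 0, so minimising over the disc suffices.\<close>
 define R where "R = sqrt gm * optical_length gp gm x y 0 + norm x"
 have R: "R \<ge> 0" using optical_length_nonneg[OF assms] assms by (simp add: R_def)
 obtain z where z: "z \<in> cball 0 R" "\<And>z'. z' \<in> cball 0 R \<Longrightarrow> optical_length gp gm x y z \<le> optical_length gp gm x y z'"
  using continuous_attains_inf[OF compact_cball _ cont, of "0 :: real^2" R] R by auto
 have "optical_length gp gm x y z \<le> optical_length gp gm x y z'" for z'
 proof (cases "z' \<in> cball 0 R")
  case False
  then have "R < norm z'" by simp
  then have "sqrt gm * optical_length gp gm x y 0 \<le> dist (lift0 z') x"
   using norm_triangle_ineq2[of "lift0 z'" x] by (simp add: R_def nz dist_norm)
  then have "optical_length gp gm x y 0 \<le> dist (lift0 z') x / sqrt gm" using assms by (simp add: pos_le_divide_eq mult.commute)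
  also have "\<dots> \<le> optical_length gp gm x y z'" using assms by (simp add: optical_length_lift0)
  finally show ?thesis using z(2)[of 0] R by simp
 qed (use z in auto)
 then show thesis using that by blast
qed

lemma DERIV_sqrt_quadratic:
 assumes "A > 0"
 shows "((\<lambda>t. sqrt (A + 2 * t * \<alpha> + t^2)) has_real_derivative \<alpha> / sqrt A) (at 0)"
 using assms by (auto intro!: derivative_eq_intros simp: field_simps)

text \<open>At a minimiser the derivative of the optical length along each tangential axis vanishes.
  Its two terms are, up to sign, the tangential components of the slowness vectors of the two legs,
  both oriented from \<open>x\<close> to \<open>y\<close> in the statement.\<close>

lemma Snell:
 assumes pos: "gp > 0" "gm > 0" and x: "x $ 3 \<noteq> 0" and y: "y $ 3 \<noteq> 0"
  and min: "\<And>z'. optical_length gp gm x y z \<le> optical_length gp gm x y z'"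
  and i: "i \<noteq> 3"
 shows "(y - lift0 z) $ i / (dist (lift0 z) y * sqrt gp) = (lift0 z - x) $ i / (dist (lift0 z) x * sqrt gm)"
proof -
 obtain j :: 2 where j: "\<And>t. lift0 (z + t *\<^sub>R axis j 1) = lift0 z + t *\<^sub>R axis i 1"
 proof (cases "i = 1")
  case True
  then have "lift0 (z + t *\<^sub>R axis 1 1) = lift0 z + t *\<^sub>R axis i 1" for t by (simp add: vec_eq_iff forall_3 axis_def)
  then show thesis using that by blast
 next
  case False
  with i have "i = 2" using exhaust_3[of i] by auto
  then have "lift0 (z + t *\<^sub>R axis 2 1) = lift0 z + t *\<^sub>R axis i 1" for t by (simp add: vec_eq_iff forall_3 axis_def)
  then show thesis using that by blast
 qed
 have d: "dist (lift0 z + t *\<^sub>R axis i 1) w = sqrt ((dist (lift0 z) w)^2 + 2 * t * (lift0 z - w) $ i + t^2)" for t w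
 proof -
  have "(norm ((lift0 z - w) + t *\<^sub>R axis i 1))^2 = (norm (lift0 z - w))^2 + 2 * t * (lift0 z - w) $ i + t^2"
   unfolding power2_norm_eq_inner by (simp add: inner_axis inner_axis' algebra_simps power2_eq_square inner_axis_axis)
  moreover have "dist (lift0 z + t *\<^sub>R axis i 1) w = norm ((lift0 z - w) + t *\<^sub>R axis i 1)" by (simp add: dist_norm algebra_simps)
  ultimately show ?thesis by (metis dist_norm norm_ge_zero real_sqrt_unique)
 qed
 have p: "dist (lift0 z) x > 0" "dist (lift0 z) y > 0" using x y by (auto simp: vec_eq_iff forall_3)
 let ?g = "\<lambda>t. optical_length gp gm x y (z + t *\<^sub>R axis j 1)"
 have "(?g has_real_derivative (lift0 z - x) $ i / dist (lift0 z) x / sqrt gm + (lift0 z - y) $ i / dist (lift0 z) y / sqrt gp) (at 0)"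
  unfolding optical_length_lift0 j d using DERIV_sqrt_quadratic[of "(dist (lift0 z) x)^2" "(lift0 z - x) $ i"]
   DERIV_sqrt_quadratic[of "(dist (lift0 z) y)^2" "(lift0 z - y) $ i"] p by (intro DERIV_add DERIV_cdivide) simp_all
 then have "(lift0 z - x) $ i / dist (lift0 z) x / sqrt gm + (lift0 z - y) $ i / dist (lift0 z) y / sqrt gp = 0"
  by (rule DERIV_local_min[where d = 1]) (use min in auto)
 moreover have "(lift0 z - y) $ i / dist (lift0 z) y / sqrt gp = - ((y - lift0 z) $ i / (dist (lift0 z) y * sqrt gp))"
  by (simp add: minus_divide_left)
 moreover have "(lift0 z - x) $ i / dist (lift0 z) x / sqrt gm = (lift0 z - x) $ i / (dist (lift0 z) x * sqrt gm)" by simp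
 ultimately show ?thesis by linarith
qed

text \<open>Linear in each half space with slowness \<open>a\<close> above and \<open>b\<close>
  below, vanishing at the point of refraction. The tangential part uses \<open>a\<close> on both
  sides, which makes continuity automatic; equality of the first two components of \<open>a\<close>
  and \<open>b\<close> is what makes \<open>b\<close> the gradient below.\<close>

definition plane_phase :: "space \<Rightarrow> space \<Rightarrow> real^2 \<Rightarrow> space \<Rightarrow> real" where
 "plane_phase a b z x = a$1 * (x$1 - z$1) + a$2 * (x$2 - z$2) + (if x$3 > 0 then a$3 else b$3) * x$3"

definition plane_phase_grad :: "space \<Rightarrow> space \<Rightarrow> space \<Rightarrow> space" where
 "plane_phase_grad a b x = (if x$3 > 0 then a else b)"

lemma plane_phase_eq:
 assumes "a$1 = b$1" "a$2 = b$2"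
 shows "plane_phase a b z x = plane_phase_grad a b x \<bullet> (x - lift0 z)"
 using assms by (simp add: plane_phase_def plane_phase_grad_def inner_vec_def sum_3)

lemma plane_phase_lipschitz:
 assumes ab: "a$1 = b$1" "a$2 = b$2" and n: "norm a \<le> C" "norm b \<le> C"
 shows "\<bar>plane_phase a b z (x + h *\<^sub>R axis i 1) - plane_phase a b z x\<bar> \<le> C * \<bar>h\<bar>"
proof -
 have c: "\<bar>a$j\<bar> \<le> C" "\<bar>b$j\<bar> \<le> C" for j using component_le_norm_cart[of a j] component_le_norm_cart[of b j] n by linarith+
 have lin: "\<bar>k * h\<bar> \<le> C * \<bar>h\<bar>" if "\<bar>k\<bar> \<le> C" for k unfolding abs_mult using that by (intro mult_right_mono) auto
 consider "i = 1" | "i = 2" | "i = 3" using exhaust_3 by blast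
 then show ?thesis
 proof cases
  case 1
  then show ?thesis using lin[OF c(1)[of 1]] by (simp add: plane_phase_def axis_def algebra_simps)
 next
  case 2
  then show ?thesis using lin[OF c(1)[of 2]] by (simp add: plane_phase_def axis_def algebra_simps)
 next
  case 3
  have key: "\<bar>(if s > 0 then a$3 else b$3) * s - (if t > 0 then a$3 else b$3) * t\<bar> \<le> C * (s - t)" if "t \<le> s" for s t :: real
  proof -
   consider "t > 0" | "s \<le> 0" | "t \<le> 0" "s > 0" by linarith
   then show ?thesis
   proof cases
    case 1
    have "\<bar>a$3\<bar> * (s - t) \<le> C * (s - t)" using that c by (intro mult_right_mono) auto
    then show ?thesis using 1 that by (simp add: right_diff_distrib[symmetric] abs_mult)
   next
    case 2
    have "\<bar>b$3\<bar> * (s - t) \<le> C * (s - t)" using that c by (intro mult_right_mono) auto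
    then show ?thesis using 2 that by (simp add: right_diff_distrib[symmetric] abs_mult)
   next
    case 3
    have "\<bar>a$3 * s - b$3 * t\<bar> \<le> \<bar>a$3\<bar> * s + \<bar>b$3\<bar> * (- t)" using 3 abs_triangle_ineq4[of "a$3 * s" "b$3 * t"] by (simp add: abs_mult)
    also have "\<dots> \<le> C * s + C * (- t)" using 3 c by (intro add_mono mult_right_mono) auto
    finally show ?thesis using 3 by (simp add: right_diff_distrib)
   qed
  qed
  have "\<bar>(if s > 0 then a$3 else b$3) * s - (if t > 0 then a$3 else b$3) * t\<bar> \<le> C * \<bar>s - t\<bar>" for s t :: real
   using key[of s t] key[of t s] by (cases "t \<le> s") (auto simp: abs_minus_commute)
  from this[of "x$3 + h" "x$3"] show ?thesis using 3 by (simp add: plane_phase_def axis_def)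
 qed
qed

lemma AE_third_coordinate: "AE x::space in lebesgue. x $ 3 \<noteq> 0"
proof -
 have "negligible {x::space. x $ 3 = 0}" using negligible_hyperplane[of "axis 3 1 :: space" 0] by (simp add: inner_axis')
 then show ?thesis by (auto simp: negligible_iff_null_sets eventually_ae_filter)
qed

lemma plane_phase_DERIV:
 assumes ab: "a$1 = b$1" "a$2 = b$2" and x: "x $ 3 \<noteq> 0"
 shows "((\<lambda>s. plane_phase a b z (x + s *\<^sub>R axis i 1)) has_real_derivative plane_phase_grad a b x $ i) (at 0)"
proof -
 define k where "k = plane_phase_grad a b x"
 have lin: "((\<lambda>s. k \<bullet> ((x + s *\<^sub>R axis i 1) - lift0 z)) has_real_derivative k $ i) (at 0)"
  by (auto intro!: derivative_eq_intros simp: inner_diff_right inner_add_right inner_axis)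
 define S where "S = (if x $ 3 > 0 then {s. (x + s *\<^sub>R axis i 1) $ 3 > 0} else {s. (x + s *\<^sub>R axis i 1) $ 3 < 0})"
 have "open {s. (x + s *\<^sub>R axis i 1) $ 3 > 0}" "open {s. (x + s *\<^sub>R axis i 1) $ 3 < 0}" by (intro open_Collect_less continuous_intros)+
 then have "open S" by (simp add: S_def)
 moreover have "0 \<in> S" using x by (simp add: S_def)
 moreover have "k \<bullet> ((x + s *\<^sub>R axis i 1) - lift0 z) = plane_phase a b z (x + s *\<^sub>R axis i 1)" if "s \<in> S" for s
 proof -
  have "(x + s *\<^sub>R axis i 1) $ 3 > 0 \<longleftrightarrow> x $ 3 > 0"
  proof (cases "x $ 3 > 0")
   case True
   then have "s \<in> {s. (x + s *\<^sub>R axis i 1) $ 3 > 0}" using that by (simp only: S_def if_True)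
   with True show ?thesis by (simp only: mem_Collect_eq)
  next
   case False
   then have "s \<in> {s. (x + s *\<^sub>R axis i 1) $ 3 < 0}" using that by (simp only: S_def if_False)
   with False show ?thesis unfolding mem_Collect_eq by linarith
  qed
  then have "plane_phase_grad a b (x + s *\<^sub>R axis i 1) = k"
   unfolding k_def plane_phase_grad_def by (rule arg_cong[where f = "\<lambda>c. if c then a else b"])
  then show ?thesis by (simp only: plane_phase_eq[OF ab])
 qed
 ultimately show ?thesis unfolding k_def[symmetric]
  using has_field_derivative_transform_within_open[OF lin, of S "\<lambda>s. plane_phase a b z (x + s *\<^sub>R axis i 1)"] by (simp only:)
qed

lemma borel_measurable_plane_phase [measurable]:
 "plane_phase a b z \<in> borel_measurable borel" "(\<lambda>x. plane_phase_grad a b x $ i) \<in> borel_measurable borel"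
proof -
 show "plane_phase a b z \<in> borel_measurable borel" unfolding plane_phase_def[abs_def] by measurable
 have "(\<lambda>x. if x$3 > 0 then a$i else b$i) \<in> borel_measurable (borel :: space measure)" by measurable
 then show "(\<lambda>x. plane_phase_grad a b x $ i) \<in> borel_measurable borel"
  by (simp add: plane_phase_grad_def if_distrib[of "\<lambda>v. v $ i"] cong: if_cong)
qed

text \<open>\<open>a\<close> and \<open>b\<close> are the unit directions of the two legs of a
  shortest path, divided by sqrt gp and sqrt gm. Snell's law matches the tangential components, the
  norms are those of the eikonal equation, and the phase difference between the end points is
  exactly the length of the path. Starting from a minimiser avoids solving for the refracted
  direction, where total reflection would have to be excluded.\<close>

lemma refracted_phase:
 assumes pos: "gp > 0" "gm > 0" and p: "p $ 3 < 0" and y: "y $ 3 > 0"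
 obtains a b z where "a$1 = b$1" "a$2 = b$2" "norm a = 1 / sqrt gp" "norm b = 1 / sqrt gm"
  "plane_phase a b z y - plane_phase a b z p \<ge> optical_distance gp gm p y"
proof -
 obtain z where z: "\<And>z'. optical_length gp gm p y z \<le> optical_length gp gm p y z'"
  using optical_length_attains_inf[OF pos, of p y] by metis
 have d: "dist (lift0 z) p > 0" "dist (lift0 z) y > 0" using p y by (auto simp: vec_eq_iff forall_3)
 define a where "a = (1 / (dist (lift0 z) y * sqrt gp)) *\<^sub>R (y - lift0 z)"
 define b where "b = (1 / (dist (lift0 z) p * sqrt gm)) *\<^sub>R (lift0 z - p)"
 have "a $ i = b $ i" if "i \<noteq> 3" for i using Snell[OF pos _ _ z that] p y by (simp add: a_def b_def)
 then have ab: "a$1 = b$1" "a$2 = b$2" by auto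
 have na: "norm a = 1 / sqrt gp" "norm b = 1 / sqrt gm" using d pos by (auto simp: a_def b_def dist_norm norm_minus_commute abs_mult)
 have "plane_phase a b z y = a \<bullet> (y - lift0 z)" "plane_phase a b z p = b \<bullet> (p - lift0 z)"
  using p y by (auto simp: plane_phase_eq[OF ab] plane_phase_grad_def)
 moreover have "a \<bullet> (y - lift0 z) = dist (lift0 z) y / sqrt gp"
  using d pos by (simp add: a_def dist_norm norm_minus_commute power2_eq_square flip: power2_norm_eq_inner)
 moreover have "b \<bullet> (p - lift0 z) = - (b \<bullet> (lift0 z - p))" by (simp add: inner_diff_right)
 moreover have "b \<bullet> (lift0 z - p) = dist (lift0 z) p / sqrt gm"
  using d pos by (simp add: b_def dist_norm power2_eq_square flip: power2_norm_eq_inner)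
 ultimately have "plane_phase a b z y - plane_phase a b z p = optical_length gp gm p y z" by (simp add: optical_length_lift0)
 then show thesis using that[OF ab na, of z] optical_distance_le[OF pos, of p y z] by simp
qed

section \<open>Upper bound for the gradient\<close>

text \<open>The hypotheses on \<open>N\<close> and \<open>N'\<close> express a Lipschitz bound for
  log N. It passes to 1 / N^2 because 1 - e^{-t} \<le> t, and the lower bound \<open>k\<close> keeps
  the prefactor finite.\<close>

lemma softmin_lipschitz:
 fixes s C k :: real
 assumes k: "k > 0" and C: "C \<ge> 0" and s: "s \<ge> 0"
  and N: "k \<le> N" "k \<le> N'" "N' \<le> exp (s * C * \<bar>h\<bar>) * N" "N \<le> exp (s * C * \<bar>h\<bar>) * N'"
 shows "\<bar>(1 / N')^2 - (1 / N)^2\<bar> \<le> (2 * s * C / k^2) * \<bar>h\<bar>"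
proof -
 define E where "E = exp (s * C * \<bar>h\<bar>)"
 have half: "(1 / N1)^2 - (1 / N2)^2 \<le> (2 * s * C / k^2) * \<bar>h\<bar>"
  if "k \<le> N1" "k \<le> N2" "N2 \<le> E * N1" for N1 N2
 proof -
  have p: "N1 > 0" "N2 > 0" "E > 0" using that k by (auto simp: E_def)
  have "1 / (E * N1) \<le> 1 / N2" using that p by (intro divide_left_mono) auto
  then have "(1 / (E * N1))^2 \<le> (1 / N2)^2" using p by (intro power_mono) auto
  then have "(1 / N1)^2 - (1 / N2)^2 \<le> (1 / N1)^2 * (1 - (1 / E)^2)" by (simp add: power_mult_distrib power_divide algebra_simps)
  also have "\<dots> \<le> (1 / k)^2 * (2 * s * C * \<bar>h\<bar>)"
  proof (rule mult_mono)
   show "(1 / N1)^2 \<le> (1 / k)^2" using that k by (intro power_mono divide_left_mono) auto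
   have "(1 / E)^2 = exp (- (2 * s * C * \<bar>h\<bar>))"
    unfolding E_def by (simp add: exp_minus power2_eq_square divide_inverse exp_add[symmetric] flip: inverse_mult_distrib)
   then show "1 - (1 / E)^2 \<le> 2 * s * C * \<bar>h\<bar>" using exp_ge_add_one_self[of "- (2 * s * C * \<bar>h\<bar>)"] by linarith
   have "1 \<le> E" using s C by (simp add: E_def)
   then have "(1 / E)^2 \<le> 1" using p by (intro power_le_one) auto
   then show "0 \<le> 1 - (1 / E)^2" by simp
  qed simp
  also have "\<dots> = (2 * s * C / k^2) * \<bar>h\<bar>" by (simp add: power_divide)
  finally show ?thesis .
 qed
 show ?thesis using half[of N' N] half[of N N'] N by (simp add: E_def abs_le_iff)
qed

context
 fixes gp gm :: real and D B :: "space set" and f :: "space \<Rightarrow> real"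
 assumes pos: "gp > 0" "gm > 0"
  and D: "D \<noteq> {}" "D \<in> sets lebesgue" "bounded D" "\<And>x. x \<in> D \<Longrightarrow> x $ 3 < 0"
  and B: "B \<noteq> {}" "bounded B" "\<And>x. x \<in> closure B \<Longrightarrow> x $ 3 > 0"
  and f: "square_integrable f" "AE x in lebesgue. x \<notin> closure B \<longrightarrow> f x = 0"
begin

private abbreviation "l \<equiv> optical_set_distance gp gm D B"

text \<open>The weight is the reciprocal of a sum of exponentials, so log W behaves like s times the
  minimum over net points y of the phase differences from x to y. Near \<open>p\<close> all of these
  are at least about \<open>l\<close>, which makes \<open>W\<close> large; each point of the closure
  of \<open>B\<close> is close to some net point, whose phase difference is then small, and
  \<open>W\<close> stays below e^{s \<delta> / sqrt gp}. Every phase has slowness exactly 1 / sqrt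
  \<gamma>0, so s = \<theta> \<tau> gives the eikonal inequality with factor \<theta>.\<close>

private lemma gradient_upper_bound_near_point:
 assumes sol: "layered_solution gp gm \<tau> f v V" and \<tau>: "\<tau> > 0" and \<theta>: "0 < \<theta>" "\<theta> < 1" and \<delta>: "\<delta> > 0"
  and p: "p \<in> D" and Y: "finite Y" "Y \<subseteq> B" "closure B \<subseteq> (\<Union>y\<in>Y. ball y \<delta>)"
 shows "(LI x. (norm (indicator (D \<inter> ball p \<delta>) x *\<^sub>R V x))^2) \<le>
  (1 + real (card Y))^2 * (l2norm f)^2 / (gm * (1 - \<theta>)^2 * \<tau>^2)
   * exp (- 2 * \<tau> * (\<theta> * (l - \<delta> * (1 / sqrt gp + 1 / sqrt gm))))"
proof -
 define s where "s = \<theta> * \<tau>"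
 have s: "s > 0" using \<theta> \<tau> by (simp add: s_def)
 have "\<forall>y\<in>Y. \<exists>a b z. a$1 = b$1 \<and> a$2 = b$2 \<and> norm a = 1 / sqrt gp \<and> norm b = 1 / sqrt gm \<and>
  l \<le> plane_phase a b z y - plane_phase a b z p"
 proof
  fix y assume y: "y \<in> Y"
  then have yB: "y \<in> B" "y $ 3 > 0" using Y(2) B(3) closure_subset by blast+
  obtain a b z where "a$1 = b$1" "a$2 = b$2" "norm a = 1 / sqrt gp" "norm b = 1 / sqrt gm"
   "plane_phase a b z y - plane_phase a b z p \<ge> optical_distance gp gm p y" using refracted_phase[OF pos D(4)[OF p] yB(2)] by metis
  then show "\<exists>a b z. a$1 = b$1 \<and> a$2 = b$2 \<and> norm a = 1 / sqrt gp \<and> norm b = 1 / sqrt gm \<and>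
    l \<le> plane_phase a b z y - plane_phase a b z p" using optical_set_distance_le[OF pos p yB(1)] by (meson order_trans)
 qed
 then obtain a b z where ph: "\<And>y. y \<in> Y \<Longrightarrow> a y$1 = b y$1 \<and> a y$2 = b y$2 \<and> norm (a y) = 1 / sqrt gp \<and> norm (b y) = 1 / sqrt gm \<and>
  l \<le> plane_phase (a y) (b y) (z y) y - plane_phase (a y) (b y) (z y) p" by metis
 define \<psi> where "\<psi> y = plane_phase (a y) (b y) (z y)" for y
 define e where "e y x = exp (- s * (\<psi> y y - \<psi> y x))" for y x
 \<comment> \<open>This term caps the soft minimum at \<open>l\<close>: the weight is then bounded
   by e^{s l} on the whole space, as the energy estimate requires, and near \<open>p\<close> it adds
   only one more term of the size allowed for the others.\<close>
 define k where "k = exp (- s * l)"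
 define N where "N x = k + (\<Sum>y\<in>Y. e y x)" for x
 define W where "W x = 1 / N x" for x
 define g where "g y = plane_phase_grad (a y) (b y)" for y
 define H where "H x = (\<Sum>y\<in>Y. (s * e y x) *\<^sub>R g y x)" for x
 define G where "G x = - (1 / (N x)^2) *\<^sub>R H x" for x
 define C where "C = max (1 / sqrt gp) (1 / sqrt gm)"
 have C: "C > 0" using pos by (simp add: C_def less_max_iff_disj)
 have k: "k > 0" by (simp add: k_def)
 have e: "e y x > 0" for y x by (simp add: e_def)
 have N: "k \<le> N x" "N x > 0" for x
 proof -
  have "0 \<le> (\<Sum>y\<in>Y. e y x)" by (intro sum_nonneg less_imp_le e)
  then show "k \<le> N x" by (simp add: N_def)
  with k show "N x > 0" by linarith
 qed
 have em [measurable]: "e y \<in> borel_measurable borel" for y unfolding e_def[abs_def] \<psi>_def by measurable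
 have Nm [measurable]: "N \<in> borel_measurable borel" unfolding N_def[abs_def] by measurable
 have gm [measurable]: "(\<lambda>x. g y x $ i) \<in> borel_measurable borel" for y i unfolding g_def by measurable
 have ng: "norm (g y x) = 1 / sqrt (gamma0 gp gm x)" if "y \<in> Y" for y x
  using ph[OF that] by (simp add: g_def plane_phase_grad_def gamma0_def)
 have nH: "norm (H x) \<le> s * (N x / sqrt (gamma0 gp gm x))" for x
 proof -
  have "norm (H x) \<le> (\<Sum>y\<in>Y. norm ((s * e y x) *\<^sub>R g y x))" unfolding H_def by (rule norm_sum)
  also have "\<dots> = (\<Sum>y\<in>Y. s * e y x * (1 / sqrt (gamma0 gp gm x)))" using s e ng by (intro sum.cong) (auto simp: abs_mult abs_of_pos)
  also have "\<dots> = s * ((\<Sum>y\<in>Y. e y x) / sqrt (gamma0 gp gm x))" by (simp add: sum_distrib_left sum_divide_distrib)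
  also have "\<dots> \<le> s * (N x / sqrt (gamma0 gp gm x))"
   using s k gamma0_bounds(1)[OF pos, of x] by (intro mult_left_mono divide_right_mono) (auto simp: N_def)
  finally show ?thesis .
 qed
 have nG: "sqrt (gamma0 gp gm x) * norm (G x) \<le> \<theta> * \<tau> * W x" for x
 proof -
  have g0: "sqrt (gamma0 gp gm x) > 0" using gamma0_bounds(1)[OF pos, of x] by simp
  have "sqrt (gamma0 gp gm x) * norm (G x) = (1 / (N x)^2) * (sqrt (gamma0 gp gm x) * norm (H x))" by (simp add: G_def)
  also have "\<dots> \<le> (1 / (N x)^2) * (sqrt (gamma0 gp gm x) * (s * (N x / sqrt (gamma0 gp gm x))))"
   using nH[of x] g0 by (intro mult_left_mono) auto
  also have "\<dots> = s * W x" using g0 N(2)[of x] by (simp add: W_def power2_eq_square)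
  finally show ?thesis by (simp add: s_def)
 qed
 have Wk: "0 < W x" "W x \<le> 1 / k" for x using N[of x] k by (auto simp: W_def intro!: divide_left_mono)
 have gC: "1 / sqrt (gamma0 gp gm x) \<le> C" for x by (simp add: C_def gamma0_def)
 have GL: "\<bar>2 * W x * G x $ i\<bar> \<le> 2 * s * C / k^2" for x i
 proof -
  have g0: "sqrt (gamma0 gp gm x) > 0" using gamma0_bounds(1)[OF pos, of x] by simp
  have "norm (G x) \<le> s * W x * (1 / sqrt (gamma0 gp gm x))" using nG[of x] g0 by (simp add: s_def pos_le_divide_eq mult.commute)
  also have "\<dots> \<le> s * (1 / k) * C" using s Wk[of x] gC[of x] g0 k by (intro mult_mono) auto
  finally have "norm (G x) \<le> s * C / k" by simp
  then have "\<bar>G x $ i\<bar> \<le> s * C / k" using component_le_norm_cart[of "G x" i] by linarith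
  then have "(2 * W x) * \<bar>G x $ i\<bar> \<le> (2 * (1 / k)) * (s * C / k)" using Wk[of x] k by (intro mult_mono) auto
  then show ?thesis using Wk[of x] by (simp add: abs_mult power2_eq_square mult_ac)
 qed
 have lipN: "N (x + h *\<^sub>R axis i 1) \<le> exp (s * C * \<bar>h\<bar>) * N x" for x h i
 proof -
  have "e y (x + h *\<^sub>R axis i 1) \<le> exp (s * C * \<bar>h\<bar>) * e y x" if "y \<in> Y" for y
  proof -
   have "\<bar>\<psi> y (x + h *\<^sub>R axis i 1) - \<psi> y x\<bar> \<le> C * \<bar>h\<bar>"
    unfolding \<psi>_def using ph[OF that] by (intro plane_phase_lipschitz) (auto simp: C_def)
   then have "s * (\<psi> y (x + h *\<^sub>R axis i 1) - \<psi> y x) \<le> s * (C * \<bar>h\<bar>)" using s by (intro mult_left_mono) auto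
   then show ?thesis unfolding e_def exp_add[symmetric] by (simp add: algebra_simps)
  qed
  then have "(\<Sum>y\<in>Y. e y (x + h *\<^sub>R axis i 1)) \<le> exp (s * C * \<bar>h\<bar>) * (\<Sum>y\<in>Y. e y x)" unfolding sum_distrib_left by (rule sum_mono)
  moreover have "1 * k \<le> exp (s * C * \<bar>h\<bar>) * k" using s C k by (intro mult_right_mono) auto
  ultimately show ?thesis by (simp add: N_def distrib_left)
 qed
 have lip: "\<bar>(W (x + h *\<^sub>R axis i 1))^2 - (W x)^2\<bar> \<le> (2 * s * C / k^2) * \<bar>h\<bar>" for x h i unfolding W_def
 proof (rule softmin_lipschitz[OF k less_imp_le[OF C] less_imp_le[OF s] N(1) N(1) lipN])
  show "N x \<le> exp (s * C * \<bar>h\<bar>) * N (x + h *\<^sub>R axis i 1)" using lipN[of "x + h *\<^sub>R axis i 1" "- h" i] by simp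
 qed
 have der: "AE x in lebesgue. ((\<lambda>t. (W (x + t *\<^sub>R axis i 1))^2) has_real_derivative 2 * W x * G x $ i) (at 0)" for i
  using AE_third_coordinate
 proof eventually_elim
  case (elim x)
  have d\<psi>: "((\<lambda>t. \<psi> y (x + t *\<^sub>R axis i 1)) has_real_derivative g y x $ i) (at 0)" if "y \<in> Y" for y
   unfolding \<psi>_def g_def using ph[OF that] elim by (intro plane_phase_DERIV) auto
  have de: "((\<lambda>t. e y (x + t *\<^sub>R axis i 1)) has_real_derivative s * e y x * g y x $ i) (at 0)" if "y \<in> Y" for y
   unfolding e_def by (auto intro!: derivative_eq_intros d\<psi>[OF that])
  have "((\<lambda>t. N (x + t *\<^sub>R axis i 1)) has_real_derivative (\<Sum>y\<in>Y. s * e y x * g y x $ i)) (at 0)"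
   unfolding N_def by (auto intro!: derivative_eq_intros de)
  then have dN: "((\<lambda>t. N (x + t *\<^sub>R axis i 1)) has_real_derivative H x $ i) (at 0)" by (simp add: H_def)
  have "((\<lambda>t. (1 / N (x + t *\<^sub>R axis i 1))^2) has_real_derivative 2 * W x * (- (1 / (N x)^2) * H x $ i)) (at 0)"
   using N(2)[of x] by (auto intro!: derivative_eq_intros dN simp: W_def power2_eq_square)
  then show ?case by (simp add: W_def G_def)
 qed
 have Gm: "(\<lambda>x. G x $ i) \<in> borel_measurable borel" for i unfolding G_def H_def by simp
 have Wm: "W \<in> borel_measurable borel" unfolding W_def[abs_def] by measurable
 note est = weighted_energy_estimate[OF sol pos \<tau> \<theta> f(1) Wm Wk Gm GL lip der nG]
 have g0m: "gamma0 gp gm x = gm" if "x \<in> D" for x using D(4)[OF that] by (simp add: gamma0_def)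
 note sqV = has_gradientD(2)[OF layered_solutionD(1)[OF sol]]
 define w where "w = 1 / ((1 + real (card Y)) * exp (- s * (l - \<delta> / sqrt gm)))"
 have w: "w > 0" by (simp add: w_def add_pos_nonneg)
 have Wlow: "w \<le> W x" if "x \<in> D \<inter> ball p \<delta>" for x
 proof -
  have le: "e y x \<le> exp (- s * (l - \<delta> / sqrt gm))" if y: "y \<in> Y" for y
  proof -
   have ab: "a y$1 = b y$1" "a y$2 = b y$2" using ph[OF y] by auto
   have "\<psi> y x - \<psi> y p = b y \<bullet> (x - p)" using D(4)[of x] D(4)[OF p] \<open>x \<in> D \<inter> ball p \<delta>\<close>
    by (simp add: \<psi>_def plane_phase_eq[OF ab] plane_phase_grad_def inner_diff_right)
   also have "\<dots> \<le> norm (b y) * norm (x - p)" by (rule norm_cauchy_schwarz)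
   also have "\<dots> \<le> 1 / sqrt gm * \<delta>" using ph[OF y] pos \<open>x \<in> D \<inter> ball p \<delta>\<close> by (intro mult_mono) (auto simp: dist_norm norm_minus_commute)
   finally have "\<psi> y x - \<psi> y p \<le> \<delta> / sqrt gm" by simp
   moreover have "l \<le> \<psi> y y - \<psi> y p" using ph[OF y] by (simp add: \<psi>_def)
   ultimately have "l - \<delta> / sqrt gm \<le> \<psi> y y - \<psi> y x" by linarith
   then show ?thesis using s by (simp add: e_def)
  qed
  have "k \<le> exp (- s * (l - \<delta> / sqrt gm))" using s \<delta> pos by (simp add: k_def)
  moreover have "(\<Sum>y\<in>Y. e y x) \<le> real (card Y) * exp (- s * (l - \<delta> / sqrt gm))" using sum_bounded_above[of Y "\<lambda>y. e y x"] le by simp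
  ultimately have "N x \<le> (1 + real (card Y)) * exp (- s * (l - \<delta> / sqrt gm))" by (simp add: N_def distrib_right)
  then show ?thesis unfolding w_def W_def using N(2)[of x] by (intro divide_left_mono) (auto simp: add_pos_nonneg)
 qed
 have Wup: "W x \<le> exp (s * (\<delta> / sqrt gp))" if x: "x \<in> closure B" for x
 proof -
  obtain y where y: "y \<in> Y" "dist y x < \<delta>" using Y(3) x by auto
  have ab: "a y$1 = b y$1" "a y$2 = b y$2" using ph[OF y(1)] by auto
  have "y \<in> closure B" using y Y(2) closure_subset by blast
  then have "\<psi> y y - \<psi> y x = a y \<bullet> (y - x)" using B(3)[of x] B(3)[of y] x
   by (simp add: \<psi>_def plane_phase_eq[OF ab] plane_phase_grad_def inner_diff_right)
  also have "\<dots> \<le> norm (a y) * norm (y - x)" by (rule norm_cauchy_schwarz)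
  also have "\<dots> \<le> 1 / sqrt gp * \<delta>" using ph[OF y(1)] pos y(2) by (intro mult_mono) (auto simp: dist_norm)
  finally have "\<psi> y y - \<psi> y x \<le> \<delta> / sqrt gp" by simp
  from mult_left_mono[OF this less_imp_le[OF s]]
  have "exp (- (s * (\<delta> / sqrt gp))) \<le> e y x" by (simp add: e_def)
  also have "\<dots> \<le> (\<Sum>y\<in>Y. e y x)" using Y(1) y(1) e by (intro member_le_sum) (auto intro: less_imp_le)
  also have "\<dots> \<le> N x" using k by (simp add: N_def)
  finally have "1 / N x \<le> 1 / exp (- (s * (\<delta> / sqrt gp)))" using N(2)[of x] by (intro divide_left_mono) auto
  then show ?thesis by (simp add: W_def exp_minus inverse_eq_divide)
 qed
 have rest: "square_integrable (\<lambda>x. indicator (D \<inter> ball p \<delta>) x *\<^sub>R V x)" using D(2) sqV by (intro square_integrable_restrict) auto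
 have "w^2 * gm * (LI x. (norm (indicator (D \<inter> ball p \<delta>) x *\<^sub>R V x))^2) =
   (LI x. w^2 * gm * (norm (indicator (D \<inter> ball p \<delta>) x *\<^sub>R V x))^2)" by simp
 also have "\<dots> \<le> (LI x. (W x)^2 * (gamma0 gp gm x * (norm (V x))^2))"
 proof (rule integral_mono[OF _ est(2)])
  show "integrable lebesgue (\<lambda>x. w^2 * gm * (norm (indicator (D \<inter> ball p \<delta>) x *\<^sub>R V x))^2)" using square_integrableD(2)[OF rest] by simp
  show "w^2 * gm * (norm (indicator (D \<inter> ball p \<delta>) x *\<^sub>R V x))^2 \<le> (W x)^2 * (gamma0 gp gm x * (norm (V x))^2)" for x
  proof (cases "x \<in> D \<inter> ball p \<delta>")
   case True
   then have "w^2 * (gm * (norm (V x))^2) \<le> (W x)^2 * (gm * (norm (V x))^2)"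
    using Wlow[OF True] w pos by (intro mult_right_mono power_mono) auto
   then show ?thesis using True g0m[of x] by (simp add: mult.assoc)
  next
   case False
   then show ?thesis using gamma0_bounds(1)[OF pos, of x] by (simp add: less_imp_le)
  qed
 qed
 finally have 1: "w^2 * gm * (LI x. (norm (indicator (D \<inter> ball p \<delta>) x *\<^sub>R V x))^2) \<le>
  (LI x. (W x)^2 * (gamma0 gp gm x * (norm (V x))^2))" .
 have "(LI x. (W x * f x)^2) \<le> (LI x. (exp (s * (\<delta> / sqrt gp)))^2 * (norm (f x))^2)"
 proof (rule integral_mono_AE')
  show "integrable lebesgue (\<lambda>x. (exp (s * (\<delta> / sqrt gp)))^2 * (norm (f x))^2)" using square_integrableD(2)[OF f(1)] by simp
  show "AE x in lebesgue. (W x * f x)^2 \<le> (exp (s * (\<delta> / sqrt gp)))^2 * (norm (f x))^2" using f(2)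
  proof eventually_elim
   case (elim x)
   show ?case
   proof (cases "x \<in> closure B")
    case True
    then have "(W x)^2 * (f x)^2 \<le> (exp (s * (\<delta> / sqrt gp)))^2 * (f x)^2"
     using Wup Wk(1)[of x] by (intro mult_right_mono power_mono) (auto intro: less_imp_le)
    then show ?thesis by (simp add: power_mult_distrib)
   qed (use elim in simp)
  qed
 qed simp
 also have "\<dots> = (exp (s * (\<delta> / sqrt gp)))^2 * (l2norm f)^2" by (simp add: l2norm_power2)
 finally have 2: "(LI x. (W x * f x)^2) \<le> (exp (s * (\<delta> / sqrt gp)))^2 * (l2norm f)^2" .
 let ?J = "LI x. (norm (indicator (D \<inter> ball p \<delta>) x *\<^sub>R V x))^2"
 define q where "q = (1 - \<theta>)^2 * \<tau>^2"
 have q: "q > 0" using \<theta> \<tau> by (simp add: q_def)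
 have "q * (w^2 * gm * ?J) \<le> q * (LI x. (W x)^2 * (gamma0 gp gm x * (norm (V x))^2))" using 1 q by (intro mult_left_mono) auto
 also have "\<dots> \<le> (exp (s * (\<delta> / sqrt gp)))^2 * (l2norm f)^2" using est(1) 2 by (simp add: q_def)
 finally have "?J * (q * w^2 * gm) \<le> (exp (s * (\<delta> / sqrt gp)))^2 * (l2norm f)^2" by (simp add: mult_ac)
 moreover have "q * w^2 * gm > 0" using q w pos by simp
 ultimately have "?J \<le> (exp (s * (\<delta> / sqrt gp)))^2 * (l2norm f)^2 / (q * w^2 * gm)" by (simp only: pos_le_divide_eq)
 also have "\<dots> = (l2norm f)^2 / (q * gm) * ((exp (s * (\<delta> / sqrt gp)))^2 * (1 / w)^2)" by (simp add: power_divide mult_ac)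
 also have "(exp (s * (\<delta> / sqrt gp)))^2 * (1 / w)^2 = (1 + real (card Y))^2 * (exp (s * (\<delta> / sqrt gp)) * exp (- s * (l - \<delta> / sqrt gm)))^2"
  by (simp add: w_def power_mult_distrib)
 also have "exp (s * (\<delta> / sqrt gp)) * exp (- s * (l - \<delta> / sqrt gm)) = exp (- s * (l - \<delta> * (1 / sqrt gp + 1 / sqrt gm)))"
  unfolding exp_add[symmetric] by (simp add: algebra_simps)
 also have "(exp (- s * (l - \<delta> * (1 / sqrt gp + 1 / sqrt gm))))^2 = exp (- 2 * \<tau> * (\<theta> * (l - \<delta> * (1 / sqrt gp + 1 / sqrt gm))))"
  unfolding power2_eq_square exp_add[symmetric] by (simp add: s_def algebra_simps)
 finally show ?thesis by (simp add: q_def mult_ac)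
qed

lemma gradient_upper_bound:
 assumes \<epsilon>: "\<epsilon> > 0"
 obtains K where "K > 0" "\<And>\<tau> v V. \<tau> \<ge> 1 \<Longrightarrow> layered_solution gp gm \<tau> f v V \<Longrightarrow>
  (l2norm (\<lambda>x. indicator D x *\<^sub>R V x))^2 \<le> K * exp (- 2 * \<tau> * (l - \<epsilon>))"
proof -
 have l0: "l \<ge> 0" by (rule optical_set_distance_nonneg[OF pos D(1) B(1)])
 define \<sigma> where "\<sigma> = 1 / sqrt gp + 1 / sqrt gm"
 have \<sigma>: "\<sigma> > 0" using pos by (simp add: \<sigma>_def add_pos_pos)
 \<comment> \<open>Half of \<epsilon> pays for the mesh size of the nets, through \<delta> \<sigma>,
   and half for the factor \<theta> = 1 - \<eta>, through \<eta> l. The cap 1 / 2 keeps \<theta>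
   positive, and l + 1 avoids dividing by l = 0.\<close>
 define \<delta> where "\<delta> = \<epsilon> / (2 * \<sigma>)"
 have \<delta>: "\<delta> > 0" "\<delta> * \<sigma> = \<epsilon> / 2" using \<epsilon> \<sigma> by (auto simp: \<delta>_def)
 define \<eta> where "\<eta> = min (1 / 2) (\<epsilon> / (2 * (l + 1)))"
 have \<eta>: "0 < \<eta>" "\<eta> < 1" using \<epsilon> l0 by (auto simp: \<eta>_def min_less_iff_disj)
 have \<eta>l: "\<eta> * l \<le> \<epsilon> / 2"
 proof -
  have "\<eta> * l \<le> \<epsilon> / (2 * (l + 1)) * (l + 1)" using l0 \<eta> \<epsilon> by (intro mult_mono) (auto simp: \<eta>_def)
  also have "\<dots> = \<epsilon> / 2" using l0 by (simp add: field_simps add_nonneg_eq_0_iff)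
  finally show ?thesis .
 qed
 define \<theta> where "\<theta> = 1 - \<eta>"
 have \<theta>: "0 < \<theta>" "\<theta> < 1" using \<eta> by (auto simp: \<theta>_def)
 have expo: "l - \<epsilon> \<le> \<theta> * (l - \<delta> * \<sigma>)"
 proof -
  have "\<theta> * (l - \<delta> * \<sigma>) = l - \<epsilon> / 2 - \<eta> * l + \<eta> * (\<epsilon> / 2)" unfolding \<theta>_def \<delta>(2) by (simp add: field_simps)
  moreover have "0 \<le> \<eta> * (\<epsilon> / 2)" using \<eta> \<epsilon> by simp
  ultimately show ?thesis using \<eta>l by linarith
 qed
 have net: "\<exists>Y. finite Y \<and> Y \<subseteq> S \<and> closure S \<subseteq> (\<Union>y\<in>Y. ball y \<delta>)" if "bounded S" for S :: "space set"
 proof -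
  have "closure S \<subseteq> (\<Union>y\<in>S. ball y \<delta>)" using \<delta>(1) by (auto simp: closure_approachable dist_commute)
  moreover have "compact (closure S)" using that by simp
  ultimately obtain Y where "Y \<subseteq> S" "finite Y" "closure S \<subseteq> (\<Union>y\<in>Y. ball y \<delta>)"
   using compactE_image[of "closure S" S "\<lambda>y. ball y \<delta>"] by auto
  then show ?thesis by blast
 qed
 \<comment> \<open>Both nets depend on \<epsilon> but neither on \<tau> nor on the solution, so the
   final constant is uniform.\<close>
 obtain Y where Y: "finite Y" "Y \<subseteq> B" "closure B \<subseteq> (\<Union>y\<in>Y. ball y \<delta>)" using net[OF B(2)] by blast
 obtain P where P: "finite P" "P \<subseteq> D" "closure D \<subseteq> (\<Union>y\<in>P. ball y \<delta>)" using net[OF D(3)] by blast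
 define K0 where "K0 = (1 + real (card Y))^2 * (l2norm f)^2 / (gm * (1 - \<theta>)^2)"
 have K0: "K0 \<ge> 0" using pos by (simp add: K0_def)
 show thesis
 proof (rule that[of "real (card P) * K0 + 1"])
  show "real (card P) * K0 + 1 > 0" using K0 by (intro add_nonneg_pos mult_nonneg_nonneg) auto
  fix \<tau> v V assume \<tau>: "\<tau> \<ge> 1" and sol: "layered_solution gp gm \<tau> f v V"
  let ?E = "exp (- 2 * \<tau> * (l - \<epsilon>))"
  let ?J = "\<lambda>p. LI x. (norm (indicator (D \<inter> ball p \<delta>) x *\<^sub>R V x))^2"
  note sqV = has_gradientD(2)[OF layered_solutionD(1)[OF sol]]
  have sqr: "square_integrable (\<lambda>x. indicator (D \<inter> ball p \<delta>) x *\<^sub>R V x)" for p using D(2) sqV by (intro square_integrable_restrict) auto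
  have J: "?J p \<le> K0 * ?E" if "p \<in> P" for p
  proof -
   have "p \<in> D" using that P(2) by blast
   have "?J p \<le> (1 + real (card Y))^2 * (l2norm f)^2 / (gm * (1 - \<theta>)^2 * \<tau>^2) * exp (- 2 * \<tau> * (\<theta> * (l - \<delta> * \<sigma>)))"
    unfolding \<sigma>_def using \<tau> by (intro gradient_upper_bound_near_point[OF sol _ \<theta> \<delta>(1) \<open>p \<in> D\<close> Y]) auto
   also have "\<dots> \<le> K0 * ?E"
   proof (rule mult_mono)
    have "gm * (1 - \<theta>)^2 * 1 \<le> gm * (1 - \<theta>)^2 * \<tau>^2" using \<tau> pos by (intro mult_left_mono one_le_power) auto
    then show "(1 + real (card Y))^2 * (l2norm f)^2 / (gm * (1 - \<theta>)^2 * \<tau>^2) \<le> K0"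
     unfolding K0_def using pos \<theta> \<tau> by (intro divide_left_mono) auto
    show "exp (- 2 * \<tau> * (\<theta> * (l - \<delta> * \<sigma>))) \<le> ?E" using expo \<tau> by simp
   qed (use K0 in auto)
   finally show ?thesis .
  qed
  have "(l2norm (\<lambda>x. indicator D x *\<^sub>R V x))^2 \<le> (LI x. (\<Sum>p\<in>P. (norm (indicator (D \<inter> ball p \<delta>) x *\<^sub>R V x))^2))" unfolding l2norm_power2
  proof (rule integral_mono)
   show "integrable lebesgue (\<lambda>x. (norm (indicator D x *\<^sub>R V x))^2)"
    by (rule square_integrableD(2)[OF square_integrable_restrict[OF D(2) sqV]])
   show "integrable lebesgue (\<lambda>x. \<Sum>p\<in>P. (norm (indicator (D \<inter> ball p \<delta>) x *\<^sub>R V x))^2)"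
    by (intro Bochner_Integration.integrable_sum square_integrableD(2)[OF sqr])
   show "(norm (indicator D x *\<^sub>R V x))^2 \<le> (\<Sum>p\<in>P. (norm (indicator (D \<inter> ball p \<delta>) x *\<^sub>R V x))^2)" for x
   proof (cases "x \<in> D")
    case True
    then obtain p where p: "p \<in> P" "x \<in> ball p \<delta>" using P(3) closure_subset[of D] by blast
    then have "(norm (indicator D x *\<^sub>R V x))^2 = (norm (indicator (D \<inter> ball p \<delta>) x *\<^sub>R V x))^2" using True by simp
    also have "\<dots> \<le> (\<Sum>p\<in>P. (norm (indicator (D \<inter> ball p \<delta>) x *\<^sub>R V x))^2)" using P(1) p(1) by (intro member_le_sum) auto
    finally show ?thesis .
   qed (simp add: sum_nonneg)
  qed
  also have "\<dots> = (\<Sum>p\<in>P. ?J p)" by (intro Bochner_Integration.integral_sum square_integrableD(2)[OF sqr])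
  also have "\<dots> \<le> real (card P) * (K0 * ?E)" using sum_bounded_above[of P ?J] J by simp
  also have "\<dots> \<le> (real (card P) * K0 + 1) * ?E" by (simp add: distrib_right)
  finally show "(l2norm (\<lambda>x. indicator D x *\<^sub>R V x))^2 \<le> (real (card P) * K0 + 1) * ?E" .
 qed
qed

end

section \<open>Bochner integrals and bounded functionals\<close>

abbreviation time_measure :: "real \<Rightarrow> real measure" where
 "time_measure T \<equiv> lebesgue_on {0<..<T}"

lemma finite_time_measure: "emeasure (time_measure T) (space (time_measure T)) < \<infinity>"
 by (cases "0 \<le> T") (simp_all add: emeasure_restrict_space)

lemma integrable_const_time: "integrable (time_measure T) (\<lambda>t. c :: real)"
 using finite_time_measure[of T] by (intro finite_measure.integrable_const finite_measureI) auto

text \<open>The limit exists only almost everywhere; completeness of Lebesgue measure transfers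
  measurability from the pointwise \<open>lim\<close> to \<open>g\<close>. Extension by 0 reduces
  the restricted measure to the full one.\<close>

lemma borel_measurable_AE_limit:
 fixes g :: "real \<Rightarrow> real"
 assumes m: "\<And>n. G n \<in> borel_measurable (time_measure T)" and lim: "AE t in time_measure T. (\<lambda>n. G n t) \<longlonglongrightarrow> g t"
 shows "g \<in> borel_measurable (time_measure T)"
proof -
 let ?S = "{0<..<T}"
 have S: "?S \<inter> space lebesgue \<in> sets lebesgue" by simp
 have m': "(\<lambda>t. indicator ?S t *\<^sub>R G n t) \<in> borel_measurable lebesgue" for n
  using m[of n] S by (simp only: borel_measurable_restrict_space_iff)
 have "(\<lambda>t. lim (\<lambda>n. indicator ?S t *\<^sub>R G n t)) \<in> borel_measurable lebesgue" by (rule borel_measurable_lim_metric[OF m'])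
 moreover have "AE t in lebesgue. lim (\<lambda>n. indicator ?S t *\<^sub>R G n t) = indicator ?S t *\<^sub>R g t"
 proof -
  have "AE t in lebesgue. t \<in> ?S \<longrightarrow> (\<lambda>n. G n t) \<longlonglongrightarrow> g t" using lim S by (simp add: AE_restrict_space_iff)
  then show ?thesis
  proof eventually_elim
   case (elim t)
   have "(\<lambda>n. indicator ?S t *\<^sub>R G n t) \<longlonglongrightarrow> indicator ?S t *\<^sub>R g t" using elim by (cases "t \<in> ?S") (auto intro: tendsto_scaleR)
   then show ?case by (rule limI)
  qed
 qed
 ultimately have "(\<lambda>t. indicator ?S t *\<^sub>R g t) \<in> borel_measurable lebesgue" by (rule borel_measurable_AE)
 then show ?thesis using S by (simp only: borel_measurable_restrict_space_iff)
qed

lemma sum_lessThan_add: "(\<Sum>k<n + m. g k) = (\<Sum>k<n. g k) + (\<Sum>k<m. g (n + k))" for g :: "nat \<Rightarrow> real" by (induction m) (simp_all add: add.assoc)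

text \<open>The axioms concern the set \<open>X\<close>. In \<open>seminormed_functional\<close> the
  seminorm enters through \<open>l_bound\<close>, so that for the dual of H^1 a bound on evaluations
  suffices; the properties of a seminorm are assumed in \<open>seminormed_norm\<close>, for the
  approximation in H^1.\<close>

locale seminormed =
 fixes X :: "('i \<Rightarrow> real) set" and N :: "('i \<Rightarrow> real) \<Rightarrow> real"
 assumes zero_in: "(\<lambda>i. 0) \<in> X"
  and lincomb_in: "x \<in> X \<Longrightarrow> y \<in> X \<Longrightarrow> (\<lambda>i. a * x i + b * y i) \<in> X"

locale seminormed_functional = seminormed +
 fixes l :: "('i \<Rightarrow> real) \<Rightarrow> real" and C :: real
 assumes l_linear: "x \<in> X \<Longrightarrow> y \<in> X \<Longrightarrow> l (\<lambda>i. a * x i + b * y i) = a * l x + b * l y"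
  and l_bound: "x \<in> X \<Longrightarrow> \<bar>l x\<bar> \<le> C * N x" and C_nonneg: "C \<ge> 0"

context seminormed
begin

lemma diff_in: "x \<in> X \<Longrightarrow> y \<in> X \<Longrightarrow> (\<lambda>i. x i - y i) \<in> X" using lincomb_in[of x y 1 "-1"] by simp

lemma sum_in: "(\<And>k. k < n \<Longrightarrow> a k \<in> X) \<Longrightarrow> (\<lambda>i. \<Sum>k<n. c k * a k i) \<in> X" for n :: nat
proof (induction n)
 case (Suc n)
 then have "(\<lambda>i. \<Sum>k<n. c k * a k i) \<in> X" "a n \<in> X" by auto
 from lincomb_in[OF this, of 1 "c n"] show ?case by simp
qed (simp add: zero_in)

lemma simple_on_in: "simple_on T X s \<Longrightarrow> s t \<in> X"
proof -
 assume "simple_on T X s"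
 then obtain n :: nat and E a where "\<forall>k<n. E k \<in> sets (time_measure T) \<and> a k \<in> X" "s = (\<lambda>t y. \<Sum>k<n. indicator (E k) t * a k y)"
  unfolding simple_on_def by blast
 then show "s t \<in> X" by (simp only: sum_in)
qed

end

context seminormed_functional
begin

lemma l_diff: "x \<in> X \<Longrightarrow> y \<in> X \<Longrightarrow> l (\<lambda>i. x i - y i) = l x - l y" using l_linear[of x y 1 "-1"] by simp

lemma l_diff_bound: "x \<in> X \<Longrightarrow> y \<in> X \<Longrightarrow> \<bar>l x - l y\<bar> \<le> C * N (\<lambda>i. x i - y i)" using l_bound[OF diff_in, of x y] by (simp add: l_diff)

lemma l_sum: "(\<And>k. k < n \<Longrightarrow> a k \<in> X) \<Longrightarrow> l (\<lambda>i. \<Sum>k<n. c k * a k i) = (\<Sum>k<n. c k * l (a k))" for n :: nat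
proof (induction n)
 case 0
 have "l (\<lambda>i. 0) = 0" using l_linear[OF zero_in zero_in, of 0 0] by simp
 then show ?case by simp
next
 case (Suc n)
 then have "(\<lambda>i. \<Sum>k<n. c k * a k i) \<in> X" "a n \<in> X" using sum_in by auto
 from l_linear[OF this, of 1 "c n"] Suc show ?case by simp
qed

text \<open>The weight \<open>m\<close> is carried along so that the same identity yields plain
  integrals and Laplace transforms. The last form exhibits the transform of a simple function as a
  finite combination of elements of \<open>X\<close>, the source of the H^1 approximant used in
  place of w.\<close>

lemma simple_functional_integral:
 fixes n :: nat
 assumes E: "\<And>k. k < n \<Longrightarrow> E k \<in> sets (time_measure T)" "\<And>k. k < n \<Longrightarrow> a k \<in> X"
  and m: "m \<in> borel_measurable (time_measure T)" "\<And>t. \<bar>m t\<bar> \<le> K"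
 defines "s \<equiv> \<lambda>t y. \<Sum>k<n. indicator (E k) t * a k y"
 shows "integrable (time_measure T) (\<lambda>t. m t * l (s t))"
  "(LINT t|time_measure T. m t * l (s t)) = (\<Sum>k<n. (LINT t|time_measure T. m t * indicator (E k) t) * l (a k))"
  "(LINT t|time_measure T. m t * l (s t)) = l (\<lambda>y. \<Sum>k<n. (LINT t|time_measure T. m t * indicator (E k) t) * a k y)"
proof -
 have ls: "l (s t) = (\<Sum>k<n. indicator (E k) t * l (a k))" for t unfolding s_def by (rule l_sum[OF E(2)])
 have i: "integrable (time_measure T) (\<lambda>t. m t * indicator (E k) t)" if "k < n" for k
 proof (rule integrableI_bounded_set[where A = "space (time_measure T)" and B = K])
  show "(\<lambda>t. m t * indicator (E k) t) \<in> borel_measurable (time_measure T)"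
   using E(1)[OF that] m(1) by (intro borel_measurable_times borel_measurable_indicator) auto
  have "0 \<le> K" using m(2)[of 0] by linarith
  then show "AE t in time_measure T. t \<in> space (time_measure T) \<longrightarrow> norm (m t * indicator (E k) t) \<le> K"
   using m(2) by (auto simp: indicator_def)
  show "AE t in time_measure T. t \<notin> space (time_measure T) \<longrightarrow> m t * indicator (E k) t = 0" by (rule AE_I2) simp
 qed (use finite_time_measure in auto)
 have eq: "m t * l (s t) = (\<Sum>k<n. (m t * indicator (E k) t) * l (a k))" for t by (simp only: ls sum_distrib_left mult.assoc)
 show "integrable (time_measure T) (\<lambda>t. m t * l (s t))" unfolding eq using i by (intro Bochner_Integration.integrable_sum) auto
 show *: "(LINT t|time_measure T. m t * l (s t)) = (\<Sum>k<n. (LINT t|time_measure T. m t * indicator (E k) t) * l (a k))"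
  unfolding eq using i by (subst Bochner_Integration.integral_sum) auto
 show "(LINT t|time_measure T. m t * l (s t)) = l (\<lambda>y. \<Sum>k<n. (LINT t|time_measure T. m t * indicator (E k) t) * a k y)"
  unfolding * by (rule l_sum[OF E(2), symmetric])
qed

lemma simple_functional:
 assumes "simple_on T X s" and m: "m \<in> borel_measurable (time_measure T)" "\<And>t. \<bar>m t\<bar> \<le> K"
 shows "\<exists>(n::nat) E a. (\<forall>k<n. E k \<in> sets (time_measure T) \<and> a k \<in> X) \<and>
  s = (\<lambda>t y. \<Sum>k<n. indicator (E k) t * a k y) \<and>
  integrable (time_measure T) (\<lambda>t. m t * l (s t)) \<and>
  (LINT t|time_measure T. m t * l (s t)) = (\<Sum>k<n. (LINT t|time_measure T. m t * indicator (E k) t) * l (a k))"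
proof -
 obtain n :: nat and E a where E: "\<forall>k<n. E k \<in> sets (time_measure T) \<and> a k \<in> X" "s = (\<lambda>t y. \<Sum>k<n. indicator (E k) t * a k y)"
  using assms unfolding simple_on_def by blast
 with simple_functional_integral(1,2)[OF _ _ m, of n E a] show ?thesis by blast
qed

lemma measurable_simple_functional: "simple_on T X s \<Longrightarrow> (\<lambda>t. l (s t)) \<in> borel_measurable (time_measure T)"
 using simple_functional[of T s "\<lambda>_. 1" 1] by auto

lemma measurable_functional:
 assumes "strongly_measurable T X N u"
 shows "(\<lambda>t. l (u t)) \<in> borel_measurable (time_measure T)"
proof -
 obtain s where s: "\<And>n. simple_on T X (s n)" "AE t in time_measure T. (\<lambda>n. N (\<lambda>y. s n t y - u t y)) \<longlonglongrightarrow> 0"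
  and uX: "AE t in time_measure T. u t \<in> X" using assms unfolding strongly_measurable_def by blast
 show ?thesis
 proof (rule borel_measurable_AE_limit)
  show "(\<lambda>t. l (s n t)) \<in> borel_measurable (time_measure T)" for n by (rule measurable_simple_functional[OF s(1)])
  show "AE t in time_measure T. (\<lambda>n. l (s n t)) \<longlonglongrightarrow> l (u t)" using s(2) uX
  proof eventually_elim
   case (elim t)
   have "(\<lambda>n. l (s n t) - l (u t)) \<longlonglongrightarrow> 0"
   proof (rule tendsto_rabs_zero_cancel, rule tendsto_sandwich[OF _ _ tendsto_const])
    show "(\<lambda>n. C * N (\<lambda>y. s n t y - u t y)) \<longlonglongrightarrow> 0" using tendsto_mult_right_zero[OF elim(1)] by simp
    show "\<forall>\<^sub>F n in sequentially. \<bar>l (s n t) - l (u t)\<bar> \<le> C * N (\<lambda>y. s n t y - u t y)"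
     using l_diff_bound[OF simple_on_in[OF s(1)] elim(2)] by simp
   qed simp
   then show ?case by (simp add: LIM_zero_iff)
  qed
 qed
qed

text \<open>Only the inequality between upper integrals is used, so no measurability of \<open>N (s - u)\<close> is needed.\<close>

lemma functional_L1_close:
 assumes u: "strongly_measurable T X N u" and s: "simple_on T X s"
  and m: "m \<in> borel_measurable (time_measure T)" "\<And>t. \<bar>m t\<bar> \<le> 1"
  and fin: "(\<integral>\<^sup>+t. ennreal (N (\<lambda>y. s t y - u t y)) \<partial>time_measure T) < ennreal d" and d: "d \<ge> 0"
 shows "integrable (time_measure T) (\<lambda>t. m t * l (u t))"
  "\<bar>(LINT t|time_measure T. m t * l (s t)) - (LINT t|time_measure T. m t * l (u t))\<bar> \<le> C * d"
proof -
 let ?M = "time_measure T"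
 have uX: "AE t in ?M. u t \<in> X" using u unfolding strongly_measurable_def by blast
 have ims: "integrable ?M (\<lambda>t. m t * l (s t))" using simple_functional[OF s m] by blast
 have um: "(\<lambda>t. m t * l (u t)) \<in> borel_measurable ?M" using measurable_functional[OF u] m(1) by simp
 have sm: "(\<lambda>t. m t * l (s t)) \<in> borel_measurable ?M" using ims by auto
 have pt: "AE t in ?M. \<bar>m t * l (s t) - m t * l (u t)\<bar> \<le> C * N (\<lambda>y. s t y - u t y)" using uX
 proof eventually_elim
  case (elim t)
  note b = l_diff_bound[OF simple_on_in[OF s] elim, of t]
  have "\<bar>m t * l (s t) - m t * l (u t)\<bar> = \<bar>m t\<bar> * \<bar>l (s t) - l (u t)\<bar>" by (simp add: abs_mult flip: right_diff_distrib)
  also have "\<dots> \<le> 1 * (C * N (\<lambda>y. s t y - u t y))" using b m(2)[of t] by (intro mult_mono) auto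
  finally show ?case by simp
 qed
 have le: "(\<integral>\<^sup>+t. ennreal \<bar>m t * l (s t) - m t * l (u t)\<bar> \<partial>?M) \<le> ennreal (C * d)"
 proof (cases "C = 0")
  case True
  with pt have "AE t in ?M. ennreal \<bar>m t * l (s t) - m t * l (u t)\<bar> \<le> 0" by (auto elim!: eventually_mono)
  from nn_integral_mono_AE[OF this] show ?thesis using True by simp
 next
  case False
  then have C: "C > 0" using C_nonneg by simp
  have "(\<integral>\<^sup>+t. ennreal \<bar>m t * l (s t) - m t * l (u t)\<bar> \<partial>?M) = (\<integral>\<^sup>+t. ennreal C * ennreal (\<bar>m t * l (s t) - m t * l (u t)\<bar> / C) \<partial>?M)"
   using C by (intro nn_integral_cong) (simp flip: ennreal_mult)
  also have "\<dots> = ennreal C * (\<integral>\<^sup>+t. ennreal (\<bar>m t * l (s t) - m t * l (u t)\<bar> / C) \<partial>?M)"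
  proof (rule nn_integral_cmult)
   have "(\<lambda>t. \<bar>m t * l (s t) - m t * l (u t)\<bar> / C) \<in> borel_measurable ?M"
    using um sm by (intro borel_measurable_divide borel_measurable_abs borel_measurable_diff) auto
   then show "(\<lambda>t. ennreal (\<bar>m t * l (s t) - m t * l (u t)\<bar> / C)) \<in> borel_measurable ?M" by (rule measurable_compose) simp
  qed
  also have "\<dots> \<le> ennreal C * (\<integral>\<^sup>+t. ennreal (N (\<lambda>y. s t y - u t y)) \<partial>?M)"
  proof (intro mult_left_mono nn_integral_mono_AE)
   show "AE t in ?M. ennreal (\<bar>m t * l (s t) - m t * l (u t)\<bar> / C) \<le> ennreal (N (\<lambda>y. s t y - u t y))"
    using pt by eventually_elim (use C in \<open>auto intro!: ennreal_leI simp: pos_divide_le_eq mult.commute\<close>)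
  qed simp
  also have "\<dots> \<le> ennreal C * ennreal d" using fin by (intro mult_left_mono) auto
  also have "\<dots> = ennreal (C * d)" using C d by (simp add: ennreal_mult)
  finally show ?thesis .
 qed
 have idiff: "integrable ?M (\<lambda>t. m t * l (s t) - m t * l (u t))"
 proof (rule integrableI_bounded)
  show "(\<integral>\<^sup>+t. ennreal (norm (m t * l (s t) - m t * l (u t))) \<partial>?M) < \<infinity>" using le by (auto intro: le_less_trans)
 qed (use sm um in auto)
 from Bochner_Integration.integrable_diff[OF ims idiff] show iu: "integrable ?M (\<lambda>t. m t * l (u t))" by simp
 have "\<bar>(LINT t|?M. m t * l (s t)) - (LINT t|?M. m t * l (u t))\<bar> \<le> (LINT t|?M. \<bar>m t * l (s t) - m t * l (u t)\<bar>)"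
  using integral_abs_bound[of ?M "\<lambda>t. m t * l (s t) - m t * l (u t)"] ims iu by simp
 also have "\<dots> = enn2real (\<integral>\<^sup>+t. ennreal \<bar>m t * l (s t) - m t * l (u t)\<bar> \<partial>?M)" using idiff by (intro integral_eq_nn_integral) auto
 also have "\<dots> \<le> C * d" using le C_nonneg d by (intro enn2real_leI) auto
 finally show "\<bar>(LINT t|?M. m t * l (s t)) - (LINT t|?M. m t * l (u t))\<bar> \<le> C * d" .
qed

text \<open>Both sides are limits of the same integrals of simple functions: the left by closeness
  in L^1, the right by closeness of the integrals in \<open>N\<close>. Through this rule
  vector-valued identities in time become scalar ones.\<close>

lemma Bochner_integral_functional:
 assumes "has_Bochner_integral_on T X N u J"
 shows "integrable (time_measure T) (\<lambda>t. l (u t))" "(LINT t|time_measure T. l (u t)) = l J"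
proof -
 let ?M = "time_measure T"
 obtain s where s: "\<And>n. simple_on T X (s n)"
   "(\<lambda>n. \<integral>\<^sup>+t. ennreal (N (\<lambda>y. s n t y - u t y)) \<partial>?M) \<longlonglongrightarrow> 0"
   "(\<lambda>n. N (\<lambda>y. (LINT t|?M. s n t y) - J y)) \<longlonglongrightarrow> 0"
  and u: "strongly_measurable T X N u" and J: "J \<in> X" using assms unfolding has_Bochner_integral_on_def by blast
 have ev: "\<forall>\<^sub>F n in sequentially. (\<integral>\<^sup>+t. ennreal (N (\<lambda>y. s n t y - u t y)) \<partial>?M) < ennreal d" if "d > 0" for d
  using that by (intro order_tendstoD(2)[OF s(2)]) auto
 have Js: "(\<lambda>y. LINT t|?M. s n t y) \<in> X" "l (\<lambda>y. LINT t|?M. s n t y) = (LINT t|?M. l (s n t))" for n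
 proof -
  have c: "(\<lambda>_. 1) \<in> borel_measurable ?M" "\<bar>1 :: real\<bar> \<le> 1" by auto
  obtain m :: nat and E a where E: "\<And>k. k < m \<Longrightarrow> E k \<in> sets ?M" "\<And>k. k < m \<Longrightarrow> a k \<in> X"
   "s n = (\<lambda>t y. \<Sum>k<m. indicator (E k) t * a k y)"
   "(LINT t|?M. 1 * l (s n t)) = (\<Sum>k<m. (LINT t|?M. 1 * indicator (E k) t) * l (a k))" using simple_functional[OF s(1)[of n] c] by blast
  have i: "integrable ?M (indicator (E k) :: real \<Rightarrow> real)" if "k < m" for k
   by (rule integrable_real_indicator[OF E(1)[OF that] le_less_trans[OF emeasure_space finite_time_measure]])
  have eq: "(\<lambda>y. LINT t|?M. s n t y) = (\<lambda>y. \<Sum>k<m. (LINT t|?M. indicator (E k) t) * a k y)"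
   unfolding E(3) using i by (subst Bochner_Integration.integral_sum) auto
  show "(\<lambda>y. LINT t|?M. s n t y) \<in> X" unfolding eq using E(2) by (rule sum_in)
  show "l (\<lambda>y. LINT t|?M. s n t y) = (LINT t|?M. l (s n t))"
   using l_sum[OF E(2), where c = "\<lambda>k. LINT t|?M. indicator (E k) t"] E(4) unfolding eq by (simp only: mult_1)
 qed
 obtain n0 where "(\<integral>\<^sup>+t. ennreal (N (\<lambda>y. s n0 t y - u t y)) \<partial>?M) < ennreal 1" using ev[of 1] by (auto simp: eventually_sequentially)
 from functional_L1_close(1)[OF u s(1) _ _ this, of "\<lambda>_. 1"]
 show "integrable ?M (\<lambda>t. l (u t))" by simp
 have "(\<lambda>n. LINT t|?M. l (s n t)) \<longlonglongrightarrow> (LINT t|?M. l (u t))"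
 proof (rule LIMSEQ_I)
  fix e :: real assume "e > 0"
  define d where "d = e / (2 * (C + 1))"
  have d: "d > 0" "C * d < e"
  proof -
   show "d > 0" using \<open>e > 0\<close> C_nonneg by (simp add: d_def)
   have "C * d \<le> (C + 1) * d" using \<open>d > 0\<close> by (intro mult_right_mono) auto
   also have "\<dots> = e / 2" using C_nonneg by (simp add: d_def field_simps add_nonneg_eq_0_iff)
   finally show "C * d < e" using \<open>e > 0\<close> by linarith
  qed
  obtain n0 where n0: "\<And>n. n \<ge> n0 \<Longrightarrow> (\<integral>\<^sup>+t. ennreal (N (\<lambda>y. s n t y - u t y)) \<partial>?M) < ennreal d"
   using ev[OF d(1)] by (auto simp: eventually_sequentially)
  have "norm ((LINT t|?M. l (s n t)) - (LINT t|?M. l (u t))) < e" if "n \<ge> n0" for n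
   using functional_L1_close(2)[OF u s(1) _ _ n0[OF that], of "\<lambda>_. 1"] d by simp
  then show "\<exists>n0. \<forall>n\<ge>n0. norm ((LINT t|?M. l (s n t)) - (LINT t|?M. l (u t))) < e" by blast
 qed
 moreover have "(\<lambda>n. LINT t|?M. l (s n t)) \<longlonglongrightarrow> l J"
 proof (rule LIM_zero_cancel, rule tendsto_rabs_zero_cancel, rule tendsto_sandwich[OF _ _ tendsto_const])
  show "(\<lambda>n. C * N (\<lambda>y. (LINT t|?M. s n t y) - J y)) \<longlonglongrightarrow> 0" using tendsto_mult_right_zero[OF s(3)] by simp
  show "\<forall>\<^sub>F n in sequentially. \<bar>(LINT t|?M. l (s n t)) - l J\<bar> \<le> C * N (\<lambda>y. (LINT t|?M. s n t y) - J y)"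
   using l_diff_bound[OF Js(1) J] by (simp add: Js(2))
 qed simp
 ultimately show "(LINT t|?M. l (u t)) = l J" using LIMSEQ_unique by blast
qed

end

section \<open>Approximation by simple functions in $L^1$ in time\<close>

locale seminormed_norm = seminormed +
 assumes N_nonneg: "x \<in> X \<Longrightarrow> 0 \<le> N x"
  and N_triangle: "x \<in> X \<Longrightarrow> y \<in> X \<Longrightarrow> N (\<lambda>i. x i + y i) \<le> N x + N y"
  and N_minus: "x \<in> X \<Longrightarrow> N (\<lambda>i. - x i) = N x"
  and N_zero: "N (\<lambda>i. 0) = 0"
begin

lemma minus_in: "x \<in> X \<Longrightarrow> (\<lambda>i. - x i) \<in> X" using lincomb_in[of x x "-1" 0] by simp

lemma N_diff_le: "x \<in> X \<Longrightarrow> y \<in> X \<Longrightarrow> N (\<lambda>i. x i - y i) \<le> N x + N y" using N_triangle[OF _ minus_in, of x y] N_minus[of y] by simp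

lemma N_diff_commute: "x \<in> X \<Longrightarrow> y \<in> X \<Longrightarrow> N (\<lambda>i. x i - y i) = N (\<lambda>i. y i - x i)" using N_minus[OF diff_in, of x y] by simp

lemma N_reverse_triangle: "x \<in> X \<Longrightarrow> y \<in> X \<Longrightarrow> \<bar>N x - N y\<bar> \<le> N (\<lambda>i. x i - y i)"
 using N_triangle[OF diff_in, of x y y] N_triangle[OF diff_in, of y x x] N_diff_commute[of x y] by simp

text \<open>\<open>N\<close> is not linear, so the sum cannot be treated term by term. Instead the
  simple function takes one value for each set of indices K, on the measurable set of those t that
  lie in exactly the sets \<open>E k\<close> with k in K.\<close>

lemma measurable_norm_simple:
 assumes "simple_on T X s"
 shows "(\<lambda>t. N (s t)) \<in> borel_measurable (time_measure T)"
proof -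
 let ?M = "time_measure T"
 obtain n :: nat and E a where E: "\<forall>k<n. E k \<in> sets ?M \<and> a k \<in> X" "s = (\<lambda>t y. \<Sum>k<n. indicator (E k) t * a k y)"
  using assms unfolding simple_on_def by blast
 define V where "V K = N (\<lambda>y. \<Sum>k<n. indicator K k * a k y)" for K
 define A where "A K = {t \<in> space ?M. \<forall>k\<in>{..<n}. t \<in> E k \<longleftrightarrow> k \<in> K}" for K
 have Am: "A K \<in> sets ?M" for K unfolding A_def
 proof (rule sets.sets_Collect_finite_All)
  fix k assume "k \<in> {..<n}"
  then have Ek: "E k \<in> sets ?M" using E(1) by simp
  then have "{t \<in> space ?M. t \<in> E k \<longleftrightarrow> k \<in> K} = (if k \<in> K then E k else space ?M - E k)" using sets.sets_into_space[OF Ek] by auto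
  then show "{t \<in> space ?M. t \<in> E k \<longleftrightarrow> k \<in> K} \<in> sets ?M" using Ek by auto
 qed simp
 have eq: "N (s t) = (\<Sum>K\<in>Pow {..<n}. V K * indicator (A K) t)" if t: "t \<in> space ?M" for t
 proof -
  define K0 where "K0 = {k. k < n \<and> t \<in> E k}"
  have "t \<in> A K \<longleftrightarrow> K = K0" if "K \<in> Pow {..<n}" for K using that t by (auto simp: A_def K0_def)
  then have "(\<Sum>K\<in>Pow {..<n}. V K * indicator (A K) t) = (\<Sum>K\<in>Pow {..<n}. if K = K0 then V K else 0)"
   by (intro sum.cong) (auto simp: indicator_def)
  also have "\<dots> = V K0" by (subst sum.delta) (auto simp: K0_def)
  also have "\<dots> = N (s t)" unfolding V_def E(2) by (intro arg_cong[where f = N] ext sum.cong) (auto simp: K0_def indicator_def)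
  finally show ?thesis by simp
 qed
 have "(\<lambda>t. \<Sum>K\<in>Pow {..<n}. V K * indicator (A K) t) \<in> borel_measurable ?M"
  using Am by (intro borel_measurable_sum borel_measurable_times borel_measurable_indicator) auto
 then show ?thesis using measurable_cong[of ?M "\<lambda>t. N (s t)" "\<lambda>t. \<Sum>K\<in>Pow {..<n}. V K * indicator (A K) t" borel] eq by simp
qed

lemma simple_on_diff:
 assumes "simple_on T X s" "simple_on T X s'"
 shows "simple_on T X (\<lambda>t y. s t y - s' t y)"
proof -
 let ?M = "time_measure T"
 obtain n :: nat and E a where E: "\<forall>k<n. E k \<in> sets ?M \<and> a k \<in> X" "s = (\<lambda>t y. \<Sum>k<n. indicator (E k) t * a k y)"
  using assms(1) unfolding simple_on_def by blast
 obtain n' :: nat and E' a' where E': "\<forall>k<n'. E' k \<in> sets ?M \<and> a' k \<in> X" "s' = (\<lambda>t y. \<Sum>k<n'. indicator (E' k) t * a' k y)"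
  using assms(2) unfolding simple_on_def by blast
 let ?E = "\<lambda>k. if k < n then E k else E' (k - n)" and ?a = "\<lambda>k. if k < n then a k else (\<lambda>y. - a' (k - n) y)"
 have "(\<Sum>k<n + n'. indicator (?E k) t * ?a k y) = s t y - s' t y" for t y
 proof -
  have "(\<Sum>k<n. indicator (?E k) t * ?a k y) = s t y" unfolding E(2) by (intro sum.cong) auto
  moreover have "(\<Sum>k<n'. indicator (?E (n + k)) t * ?a (n + k) y) = (\<Sum>k<n'. - (indicator (E' k) t * a' k y))" by (intro sum.cong) auto
  moreover have "\<dots> = - s' t y" unfolding E'(2) by (rule sum_negf)
  ultimately show ?thesis unfolding sum_lessThan_add by (simp only: diff_conv_add_uminus)
 qed
 moreover have "\<forall>k<n + n'. ?E k \<in> sets ?M \<and> ?a k \<in> X" using E(1) E'(1) minus_in by auto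
 ultimately show ?thesis unfolding simple_on_def by (intro exI[of _ "n + n'"] exI[of _ ?E] exI[of _ ?a]) auto
qed

lemma simple_on_restrict:
 assumes "simple_on T X s" "A \<in> sets (time_measure T)"
 shows "simple_on T X (\<lambda>t y. indicator A t * s t y)"
proof -
 let ?M = "time_measure T"
 obtain n :: nat and E a where E: "\<forall>k<n. E k \<in> sets ?M \<and> a k \<in> X" "s = (\<lambda>t y. \<Sum>k<n. indicator (E k) t * a k y)"
  using assms(1) unfolding simple_on_def by blast
 have "(\<lambda>t y. indicator A t * s t y) = (\<lambda>t y. \<Sum>k<n. indicator (A \<inter> E k) t * a k y)"
  unfolding E(2) by (simp only: sum_distrib_left indicator_inter_arith mult.assoc)
 moreover have "\<forall>k<n. A \<inter> E k \<in> sets ?M \<and> a k \<in> X" using E(1) assms(2) by auto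
 ultimately show ?thesis unfolding simple_on_def by (intro exI[of _ n] exI[of _ "\<lambda>k. A \<inter> E k"] exI[of _ a]) simp
qed

text \<open>The pointwise approximating sequence has no integrable majorant in general. Setting its
  members to 0 outside \<open>A n\<close>, where their norm is at most 2 |N u| + 1, gives the
  majorant 3 |N u| + 1; at almost every t the truncation is inactive for large n.\<close>

lemma simple_approx_L1:
 assumes u: "u \<in> Bochner_L2 T X N" and d: "d > 0"
 obtains s where "simple_on T X s" "(\<integral>\<^sup>+t. ennreal (N (\<lambda>y. s t y - u t y)) \<partial>time_measure T) < ennreal d"
proof -
 let ?M = "time_measure T"
 obtain s where s: "\<And>n. simple_on T X (s n)" "AE t in ?M. (\<lambda>n. N (\<lambda>y. s n t y - u t y)) \<longlonglongrightarrow> 0"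
  and uX: "AE t in ?M. u t \<in> X"
  and int: "integrable ?M (\<lambda>t. (N (u t))^2)" using u unfolding Bochner_L2_def strongly_measurable_def by blast
 \<comment> \<open>Only the square of the norm is known to be measurable; its root recovers the
   absolute value.\<close>
 have Nu_abs: "(\<lambda>t. \<bar>N (u t)\<bar>) \<in> borel_measurable ?M"
 proof -
  have "(\<lambda>t. sqrt ((N (u t))^2)) \<in> borel_measurable ?M" by (rule measurable_compose[OF borel_measurable_integrable[OF int]])
    (intro borel_measurable_continuous_onI continuous_intros)
  then show ?thesis by simp
 qed
 have iNu: "integrable ?M (\<lambda>t. \<bar>N (u t)\<bar>)"
 proof (rule Bochner_Integration.integrable_bound)
  show "integrable ?M (\<lambda>t. 1 + (N (u t))^2)"
   using int finite_time_measure by (intro Bochner_Integration.integrable_add) (auto intro: integrable_const_time)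
  show "AE t in ?M. norm \<bar>N (u t)\<bar> \<le> norm (1 + (N (u t))^2)" using abs_le_1_plus_square by (intro AE_I2) simp
 qed (rule Nu_abs)
 define A where "A n = {t \<in> space ?M. N (s n t) \<le> 2 * \<bar>N (u t)\<bar> + 1}" for n
 have Am: "A n \<in> sets ?M" for n unfolding A_def using measurable_norm_simple[OF s(1)] Nu_abs by measurable
 define s' where "s' n = (\<lambda>t y. indicator (A n) t * s n t y)" for n
 have s': "simple_on T X (s' n)" for n unfolding s'_def by (rule simple_on_restrict[OF s(1) Am])
 \<comment> \<open>Measurability of the distance to \<open>u\<close> is obtained from distances to
   simple functions, which approach it almost everywhere.\<close>
 have m: "(\<lambda>t. N (\<lambda>y. s' n t y - u t y)) \<in> borel_measurable ?M" for n
 proof (rule borel_measurable_AE_limit)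
  show "(\<lambda>t. N (\<lambda>y. s' n t y - s m t y)) \<in> borel_measurable ?M" for m by (rule measurable_norm_simple[OF simple_on_diff[OF s' s(1)]])
  show "AE t in ?M. (\<lambda>m. N (\<lambda>y. s' n t y - s m t y)) \<longlonglongrightarrow> N (\<lambda>y. s' n t y - u t y)" using s(2) uX
  proof eventually_elim
   case (elim t)
   note in1 = simple_on_in[OF s', of n t] and in2 = simple_on_in[OF s(1), of _ t]
   have "\<bar>N (\<lambda>y. s' n t y - s m t y) - N (\<lambda>y. s' n t y - u t y)\<bar> \<le> N (\<lambda>y. s m t y - u t y)" for m
    using N_reverse_triangle[OF diff_in[OF in1 in2[of m]] diff_in[OF in1 elim(2)]] N_diff_commute[OF in2[of m] elim(2)] by simp
   then have "(\<lambda>m. N (\<lambda>y. s' n t y - s m t y) - N (\<lambda>y. s' n t y - u t y)) \<longlonglongrightarrow> 0"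
    by (intro Lim_null_comparison[OF _ elim(1)] always_eventually allI) simp
   then show ?case by (simp add: LIM_zero_iff)
  qed
 qed
 have "(\<lambda>n. LINT t|?M. N (\<lambda>y. s' n t y - u t y)) \<longlonglongrightarrow> (LINT t|?M. 0)"
 proof (rule integral_dominated_convergence[where w = "\<lambda>t. 3 * \<bar>N (u t)\<bar> + 1"])
  show "integrable ?M (\<lambda>t. 3 * \<bar>N (u t)\<bar> + 1)"
   using iNu finite_time_measure by (intro Bochner_Integration.integrable_add) (auto intro: integrable_const_time)
  show "AE t in ?M. norm (N (\<lambda>y. s' n t y - u t y)) \<le> 3 * \<bar>N (u t)\<bar> + 1" for n using uX
  proof eventually_elim
   case (elim t)
   note in1 = simple_on_in[OF s', of n t]
   have "N (s' n t) \<le> 2 * \<bar>N (u t)\<bar> + 1" by (cases "t \<in> A n") (auto simp: s'_def A_def N_zero)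
   then show ?case using N_diff_le[OF in1 elim] N_nonneg[OF diff_in[OF in1 elim]] by simp
  qed
  show "AE t in ?M. (\<lambda>n. N (\<lambda>y. s' n t y - u t y)) \<longlonglongrightarrow> 0" using s(2) uX AE_space
  proof eventually_elim
   case (elim t)
   have "\<forall>\<^sub>F n in sequentially. N (\<lambda>y. s n t y - u t y) < 1" by (rule order_tendstoD(2)[OF elim(1)]) simp
   then have "\<forall>\<^sub>F n in sequentially. N (\<lambda>y. s n t y - u t y) = N (\<lambda>y. s' n t y - u t y)"
   proof eventually_elim
    case (elim n)
    have "N (s n t) \<le> 2 * \<bar>N (u t)\<bar> + 1"
     using N_reverse_triangle[OF simple_on_in[OF s(1)] \<open>u t \<in> X\<close>, of n t] elim N_nonneg[OF \<open>u t \<in> X\<close>] by linarith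
    then have "t \<in> A n" using \<open>t \<in> space ?M\<close> by (simp add: A_def)
    then show ?case by (simp add: s'_def)
   qed
   then show ?case by (rule Lim_transform_eventually[OF elim(1)])
  qed
 qed (use m in auto)
 then have "\<forall>\<^sub>F n in sequentially. (LINT t|?M. N (\<lambda>y. s' n t y - u t y)) < d" using d by (intro order_tendstoD(2)) auto
 then obtain n where n: "(LINT t|?M. N (\<lambda>y. s' n t y - u t y)) < d" by (auto simp: eventually_sequentially)
 have nn: "AE t in ?M. 0 \<le> N (\<lambda>y. s' n t y - u t y)" using uX by eventually_elim (rule N_nonneg[OF diff_in[OF simple_on_in[OF s']]])
 have "integrable ?M (\<lambda>t. N (\<lambda>y. s' n t y - u t y))"
 proof (rule Bochner_Integration.integrable_bound)
  show "integrable ?M (\<lambda>t. 3 * \<bar>N (u t)\<bar> + 1)"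
   using iNu finite_time_measure by (intro Bochner_Integration.integrable_add) (auto intro: integrable_const_time)
  show "AE t in ?M. norm (N (\<lambda>y. s' n t y - u t y)) \<le> norm (3 * \<bar>N (u t)\<bar> + 1)" using uX
  proof eventually_elim
   case (elim t)
   note in1 = simple_on_in[OF s', of n t]
   have "N (s' n t) \<le> 2 * \<bar>N (u t)\<bar> + 1" by (cases "t \<in> A n") (auto simp: s'_def A_def N_zero)
   then show ?case using N_diff_le[OF in1 elim] N_nonneg[OF diff_in[OF in1 elim]] by simp
  qed
 qed (rule m)
 from nn_integral_eq_integral[OF this nn]
 have "(\<integral>\<^sup>+t. ennreal (N (\<lambda>y. s' n t y - u t y)) \<partial>?M) < ennreal d" using n d by (simp add: ennreal_lessI)
 with s' that show thesis by blast
qed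

end

context seminormed_functional
begin

lemma functional_integrable:
 assumes "u \<in> Bochner_L2 T X N"
 shows "integrable (time_measure T) (\<lambda>t. l (u t))"
proof (rule Bochner_Integration.integrable_bound)
 have u: "strongly_measurable T X N u" "integrable (time_measure T) (\<lambda>t. (N (u t))^2)" using assms by (auto simp: Bochner_L2_def)
 then show "integrable (time_measure T) (\<lambda>t. C * (1 + (N (u t))^2))"
  using integrable_const_time by (intro integrable_mult_right Bochner_Integration.integrable_add) auto
 show "(\<lambda>t. l (u t)) \<in> borel_measurable (time_measure T)" by (rule measurable_functional[OF u(1)])
 have "AE t in time_measure T. u t \<in> X" using u(1) unfolding strongly_measurable_def by blast
 then show "AE t in time_measure T. norm (l (u t)) \<le> norm (C * (1 + (N (u t))^2))"
 proof eventually_elim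
  case (elim t)
  have "\<bar>l (u t)\<bar> \<le> C * (1 + (N (u t))^2)" using l_bound[OF elim] mult_left_mono[OF abs_le_1_plus_square C_nonneg, of "N (u t)"]
    mult_left_mono[OF abs_ge_self C_nonneg, of "N (u t)"] by linarith
  then show ?case by simp
 qed
qed

text \<open>The homogeneity \<open>hom\<close> is asked for all functions, not just for those in
  \<open>X\<close>: the values of \<open>u\<close> and \<open>v\<close> are in \<open>X\<close> at
  most almost everywhere, and scalars can then be pulled out without exceptional sets.\<close>

lemma weak_time_derivative_functional:
 assumes d: "has_weak_time_derivative T X N u v" and \<psi>: "\<psi> \<in> test_functions {0<..<T}"
  and hom: "\<And>c x. l (\<lambda>i. c * x i) = c * l x"
 shows "(LINT t|time_measure T. deriv \<psi> t * l (u t)) = - (LINT t|time_measure T. \<psi> t * l (v t))"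
proof -
 obtain J where J: "has_Bochner_integral_on T X N (\<lambda>t y. deriv \<psi> t * u t y) J"
  "has_Bochner_integral_on T X N (\<lambda>t y. - (\<psi> t * v t y)) J" using d \<psi> unfolding has_weak_time_derivative_def by blast
 have neg: "l (\<lambda>y. - (\<psi> t * v t y)) = - (\<psi> t * l (v t))" for t using hom[of "- \<psi> t" "v t"] by simp
 show ?thesis using Bochner_integral_functional(2)[OF J(1)] Bochner_integral_functional(2)[OF J(2)] unfolding hom neg by simp
qed

text \<open>The continuous representative is determined only up to seminorm 0. A bounded functional
  does not see such differences, so pairing with it yields an ordinary continuous function of time
  with the prescribed initial value.\<close>

lemma initial_value_functional:
 assumes u: "strongly_measurable T X N u" and g: "g \<in> X" and T: "T > 0"
  and U: "\<forall>t\<in>{0..T}. U t \<in> X \<and> ((\<lambda>s. N (\<lambda>y. U s y - U t y)) \<longlongrightarrow> 0) (at t within {0..T})"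
   "AE t in time_measure T. N (\<lambda>y. u t y - U t y) = 0" "N (\<lambda>y. U 0 y - g y) = 0"
 shows "continuous_on {0..T} (\<lambda>t. l (U t))" "AE t in time_measure T. l (u t) = l (U t)" "l (U 0) = l g"
proof -
 have zero: "l x = l y" if "x \<in> X" "y \<in> X" "N (\<lambda>i. x i - y i) = 0" for x y using l_diff_bound[OF that(1,2)] that(3) by simp
 show "l (U 0) = l g" using zero U T g by auto
 have "AE t in time_measure T. u t \<in> X" using u unfolding strongly_measurable_def by blast
 then show "AE t in time_measure T. l (u t) = l (U t)" using U(2) AE_space
 proof eventually_elim
  case (elim t)
  then show ?case using U(1) by (intro zero) auto
 qed
 show "continuous_on {0..T} (\<lambda>t. l (U t))" unfolding continuous_on_def
 proof
  fix t assume t: "t \<in> {0..T}"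
  have "((\<lambda>s. C * N (\<lambda>y. U s y - U t y)) \<longlongrightarrow> 0) (at t within {0..T})" using U(1) t by (intro tendsto_mult_right_zero) auto
  moreover have "\<forall>\<^sub>F s in at t within {0..T}. norm (l (U s) - l (U t)) \<le> C * N (\<lambda>y. U s y - U t y)"
   unfolding eventually_at_filter using U(1) t l_diff_bound by (intro always_eventually) auto
  ultimately have "((\<lambda>s. l (U s) - l (U t)) \<longlongrightarrow> 0) (at t within {0..T})" by (rule Lim_null_comparison[rotated])
  then show "((\<lambda>s. l (U s)) \<longlongrightarrow> l (U t)) (at t within {0..T})" by (simp add: LIM_zero_iff)
 qed
qed

end

section \<open>Integration by parts against $e^{-\tau t}$\<close>

lemma smooth_exp: "smooth (exp :: real \<Rightarrow> real)"
proof -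
 have "Ck k (\<lambda>x::real. exp x)" for k
 proof (induction k)
  case (Suc k)
  show ?case
  proof (rule Ck_SucI)
   show "((\<lambda>x::real. exp x) has_derivative (\<lambda>b. exp x * b)) (at x)" for x using DERIV_exp[of x] by (simp add: has_field_derivative_def)
   show "Ck k (\<lambda>x. exp x * b)" for b :: real by (intro Ck_mult Suc.IH Ck_const)
  qed
 qed (auto intro: continuous_intros)
 then show ?thesis by (simp add: smooth_def)
qed

definition step_deriv :: "real \<Rightarrow> real" where
 "step_deriv x = frechet_derivative smooth_step (at x) 1"

lemma DERIV_smooth_step: "(smooth_step has_real_derivative step_deriv x) (at x)"
 using test_function_line_derivative[OF smooth_smooth_step, of 0 1 x] by (simp add: step_deriv_def)

lemma continuous_step_deriv: "continuous_on S step_deriv"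
 using smooth_continuous[OF smooth_frechet[OF smooth_smooth_step, of 1]] continuous_on_subset
 unfolding step_deriv_def[abs_def] by fastforce

lemma step_deriv_support: "step_deriv x \<noteq> 0 \<Longrightarrow> 0 \<le> x \<and> x \<le> 1"
proof (rule ccontr)
 assume nz: "step_deriv x \<noteq> 0" and "\<not> (0 \<le> x \<and> x \<le> 1)"
 then consider "x < 0" | "x > 1" by linarith
 then have "(smooth_step has_real_derivative 0) (at x)"
 proof cases
  case 1
  then show ?thesis using has_field_derivative_transform_within_open[of "\<lambda>x. 0 :: real" 0 x "{..<0}" smooth_step]
   by (auto simp: smooth_step_eq_0)
 next
  case 2
  then show ?thesis using has_field_derivative_transform_within_open[of "\<lambda>x. 1 :: real" 0 x "{1<..}" smooth_step]
   by (auto simp: smooth_step_eq_1)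
 qed
 with nz show False using DERIV_unique DERIV_smooth_step by blast
qed

lemma step_deriv_bounded: obtains M where "M > 0" "\<And>x. \<bar>step_deriv x\<bar> \<le> M"
proof -
 obtain M where "M \<ge> 0" "\<And>x. \<bar>step_deriv x\<bar> \<le> M" by (rule continuous_compact_support_bounded[OF continuous_step_deriv, of "{0..1}"])
   (use step_deriv_support in auto)
 then show thesis using that[of "M + 1"] by (meson add_strict_increasing2 dual_order.trans less_eq_real_def less_add_one zero_less_one)
qed

text \<open>The bound n K on a support of length 1 / n keeps the L^1 norms of the kernels below
  \<open>K\<close>, which takes the place of positivity. The point \<open>c\<close> may be an end
  point of the time interval, as it is in the applications to 0 and T.\<close>

lemma approximate_identity:
 fixes k :: "nat \<Rightarrow> real \<Rightarrow> real"
 assumes T: "T > 0" and g: "continuous_on {0..T} g" and c: "c \<in> {0..T}" and K: "K > 0"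
  and k: "\<And>n. continuous_on UNIV (k n)" "\<And>n t. \<bar>k n t\<bar> \<le> real n * K"
  and supp: "\<And>n t. n > 0 \<Longrightarrow> k n t \<noteq> 0 \<Longrightarrow> t \<in> {a n..a n + 1 / real n} \<and> \<bar>t - c\<bar> \<le> 2 / real n"
  and one: "\<And>n. real n * T \<ge> 4 \<Longrightarrow> (LINT t|time_measure T. k n t) = 1"
 shows "(\<lambda>n. LINT t|time_measure T. g t * k n t) \<longlonglongrightarrow> g c"
proof (rule LIMSEQ_I)
 let ?M = "time_measure T"
 fix e :: real assume e: "e > 0"
 define \<epsilon> where "\<epsilon> = e / (2 * K)"
 have \<epsilon>: "\<epsilon> > 0" "\<epsilon> * K < e" using e K by (auto simp: \<epsilon>_def)
 obtain \<delta> where \<delta>: "\<delta> > 0" "\<And>t. t \<in> {0..T} \<Longrightarrow> dist t c < \<delta> \<Longrightarrow> dist (g t) (g c) < \<epsilon>" using g c \<epsilon>(1) unfolding continuous_on_iff by metis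
 obtain n0 :: nat where n0: "max (4 / T) (2 / \<delta>) < real n0" using reals_Archimedean2 by blast
 have gm: "g \<in> borel_measurable ?M" using g by (intro continuous_imp_measurable_on_sets_lebesgue continuous_on_subset[OF g]) auto
 have km: "k n \<in> borel_measurable ?M" for n
  using k(1)[of n] by (intro continuous_imp_measurable_on_sets_lebesgue continuous_on_subset[OF k(1)]) auto
 obtain G where "\<forall>y\<in>g ` {0..T}. norm y \<le> G"
  using compact_imp_bounded[OF compact_continuous_image[OF g compact_Icc]] unfolding bounded_iff by blast
 then have G: "\<And>t. t \<in> {0..T} \<Longrightarrow> \<bar>g t\<bar> \<le> G" by simp
 have ik: "integrable ?M (k n)" "integrable ?M (\<lambda>t. g t * k n t)" for n
 proof -
  show "integrable ?M (k n)"
   by (rule Bochner_Integration.integrable_bound[OF integrable_const_time[of T "real n * K"] km]) (use k(2) K in auto)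
  show "integrable ?M (\<lambda>t. g t * k n t)"
  proof (rule Bochner_Integration.integrable_bound[OF integrable_const_time[of T "G * (real n * K)"]])
   show "(\<lambda>t. g t * k n t) \<in> borel_measurable ?M" using gm km by simp
   have "\<bar>g t * k n t\<bar> \<le> \<bar>G * (real n * K)\<bar>" if "t \<in> {0<..<T}" for t
   proof -
    have "\<bar>g t * k n t\<bar> \<le> G * (real n * K)" unfolding abs_mult using G[of t] k(2)[of n t] that by (intro mult_mono) auto
    then show ?thesis by linarith
   qed
   then show "AE t in ?M. norm (g t * k n t) \<le> norm (G * (real n * K))" by (intro AE_I2) simp
  qed
 qed
 have "norm ((LINT t|?M. g t * k n t) - g c) < e" if n: "n \<ge> n0" for n
 proof -
  have n': "real n > 4 / T" "real n > 2 / \<delta>" using n0 n by (auto simp: max_less_iff_conj intro: less_le_trans)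
  then have n1: "real n * T \<ge> 4" "real n > 0" "2 / real n < \<delta>"
  proof -
   show "real n * T \<ge> 4" using n'(1) T by (simp add: pos_divide_less_eq)
   show "real n > 0" using n'(1) T by (meson divide_pos_pos less_trans zero_less_numeral)
   then show "2 / real n < \<delta>" using n'(2) \<delta>(1) by (simp add: pos_divide_less_eq mult.commute)
  qed
  let ?I = "{a n..a n + 1 / real n}"
  have mI: "integrable ?M (\<lambda>t. indicator ?I t :: real)" "(LINT t|?M. indicator ?I t) \<le> 1 / real n"
  proof -
   have I: "?I \<inter> {0<..<T} \<in> lmeasurable" by (intro fmeasurable.Int) auto
   show "integrable ?M (\<lambda>t. indicator ?I t :: real)"
   proof (rule Bochner_Integration.integrable_bound[OF integrable_const_time[of T 1]])
    have "(\<lambda>t. indicator ?I t :: real) \<in> borel_measurable borel" by (intro borel_measurable_indicator) auto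
    then show "(\<lambda>t. indicator ?I t :: real) \<in> borel_measurable ?M"
     by (intro measurable_restrict_space1) (simp add: measurable_completion)
   qed (auto simp: indicator_def)
   have "(LINT t|?M. indicator ?I t) = measure ?M (?I \<inter> {0<..<T})" by simp
   also have "\<dots> = measure lebesgue (?I \<inter> {0<..<T})" by (rule measure_restrict_space) auto
   also have "\<dots> \<le> measure lebesgue ?I" by (intro measure_mono_fmeasurable) auto
   also have "\<dots> = 1 / real n" by simp
   finally show "(LINT t|?M. indicator ?I t) \<le> 1 / real n" .
  qed
  have "(LINT t|?M. g t * k n t) - g c = (LINT t|?M. g t * k n t) - g c * (LINT t|?M. k n t)" using one[OF n1(1)] by simp
  also have "\<dots> = (LINT t|?M. (g t - g c) * k n t)" using ik[of n] by (simp add: left_diff_distrib)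
  finally have eq: "(LINT t|?M. g t * k n t) - g c = (LINT t|?M. (g t - g c) * k n t)" .
  have "\<bar>LINT t|?M. (g t - g c) * k n t\<bar> \<le> (LINT t|?M. (\<epsilon> * (real n * K)) * indicator ?I t)"
  proof (rule order_trans[OF integral_abs_bound integral_mono])
   show "integrable ?M (\<lambda>t. \<bar>(g t - g c) * k n t\<bar>)" using ik[of n] by (intro integrable_abs) (simp add: left_diff_distrib)
   show "integrable ?M (\<lambda>t. (\<epsilon> * (real n * K)) * indicator ?I t)" using mI(1) by simp
   show "\<bar>(g t - g c) * k n t\<bar> \<le> (\<epsilon> * (real n * K)) * indicator ?I t" if t: "t \<in> space ?M" for t
   proof (cases "k n t = 0")
    case True
    then show ?thesis using \<epsilon> K by (simp add: indicator_def)
   next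
    case False
    then have s: "t \<in> ?I" "\<bar>t - c\<bar> \<le> 2 / real n" using supp[of n t] n1(2) by auto
    then have "\<bar>g t - g c\<bar> \<le> \<epsilon>" using \<delta>(2)[of t] t n1(3) by (auto simp: dist_real_def)
    then have "\<bar>g t - g c\<bar> * \<bar>k n t\<bar> \<le> \<epsilon> * (real n * K)" using k(2)[of n t] \<epsilon>(1) by (intro mult_mono) auto
    then show ?thesis using s(1) by (simp add: abs_mult)
   qed
  qed
  also have "\<dots> = (\<epsilon> * (real n * K)) * (LINT t|?M. indicator ?I t)" by (rule integral_mult_right_zero)
  also have "\<dots> \<le> (\<epsilon> * (real n * K)) * (1 / real n)" using mI(2) \<epsilon> K by (intro mult_left_mono) auto
  also have "\<dots> = \<epsilon> * K" using n1(2) by simp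
  finally show ?thesis using eq \<epsilon>(2) by simp
 qed
 then show "\<exists>n0. \<forall>n\<ge>n0. norm ((LINT t|?M. g t * k n t) - g c) < e" by blast
qed

lemma FTC_time_measure:
 assumes T: "T > 0" and F: "\<And>t. (F has_real_derivative F' t) (at t)" and c: "continuous_on UNIV F'"
 shows "(LINT t|time_measure T. F' t) = F T - F 0"
proof -
 have hi: "(F' has_integral F T - F 0) {0..T}" using T F by (intro fundamental_theorem_of_calculus)
   (auto simp: has_real_derivative_iff_has_vector_derivative[symmetric] intro: has_field_derivative_at_within)
 obtain G where "\<forall>y\<in>F' ` {0..T}. norm y \<le> G"
  using compact_imp_bounded[OF compact_continuous_image[OF continuous_on_subset[OF c subset_UNIV] compact_Icc[of 0 T]]]
  unfolding bounded_iff by blast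
 then have G: "\<And>t. t \<in> {0..T} \<Longrightarrow> \<bar>F' t\<bar> \<le> G" by simp
 have i: "integrable (time_measure T) F'"
 proof (rule Bochner_Integration.integrable_bound[OF integrable_const_time[of T G]])
  show "F' \<in> borel_measurable (time_measure T)" by (intro continuous_imp_measurable_on_sets_lebesgue continuous_on_subset[OF c]) auto
  show "AE t in time_measure T. norm (F' t) \<le> norm G" using G by (intro AE_I2) (auto intro: order_trans[OF _ abs_ge_self])
 qed
 have "(LINT t|time_measure T. F' t) = integral {0<..<T} F'" by (rule lebesgue_integral_eq_integral[OF i]) simp
 also have "\<dots> = integral {0..T} F'" using integral_open_interval_real[of 0 T F'] by simp
 finally show ?thesis using hi by (simp add: integral_unique)
qed

text \<open>The function e^{-\<tau> t} is no test function on the open interval, so it is cut off at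
  both ends. The derivatives of the two cutoffs are, up to sign, approximate identities at 0 and T
  and produce the boundary values of the continuous representative \<open>P\<close>.\<close>

lemma laplace_by_parts:
 assumes T: "T > 0" and p: "integrable (time_measure T) p" and q: "integrable (time_measure T) q"
  and P: "continuous_on {0..T} P" "AE t in time_measure T. p t = P t"
  and weak: "\<And>\<psi>. \<psi> \<in> test_functions {0<..<T} \<Longrightarrow>
   (LINT t|time_measure T. deriv \<psi> t * p t) = - (LINT t|time_measure T. \<psi> t * q t)"
  and \<tau>: "\<tau> > 0"
 shows "(LINT t|time_measure T. exp (- \<tau> * t) * q t) = exp (- \<tau> * T) * P T - P 0 + \<tau> * (LINT t|time_measure T. exp (- \<tau> * t) * p t)"
proof -
 let ?M = "time_measure T"
 define E where "E t = exp (- \<tau> * t)" for t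
 \<comment> \<open>\<open>L n\<close> rises from 0 to 1 between 1 / n and 2 / n, and
   \<open>R n\<close> falls back between T - 2 / n and T - 1 / n; the product has compact support in
   the open interval. \<open>R'\<close> is the derivative of \<open>R\<close> with the sign
   reversed.\<close>
 define L where "L n t = smooth_step (real n * t - 1)" for n t
 define R where "R n t = smooth_step (real n * (T - t) - 1)" for n t
 define L' where "L' n t = real n * step_deriv (real n * t - 1)" for n t
 define R' where "R' n t = real n * step_deriv (real n * (T - t) - 1)" for n t
 define \<psi> where "\<psi> n t = E t * (L n t * R n t)" for n t
 have dE: "(E has_real_derivative - \<tau> * E t) (at t)" for t unfolding E_def[abs_def] by (auto intro!: derivative_eq_intros)
 have dL: "(L n has_real_derivative L' n t) (at t)" for n t
 proof -
  have "((\<lambda>t. real n * t - 1) has_real_derivative real n) (at t)" by (auto intro!: derivative_eq_intros)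
  from DERIV_chain2[OF DERIV_smooth_step this] show ?thesis unfolding L_def[abs_def] L'_def by (simp only: mult.commute)
 qed
 have dR: "(R n has_real_derivative - R' n t) (at t)" for n t
 proof -
  have "((\<lambda>t. real n * (T - t) - 1) has_real_derivative - real n) (at t)" by (auto intro!: derivative_eq_intros)
  from DERIV_chain2[OF DERIV_smooth_step this] show ?thesis unfolding R_def[abs_def] R'_def by (simp add: mult.commute)
 qed
 have b01: "0 \<le> L n t" "L n t \<le> 1" "0 \<le> R n t" "R n t \<le> 1" for n t by (auto simp: L_def R_def smooth_step_bounds)
 have cont: "continuous_on UNIV E" "continuous_on UNIV (L n)" "continuous_on UNIV (R n)" for n
  using dE dL dR by (auto intro!: continuous_at_imp_continuous_on DERIV_isCont)
 have cont': "continuous_on UNIV (L' n)" "continuous_on UNIV (R' n)" for n unfolding L'_def[abs_def] R'_def[abs_def]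
  by (auto intro!: continuous_intros continuous_on_compose2[OF continuous_step_deriv])
 have d\<psi>: "deriv (\<psi> n) t = - \<tau> * E t * (L n t * R n t) + E t * (L' n t * R n t - L n t * R' n t)" for n t
  unfolding \<psi>_def[abs_def] by (rule DERIV_imp_deriv) (auto intro!: derivative_eq_intros dE dL dR simp: algebra_simps)
 have \<psi>: "\<psi> n \<in> test_functions {0<..<T}" if n: "n > 0" for n
 proof (rule test_functionsI)
  have lin: "bounded_linear (\<lambda>t::real. c * t)" for c by (rule bounded_linear_mult_right)
  have "smooth (\<lambda>t. exp ((- \<tau>) * t + 0))" by (rule smooth_affine_functional[OF lin smooth_exp])
  moreover have "smooth (\<lambda>t. smooth_step (real n * t + (- 1)))" by (rule smooth_affine_functional[OF lin smooth_smooth_step])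
  moreover have "smooth (\<lambda>t. smooth_step ((- real n) * t + (real n * T - 1)))"
   by (rule smooth_affine_functional[OF lin smooth_smooth_step])
  ultimately have "smooth (\<lambda>t. exp ((- \<tau>) * t + 0) * (smooth_step (real n * t + (- 1)) * smooth_step ((- real n) * t + (real n * T - 1))))"
   by (intro smooth_mult)
  then show "smooth (\<psi> n)" by (simp add: \<psi>_def[abs_def] E_def L_def R_def algebra_simps)
  show "t \<in> {1 / real n..T - 1 / real n}" if "\<psi> n t \<noteq> 0" for t
  proof -
   have "real n * t - 1 > 0" "real n * (T - t) - 1 > 0"
  proof -
   have "L n t \<noteq> 0" "R n t \<noteq> 0" using that by (auto simp: \<psi>_def)
   then show "real n * t - 1 > 0" "real n * (T - t) - 1 > 0"
    using smooth_step_eq_0[of "real n * t - 1"] smooth_step_eq_0[of "real n * (T - t) - 1"] unfolding L_def R_def by linarith+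
  qed
   then show ?thesis using n by (simp add: pos_divide_le_eq pos_le_divide_eq field_simps)
  qed
  show "{1 / real n..T - 1 / real n} \<subseteq> {0<..<T}"
  proof
   fix t assume t: "t \<in> {1 / real n..T - 1 / real n}"
   have "1 / real n > 0" using n by simp
   with t have "0 < t" "t < T" unfolding atLeastAtMost_iff by linarith+
   then show "t \<in> {0<..<T}" by simp
  qed
 qed simp
 have meas: "h \<in> borel_measurable ?M" if "continuous_on UNIV h" for h :: "real \<Rightarrow> real"
  by (intro continuous_imp_measurable_on_sets_lebesgue continuous_on_subset[OF that]) auto
 have E1: "0 < E t" "t \<in> {0<..<T} \<Longrightarrow> E t \<le> 1" for t using \<tau> by (auto simp: E_def)
 have cut: "(\<lambda>n. LINT t|?M. E t * (L n t * R n t) * f t) \<longlonglongrightarrow> (LINT t|?M. E t * f t)"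
  and cut_int: "\<And>n. integrable ?M (\<lambda>t. E t * (L n t * R n t) * f t)" if f: "integrable ?M f" for f
 proof -
  have m: "(\<lambda>t. E t * (L n t * R n t) * f t) \<in> borel_measurable ?M" for n
   by (intro borel_measurable_times meas cont borel_measurable_integrable[OF f])
  have bnd: "norm (E t * (L n t * R n t) * f t) \<le> \<bar>f t\<bar>" if "t \<in> {0<..<T}" for n t
  proof -
   have "\<bar>E t * (L n t * R n t)\<bar> \<le> 1" using E1[of t] b01[of n t] that by (simp add: abs_mult mult_le_one)
   then have "\<bar>E t * (L n t * R n t)\<bar> * \<bar>f t\<bar> \<le> 1 * \<bar>f t\<bar>" by (intro mult_right_mono) auto
   then show ?thesis by (simp only: real_norm_def abs_mult mult_1)
  qed
  show "integrable ?M (\<lambda>t. E t * (L n t * R n t) * f t)" for n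
   by (rule Bochner_Integration.integrable_bound[OF f m]) (intro AE_I2, use bnd in simp)
  show "(\<lambda>n. LINT t|?M. E t * (L n t * R n t) * f t) \<longlonglongrightarrow> (LINT t|?M. E t * f t)"
  proof (rule integral_dominated_convergence[where w = "\<lambda>t. \<bar>f t\<bar>"])
   show "AE t in ?M. (\<lambda>n. E t * (L n t * R n t) * f t) \<longlonglongrightarrow> E t * f t"
   proof (rule AE_I2)
    fix t assume "t \<in> space ?M"
    then have t: "0 < t" "t < T" by auto
    obtain n0 :: nat where n0: "max (2 / t) (2 / (T - t)) < real n0" using reals_Archimedean2 by blast
    have "L n t * R n t = 1" if "n \<ge> n0" for n
    proof -
     have "2 / t < real n" "2 / (T - t) < real n" using n0 that by (auto simp: max_less_iff_conj intro: less_le_trans)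
     then have "real n * t - 1 \<ge> 1" "real n * (T - t) - 1 \<ge> 1" using t by (simp_all add: pos_divide_less_eq)
     then show ?thesis by (simp add: L_def R_def smooth_step_eq_1)
    qed
    then have "\<forall>\<^sub>F n in sequentially. E t * f t = E t * (L n t * R n t) * f t"
     unfolding eventually_sequentially by (intro exI[of _ n0]) auto
    then show "(\<lambda>n. E t * (L n t * R n t) * f t) \<longlonglongrightarrow> E t * f t" by (rule Lim_transform_eventually[OF tendsto_const])
   qed
   show "AE t in ?M. norm (E t * (L n t * R n t) * f t) \<le> \<bar>f t\<bar>" for n using bnd by (intro AE_I2) simp
   show "(\<lambda>t. E t * f t) \<in> borel_measurable ?M" using cont meas f by (intro borel_measurable_times) auto
  qed (use f m in auto)
 qed
 obtain K where K: "K > 0" "\<And>x. \<bar>step_deriv x\<bar> \<le> K" using step_deriv_bounded by blast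
 have EP: "continuous_on {0..T} (\<lambda>t. E t * P t)" using cont(1) P(1) by (intro continuous_intros) (auto intro: continuous_on_subset)
 have bL: "\<bar>L' n t\<bar> \<le> real n * K" "\<bar>R' n t\<bar> \<le> real n * K" for n t using K by (auto simp: L'_def R'_def abs_mult intro!: mult_left_mono)
 have limL: "(\<lambda>n. LINT t|?M. (E t * P t) * L' n t) \<longlonglongrightarrow> E 0 * P 0"
 proof (rule approximate_identity[OF T EP _ K(1) cont'(1) bL(1), where a = "\<lambda>n. 1 / real n"])
  fix n :: nat and t assume n: "n > 0" and nz: "L' n t \<noteq> 0"
  then have "0 \<le> real n * t - 1 \<and> real n * t - 1 \<le> 1" by (intro step_deriv_support) (auto simp: L'_def)
  then have t: "1 / real n \<le> t" "t \<le> 2 / real n" using n by (simp_all add: pos_divide_le_eq pos_le_divide_eq mult.commute)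
  moreover have "0 < 1 / real n" "2 / real n = 1 / real n + 1 / real n" using n by auto
  ultimately show "t \<in> {1 / real n..1 / real n + 1 / real n} \<and> \<bar>t - 0\<bar> \<le> 2 / real n" unfolding atLeastAtMost_iff abs_le_iff by linarith
 next
  fix n :: nat assume "real n * T \<ge> 4"
  then show "(LINT t|?M. L' n t) = 1"
   using FTC_time_measure[OF T dL cont'(1), of n] by (simp add: L_def smooth_step_eq_0 smooth_step_eq_1)
 qed (use T in auto)
 have limR: "(\<lambda>n. LINT t|?M. (E t * P t) * R' n t) \<longlonglongrightarrow> E T * P T"
 proof (rule approximate_identity[OF T EP _ K(1) cont'(2) bL(2), where a = "\<lambda>n. T - 2 / real n"])
  fix n :: nat and t assume n: "n > 0" and nz: "R' n t \<noteq> 0"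
  then have "0 \<le> real n * (T - t) - 1 \<and> real n * (T - t) - 1 \<le> 1" by (intro step_deriv_support) (auto simp: R'_def)
  then have t: "1 / real n \<le> T - t" "T - t \<le> 2 / real n" using n by (simp_all add: pos_divide_le_eq pos_le_divide_eq mult.commute)
  moreover have "0 < 1 / real n" "2 / real n = 1 / real n + 1 / real n" using n by auto
  ultimately show "t \<in> {T - 2 / real n..T - 2 / real n + 1 / real n} \<and> \<bar>t - T\<bar> \<le> 2 / real n"
   unfolding atLeastAtMost_iff abs_le_iff by linarith
 next
  fix n :: nat assume "real n * T \<ge> 4"
  moreover have "((\<lambda>t. - R n t) has_real_derivative R' n t) (at t)" for t using DERIV_minus[OF dR] by simp
  ultimately show "(LINT t|?M. R' n t) = 1"
   using FTC_time_measure[OF T _ cont'(2), of "\<lambda>t. - R n t" n] by (simp add: R_def smooth_step_eq_0 smooth_step_eq_1)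
 qed (use T in auto)
 have ev: "\<forall>\<^sub>F n in sequentially. (LINT t|?M. E t * (L n t * R n t) * q t) =
   \<tau> * (LINT t|?M. E t * (L n t * R n t) * p t) - ((LINT t|?M. (E t * P t) * L' n t) - (LINT t|?M. (E t * P t) * R' n t))"
 proof -
  obtain n0 :: nat where n0: "4 / T < real n0" using reals_Archimedean2 by blast
  have "(LINT t|?M. E t * (L n t * R n t) * q t) =
   \<tau> * (LINT t|?M. E t * (L n t * R n t) * p t) - ((LINT t|?M. (E t * P t) * L' n t) - (LINT t|?M. (E t * P t) * R' n t))"
   if n: "n \<ge> n0" for n
  proof -
   have nT: "real n * T \<ge> 4" using n0 n T by (auto simp: pos_divide_less_eq intro: order_trans[OF less_imp_le] mult_right_mono)
   then have n1: "n > 0" using T by (cases n) auto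
   \<comment> \<open>For n T \<ge> 4 the two transition zones do not interfere: where one cutoff has
     a nonzero derivative, the other equals 1.\<close>
   have LR: "L' n t * R n t - L n t * R' n t = L' n t - R' n t" for t
   proof -
    have "L' n t * R n t = L' n t"
    proof (cases "L' n t = 0")
     case False
     then have "real n * t - 1 \<le> 1" using step_deriv_support[of "real n * t - 1"] by (auto simp: L'_def)
     then have "real n * (T - t) - 1 \<ge> 1" using nT by (simp add: right_diff_distrib)
     then show ?thesis by (simp add: R_def smooth_step_eq_1)
    qed simp
    moreover have "L n t * R' n t = R' n t"
    proof (cases "R' n t = 0")
     case False
     then have "real n * (T - t) - 1 \<le> 1" using step_deriv_support[of "real n * (T - t) - 1"] by (auto simp: R'_def)
     then have "real n * t - 1 \<ge> 1" using nT by (simp add: right_diff_distrib)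
     then show ?thesis by (simp add: L_def smooth_step_eq_1)
    qed simp
    ultimately show ?thesis by (simp only:)
   qed
   have iP: "integrable ?M (\<lambda>t. (E t * P t) * h t)" if h: "continuous_on UNIV h" for h
   proof -
    have "continuous_on {0..T} (\<lambda>t. (E t * P t) * h t)" by (intro continuous_on_mult EP continuous_on_subset[OF h]) simp
    then have "(\<lambda>t. (E t * P t) * h t) absolutely_integrable_on {0..T}" using absolutely_integrable_continuous_real by blast
    then have "(\<lambda>t. (E t * P t) * h t) absolutely_integrable_on {0<..<T}" by (rule set_integrable_subset) auto
    then show ?thesis by (simp add: set_integrable_def integrable_restrict_space)
   qed
   have "(LINT t|?M. deriv (\<psi> n) t * p t) =
    (LINT t|?M. (- \<tau>) * (E t * (L n t * R n t) * p t) + ((E t * P t) * L' n t - (E t * P t) * R' n t))"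
   proof (rule integral_cong_AE)
    show "(\<lambda>t. deriv (\<psi> n) t * p t) \<in> borel_measurable ?M" unfolding d\<psi>
     by (rule borel_measurable_times[OF meas borel_measurable_integrable[OF p]])
      (intro continuous_intros cont cont')
    show "(\<lambda>t. (- \<tau>) * (E t * (L n t * R n t) * p t) + ((E t * P t) * L' n t - (E t * P t) * R' n t)) \<in> borel_measurable ?M"
     using cut_int[OF p, of n] iP[OF cont'(1)[of n]] iP[OF cont'(2)[of n]] by (intro borel_measurable_integrable) simp
    show "AE t in ?M. deriv (\<psi> n) t * p t = (- \<tau>) * (E t * (L n t * R n t) * p t) + ((E t * P t) * L' n t - (E t * P t) * R' n t)"
     using P(2) by eventually_elim (simp add: d\<psi> LR algebra_simps)
   qed
   also have "\<dots> = (- \<tau>) * (LINT t|?M. E t * (L n t * R n t) * p t) + ((LINT t|?M. (E t * P t) * L' n t) - (LINT t|?M. (E t * P t) * R' n t))"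
    using cut_int[OF p, of n] iP[OF cont'(1)[of n]] iP[OF cont'(2)[of n]] by (subst Bochner_Integration.integral_add) auto
   finally show ?thesis using weak[OF \<psi>[OF n1]] by (simp add: \<psi>_def)
  qed
  then show ?thesis unfolding eventually_sequentially by blast
 qed
 have "(\<lambda>n. \<tau> * (LINT t|?M. E t * (L n t * R n t) * p t) - ((LINT t|?M. (E t * P t) * L' n t) - (LINT t|?M. (E t * P t) * R' n t)))
   \<longlonglongrightarrow> \<tau> * (LINT t|?M. E t * p t) - (E 0 * P 0 - E T * P T)" by (intro tendsto_intros cut[OF p] limL limR)
 then have "(\<lambda>n. LINT t|?M. E t * (L n t * R n t) * q t) \<longlonglongrightarrow> \<tau> * (LINT t|?M. E t * p t) - (E 0 * P 0 - E T * P T)"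
  using tendsto_cong[OF ev] by simp
 from LIMSEQ_unique[OF cut[OF q] this] show ?thesis by (simp add: E_def)
qed

section \<open>Functionals on $L^2$, $H^1$ and the dual of $H^1$\<close>

lemma L2_functional:
 assumes "square_integrable \<phi>"
 shows "seminormed_functional L2 L2_norm (\<lambda>x. LI y. x y * \<phi> y) (l2norm \<phi>)"
proof
 show "(\<lambda>i. 0) \<in> L2" by (simp add: L2_def)
 fix x y :: "space \<Rightarrow> real" and a b :: real
 assume x: "x \<in> L2"
 then have xs: "square_integrable x" by (simp add: L2_def)
 show "\<bar>LI y. x y * \<phi> y\<bar> \<le> l2norm \<phi> * L2_norm x" using l2_Cauchy_Schwarz_real[OF xs assms] by (simp add: L2_norm_eq_l2norm mult.commute)
 assume y: "y \<in> L2"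
 then have ys: "square_integrable y" by (simp add: L2_def)
 show "(\<lambda>i. a * x i + b * y i) \<in> L2" using xs ys by (simp add: L2_def square_integrable_add square_integrable_cmult)
 have "(LI i. (a * x i + b * y i) * \<phi> i) = (LI i. a * (x i * \<phi> i) + b * (y i * \<phi> i))" by (simp add: distrib_right mult.assoc)
 also have "\<dots> = a * (LI i. x i * \<phi> i) + b * (LI i. y i * \<phi> i)" using integrable_times[OF xs assms] integrable_times[OF ys assms] by simp
 finally show "(LI i. (a * x i + b * y i) * \<phi> i) = a * (LI i. x i * \<phi> i) + b * (LI i. y i * \<phi> i)" .
qed simp

lemma H1_norm_eq:
 assumes "has_gradient u G"
 shows "H1_norm u = sqrt ((l2norm u)^2 + (l2norm G)^2)"
proof -
 have "has_gradient u (weak_gradient u)" using H1_has_gradient[OF has_gradient_imp_H1[OF assms]] .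
 then have "l2norm (weak_gradient u) = l2norm G" by (intro l2norm_cong_AE weak_gradient_eq_AE assms)
   (auto dest: has_gradientD(2) square_integrableD(1) intro: has_gradientD(2)[OF assms, THEN square_integrableD(1)])
 then show ?thesis by (simp add: H1_norm_def l2norm_power2[symmetric]) (simp add: l2norm_power2)
qed

lemma H1_norm_bounds:
 assumes "has_gradient u G"
 shows "l2norm u \<le> H1_norm u" "l2norm G \<le> H1_norm u" unfolding H1_norm_eq[OF assms] by (auto intro!: real_le_rsqrt)

lemma seminormed_norm_H1: "seminormed_norm H1 H1_norm"
proof
 show "(\<lambda>i. 0) \<in> H1" by (rule has_gradient_imp_H1[OF has_gradient_zero])
 show "H1_norm (\<lambda>i. 0) = 0" by (simp add: H1_norm_eq[OF has_gradient_zero])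
 fix x y :: "space \<Rightarrow> real" and a b :: real
 assume "x \<in> H1"
 note x = H1_has_gradient[OF this]
 show "0 \<le> H1_norm x" using H1_norm_bounds(1)[OF x] l2norm_nonneg[of x] by linarith
 show "H1_norm (\<lambda>i. - x i) = H1_norm x"
  using H1_norm_eq[OF has_gradient_diff[OF has_gradient_zero x]] H1_norm_eq[OF x] by (simp add: l2norm_minus)
 assume "y \<in> H1"
 note y = H1_has_gradient[OF this]
 show "(\<lambda>i. a * x i + b * y i) \<in> H1" by (rule has_gradient_imp_H1[OF has_gradient_lincomb[OF x y]])
 have xy: "has_gradient (\<lambda>i. x i + y i) (\<lambda>i. weak_gradient x i + weak_gradient y i)" using has_gradient_lincomb[OF x y, of 1 1] by simp
 have "l2norm (\<lambda>i. x i + y i) \<le> l2norm x + l2norm y"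
  "l2norm (\<lambda>i. weak_gradient x i + weak_gradient y i) \<le> l2norm (weak_gradient x) + l2norm (weak_gradient y)"
  using has_gradientD(1,2)[OF x] has_gradientD(1,2)[OF y] by (auto intro: l2norm_triangle)
 then have "H1_norm (\<lambda>i. x i + y i) \<le> sqrt ((l2norm x + l2norm y)^2 + (l2norm (weak_gradient x) + l2norm (weak_gradient y))^2)"
  unfolding H1_norm_eq[OF xy] by (intro real_sqrt_le_mono add_mono power_mono) auto
 also have "\<dots> \<le> H1_norm x + H1_norm y" unfolding H1_norm_eq[OF x] H1_norm_eq[OF y] by (rule real_sqrt_sum_squares_triangle_ineq)
 finally show "H1_norm (\<lambda>i. x i + y i) \<le> H1_norm x + H1_norm y" .
qed

interpretation H1: seminormed_norm H1 H1_norm by (rule seminormed_norm_H1)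

lemma H1_functional_L2:
 assumes \<phi>: "square_integrable \<phi>"
 shows "seminormed_functional H1 H1_norm (\<lambda>x. LI y. x y * \<phi> y) (l2norm \<phi>)"
proof
 interpret L2: seminormed_functional L2 L2_norm "\<lambda>x. LI y. x y * \<phi> y" "l2norm \<phi>" by (rule L2_functional[OF \<phi>])
 have sub: "x \<in> H1 \<Longrightarrow> x \<in> L2" for x by (simp add: H1_def)
 fix x y :: "space \<Rightarrow> real" and a b :: real
 assume x: "x \<in> H1"
 have "\<bar>LI y. x y * \<phi> y\<bar> \<le> l2norm \<phi> * l2norm x" using L2.l_bound[OF sub[OF x]] by (simp add: L2_norm_eq_l2norm)
 also have "\<dots> \<le> l2norm \<phi> * H1_norm x" using H1_norm_bounds(1)[OF H1_has_gradient[OF x]] by (intro mult_left_mono) auto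
 finally show "\<bar>LI y. x y * \<phi> y\<bar> \<le> l2norm \<phi> * H1_norm x" .
 assume y: "y \<in> H1"
 show "(LI i. (a * x i + b * y i) * \<phi> i) = a * (LI i. x i * \<phi> i) + b * (LI i. y i * \<phi> i)" by (rule L2.l_linear[OF sub[OF x] sub[OF y]])
qed simp

text \<open>Evaluation at \<phi> is bounded by scaling \<phi> to norm 1, where the supremum in the
  dual norm applies; it is finite because a member of the dual has a bound \<open>C\<close>. If the
  seminorm of \<phi> is 0, the same bound forces the value 0.\<close>

lemma H1_dual_functional:
 assumes \<phi>: "\<phi> \<in> H1"
 shows "seminormed_functional H1_dual H1_dual_norm (\<lambda>l. l \<phi>) (H1_norm \<phi>)"
proof
 show "(\<lambda>i. 0) \<in> H1_dual" by (auto simp: H1_dual_def intro: exI[of _ 0])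
 show "0 \<le> H1_norm \<phi>" by (rule H1.N_nonneg[OF \<phi>])
 fix x y :: "(space \<Rightarrow> real) \<Rightarrow> real" and a b :: real
 assume x: "x \<in> H1_dual"
 then have lin: "x (\<lambda>y. a * \<phi> y + b * \<psi> y) = a * x \<phi> + b * x \<psi>" if "\<phi> \<in> H1" "\<psi> \<in> H1" for \<phi> \<psi> a b using that by (simp add: H1_dual_def)
 obtain C where C: "\<And>\<phi>. \<phi> \<in> H1 \<Longrightarrow> \<bar>x \<phi>\<bar> \<le> C * H1_norm \<phi>" using x unfolding H1_dual_def by blast
 show "\<bar>x \<phi>\<bar> \<le> H1_norm \<phi> * H1_dual_norm x"
 proof (cases "H1_norm \<phi> = 0")
  case True
  then show ?thesis using C[OF \<phi>] by simp
 next
  case False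
  then have pos: "H1_norm \<phi> > 0" using H1.N_nonneg[OF \<phi>] by simp
  define c where "c = inverse (H1_norm \<phi>)"
  have c: "c > 0" using pos by (simp add: c_def)
  have g: "has_gradient (\<lambda>y. c * \<phi> y) (\<lambda>y. c *\<^sub>R weak_gradient \<phi> y)"
   using has_gradient_lincomb[OF H1_has_gradient[OF \<phi>] H1_has_gradient[OF \<phi>], of c 0] by simp
  have "H1_norm (\<lambda>y. c * \<phi> y) = sqrt (c^2 * ((l2norm \<phi>)^2 + (l2norm (weak_gradient \<phi>))^2))"
   unfolding H1_norm_eq[OF g] by (simp add: l2norm_cmult l2norm_scaleR power_mult_distrib distrib_left)
  also have "\<dots> = c * H1_norm \<phi>" unfolding H1_norm_eq[OF H1_has_gradient[OF \<phi>]] using c by (simp add: real_sqrt_mult)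
  also have "\<dots> = 1" using pos by (simp add: c_def)
  finally have mem: "(\<lambda>y. c * \<phi> y) \<in> {\<phi> \<in> H1. H1_norm \<phi> \<le> 1}" using has_gradient_imp_H1[OF g] by simp
  have "bdd_above ((\<lambda>\<phi>. \<bar>x \<phi>\<bar>) ` {\<phi> \<in> H1. H1_norm \<phi> \<le> 1})"
  proof (rule bdd_aboveI2)
   fix \<psi> assume "\<psi> \<in> {\<phi> \<in> H1. H1_norm \<phi> \<le> 1}"
   then have \<psi>: "\<psi> \<in> H1" "H1_norm \<psi> \<le> 1" by auto
   have "\<bar>x \<psi>\<bar> \<le> C * H1_norm \<psi>" by (rule C[OF \<psi>(1)])
   also have "\<dots> \<le> \<bar>C\<bar> * 1" using \<psi>(2) H1.N_nonneg[OF \<psi>(1)] by (intro mult_mono) auto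
   finally show "\<bar>x \<psi>\<bar> \<le> \<bar>C\<bar>" by simp
  qed
  then have "\<bar>x (\<lambda>y. c * \<phi> y)\<bar> \<le> H1_dual_norm x" unfolding H1_dual_norm_def by (rule cSUP_upper[OF mem])
  moreover have "x (\<lambda>y. c * \<phi> y) = c * x \<phi>" using lin[OF \<phi> \<phi>, of c 0] by simp
  ultimately have "c * \<bar>x \<phi>\<bar> \<le> H1_dual_norm x" using c by (simp add: abs_mult)
  then have "H1_norm \<phi> * (c * \<bar>x \<phi>\<bar>) \<le> H1_norm \<phi> * H1_dual_norm x" using pos by (intro mult_left_mono) auto
  moreover have "H1_norm \<phi> * c = 1" using pos by (simp add: c_def)
  ultimately show ?thesis by (simp only: mult.assoc[symmetric] mult_1)
 qed
 assume y: "y \<in> H1_dual"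
 then have lin': "y (\<lambda>i. a * \<phi> i + b * \<psi> i) = a * y \<phi> + b * y \<psi>" if "\<phi> \<in> H1" "\<psi> \<in> H1" for \<phi> \<psi> a b using that by (simp add: H1_dual_def)
 obtain C' where C': "\<And>\<phi>. \<phi> \<in> H1 \<Longrightarrow> \<bar>y \<phi>\<bar> \<le> C' * H1_norm \<phi>" using y unfolding H1_dual_def by blast
 have "\<bar>a * x \<psi> + b * y \<psi>\<bar> \<le> (\<bar>a\<bar> * C + \<bar>b\<bar> * C') * H1_norm \<psi>" if "\<psi> \<in> H1" for \<psi>
 proof -
  have "\<bar>a * x \<psi> + b * y \<psi>\<bar> \<le> \<bar>a\<bar> * \<bar>x \<psi>\<bar> + \<bar>b\<bar> * \<bar>y \<psi>\<bar>" using abs_triangle_ineq[of "a * x \<psi>" "b * y \<psi>"] by (simp add: abs_mult)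
  also have "\<dots> \<le> \<bar>a\<bar> * (C * H1_norm \<psi>) + \<bar>b\<bar> * (C' * H1_norm \<psi>)" using C[OF that] C'[OF that] by (intro add_mono mult_left_mono) auto
  finally show ?thesis by (simp add: algebra_simps)
 qed
 moreover have "\<forall>\<phi>\<in>H1. \<forall>\<psi>\<in>H1. \<forall>c d. a * x (\<lambda>i. c * \<phi> i + d * \<psi> i) + b * y (\<lambda>i. c * \<phi> i + d * \<psi> i) =
   c * (a * x \<phi> + b * y \<phi>) + d * (a * x \<psi> + b * y \<psi>)" by (simp add: lin lin' algebra_simps)
 ultimately show "(\<lambda>i. a * x i + b * y i) \<in> H1_dual" unfolding H1_dual_def by blast
qed simp

section \<open>The Laplace transform of the wave equation\<close>

locale bounded_coefficient =
 fixes A :: "space \<Rightarrow> real^3^3" and \<Lambda> :: real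
 assumes A_meas: "(\<lambda>x. A x $ i $ j) \<in> borel_measurable lebesgue"
  and A_bound: "AE x in lebesgue. \<forall>\<xi>. norm (A x *v \<xi>) \<le> \<Lambda> * norm \<xi>" and \<Lambda>_nonneg: "\<Lambda> \<ge> 0"
begin

lemma square_integrable_A:
 assumes G: "square_integrable G"
 shows "square_integrable (\<lambda>x. A x *v G x)" "l2norm (\<lambda>x. A x *v G x) \<le> \<Lambda> * l2norm G"
proof -
 have Gi: "(\<lambda>x. G x $ j) \<in> borel_measurable lebesgue" for j using square_integrableD(1)[OF square_integrable_component[OF G]] .
 have m: "(\<lambda>x. A x *v G x) \<in> borel_measurable lebesgue" by (intro borel_measurable_vec3)
   (simp add: matrix_vector_mult_def borel_measurable_sum borel_measurable_times[OF A_meas Gi])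
 have b: "AE x in lebesgue. norm (A x *v G x) \<le> norm (\<Lambda> *\<^sub>R G x)" using A_bound by eventually_elim (use \<Lambda>_nonneg in auto)
 note sq = square_integrable_scaleR[OF G, of \<Lambda>]
 show "square_integrable (\<lambda>x. A x *v G x)" by (rule square_integrable_bound[OF m sq b])
 show "l2norm (\<lambda>x. A x *v G x) \<le> \<Lambda> * l2norm G" using l2norm_mono[OF m sq b] \<Lambda>_nonneg by (simp add: l2norm_scaleR)
qed

lemma integral_A_cong:
 assumes "has_gradient u G" "has_gradient \<phi> \<Phi>"
 shows "(LI x. (A x *v weak_gradient u x) \<bullet> weak_gradient \<phi> x) = (LI x. (A x *v G x) \<bullet> \<Phi> x)"
proof (rule integral_cong_AE)
 note u = assms(1) H1_has_gradient[OF has_gradient_imp_H1[OF assms(1)]]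
 note \<phi> = assms(2) H1_has_gradient[OF has_gradient_imp_H1[OF assms(2)]]
 show "(\<lambda>x. (A x *v weak_gradient u x) \<bullet> weak_gradient \<phi> x) \<in> borel_measurable lebesgue"
  "(\<lambda>x. (A x *v G x) \<bullet> \<Phi> x) \<in> borel_measurable lebesgue"
  using integrable_inner[OF square_integrable_A(1)[OF has_gradientD(2)[OF u(2)]] has_gradientD(2)[OF \<phi>(2)]]
   integrable_inner[OF square_integrable_A(1)[OF has_gradientD(2)[OF u(1)]] has_gradientD(2)[OF \<phi>(1)]]
  by (auto intro: borel_measurable_integrable)
 show "AE x in lebesgue. (A x *v weak_gradient u x) \<bullet> weak_gradient \<phi> x = (A x *v G x) \<bullet> \<Phi> x"
  using weak_gradient_eq_AE[OF assms(1)] weak_gradient_eq_AE[OF assms(2)] by eventually_elim simp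
qed

lemma H1_functional_A:
 assumes \<phi>: "has_gradient \<phi> \<Phi>"
 shows "seminormed_functional H1 H1_norm (\<lambda>x. LI y. (A y *v weak_gradient x y) \<bullet> weak_gradient \<phi> y) (\<Lambda> * l2norm \<Phi>)"
proof
 fix x y :: "space \<Rightarrow> real" and a b :: real
 assume "x \<in> H1"
 note x = H1_has_gradient[OF this]
 note Ax = square_integrable_A[OF has_gradientD(2)[OF x]]
 note \<Phi> = has_gradientD(2)[OF \<phi>]
 have "\<bar>LI y. (A y *v weak_gradient x y) \<bullet> \<Phi> y\<bar> \<le> l2norm (\<lambda>y. A y *v weak_gradient x y) * l2norm \<Phi>" by (rule l2_Cauchy_Schwarz[OF Ax(1) \<Phi>])
 also have "\<dots> \<le> (\<Lambda> * H1_norm x) * l2norm \<Phi>" using Ax(2) mult_left_mono[OF H1_norm_bounds(2)[OF x] \<Lambda>_nonneg] by (intro mult_right_mono) auto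
 finally show "\<bar>LI y. (A y *v weak_gradient x y) \<bullet> weak_gradient \<phi> y\<bar> \<le> \<Lambda> * l2norm \<Phi> * H1_norm x"
  by (simp add: integral_A_cong[OF x \<phi>] ac_simps)
 assume "y \<in> H1"
 note y = H1_has_gradient[OF this]
 note Ay = square_integrable_A[OF has_gradientD(2)[OF y]]
 have "(LI i. (A i *v (a *\<^sub>R weak_gradient x i + b *\<^sub>R weak_gradient y i)) \<bullet> \<Phi> i) =
   (LI i. a * ((A i *v weak_gradient x i) \<bullet> \<Phi> i) + b * ((A i *v weak_gradient y i) \<bullet> \<Phi> i))"
  by (simp add: matrix_vector_right_distrib inner_add_left matrix_vector_mult_scaleR)
 also have "\<dots> = a * (LI i. (A i *v weak_gradient x i) \<bullet> \<Phi> i) + b * (LI i. (A i *v weak_gradient y i) \<bullet> \<Phi> i)"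
  using integrable_inner[OF Ax(1) \<Phi>] integrable_inner[OF Ay(1) \<Phi>] by simp
 finally show "(LI i. (A i *v weak_gradient (\<lambda>i. a * x i + b * y i) i) \<bullet> weak_gradient \<phi> i) =
   a * (LI i. (A i *v weak_gradient x i) \<bullet> weak_gradient \<phi> i) +
   b * (LI i. (A i *v weak_gradient y i) \<bullet> weak_gradient \<phi> i)"
  by (simp only: integral_A_cong[OF has_gradient_lincomb[OF x y] \<phi>] integral_A_cong[OF x \<phi>] integral_A_cong[OF y \<phi>])
qed (simp add: \<Lambda>_nonneg)

text \<open>Two integrations by parts in time, for each fixed spatial test function. The residual
  functional collects the final data and is bounded by the L^2 norms of u and its time derivative at
  time T, so \<open>K\<close> depends on neither \<tau> nor \<phi>. The bilinear form stays under
  the time integral because the transform of \<open>u\<close> has not been identified as an element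
  of H^1.\<close>

lemma wave_laplace_transform:
 assumes wave: "wave_weak_solution A T f u" and T: "T > 0" and f: "square_integrable f"
 obtains K where "K \<ge> 0"
  "\<And>\<tau>. \<tau> > 0 \<Longrightarrow> \<exists>L. (\<forall>\<phi> \<Phi>. has_gradient \<phi> \<Phi> \<longrightarrow> \<bar>L \<phi>\<bar> \<le> K * (1 + \<tau>) * l2norm \<phi> \<and>
    (LINT t|time_measure T. exp (- \<tau> * t) * (LI x. (A x *v weak_gradient (u t) x) \<bullet> weak_gradient \<phi> x)) =
    (LI x. f x * \<phi> x) - exp (- \<tau> * T) * L \<phi> - \<tau>^2 * (LINT t|time_measure T. exp (- \<tau> * t) * (LI x. u t x * \<phi> x)))"
proof -
 let ?M = "time_measure T"
 obtain u' u'' where uB: "u \<in> Bochner_L2 T H1 H1_norm" and u'B: "u' \<in> Bochner_L2 T L2 L2_norm"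
  and u''B: "u'' \<in> Bochner_L2 T H1_dual H1_dual_norm"
  and d1: "has_weak_time_derivative T L2 L2_norm u u'"
  and d2: "has_weak_time_derivative T H1_dual H1_dual_norm (\<lambda>t. L2_to_H1_dual (u' t)) u''"
  and eq: "\<And>\<phi>. \<phi> \<in> H1 \<Longrightarrow> AE t in ?M. u'' t \<phi> + (LI x. (A x *v weak_gradient (u t) x) \<bullet> weak_gradient \<phi> x) = 0"
  and i0: "has_initial_value T H1 H1_norm u (\<lambda>x. 0)" and i1: "has_initial_value T L2 L2_norm u' f"
  using wave unfolding wave_weak_solution_def by blast
 obtain U where U: "\<forall>t\<in>{0..T}. U t \<in> H1 \<and> ((\<lambda>s. H1_norm (\<lambda>y. U s y - U t y)) \<longlongrightarrow> 0) (at t within {0..T})"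
   "AE t in ?M. H1_norm (\<lambda>y. u t y - U t y) = 0" "H1_norm (\<lambda>y. U 0 y - 0) = 0" using i0 unfolding has_initial_value_def by auto
 obtain U' where U': "\<forall>t\<in>{0..T}. U' t \<in> L2 \<and> ((\<lambda>s. L2_norm (\<lambda>y. U' s y - U' t y)) \<longlongrightarrow> 0) (at t within {0..T})"
   "AE t in ?M. L2_norm (\<lambda>y. u' t y - U' t y) = 0" "L2_norm (\<lambda>y. U' 0 y - f y) = 0" using i1 unfolding has_initial_value_def by auto
 have su: "strongly_measurable T H1 H1_norm u" and su': "strongly_measurable T L2 L2_norm u'" using uB u'B by (auto simp: Bochner_L2_def)
 have UT: "square_integrable (U T)" "square_integrable (U' T)" using U(1) U'(1) T by (auto simp: H1_def L2_def)
 show thesis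
 proof
  show "l2norm (U T) + l2norm (U' T) \<ge> 0" by simp
  fix \<tau> :: real assume \<tau>: "\<tau> > 0"
  \<comment> \<open>The boundary terms at time T of the two integrations by parts; those at time 0
    reduce to the pairing with \<open>f\<close>, since u starts from 0.\<close>
  define L where "L \<phi> = (LI x. U' T x * \<phi> x) + \<tau> * (LI x. U T x * \<phi> x)" for \<phi>
  show "\<exists>L. (\<forall>\<phi> \<Phi>. has_gradient \<phi> \<Phi> \<longrightarrow> \<bar>L \<phi>\<bar> \<le> (l2norm (U T) + l2norm (U' T)) * (1 + \<tau>) * l2norm \<phi> \<and>
    (LINT t|?M. exp (- \<tau> * t) * (LI x. (A x *v weak_gradient (u t) x) \<bullet> weak_gradient \<phi> x)) =
    (LI x. f x * \<phi> x) - exp (- \<tau> * T) * L \<phi> - \<tau>^2 * (LINT t|?M. exp (- \<tau> * t) * (LI x. u t x * \<phi> x)))"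
  proof (intro exI[of _ L] allI impI conjI)
   fix \<phi> \<Phi> assume \<phi>: "has_gradient \<phi> \<Phi>"
   note sq = has_gradientD(1)[OF \<phi>] and H = has_gradient_imp_H1[OF \<phi>]
   have "\<bar>L \<phi>\<bar> \<le> l2norm (U' T) * l2norm \<phi> + \<tau> * (l2norm (U T) * l2norm \<phi>)"
    unfolding L_def using l2_Cauchy_Schwarz_real[OF UT(2) sq] mult_left_mono[OF l2_Cauchy_Schwarz_real[OF UT(1) sq], of \<tau>] \<tau>
    by (intro order_trans[OF abs_triangle_ineq add_mono]) (auto simp: abs_mult)
   also have "\<dots> \<le> (l2norm (U T) + l2norm (U' T)) * (1 + \<tau>) * l2norm \<phi>" using \<tau> by (simp add: algebra_simps)
   finally show "\<bar>L \<phi>\<bar> \<le> (l2norm (U T) + l2norm (U' T)) * (1 + \<tau>) * l2norm \<phi>" .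
   interpret LF: seminormed_functional L2 L2_norm "\<lambda>x. LI y. x y * \<phi> y" "l2norm \<phi>" by (rule L2_functional[OF sq])
   interpret HF: seminormed_functional H1 H1_norm "\<lambda>x. LI y. x y * \<phi> y" "l2norm \<phi>" by (rule H1_functional_L2[OF sq])
   interpret DF: seminormed_functional H1_dual H1_dual_norm "\<lambda>l. l \<phi>" "H1_norm \<phi>" by (rule H1_dual_functional[OF H])
   let ?p = "\<lambda>t. LI x. u t x * \<phi> x" and ?p1 = "\<lambda>t. LI x. u' t x * \<phi> x"
   note ivu = HF.initial_value_functional[OF su H1.zero_in T U]
   note ivu' = LF.initial_value_functional[OF su' _ T U', unfolded L2_def mem_Collect_eq, OF f]
   have a: "(LINT t|?M. exp (- \<tau> * t) * ?p1 t) = exp (- \<tau> * T) * (LI x. U T x * \<phi> x) - (LI x. U 0 x * \<phi> x) + \<tau> * (LINT t|?M. exp (- \<tau> * t) * ?p t)"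
    by (rule laplace_by_parts[OF T HF.functional_integrable[OF uB] LF.functional_integrable[OF u'B] ivu(1,2) _ \<tau>],
      rule LF.weak_time_derivative_functional[OF d1]) (simp_all add: mult.assoc)
   have wd2: "(LINT t|?M. deriv \<psi> t * ?p1 t) = - (LINT t|?M. \<psi> t * u'' t \<phi>)" if "\<psi> \<in> test_functions {0<..<T}" for \<psi>
    using DF.weak_time_derivative_functional[OF d2 that] by (simp add: L2_to_H1_dual_def)
   have b: "(LINT t|?M. exp (- \<tau> * t) * u'' t \<phi>) = exp (- \<tau> * T) * (LI x. U' T x * \<phi> x) - (LI x. U' 0 x * \<phi> x) + \<tau> * (LINT t|?M. exp (- \<tau> * t) * ?p1 t)"
    by (rule laplace_by_parts[OF T LF.functional_integrable[OF u'B] DF.functional_integrable[OF u''B] ivu'(1,2) wd2 \<tau>])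
   interpret AF: seminormed_functional H1 H1_norm "\<lambda>x. LI y. (A y *v weak_gradient x y) \<bullet> weak_gradient \<phi> y" "\<Lambda> * l2norm \<Phi>"
    by (rule H1_functional_A[OF \<phi>])
   let ?B = "\<lambda>t. LI x. (A x *v weak_gradient (u t) x) \<bullet> weak_gradient \<phi> x"
   have em: "(\<lambda>t. exp (- \<tau> * t)) \<in> borel_measurable ?M" by (intro continuous_imp_measurable_on_sets_lebesgue continuous_intros) auto
   have "(LINT t|?M. exp (- \<tau> * t) * ?B t) = (LINT t|?M. - (exp (- \<tau> * t) * u'' t \<phi>))"
   proof (rule integral_cong_AE)
    show "(\<lambda>t. exp (- \<tau> * t) * ?B t) \<in> borel_measurable ?M"
     by (rule borel_measurable_times[OF em borel_measurable_integrable[OF AF.functional_integrable[OF uB]]])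
    show "(\<lambda>t. - (exp (- \<tau> * t) * u'' t \<phi>)) \<in> borel_measurable ?M"
     by (rule borel_measurable_uminus[OF borel_measurable_times[OF em borel_measurable_integrable[OF DF.functional_integrable[OF u''B]]]])
    show "AE t in ?M. exp (- \<tau> * t) * ?B t = - (exp (- \<tau> * t) * u'' t \<phi>)" using eq[OF H]
    proof eventually_elim
     case (elim t)
     then have "?B t = - u'' t \<phi>" by linarith
     then show ?case by simp
    qed
   qed
   then have "(LINT t|?M. exp (- \<tau> * t) * ?B t) = - (LINT t|?M. exp (- \<tau> * t) * u'' t \<phi>)"
    by (simp only: Bochner_Integration.integral_minus)
   then show "(LINT t|?M. exp (- \<tau> * t) * ?B t) = (LI x. f x * \<phi> x) - exp (- \<tau> * T) * L \<phi> - \<tau>^2 * (LINT t|?M. exp (- \<tau> * t) * ?p t)"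
    unfolding a b ivu(3) ivu'(3) L_def by (simp add: algebra_simps power2_eq_square)
  qed
 qed
qed

end

text \<open>\<omega> is the exact transform of a simple function close to \<open>u\<close> in
  L^1(0,T; H^1), hence a finite combination of H^1 functions. A single bound on that distance
  controls every bounded functional, so the errors hold for all test functions at once.\<close>

lemma (in bounded_coefficient) time_transform_approximation:
 assumes u: "u \<in> Bochner_L2 T H1 H1_norm" and w: "is_time_transform T \<tau> u w" and \<tau>: "\<tau> > 0"
  and f: "square_integrable f" and e: "e > 0"
 obtains \<omega> W where "has_gradient \<omega> W" "\<bar>(LI x. f x * \<omega> x) - (LI x. f x * w x)\<bar> \<le> e"
  "\<And>\<phi> \<Phi>. has_gradient \<phi> \<Phi> \<Longrightarrow> \<bar>(LI x. (A x *v W x) \<bullet> \<Phi> x) -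
   (LINT t|time_measure T. exp (- \<tau> * t) * (LI x. (A x *v weak_gradient (u t) x) \<bullet> weak_gradient \<phi> x))\<bar> \<le> e * l2norm \<Phi>"
  "\<And>\<phi> \<Phi>. has_gradient \<phi> \<Phi> \<Longrightarrow> \<bar>(LI x. \<omega> x * \<phi> x) -
   (LINT t|time_measure T. exp (- \<tau> * t) * (LI x. u t x * \<phi> x))\<bar> \<le> e * l2norm \<phi>"
proof -
 let ?M = "time_measure T"
 \<comment> \<open>The functionals involved have norms at most \<Lambda> ||\<Phi>||, ||\<phi>|| and
   ||f||; dividing by the sum of the constants makes all three errors as small as claimed.\<close>
 define d where "d = e / (\<Lambda> + 1 + l2norm f)"
 have den: "\<Lambda> + 1 + l2norm f > 0" using \<Lambda>_nonneg l2norm_nonneg[of f] by linarith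
 have d: "d > 0" using e den by (simp add: d_def)
 have "e = (\<Lambda> + 1 + l2norm f) * d" using den by (simp add: d_def)
 then have "e = \<Lambda> * d + d + l2norm f * d" by (simp only: distrib_right mult_1)
 moreover have "0 \<le> \<Lambda> * d" "0 \<le> l2norm f * d" using \<Lambda>_nonneg d by auto
 ultimately have de: "\<Lambda> * d \<le> e" "d \<le> e" "l2norm f * d \<le> e" using d by linarith+
 obtain s where s: "simple_on T H1 s" "(\<integral>\<^sup>+t. ennreal (H1_norm (\<lambda>y. s t y - u t y)) \<partial>?M) < ennreal d"
  using H1.simple_approx_L1[OF u d] by blast
 then obtain n :: nat and E a where E: "\<And>k. k < n \<Longrightarrow> E k \<in> sets ?M" "\<And>k. k < n \<Longrightarrow> a k \<in> H1"
  and s_eq: "s = (\<lambda>t y. \<Sum>k<n. indicator (E k) t * a k y)" unfolding simple_on_def by blast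
 \<comment> \<open>Equal to e^{-\<tau> t} on the time interval but bounded by 1 on the whole line,
   as the lemmas on simple functions demand of a weight.\<close>
 define m where "m t = exp (- \<tau> * max t 0)" for t
 have m1: "\<bar>m t\<bar> \<le> 1" for t using \<tau> by (simp add: m_def)
 have mm: "m \<in> borel_measurable ?M" unfolding m_def by (intro continuous_imp_measurable_on_sets_lebesgue continuous_intros) auto
 have m_eq: "(LINT t|?M. m t * g t) = (LINT t|?M. exp (- \<tau> * t) * g t)" for g :: "real \<Rightarrow> real"
  by (rule Bochner_Integration.integral_cong) (auto simp: m_def)
 have su: "strongly_measurable T H1 H1_norm u" using u by (simp add: Bochner_L2_def)
 define \<omega> where "\<omega> = (\<lambda>y. \<Sum>k<n. (LINT t|?M. m t * indicator (E k) t) * a k y)"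
 have close: "\<bar>l \<omega> - (LINT t|?M. exp (- \<tau> * t) * l (u t))\<bar> \<le> C * d" if "seminormed_functional H1 H1_norm l C" for l C
 proof -
  interpret seminormed_functional H1 H1_norm l C by (rule that)
  have "(LINT t|?M. m t * l (s t)) = l \<omega>" unfolding s_eq \<omega>_def using simple_functional_integral(3)[OF E mm m1] by simp
  then show ?thesis using functional_L1_close(2)[OF su s(1) mm m1 s(2)] d by (simp add: m_eq)
 qed
 have \<omega>: "\<omega> \<in> H1" unfolding \<omega>_def by (rule H1.sum_in[OF E(2)])
 note g\<omega> = H1_has_gradient[OF \<omega>]
 show thesis
 proof
  show "has_gradient \<omega> (weak_gradient \<omega>)" by (rule g\<omega>)
  interpret F: seminormed_functional L2 L2_norm "\<lambda>x. LI y. x y * f y" "l2norm f" by (rule L2_functional[OF f])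
  have "(LINT t|?M. exp (- \<tau> * t) * (LI x. u t x * f x)) = (LI x. w x * f x)"
   using F.Bochner_integral_functional(2)[OF w[unfolded is_time_transform_def]] by (simp add: mult.assoc)
  then show "\<bar>(LI x. f x * \<omega> x) - (LI x. f x * w x)\<bar> \<le> e" using close[OF H1_functional_L2[OF f]] de(3) by (simp add: mult.commute)
  fix \<phi> \<Phi> assume \<phi>: "has_gradient \<phi> \<Phi>"
  have "\<bar>(LI x. \<omega> x * \<phi> x) - (LINT t|?M. exp (- \<tau> * t) * (LI x. u t x * \<phi> x))\<bar> \<le> l2norm \<phi> * d"
   by (rule close[OF H1_functional_L2[OF has_gradientD(1)[OF \<phi>]]])
  also have "\<dots> \<le> e * l2norm \<phi>" using mult_left_mono[OF de(2) l2norm_nonneg[of \<phi>]] by (simp only: mult.commute)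
  finally show "\<bar>(LI x. \<omega> x * \<phi> x) - (LINT t|?M. exp (- \<tau> * t) * (LI x. u t x * \<phi> x))\<bar> \<le> e * l2norm \<phi>" .
  have "\<bar>(LI x. (A x *v weak_gradient \<omega> x) \<bullet> weak_gradient \<phi> x) -
   (LINT t|?M. exp (- \<tau> * t) * (LI x. (A x *v weak_gradient (u t) x) \<bullet> weak_gradient \<phi> x))\<bar> \<le> \<Lambda> * l2norm \<Phi> * d"
   by (rule close[OF H1_functional_A[OF \<phi>]])
  also have "\<dots> = (\<Lambda> * d) * l2norm \<Phi>" by simp
  also have "\<dots> \<le> e * l2norm \<Phi>" using de(1) by (intro mult_right_mono) auto
  finally show "\<bar>(LI x. (A x *v weak_gradient \<omega> x) \<bullet> \<Phi> x) -
   (LINT t|?M. exp (- \<tau> * t) * (LI x. (A x *v weak_gradient (u t) x) \<bullet> weak_gradient \<phi> x))\<bar> \<le> e * l2norm \<Phi>"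
   by (simp only: integral_A_cong[OF g\<omega> \<phi>])
 qed
qed

section \<open>Energy identities for the indicator function\<close>

lemma Young_inequality_weighted:
 fixes a b c :: real
 assumes "c > 0"
 shows "2 * (a * b) \<le> c * a^2 + b^2 / c"
proof -
 have "0 \<le> (c * a - b)^2 / c" using assms by simp
 also have "\<dots> = c * a^2 + b^2 / c - 2 * (a * b)" using assms by (simp add: field_simps power2_eq_square)
 finally show ?thesis by simp
qed

lemma layered_form_coercive:
 assumes pos: "gp > 0" "gm > 0" and V: "square_integrable V"
 shows "min gp gm * (l2norm V)^2 \<le> (LI x. gamma0 gp gm x * (V x \<bullet> V x))"
proof -
 have "min gp gm * (l2norm V)^2 = (LI x. min gp gm * (norm (V x))^2)" by (simp add: l2norm_power2)
 also have "\<dots> \<le> (LI x. gamma0 gp gm x * (V x \<bullet> V x))"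
  using gamma0_bounds(2)[OF pos] integrable_inner[OF square_integrable_gamma0_scaleR[OF pos V] V] square_integrableD(2)[OF V]
  by (intro integral_mono) (auto simp: power2_norm_eq_inner intro!: mult_right_mono)
 finally show ?thesis .
qed

locale layered_perturbation = bounded_coefficient H M for H M +
 fixes gp gm c1 :: real and D :: "space set"
 assumes pos: "gp > 0" "gm > 0" and D: "D \<in> sets lebesgue" and c1: "c1 > 0"
  and H_support: "x \<notin> D \<Longrightarrow> H x = 0"
  and H_symmetric: "(H x *v \<xi>) \<bullet> \<eta> = (H x *v \<eta>) \<bullet> \<xi>"
  and elliptic: "AE x in lebesgue. \<forall>\<xi>. c1 * (norm \<xi>)^2 \<le> gamma0 gp gm x * (\<xi> \<bullet> \<xi>) + (H x *v \<xi>) \<bullet> \<xi>"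
begin

abbreviation "form0 V \<Phi> \<equiv> LI x. gamma0 gp gm x * (V x \<bullet> \<Phi> x)"
abbreviation "formH V \<Phi> \<equiv> LI x. (H x *v V x) \<bullet> \<Phi> x"
abbreviation "normD V \<equiv> l2norm (\<lambda>x. indicator D x *\<^sub>R V x)"

lemma integrable_form0: "square_integrable V \<Longrightarrow> square_integrable \<Phi> \<Longrightarrow> integrable lebesgue (\<lambda>x. gamma0 gp gm x * (V x \<bullet> \<Phi> x))"
 using integrable_inner[OF square_integrable_gamma0_scaleR[OF pos], of V \<Phi>] by simp

lemma integrable_formH: "square_integrable V \<Longrightarrow> square_integrable \<Phi> \<Longrightarrow> integrable lebesgue (\<lambda>x. (H x *v V x) \<bullet> \<Phi> x)"
 by (intro integrable_inner square_integrable_A)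

lemma form_diff:
 assumes "square_integrable W" "square_integrable V" "square_integrable \<Phi>"
 shows "form0 (\<lambda>x. W x - V x) \<Phi> = form0 W \<Phi> - form0 V \<Phi>" "formH (\<lambda>x. W x - V x) \<Phi> = formH W \<Phi> - formH V \<Phi>"
 using integrable_form0[OF assms(1,3)] integrable_form0[OF assms(2,3)] integrable_formH[OF assms(1,3)] integrable_formH[OF assms(2,3)]
 by (simp_all add: matrix_vector_mult_diff_distrib inner_diff_left right_diff_distrib Bochner_Integration.integral_diff)

lemma form_sym: "form0 V \<Phi> = form0 \<Phi> V" "formH V \<Phi> = formH \<Phi> V" using H_symmetric[of _ "V _" "\<Phi> _"] by (simp_all add: inner_commute)

lemma square_integrable_D: "square_integrable V \<Longrightarrow> square_integrable (\<lambda>x. indicator D x *\<^sub>R V x)" using square_integrable_restrict[OF D] .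

lemma H_restrict: "H x *v (indicator D x *\<^sub>R V) = H x *v V" using H_support[of x] by (cases "x \<in> D") auto

lemma formH_bound:
 assumes V: "square_integrable V" and \<Phi>: "square_integrable \<Phi>"
 shows "\<bar>formH V \<Phi>\<bar> \<le> M * normD V * l2norm \<Phi>"
proof -
 note HV = square_integrable_A[OF square_integrable_D[OF V], unfolded H_restrict]
 have "\<bar>formH V \<Phi>\<bar> \<le> l2norm (\<lambda>x. H x *v V x) * l2norm \<Phi>" by (rule l2_Cauchy_Schwarz[OF HV(1) \<Phi>])
 also have "\<dots> \<le> M * normD V * l2norm \<Phi>" using HV(2) by (intro mult_right_mono) auto
 finally show ?thesis .
qed

lemma formH_diag_bound:
 assumes V: "square_integrable V"
 shows "\<bar>formH V V\<bar> \<le> M * (normD V)^2"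
proof -
 have "formH V V = formH V (\<lambda>x. indicator D x *\<^sub>R V x)"
  using H_support by (intro Bochner_Integration.integral_cong) (auto simp: indicator_def)
 then show ?thesis using formH_bound[OF V square_integrable_D[OF V]] by (simp add: power2_eq_square mult.assoc)
qed

lemma formH_coercive:
 assumes V: "square_integrable V" and co: "AE x in lebesgue. x \<in> D \<longrightarrow> (\<forall>\<xi>. s * ((H x *v \<xi>) \<bullet> \<xi>) \<ge> C' * (norm \<xi>)^2)"
 shows "C' * (normD V)^2 \<le> s * formH V V"
proof -
 have "C' * (normD V)^2 = (LI x. C' * (norm (indicator D x *\<^sub>R V x))^2)" by (simp add: l2norm_power2)
 also have "\<dots> \<le> (LI x. s * ((H x *v V x) \<bullet> V x))"
 proof (rule integral_mono_AE)
  show "integrable lebesgue (\<lambda>x. C' * (norm (indicator D x *\<^sub>R V x))^2)"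
   by (intro integrable_mult_right square_integrableD(2) square_integrable_D V)
  show "AE x in lebesgue. C' * (norm (indicator D x *\<^sub>R V x))^2 \<le> s * ((H x *v V x) \<bullet> V x)" using co
  proof eventually_elim
   case (elim x)
   then show ?case using H_support[of x] by (cases "x \<in> D") auto
  qed
 qed (intro integrable_mult_right integrable_formH V)
 finally show ?thesis by simp
qed

lemma form_elliptic:
 assumes V: "square_integrable V"
 shows "c1 * (l2norm V)^2 \<le> form0 V V + formH V V"
proof -
 have "c1 * (l2norm V)^2 = (LI x. c1 * (norm (V x))^2)" by (simp add: l2norm_power2)
 also have "\<dots> \<le> (LI x. gamma0 gp gm x * (V x \<bullet> V x) + (H x *v V x) \<bullet> V x)"
 proof (rule integral_mono_AE)
  show "AE x in lebesgue. c1 * (norm (V x))^2 \<le> gamma0 gp gm x * (V x \<bullet> V x) + (H x *v V x) \<bullet> V x" using elliptic by eventually_elim simp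
 qed (intro integrable_mult_right square_integrableD(2) V Bochner_Integration.integrable_add integrable_form0 integrable_formH)+
 also have "\<dots> = form0 V V + formH V V" by (intro Bochner_Integration.integral_add integrable_form0 integrable_formH V)
 finally show ?thesis .
qed

text \<open>Up to residuals, \<open>J\<close> has the two representations
 \<open>- formH V V + (form0 + formH) G G + \<tau>^2 Y^2\<close> and \<open>- formH W W - form0 G G - \<tau>^2 Y^2\<close> with \<open>G = W - V\<close>,
 which settle its sign for negative and for positive \<open>H\<close>.\<close>

lemma indicator_estimates:
 assumes v: "layered_solution gp gm \<tau> f v V" and \<omega>: "has_gradient \<omega> W" and f: "square_integrable f"
  and \<delta>: "\<forall>\<phi> \<Phi>. has_gradient \<phi> \<Phi> \<longrightarrow> \<bar>form0 W \<Phi> + formH W \<Phi> + \<tau>^2 * (LI x. \<omega> x * \<phi> x) - (LI x. f x * \<phi> x)\<bar>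
   \<le> \<eta> * l2norm \<phi> + e * l2norm \<Phi>"
 defines "X \<equiv> l2norm (\<lambda>x. W x - V x)" and "Y \<equiv> l2norm (\<lambda>x. \<omega> x - v x)"
  and "J \<equiv> (LI x. f x * (\<omega> x - v x))" and "\<rho> \<equiv> \<eta> * l2norm v + e * l2norm V"
 shows "c1 * X^2 + \<tau>^2 * Y^2 \<le> \<eta> * Y + (e + M * normD V) * X"
  "\<bar>J\<bar> \<le> M * (normD V)^2 + M * normD V * X + \<rho>"
  "AE x in lebesgue. x \<in> D \<longrightarrow> (\<forall>\<xi>. - ((H x *v \<xi>) \<bullet> \<xi>) \<ge> C' * (norm \<xi>)^2) \<Longrightarrow>
   C' * (normD V)^2 - (\<rho> + \<eta> * Y + e * X) \<le> J"
  "C' \<ge> 0 \<Longrightarrow> AE x in lebesgue. x \<in> D \<longrightarrow> (\<forall>\<xi>. (H x *v \<xi>) \<bullet> \<xi> \<ge> C' * (norm \<xi>)^2) \<Longrightarrow>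
   min C' (min gp gm) / 2 * (normD V)^2 - (\<rho> + \<eta> * Y + e * X) \<le> - J"
proof -
 define R where "R x = \<omega> x - v x" for x
 define G where "G x = W x - V x" for x
 note gv = layered_solutionD(1)[OF v] and veq = layered_solutionD(2)[OF v]
 have gR: "has_gradient R G" unfolding R_def[abs_def] G_def[abs_def] by (rule has_gradient_diff[OF \<omega> gv])
 note sq = has_gradientD(1,2)[OF gv] has_gradientD(1,2)[OF \<omega>] has_gradientD(1,2)[OF gR]
 define res where "res \<phi> \<Phi> = form0 W \<Phi> + formH W \<Phi> + \<tau>^2 * (LI x. \<omega> x * \<phi> x) - (LI x. f x * \<phi> x)" for \<phi> \<Phi>
 have diff_eq: "form0 G \<Phi> + formH G \<Phi> + formH V \<Phi> + \<tau>^2 * (LI x. R x * \<phi> x) = res \<phi> \<Phi>" if \<phi>: "has_gradient \<phi> \<Phi>" for \<phi> \<Phi>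
 proof -
  note s = has_gradientD(1,2)[OF \<phi>]
  have "form0 G \<Phi> = form0 W \<Phi> - form0 V \<Phi>" "formH G \<Phi> = formH W \<Phi> - formH V \<Phi>"
   unfolding G_def[abs_def] by (rule form_diff[OF sq(4,2) s(2)])+
  moreover have "(LI x. R x * \<phi> x) = (LI x. \<omega> x * \<phi> x) - (LI x. v x * \<phi> x)"
   using integrable_times[OF sq(3) s(1)] integrable_times[OF sq(1) s(1)] by (simp add: R_def left_diff_distrib)
  ultimately show ?thesis using veq[OF \<phi>] by (simp add: res_def right_diff_distrib)
 qed
 have resR: "\<bar>res R G\<bar> \<le> \<eta> * Y + e * X" and resv: "\<bar>res v V\<bar> \<le> \<rho>"
  using \<delta>[rule_format, OF gR] \<delta>[rule_format, OF gv] by (simp_all add: res_def X_def Y_def \<rho>_def R_def[abs_def] G_def[abs_def])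
 have RR: "(LI x. R x * R x) = Y^2" unfolding Y_def l2norm_power2 by (simp add: R_def power2_eq_square)
 have XG: "X = l2norm G" by (simp add: X_def G_def[abs_def])
 have VG: "\<bar>formH V G\<bar> \<le> M * normD V * X" unfolding XG by (rule formH_bound[OF sq(2,6)])
 have E1: "form0 G G + formH G G + formH V G + \<tau>^2 * Y^2 = res R G" using diff_eq[OF gR] RR by simp
 have "c1 * X^2 \<le> form0 G G + formH G G" unfolding XG by (rule form_elliptic[OF sq(6)])
 then show "c1 * X^2 + \<tau>^2 * Y^2 \<le> \<eta> * Y + (e + M * normD V) * X" using E1 resR VG by (simp add: distrib_right abs_le_iff)
 \<comment> \<open>The equation of \<open>v\<close> is tested with R = \<omega> - v and the equation
   of \<open>R\<close> with \<open>v\<close>; symmetry of the forms cancels everything except the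
   residual and the terms with \<open>H\<close>.\<close>
 have J: "J = res v V - formH V V - formH V G"
 proof -
  have "J = form0 V G + \<tau>^2 * (LI x. v x * R x)" using veq[OF gR] by (simp add: J_def R_def)
  moreover have "form0 V G = form0 G V" "formH V G = formH G V" by (rule form_sym)+
  ultimately show ?thesis using diff_eq[OF gv] by (simp add: mult.commute)
 qed
 show "\<bar>J\<bar> \<le> M * (normD V)^2 + M * normD V * X + \<rho>" using formH_diag_bound[OF sq(2)] VG resv unfolding J by linarith
 \<comment> \<open>The mixed term \<open>formH V G\<close> is eliminated by the energy identity
   \<open>E1\<close>, which replaces it by the elliptic form of \<open>G\<close> with the favourable
   sign.\<close>
 show "C' * (normD V)^2 - (\<rho> + \<eta> * Y + e * X) \<le> J"
  if "AE x in lebesgue. x \<in> D \<longrightarrow> (\<forall>\<xi>. - ((H x *v \<xi>) \<bullet> \<xi>) \<ge> C' * (norm \<xi>)^2)"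
 proof -
  have "C' * (normD V)^2 \<le> - formH V V" using formH_coercive[OF sq(2), where s = "-1" and C' = C'] that by simp
  moreover have "0 \<le> c1 * (l2norm G)^2" "0 \<le> \<tau>^2 * Y^2" using c1 by auto
  moreover note form_elliptic[OF sq(6)] E1 resR resv
  ultimately show ?thesis unfolding J by linarith
 qed
 show "min C' (min gp gm) / 2 * (normD V)^2 - (\<rho> + \<eta> * Y + e * X) \<le> - J"
  if C': "C' \<ge> 0" and co: "AE x in lebesgue. x \<in> D \<longrightarrow> (\<forall>\<xi>. (H x *v \<xi>) \<bullet> \<xi> \<ge> C' * (norm \<xi>)^2)"
 proof -
  \<comment> \<open>On \<open>D\<close> the form of \<open>H\<close> controls \<open>W\<close>, and
    the layered form controls \<open>G\<close>. Since V = W - G, the square of a sum of two norms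
    costs the factor 2, hence k / 2.\<close>
  define k where "k = min C' (min gp gm)"
  have k: "0 \<le> k" "k \<le> C'" "k \<le> min gp gm" using C' pos by (auto simp: k_def)
  have WW: "formH W W = formH V V + 2 * formH V G + formH G G"
  proof -
   have "formH G G = formH W G - formH V G" "formH G V = formH W V - formH V V" "formH G W = formH W W - formH V W"
    unfolding G_def[abs_def] by (rule form_diff(2)[OF sq(4,2)], use sq in \<open>simp add: square_integrable_diff\<close>)+
   moreover have "formH V G = formH G V" "formH W G = formH G W" "formH V W = formH W V" by (rule form_sym)+
   ultimately show ?thesis by linarith
  qed
  have "normD V \<le> normD W + normD G"
  proof -
   have "(\<lambda>x. indicator D x *\<^sub>R V x) = (\<lambda>x. indicator D x *\<^sub>R W x - indicator D x *\<^sub>R G x)" by (simp add: G_def scaleR_diff_right)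
   then show ?thesis using l2norm_triangle_diff[OF square_integrable_D[OF sq(4)] square_integrable_D[OF sq(6)]] by simp
  qed
  moreover have "normD G \<le> l2norm G"
   by (rule l2norm_mono[OF square_integrableD(1)[OF square_integrable_D[OF sq(6)]] sq(6)]) (simp add: indicator_def)
  ultimately have "normD V \<le> normD W + l2norm G" by linarith
  then have "(normD V)^2 \<le> (normD W + l2norm G)^2" by (intro power_mono) auto
  also have "\<dots> \<le> 2 * ((normD W)^2 + (l2norm G)^2)"
   using zero_le_power2[of "normD W - l2norm G"] by (simp add: power2_eq_square algebra_simps)
  finally have "k / 2 * (normD V)^2 \<le> k / 2 * (2 * ((normD W)^2 + (l2norm G)^2))" using k by (intro mult_left_mono) auto
  also have "\<dots> = k * (normD W)^2 + k * (l2norm G)^2" by (simp add: distrib_left)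
  also have "\<dots> \<le> C' * (normD W)^2 + min gp gm * (l2norm G)^2" using k by (intro add_mono mult_right_mono) auto
  also have "\<dots> \<le> formH W W + form0 G G"
   using formH_coercive[OF sq(4), where s = 1 and C' = C'] co layered_form_coercive[OF pos sq(6)] by simp
  finally have "k / 2 * (normD V)^2 \<le> formH W W + form0 G G" .
  moreover have "0 \<le> \<tau>^2 * Y^2" by simp
  moreover note WW E1 resR resv
  ultimately show ?thesis unfolding J k_def[symmetric] by linarith
 qed
qed

end

lemma layered_solution_energy_bounds:
 assumes v: "layered_solution gp gm \<tau> f v V" and f: "square_integrable f" and pos: "gp > 0" "gm > 0" "\<tau> > 0"
 shows "l2norm v \<le> l2norm f / \<tau>^2" "l2norm V \<le> l2norm f / sqrt (min gp gm) / \<tau>"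
proof -
 note g = layered_solutionD(1)[OF v]
 note sq = has_gradientD(1,2)[OF g]
 have vv: "(LI x. v x * v x) = (l2norm v)^2" unfolding l2norm_power2 by (simp add: power2_eq_square)
 have min_pos: "min gp gm > 0" using pos by simp
 have sum: "min gp gm * (l2norm V)^2 + \<tau>^2 * (l2norm v)^2 \<le> l2norm f * l2norm v"
  using layered_form_coercive[OF pos(1,2) sq(2)] layered_solutionD(2)[OF v g] l2_Cauchy_Schwarz_real[OF f sq(1)] unfolding vv by linarith
 have "0 \<le> min gp gm * (l2norm V)^2" "0 \<le> \<tau>^2 * (l2norm v)^2" using min_pos by simp_all
 with sum have le: "\<tau>^2 * (l2norm v)^2 \<le> l2norm f * l2norm v" "min gp gm * (l2norm V)^2 \<le> l2norm f * l2norm v" by linarith+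
 show v_le: "l2norm v \<le> l2norm f / \<tau>^2"
 proof (cases "l2norm v = 0")
  case False
  then have "l2norm v > 0" using l2norm_nonneg[of v] by linarith
  then have "\<tau>^2 * l2norm v \<le> l2norm f" using le(1) by (simp add: power2_eq_square mult.assoc[symmetric])
  then show ?thesis using pos by (simp add: pos_le_divide_eq mult.commute)
 qed simp
 have "min gp gm * (l2norm V)^2 \<le> (l2norm f / \<tau>)^2"
  using le(2) mult_left_mono[OF v_le l2norm_nonneg[of f]] by (simp add: power_divide power2_eq_square)
 then have "(sqrt (min gp gm) * l2norm V)^2 \<le> (l2norm f / \<tau>)^2" using min_pos by (simp add: power_mult_distrib)
 then have "sqrt (min gp gm) * l2norm V \<le> l2norm f / \<tau>" by (rule power2_le_imp_le) (use pos in simp)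
 moreover have "sqrt (min gp gm) > 0" using min_pos by simp
 ultimately have "l2norm V \<le> (l2norm f / \<tau>) / sqrt (min gp gm)" by (simp only: pos_le_divide_eq mult.commute)
 then show "l2norm V \<le> l2norm f / sqrt (min gp gm) / \<tau>" by (simp only: divide_divide_eq_left mult.commute)
qed

lemma mat_vector_mult: "mat k *v \<xi> = k *\<^sub>R \<xi>" for \<xi> :: space
proof -
 have "(mat k *v \<xi>) $ i = (\<Sum>j\<in>UNIV. if i = j then k * \<xi> $ j else 0)" for i
  by (simp add: matrix_vector_mult_def mat_def if_distrib[of "\<lambda>x. x * _"] cong: if_cong)
 then show ?thesis by (simp add: vec_eq_iff)
qed

lemma exp_minus_le_inverse: "a > 0 \<Longrightarrow> exp (- a) \<le> 1 / a" for a :: real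
proof -
 assume "a > 0"
 moreover have "a \<le> exp a" using exp_ge_add_one_self[of a] by linarith
 ultimately show ?thesis by (simp add: exp_minus inverse_eq_divide frac_le)
qed

lemma le_sqrt_divide:
 fixes a x \<tau> Q :: real
 assumes "a * x^2 \<le> Q / \<tau>^2" "a > 0" "\<tau> > 0" "x \<ge> 0"
 shows "x \<le> sqrt (Q / a) / \<tau>"
proof -
 have "x^2 \<le> (Q / a) / \<tau>^2" using assms by (simp add: pos_le_divide_eq mult.commute mult.left_commute)
 then have "sqrt (x^2) \<le> sqrt ((Q / a) / \<tau>^2)" by (rule real_sqrt_le_mono)
 then show ?thesis unfolding real_sqrt_divide[of "Q / a"] using assms by simp
qed

context layered_perturbation
begin

lemma bounded_coefficient_sum:
 assumes A: "\<And>x. A x = mat (gamma0 gp gm x) + H x"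
 shows "bounded_coefficient A (max gp gm + M)"
proof
 show "(\<lambda>x. A x $ i $ j) \<in> borel_measurable lebesgue" for i j
 proof -
  have "(\<lambda>x. (if i = j then gamma0 gp gm x else 0) + H x $ i $ j) \<in> borel_measurable lebesgue"
   using borel_measurable_gamma0_lebesgue A_meas by (cases "i = j") (auto intro: borel_measurable_add)
  then show ?thesis by (simp add: A mat_def)
 qed
 show "AE x in lebesgue. \<forall>\<xi>. norm (A x *v \<xi>) \<le> (max gp gm + M) * norm \<xi>" using A_bound
 proof eventually_elim
  case (elim x)
  show ?case
  proof
   fix \<xi>
   have "norm (A x *v \<xi>) \<le> norm (gamma0 gp gm x *\<^sub>R \<xi>) + norm (H x *v \<xi>)"
    unfolding A matrix_vector_mult_add_rdistrib mat_vector_mult by (rule norm_triangle_ineq)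
   also have "\<dots> \<le> max gp gm * norm \<xi> + M * norm \<xi>"
    using gamma0_bounds(1,3)[OF pos, of x] elim by (intro add_mono) (auto intro!: mult_right_mono)
   finally show "norm (A x *v \<xi>) \<le> (max gp gm + M) * norm \<xi>" by (simp add: distrib_right)
  qed
 qed
 show "0 \<le> max gp gm + M" using pos \<Lambda>_nonneg by (simp add: max_def)
qed

text \<open>The factor 1 / \<tau> in the remainder comes from crude a priori bounds:
  \<open>X\<close>, \<tau> Y and the norm on \<open>D\<close> are O(1 / \<tau>), and the residual
  multiplies them by E = e^{-\<tau> T}, with the factor \<tau> that accompanies Y. The one product
  not of this type, M n X, is split by Young's inequality into a multiple of n^2 and a multiple of
  E^2.\<close>

lemma indicator_asymptotics:
 assumes A: "\<And>x. A x = mat (gamma0 gp gm x) + H x" and wave: "wave_weak_solution A T f u" and T: "T > 0"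
  and f: "square_integrable f"
  and w: "\<And>\<tau>. \<tau> > 0 \<Longrightarrow> is_time_transform T \<tau> u (w \<tau>)"
  and v: "\<And>\<tau>. \<tau> > 0 \<Longrightarrow> layered_solution gp gm \<tau> f (v \<tau>) (V \<tau>)"
 defines "I \<equiv> \<lambda>\<tau>. LI x. f x * (w \<tau> x - v \<tau> x)"
 obtains C K where "C \<ge> 0" "K \<ge> 0"
  "\<And>\<tau>. \<tau> \<ge> 1 \<Longrightarrow> \<bar>I \<tau>\<bar> \<le> C * (normD (V \<tau>))^2 + K * (exp (- \<tau> * T) / \<tau>)"
  "\<And>\<tau> C'. \<tau> \<ge> 1 \<Longrightarrow> AE x in lebesgue. x \<in> D \<longrightarrow> (\<forall>\<xi>. - ((H x *v \<xi>) \<bullet> \<xi>) \<ge> C' * (norm \<xi>)^2) \<Longrightarrow>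
   C' * (normD (V \<tau>))^2 - K * (exp (- \<tau> * T) / \<tau>) \<le> I \<tau>"
  "\<And>\<tau> C'. \<tau> \<ge> 1 \<Longrightarrow> C' \<ge> 0 \<Longrightarrow> AE x in lebesgue. x \<in> D \<longrightarrow> (\<forall>\<xi>. (H x *v \<xi>) \<bullet> \<xi> \<ge> C' * (norm \<xi>)^2) \<Longrightarrow>
   min C' (min gp gm) / 2 * (normD (V \<tau>))^2 - K * (exp (- \<tau> * T) / \<tau>) \<le> - I \<tau>"
proof -
 interpret A: bounded_coefficient A "max gp gm + M" by (rule bounded_coefficient_sum[OF A])
 obtain K0 where K0: "K0 \<ge> 0" and laplace:
  "\<And>\<tau>. \<tau> > 0 \<Longrightarrow> \<exists>L. (\<forall>\<phi> \<Phi>. has_gradient \<phi> \<Phi> \<longrightarrow> \<bar>L \<phi>\<bar> \<le> K0 * (1 + \<tau>) * l2norm \<phi> \<and>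
    (LINT t|time_measure T. exp (- \<tau> * t) * (LI x. (A x *v weak_gradient (u t) x) \<bullet> weak_gradient \<phi> x)) =
    (LI x. f x * \<phi> x) - exp (- \<tau> * T) * L \<phi> - \<tau>^2 * (LINT t|time_measure T. exp (- \<tau> * t) * (LI x. u t x * \<phi> x)))"
  using A.wave_laplace_transform[OF wave T f] by blast
 have uB: "u \<in> Bochner_L2 T H1 H1_norm" using wave by (auto simp: wave_weak_solution_def)
 define K2 where "K2 = 2 * K0 + 1"
 define N1 where "N1 = l2norm f / sqrt (min gp gm)"
 \<comment> \<open>\<open>Q\<close> bounds \<tau>^2 times the absorbed right side, using E \<le> 1 /
   (T \<tau>) and n \<le> N1 / \<tau>. The constants \<open>k1\<close>, \<open>k2\<close> and
   \<open>k3\<close> are the resulting coefficients of E / \<tau> in the residual at v, the residual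
   at \<omega> - v and the cross term.\<close>
 define Q where "Q = K2^2 / T^2 + (1 / T + M * N1)^2 / c1"
 define k1 where "k1 = K2 * l2norm f + N1"
 define k2 where "k2 = K2 * sqrt Q + sqrt (Q / c1)"
 define k3 where "k3 = (K2^2 + 2 / c1) / (2 * T)"
 define C where "C = M + 3 * M^2 / (2 * c1)"
 have nn: "K2 \<ge> 0" "N1 \<ge> 0" "Q \<ge> 0" "k1 \<ge> 0" "k2 \<ge> 0" "k3 \<ge> 0" "C \<ge> 0"
 proof -
  show "K2 \<ge> 0" using K0 by (simp add: K2_def)
  show "N1 \<ge> 0" using pos by (simp add: N1_def)
  show "Q \<ge> 0" "k3 \<ge> 0" "C \<ge> 0" using T c1 \<Lambda>_nonneg by (auto simp: Q_def k3_def C_def)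
  then show "k1 \<ge> 0" "k2 \<ge> 0" using \<open>K2 \<ge> 0\<close> \<open>N1 \<ge> 0\<close> c1 by (auto simp: k1_def k2_def)
 qed
 have key: "\<bar>I \<tau>\<bar> \<le> C * (normD (V \<tau>))^2 + (k1 + k2 + k3 + 1) * (exp (- \<tau> * T) / \<tau>) \<and>
  (\<forall>C'. (AE x in lebesgue. x \<in> D \<longrightarrow> (\<forall>\<xi>. - ((H x *v \<xi>) \<bullet> \<xi>) \<ge> C' * (norm \<xi>)^2)) \<longrightarrow>
   C' * (normD (V \<tau>))^2 - (k1 + k2 + k3 + 1) * (exp (- \<tau> * T) / \<tau>) \<le> I \<tau>) \<and>
  (\<forall>C'\<ge>0. (AE x in lebesgue. x \<in> D \<longrightarrow> (\<forall>\<xi>. (H x *v \<xi>) \<bullet> \<xi> \<ge> C' * (norm \<xi>)^2)) \<longrightarrow>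
   min C' (min gp gm) / 2 * (normD (V \<tau>))^2 - (k1 + k2 + k3 + 1) * (exp (- \<tau> * T) / \<tau>) \<le> - I \<tau>)"
  if \<tau>1: "\<tau> \<ge> 1" for \<tau>
 proof -
  have \<tau>: "\<tau> > 0" using \<tau>1 by simp
  define E where "E = exp (- \<tau> * T)"
  define z where "z = E / \<tau>"
  have E: "E > 0" "E \<le> 1" "E \<le> (1 / T) / \<tau>" using \<tau> T exp_minus_le_inverse[of "\<tau> * T"] by (auto simp: E_def mult.commute)
  have z: "z > 0" using E \<tau> by (simp add: z_def)
  have EE: "E^2 \<le> z / T" using mult_left_mono[OF E(3), of E] E(1) by (simp add: z_def power2_eq_square mult.commute)
  \<comment> \<open>This accuracy satisfies e \<le> E, \<tau>^2 e \<le> E and e \<le> E / \<tau>, so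
    replacing \<open>w\<close> by \<omega> costs no more than the residual itself: in the forms, in
    the term with \<tau>^2, and in the indicator.\<close>
  define e where "e = E / (1 + \<tau>^2)"
  have \<tau>2: "1 + \<tau>^2 > 0" "\<tau> \<le> 1 + \<tau>^2"
  proof -
   have "1 * \<tau> \<le> \<tau> * \<tau>" using \<tau>1 by (intro mult_right_mono) auto
   then show "\<tau> \<le> 1 + \<tau>^2" by (simp add: power2_eq_square)
  qed (simp add: add_pos_nonneg)
  have e: "e > 0" "e \<le> E" "\<tau>^2 * e \<le> E" "e \<le> z"
  proof -
   show "e > 0" using E \<tau>2 by (simp add: e_def)
   moreover have "E = e + \<tau>^2 * e"
   proof -
    have "E = (1 + \<tau>^2) * e" using \<tau>2(1) by (simp add: e_def)
    then show ?thesis by (simp only: distrib_right mult_1)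
   qed
   moreover have "0 \<le> \<tau>^2 * e" using \<open>e > 0\<close> by simp
   ultimately show "e \<le> E" "\<tau>^2 * e \<le> E" by linarith+
   show "e \<le> z" unfolding e_def z_def using \<tau>2 \<tau> E by (intro divide_left_mono) auto
  qed
  \<comment> \<open>The coefficient of ||\<phi>|| in the residual: K0 (1 + \<tau>) from the final
    data and 1 from the approximation, together at most (2 K0 + 1) \<tau> for \<tau> \<ge> 1, times
    E.\<close>
  define \<eta> where "\<eta> = K2 * \<tau> * E"
  obtain L where L: "\<And>\<phi> \<Phi>. has_gradient \<phi> \<Phi> \<Longrightarrow> \<bar>L \<phi>\<bar> \<le> K0 * (1 + \<tau>) * l2norm \<phi>"
   "\<And>\<phi> \<Phi>. has_gradient \<phi> \<Phi> \<Longrightarrow> (LINT t|time_measure T. exp (- \<tau> * t) * (LI x. (A x *v weak_gradient (u t) x) \<bullet> weak_gradient \<phi> x)) =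
    (LI x. f x * \<phi> x) - E * L \<phi> - \<tau>^2 * (LINT t|time_measure T. exp (- \<tau> * t) * (LI x. u t x * \<phi> x))"
   using laplace[OF \<tau>] unfolding E_def by blast
  obtain \<omega> W where \<omega>: "has_gradient \<omega> W" and f\<omega>: "\<bar>(LI x. f x * \<omega> x) - (LI x. f x * w \<tau> x)\<bar> \<le> e"
   and aA: "\<And>\<phi> \<Phi>. has_gradient \<phi> \<Phi> \<Longrightarrow> \<bar>(LI x. (A x *v W x) \<bullet> \<Phi> x) -
    (LINT t|time_measure T. exp (- \<tau> * t) * (LI x. (A x *v weak_gradient (u t) x) \<bullet> weak_gradient \<phi> x))\<bar> \<le> e * l2norm \<Phi>"
   and au: "\<And>\<phi> \<Phi>. has_gradient \<phi> \<Phi> \<Longrightarrow> \<bar>(LI x. \<omega> x * \<phi> x) -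
    (LINT t|time_measure T. exp (- \<tau> * t) * (LI x. u t x * \<phi> x))\<bar> \<le> e * l2norm \<phi>"
   using A.time_transform_approximation[OF uB w[OF \<tau>] \<tau> f e(1)] by blast
  have \<delta>: "\<bar>form0 W \<Phi> + formH W \<Phi> + \<tau>^2 * (LI x. \<omega> x * \<phi> x) - (LI x. f x * \<phi> x)\<bar>
    \<le> \<eta> * l2norm \<phi> + E * l2norm \<Phi>" if \<phi>: "has_gradient \<phi> \<Phi>" for \<phi> \<Phi>
  proof -
   define p where "p = (LI x. \<omega> x * \<phi> x)"
   define q where "q = (LINT t|time_measure T. exp (- \<tau> * t) * (LI x. u t x * \<phi> x))"
   define g where "g = (LI x. (A x *v W x) \<bullet> \<Phi> x)"
   define F where "F = (LI x. f x * \<phi> x)"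
   have form: "form0 W \<Phi> + formH W \<Phi> = g"
   proof -
    note s = has_gradientD(2)[OF \<omega>] has_gradientD(2)[OF \<phi>]
    have "g = (LI x. gamma0 gp gm x * (W x \<bullet> \<Phi> x) + (H x *v W x) \<bullet> \<Phi> x)"
     by (simp add: g_def A matrix_vector_mult_add_rdistrib mat_vector_mult inner_add_left)
    then show ?thesis using Bochner_Integration.integral_add[OF integrable_form0[OF s] integrable_formH[OF s]] by simp
   qed
   have "\<bar>g - (F - E * L \<phi> - \<tau>^2 * q)\<bar> \<le> e * l2norm \<Phi>" using aA[OF \<phi>] unfolding L(2)[OF \<phi>] g_def F_def q_def .
   moreover have "e * l2norm \<Phi> \<le> E * l2norm \<Phi>" using e by (intro mult_right_mono) auto
   moreover have "\<bar>\<tau>^2 * p - \<tau>^2 * q\<bar> \<le> E * l2norm \<phi>"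
   proof -
    have "\<bar>\<tau>^2 * p - \<tau>^2 * q\<bar> = \<tau>^2 * \<bar>p - q\<bar>" by (simp add: right_diff_distrib[symmetric] abs_mult)
    also have "\<dots> \<le> \<tau>^2 * (e * l2norm \<phi>)" using au[OF \<phi>] unfolding p_def q_def by (intro mult_left_mono) auto
    also have "\<dots> \<le> E * l2norm \<phi>" using mult_right_mono[OF e(3) l2norm_nonneg[of \<phi>]] by (simp only: mult.assoc)
    finally show ?thesis .
   qed
   moreover have "\<bar>E * L \<phi>\<bar> \<le> E * (K0 * (1 + \<tau>) * l2norm \<phi>)" using L(1)[OF \<phi>] E by (simp add: abs_mult)
   moreover have "E * (K0 * (1 + \<tau>) * l2norm \<phi>) + E * l2norm \<phi> \<le> \<eta> * l2norm \<phi>"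
   proof -
    have "K0 * (1 + \<tau>) + 1 \<le> K0 * (2 * \<tau>) + \<tau>" using \<tau>1 K0 by (intro add_mono mult_left_mono) auto
    then have "(K0 * (1 + \<tau>) + 1) * (E * l2norm \<phi>) \<le> (K0 * (2 * \<tau>) + \<tau>) * (E * l2norm \<phi>)" using E by (intro mult_right_mono) auto
    then show ?thesis by (simp add: \<eta>_def K2_def algebra_simps)
   qed
   ultimately have "\<bar>g + \<tau>^2 * p - F\<bar> \<le> \<eta> * l2norm \<phi> + E * l2norm \<Phi>" by linarith
   then show ?thesis by (simp only: form p_def F_def)
  qed
  then have \<delta>': "\<forall>\<phi> \<Phi>. has_gradient \<phi> \<Phi> \<longrightarrow> \<bar>form0 W \<Phi> + formH W \<Phi> + \<tau>^2 * (LI x. \<omega> x * \<phi> x) - (LI x. f x * \<phi> x)\<bar>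
    \<le> \<eta> * l2norm \<phi> + E * l2norm \<Phi>" by blast
  define n where "n = normD (V \<tau>)"
  define X where "X = l2norm (\<lambda>x. W x - V \<tau> x)"
  define Y where "Y = l2norm (\<lambda>x. \<omega> x - v \<tau> x)"
  define J where "J = (LI x. f x * (\<omega> x - v \<tau> x))"
  define \<rho> where "\<rho> = \<eta> * l2norm (v \<tau>) + E * l2norm (V \<tau>)"
  note est = indicator_estimates[OF v[OF \<tau>] \<omega> f \<delta>', folded X_def Y_def J_def n_def, folded \<rho>_def]
  have XY0: "X \<ge> 0" "Y \<ge> 0" "n \<ge> 0" by (simp_all add: X_def Y_def n_def)
  note bounds = layered_solution_energy_bounds[OF v[OF \<tau>] f pos \<tau>]
  have sqv: "square_integrable (v \<tau>)" "square_integrable (V \<tau>)" using has_gradientD(1,2)[OF layered_solutionD(1)[OF v[OF \<tau>]]] .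
  have n_le: "n \<le> N1 / \<tau>"
  proof -
   have "n \<le> l2norm (V \<tau>)" unfolding n_def
    by (rule l2norm_mono[OF square_integrableD(1)[OF square_integrable_D[OF sqv(2)]] sqv(2)]) (simp add: indicator_def)
   then show ?thesis using bounds(2) by (simp add: N1_def)
  qed
  have \<rho>_le: "\<rho> \<le> k1 * z"
  proof -
   have "\<eta> * l2norm (v \<tau>) \<le> \<eta> * (l2norm f / \<tau>^2)" using bounds(1) nn(1) E \<tau> by (intro mult_left_mono) (auto simp: \<eta>_def)
   also have "\<dots> = K2 * l2norm f * z" using \<tau> by (simp add: \<eta>_def z_def power2_eq_square)
   finally have "\<eta> * l2norm (v \<tau>) \<le> K2 * l2norm f * z" .
   moreover have "E * l2norm (V \<tau>) \<le> N1 * z" using mult_left_mono[OF bounds(2), of E] E by (simp add: N1_def z_def mult.commute)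
   ultimately show ?thesis by (simp add: \<rho>_def k1_def distrib_right)
  qed
  \<comment> \<open>Young's inequality is applied to twice the energy bound with exactly the weights
    on its left side, so that one copy of the left side cancels.\<close>
  have absorb: "c1 * X^2 + \<tau>^2 * Y^2 \<le> K2^2 * E^2 + (E + M * n)^2 / c1"
  proof -
   have "2 * (Y * \<eta>) \<le> \<tau>^2 * Y^2 + \<eta>^2 / \<tau>^2" using \<tau> by (intro Young_inequality_weighted) simp
   moreover have "\<eta>^2 / \<tau>^2 = K2^2 * E^2" using \<tau> by (simp add: \<eta>_def power_mult_distrib)
   moreover have "2 * (X * (E + M * n)) \<le> c1 * X^2 + (E + M * n)^2 / c1" by (rule Young_inequality_weighted[OF c1])
   ultimately show ?thesis using est(1) by (simp only: mult.commute)
  qed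
  also have "\<dots> \<le> Q / \<tau>^2"
  proof -
   have "E^2 \<le> ((1 / T) / \<tau>)^2" using E by (intro power_mono) auto
   then have "K2^2 * E^2 \<le> K2^2 * ((1 / T) / \<tau>)^2" by (intro mult_left_mono) auto
   moreover have "M * n \<le> M * (N1 / \<tau>)" using n_le \<Lambda>_nonneg by (intro mult_left_mono) auto
   then have "E + M * n \<le> (1 / T + M * N1) / \<tau>" using E(3) by (simp add: add_divide_distrib)
   then have "(E + M * n)^2 \<le> ((1 / T + M * N1) / \<tau>)^2" using E XY0 \<Lambda>_nonneg by (intro power_mono) auto
   then have "(E + M * n)^2 / c1 \<le> ((1 / T + M * N1) / \<tau>)^2 / c1" using c1 by (intro divide_right_mono) auto
   moreover have "Q / \<tau>^2 = K2^2 * ((1 / T) / \<tau>)^2 + ((1 / T + M * N1) / \<tau>)^2 / c1"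
   proof -
    have "(K2^2 / T^2 + q^2 / c1) / \<tau>^2 = K2^2 * ((1 / T) / \<tau>)^2 + (q / \<tau>)^2 / c1" for q
     by (simp add: power_divide power_mult_distrib add_divide_distrib mult.commute)
    then show ?thesis by (simp only: Q_def)
   qed
   ultimately show ?thesis by linarith
  qed
  finally have XYQ: "c1 * X^2 + \<tau>^2 * Y^2 \<le> Q / \<tau>^2" .
  have sqpos: "0 \<le> c1 * X^2" "0 \<le> \<tau>^2 * Y^2" using c1 by auto
  have X_le: "X \<le> sqrt (Q / c1) / \<tau>" using XYQ sqpos c1 \<tau> XY0 by (intro le_sqrt_divide) linarith+
  have Y_le: "\<tau> * Y \<le> sqrt (Q / 1) / \<tau>" using XYQ sqpos \<tau> XY0 by (intro le_sqrt_divide) (auto simp: power_mult_distrib)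
  have res_le: "\<eta> * Y + E * X \<le> k2 * z"
  proof -
   have "\<eta> * Y = K2 * E * (\<tau> * Y)" by (simp add: \<eta>_def)
   also have "\<dots> \<le> K2 * E * (sqrt Q / \<tau>)" using Y_le nn E by (intro mult_left_mono) auto
   finally have "\<eta> * Y \<le> K2 * sqrt Q * z" by (simp add: z_def ac_simps)
   moreover have "E * X \<le> sqrt (Q / c1) * z" using mult_left_mono[OF X_le, of E] E by (simp add: z_def mult.commute)
   ultimately show ?thesis by (simp add: k2_def distrib_right)
  qed
  have cross: "M * n * X \<le> 3 * M^2 / (2 * c1) * n^2 + k3 * z"
  proof -
   have "2 * (X * (M * n)) \<le> c1 * X^2 + (M * n)^2 / c1" by (rule Young_inequality_weighted[OF c1])
   also have "\<dots> \<le> K2^2 * E^2 + (E + M * n)^2 / c1 + (M * n)^2 / c1" using absorb sqpos by linarith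
   also have "\<dots> \<le> K2^2 * E^2 + (2 * E^2 + 2 * (M * n)^2) / c1 + (M * n)^2 / c1"
   proof -
    have "(E + M * n)^2 \<le> 2 * E^2 + 2 * (M * n)^2" using zero_le_power2[of "E - M * n"] by (simp add: power2_eq_square algebra_simps)
    then show ?thesis using c1 by (intro add_mono divide_right_mono) auto
   qed
   also have "\<dots> = (K2^2 + 2 / c1) * E^2 + 3 * (M^2 / c1 * n^2)" by (simp add: add_divide_distrib power_mult_distrib algebra_simps)
   also have "\<dots> \<le> (K2^2 + 2 / c1) * (z / T) + 3 * (M^2 / c1 * n^2)" using EE c1 by (intro add_right_mono mult_left_mono) auto
   also have "(K2^2 + 2 / c1) * (z / T) = 2 * (k3 * z)" by (simp add: k3_def)
   finally show ?thesis by (simp add: mult.commute mult.left_commute)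
  qed
  have IJ: "\<bar>I \<tau> - J\<bar> \<le> z"
  proof -
   have wL: "square_integrable (w \<tau>)" using w[OF \<tau>] by (auto simp: is_time_transform_def has_Bochner_integral_on_def L2_def)
   note i = integrable_times[OF f wL] integrable_times[OF f sqv(1)] integrable_times[OF f has_gradientD(1)[OF \<omega>]]
   have "I \<tau> = (LI x. f x * w \<tau> x) - (LI x. f x * v \<tau> x)"
    "J = (LI x. f x * \<omega> x) - (LI x. f x * v \<tau> x)"
    using i by (simp_all add: I_def J_def right_diff_distrib Bochner_Integration.integral_diff)
   then show ?thesis using f\<omega> e(4) by linarith
  qed
  have K: "k1 * z \<ge> 0" "k2 * z \<ge> 0" "k3 * z \<ge> 0" "(k1 + k2 + k3 + 1) * z = k1 * z + k2 * z + k3 * z + z"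
   using nn z by (auto simp: distrib_right)
  have Cn: "C * n^2 = M * n^2 + 3 * M^2 / (2 * c1) * n^2" by (simp add: C_def distrib_right)
  show ?thesis unfolding n_def[symmetric] E_def[symmetric] z_def[symmetric] K(4)
  proof (intro conjI allI impI)
   show "\<bar>I \<tau>\<bar> \<le> C * n^2 + (k1 * z + k2 * z + k3 * z + z)" using est(2) cross \<rho>_le IJ K(2) unfolding Cn by linarith
   show "C' * n^2 - (k1 * z + k2 * z + k3 * z + z) \<le> I \<tau>"
    if "AE x in lebesgue. x \<in> D \<longrightarrow> (\<forall>\<xi>. - ((H x *v \<xi>) \<bullet> \<xi>) \<ge> C' * (norm \<xi>)^2)" for C'
    using est(3)[OF that] \<rho>_le res_le IJ K(3) by linarith
   show "min C' (min gp gm) / 2 * n^2 - (k1 * z + k2 * z + k3 * z + z) \<le> - I \<tau>"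
    if "C' \<ge> 0" "AE x in lebesgue. x \<in> D \<longrightarrow> (\<forall>\<xi>. (H x *v \<xi>) \<bullet> \<xi> \<ge> C' * (norm \<xi>)^2)" for C'
    using est(4)[OF that] \<rho>_le res_le IJ K(3) by linarith
  qed
 qed
 show thesis by (rule that[of C "k1 + k2 + k3 + 1"]) (use nn key in \<open>blast intro: add_nonneg_nonneg zero_le_one\<close>)+
qed

end

section \<open>Limits of the indicator function\<close>

lemma exp_rate_combine:
 fixes \<tau> T s :: real
 shows "exp (\<tau> * T) * exp (- 2 * \<tau> * s) = exp (\<tau> * (T - 2 * s))" by (simp add: exp_add[symmetric] algebra_simps)

text \<open>A reduction to one variable: \<open>J\<close> stands for the indicator function and
  \<open>n\<close> for the norm of the gradient on \<open>D\<close>, whose rate is \<open>l\<close>.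
  The factor 1 / \<tau> in the remainder is what lets e^{\<tau> T} J tend to 0 and not merely stay
  bounded.\<close>

locale indicator_rates =
 fixes J n :: "real \<Rightarrow> real" and T l C K :: real
 assumes C: "C \<ge> 0" and K: "K \<ge> 0"
  and J_le: "\<And>\<tau>. \<tau> \<ge> 1 \<Longrightarrow> \<bar>J \<tau>\<bar> \<le> C * (n \<tau>)^2 + K * (exp (- \<tau> * T) / \<tau>)"
  and n_le: "\<And>\<epsilon>. \<epsilon> > 0 \<Longrightarrow> \<exists>k>0. \<forall>\<tau>\<ge>1. (n \<tau>)^2 \<le> k * exp (- 2 * \<tau> * (l - \<epsilon>))"
  and n_ge: "\<And>\<epsilon>. \<epsilon> > 0 \<Longrightarrow> \<exists>k>0. \<exists>\<tau>0>0. \<forall>\<tau>\<ge>\<tau>0. k * exp (- \<tau> * (l + \<epsilon>)) \<le> n \<tau>"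
begin

lemma tendsto_zero:
 assumes T: "T < 2 * l"
 shows "((\<lambda>\<tau>. exp (\<tau> * T) * J \<tau>) \<longlongrightarrow> 0) at_top"
proof -
 \<comment> \<open>Half of the gap 2 l - T; with loss a / 2 in the rate the squared norm still
   decays faster than e^{-\<tau> T}, by the factor e^{-a \<tau>}.\<close>
 define a where "a = (2 * l - T) / 2"
 have a: "a > 0" "T - 2 * (l - a / 2) = - a" using T by (simp_all add: a_def right_diff_distrib diff_divide_distrib)
 obtain k where k: "k > 0" "\<And>\<tau>. \<tau> \<ge> 1 \<Longrightarrow> (n \<tau>)^2 \<le> k * exp (- 2 * \<tau> * (l - a / 2))" using n_le[of "a / 2"] a(1) by auto
 have "\<bar>exp (\<tau> * T) * J \<tau>\<bar> \<le> (C * k / a + K) / \<tau>" if \<tau>: "\<tau> \<ge> 1" for \<tau>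
 proof -
  have "\<bar>J \<tau>\<bar> \<le> C * (k * exp (- 2 * \<tau> * (l - a / 2))) + K * (exp (- \<tau> * T) / \<tau>)"
   using J_le[OF \<tau>] mult_left_mono[OF k(2)[OF \<tau>] C] by linarith
  then have "exp (\<tau> * T) * \<bar>J \<tau>\<bar> \<le> exp (\<tau> * T) * (C * (k * exp (- 2 * \<tau> * (l - a / 2))) + K * (exp (- \<tau> * T) / \<tau>))"
   by (intro mult_left_mono) auto
  also have "\<dots> = C * k * (exp (\<tau> * T) * exp (- 2 * \<tau> * (l - a / 2))) + K * (exp (\<tau> * T) * exp (- \<tau> * T)) / \<tau>"
   by (simp add: distrib_left ac_simps)
  also have "\<dots> = C * k * exp (- (a * \<tau>)) + K / \<tau>" unfolding exp_rate_combine a(2) by (simp add: exp_add[symmetric] mult.commute)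
  also have "\<dots> \<le> C * k * (1 / (a * \<tau>)) + K / \<tau>" using a \<tau> C k by (intro add_right_mono mult_left_mono exp_minus_le_inverse) auto
  also have "\<dots> = (C * k / a + K) / \<tau>" by (simp add: add_divide_distrib)
  finally show ?thesis by (simp add: abs_mult)
 qed
 then have "\<forall>\<^sub>F \<tau> in at_top. norm (exp (\<tau> * T) * J \<tau>) \<le> (C * k / a + K) / \<tau>" by (intro eventually_mono[OF eventually_ge_at_top[of 1]]) simp
 moreover have "((\<lambda>\<tau>. (C * k / a + K) / \<tau>) \<longlongrightarrow> 0) at_top" by (intro real_tendsto_divide_at_top[OF tendsto_const] filterlim_ident)
 ultimately show ?thesis by (rule Lim_null_comparison)
qed

text \<open>The sign \<open>s\<close> is 1 under (A1) and -1 under (A2). Since T > 2 (l +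
  \<epsilon>), the remainder has the smaller exponential and is eventually at most half of the lower
  bound for c n^2.\<close>

lemma lower_estimate:
 assumes c: "c > 0" and low: "\<And>\<tau>. \<tau> \<ge> 1 \<Longrightarrow> c * (n \<tau>)^2 - K * (exp (- \<tau> * T) / \<tau>) \<le> s * J \<tau>"
  and T: "T > 2 * l" and \<epsilon>: "\<epsilon> > 0" "2 * \<epsilon> < T - 2 * l"
 obtains k \<tau>0 where "k > 0" "\<tau>0 \<ge> 1" "\<And>\<tau>. \<tau> \<ge> \<tau>0 \<Longrightarrow> k * exp (- 2 * \<tau> * (l + \<epsilon>)) \<le> s * J \<tau>"
proof -
 define b where "b = T - 2 * (l + \<epsilon>)"
 have b: "b > 0" using \<epsilon> by (simp add: b_def)
 obtain k \<tau>0 where k: "k > 0" "\<tau>0 > 0" "\<And>\<tau>. \<tau> \<ge> \<tau>0 \<Longrightarrow> k * exp (- \<tau> * (l + \<epsilon>)) \<le> n \<tau>" using n_ge[OF \<epsilon>(1)] by blast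
 define \<tau>1 where "\<tau>1 = max (max 1 \<tau>0) (2 * K / (b * (c * k^2)))"
 show thesis
 proof
  show "c * k^2 / 2 > 0" using c k by simp
  show "\<tau>1 \<ge> 1" by (simp add: \<tau>1_def)
  fix \<tau> assume "\<tau> \<ge> \<tau>1"
  then have \<tau>: "\<tau> \<ge> 1" "\<tau> \<ge> \<tau>0" "\<tau> \<ge> 2 * K / (b * (c * k^2))" by (auto simp: \<tau>1_def)
  define E where "E = exp (- 2 * \<tau> * (l + \<epsilon>))"
  have E: "E > 0" "(exp (- \<tau> * (l + \<epsilon>)))^2 = E" "exp (- \<tau> * T) = E * exp (- (b * \<tau>))"
   by (auto simp: E_def b_def power2_eq_square exp_add[symmetric] algebra_simps)
  have "(k * exp (- \<tau> * (l + \<epsilon>)))^2 \<le> (n \<tau>)^2" using k(3)[OF \<tau>(2)] k(1) by (intro power_mono) auto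
  then have "c * (k^2 * E) \<le> c * (n \<tau>)^2" unfolding power_mult_distrib E(2) using c by simp
  moreover have "K * (exp (- \<tau> * T) / \<tau>) \<le> c * k^2 / 2 * E"
  proof -
   have "exp (- (b * \<tau>)) / \<tau> \<le> exp (- (b * \<tau>))" using \<tau> by (simp add: pos_divide_le_eq)
   also have "\<dots> \<le> 1 / (b * \<tau>)" using b \<tau> by (intro exp_minus_le_inverse) auto
   finally have "K * (exp (- (b * \<tau>)) / \<tau>) \<le> K * (1 / (b * \<tau>))" by (rule mult_left_mono[OF _ K])
   also have "\<dots> \<le> c * k^2 / 2"
   proof -
    have "2 * K \<le> \<tau> * (b * (c * k^2))" using \<tau>(3) b c k by (simp add: pos_divide_le_eq)
    then show ?thesis using b \<tau> by (simp add: pos_divide_le_eq ac_simps)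
   qed
   finally have "E * (K * (exp (- (b * \<tau>)) / \<tau>)) \<le> E * (c * k^2 / 2)" using E(1) by (intro mult_left_mono) auto
   then show ?thesis unfolding E(3) by (simp add: ac_simps)
  qed
  ultimately show "c * k^2 / 2 * exp (- 2 * \<tau> * (l + \<epsilon>)) \<le> s * J \<tau>" using low[OF \<tau>(1)] unfolding E_def[symmetric] by simp
 qed
qed

lemma filterlim_signed:
 assumes "c > 0" "\<And>\<tau>. \<tau> \<ge> 1 \<Longrightarrow> c * (n \<tau>)^2 - K * (exp (- \<tau> * T) / \<tau>) \<le> s * J \<tau>" "T > 2 * l"
 shows "filterlim (\<lambda>\<tau>. s * (exp (\<tau> * T) * J \<tau>)) at_top at_top"
proof -
 define \<epsilon> where "\<epsilon> = (T - 2 * l) / 4"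
 define b where "b = T - 2 * (l + \<epsilon>)"
 have \<epsilon>: "\<epsilon> > 0" "2 * \<epsilon> < T - 2 * l" using assms(3) by (auto simp: \<epsilon>_def)
 then have b: "b > 0" by (simp add: b_def)
 obtain k \<tau>0 where k: "k > 0" "\<tau>0 \<ge> 1" "\<And>\<tau>. \<tau> \<ge> \<tau>0 \<Longrightarrow> k * exp (- 2 * \<tau> * (l + \<epsilon>)) \<le> s * J \<tau>" using lower_estimate[OF assms \<epsilon>] by blast
 have "k * b * \<tau> \<le> s * (exp (\<tau> * T) * J \<tau>)" if "\<tau> \<ge> \<tau>0" for \<tau>
 proof -
  have "b * \<tau> \<le> exp (\<tau> * b)" using exp_ge_add_one_self[of "\<tau> * b"] mult.commute[of b \<tau>] by linarith
  then have "k * (b * \<tau>) \<le> k * exp (\<tau> * b)" using k(1) by (intro mult_left_mono) auto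
  also have "\<dots> = exp (\<tau> * T) * (k * exp (- 2 * \<tau> * (l + \<epsilon>)))" unfolding b_def exp_rate_combine[symmetric] by simp
  also have "\<dots> \<le> exp (\<tau> * T) * (s * J \<tau>)" using k(3)[OF that] by (intro mult_left_mono) auto
  finally show ?thesis by (simp add: ac_simps)
 qed
 then have "\<forall>\<^sub>F \<tau> in at_top. k * b * \<tau> \<le> s * (exp (\<tau> * T) * J \<tau>)" by (intro eventually_mono[OF eventually_ge_at_top[of \<tau>0]]) simp
 moreover have "filterlim (\<lambda>\<tau>. k * b * \<tau>) at_top at_top"
  using k(1) b by (intro filterlim_tendsto_pos_mult_at_top[OF tendsto_const] filterlim_ident) auto
 ultimately show ?thesis by (rule filterlim_at_top_mono[rotated])
qed

lemma log_limit:
 assumes low: "c > 0" "\<And>\<tau>. \<tau> \<ge> 1 \<Longrightarrow> c * (n \<tau>)^2 - K * (exp (- \<tau> * T) / \<tau>) \<le> s * J \<tau>" "T > 2 * l"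
  and s: "\<bar>s\<bar> = 1"
 shows "((\<lambda>\<tau>. 1 / \<tau> * ln \<bar>J \<tau>\<bar>) \<longlongrightarrow> - 2 * l) at_top"
proof (rule tendstoI)
 fix \<epsilon>' :: real assume \<epsilon>': "\<epsilon>' > 0"
 \<comment> \<open>After division by \<tau> the loss in the rate contributes 2 \<epsilon> \<le>
   \<epsilon>' / 2, and the logarithms of the constants, collected in \<open>m\<close>, less than
   \<epsilon>' / 4. The second bound keeps the main term ahead of the remainder.\<close>
 define \<epsilon> where "\<epsilon> = min (\<epsilon>' / 4) ((T - 2 * l) / 4)"
 have \<epsilon>: "\<epsilon> > 0" "2 * \<epsilon> < T - 2 * l" "\<epsilon> \<le> \<epsilon>' / 4" using \<epsilon>' low(3) by (auto simp: \<epsilon>_def min_def)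
 obtain k \<tau>0 where k: "k > 0" "\<tau>0 \<ge> 1" "\<And>\<tau>. \<tau> \<ge> \<tau>0 \<Longrightarrow> k * exp (- 2 * \<tau> * (l + \<epsilon>)) \<le> s * J \<tau>" using lower_estimate[OF low \<epsilon>(1,2)] by blast
 obtain k' where k': "k' > 0" "\<And>\<tau>. \<tau> \<ge> 1 \<Longrightarrow> (n \<tau>)^2 \<le> k' * exp (- 2 * \<tau> * (l - \<epsilon>))" using n_le[OF \<epsilon>(1)] by auto
 define q where "q = C * k' + K + 1"
 have q: "q > 0" using C K k'(1) by (simp add: q_def add_nonneg_pos)
 define m where "m = \<bar>ln k\<bar> + \<bar>ln q\<bar>"
 have "dist (1 / \<tau> * ln \<bar>J \<tau>\<bar>) (- 2 * l) < \<epsilon>'" if \<tau>: "\<tau> \<ge> \<tau>0" "\<tau> > 4 * m / \<epsilon>'" for \<tau>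
 proof -
  have \<tau>1: "\<tau> \<ge> 1" using \<tau> k(2) by simp
  have "s * J \<tau> \<le> \<bar>J \<tau>\<bar>" using s abs_ge_self[of "s * J \<tau>"] by (simp add: abs_mult)
  then have ge: "k * exp (- 2 * \<tau> * (l + \<epsilon>)) \<le> \<bar>J \<tau>\<bar>" using k(3)[OF \<tau>(1)] by linarith
  moreover have kpos: "0 < k * exp (- 2 * \<tau> * (l + \<epsilon>))" using k(1) by simp
  ultimately have Jpos: "\<bar>J \<tau>\<bar> > 0" by linarith
  have "ln (k * exp (- 2 * \<tau> * (l + \<epsilon>))) \<le> ln \<bar>J \<tau>\<bar>" using ge kpos Jpos by (simp only: ln_le_cancel_iff)
  then have lower: "ln k - 2 * \<tau> * (l + \<epsilon>) \<le> ln \<bar>J \<tau>\<bar>" using k(1) by (simp add: ln_mult)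
  have "\<bar>J \<tau>\<bar> \<le> q * exp (- 2 * \<tau> * (l - \<epsilon>))"
  proof -
   have "exp (- \<tau> * T) / \<tau> \<le> exp (- \<tau> * T)" using \<tau>1 by (simp add: pos_divide_le_eq)
   also have "\<dots> \<le> exp (- 2 * \<tau> * (l - \<epsilon>))"
   proof -
    have "\<tau> * (2 * (l - \<epsilon>)) \<le> \<tau> * T" using \<epsilon>(1) low(3) \<tau>1 by (intro mult_left_mono) auto
    then show ?thesis by (simp add: algebra_simps)
   qed
   finally have "K * (exp (- \<tau> * T) / \<tau>) \<le> K * exp (- 2 * \<tau> * (l - \<epsilon>))" by (rule mult_left_mono[OF _ K])
   moreover have "C * (n \<tau>)^2 \<le> C * (k' * exp (- 2 * \<tau> * (l - \<epsilon>)))" by (rule mult_left_mono[OF k'(2)[OF \<tau>1] C])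
   moreover have "q * exp (- 2 * \<tau> * (l - \<epsilon>)) =
     C * (k' * exp (- 2 * \<tau> * (l - \<epsilon>))) + K * exp (- 2 * \<tau> * (l - \<epsilon>)) + exp (- 2 * \<tau> * (l - \<epsilon>))"
    unfolding q_def by (simp only: distrib_right mult.assoc mult_1)
   moreover have "exp (- 2 * \<tau> * (l - \<epsilon>)) > 0" by simp
   ultimately show ?thesis using J_le[OF \<tau>1] by linarith
  qed
  then have "ln \<bar>J \<tau>\<bar> \<le> ln (q * exp (- 2 * \<tau> * (l - \<epsilon>)))" using Jpos q by (subst ln_le_cancel_iff) auto
  then have upper: "ln \<bar>J \<tau>\<bar> \<le> ln q - 2 * \<tau> * (l - \<epsilon>)" using q by (simp add: ln_mult)
  have "\<tau> * \<epsilon> \<le> \<tau> * (\<epsilon>' / 4)" using \<epsilon>(3) \<tau>1 by (intro mult_left_mono) auto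
  moreover have "m < \<tau> * \<epsilon>' / 4" using \<tau>(2) \<epsilon>' by (simp add: pos_divide_less_eq)
  moreover have "\<tau> * \<epsilon>' > 0" using \<tau>1 \<epsilon>' by simp
  ultimately have "\<bar>ln \<bar>J \<tau>\<bar> + 2 * \<tau> * l\<bar> < \<tau> * \<epsilon>'"
   using lower upper unfolding m_def by (simp add: distrib_left right_diff_distrib abs_less_iff) linarith
  moreover have "1 / \<tau> * ln \<bar>J \<tau>\<bar> - (- 2 * l) = (ln \<bar>J \<tau>\<bar> + 2 * \<tau> * l) / \<tau>" using \<tau>1 by (simp add: field_simps)
  ultimately show ?thesis using \<tau>1 by (simp add: dist_real_def pos_divide_less_eq mult.commute)
 qed
 then show "\<forall>\<^sub>F \<tau> in at_top. dist (1 / \<tau> * ln \<bar>J \<tau>\<bar>) (- 2 * l) < \<epsilon>'"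
  by (intro eventually_mono[OF eventually_conj[OF eventually_ge_at_top[of \<tau>0] eventually_gt_at_top[of "4 * m / \<epsilon>'"]]]) simp
qed

end

section \<open>Proof of the theorem\<close>

text \<open>The complement of the support is a union of possibly uncountably many open sets on which
  \<open>f\<close> vanishes almost everywhere; Lindelof's theorem extracts a countable subfamily
  with the same union, so the exceptional sets add up to a null set.\<close>

lemma ess_support_AE:
 assumes S: "ess_support f \<subseteq> S" "closed S"
 shows "AE x in lebesgue. x \<notin> S \<longrightarrow> f x = 0"
proof -
 let ?F = "{U. open U \<and> (AE y in lebesgue. y \<in> U \<longrightarrow> f y = 0)}"
 obtain F' where F': "F' \<subseteq> ?F" "countable F'" "\<Union>F' = \<Union>?F" using Lindelof[of ?F] by (metis (mono_tags, lifting) mem_Collect_eq)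
 have cover: "x \<in> \<Union>F'" if "x \<notin> S" for x using that S(1) unfolding F'(3) ess_support_def by auto
 have "AE y in lebesgue. \<forall>U\<in>F'. y \<in> U \<longrightarrow> f y = 0" using F'(1,2) by (subst AE_ball_countable) auto
 then show ?thesis by eventually_elim (use cover in blast)
qed

lemma gradient_lower_bound_positive_source:
 assumes \<gamma>: "0 < gp" "gp < gm" and f: "square_integrable f" "AE x in lebesgue. x \<notin> closure (ball c r) \<longrightarrow> f x = 0"
  and C0: "C0 > 0" "AE x in lebesgue. x \<in> ball c r \<longrightarrow> C0 \<le> f x" and r: "r > 0" and upper: "closure (ball c r) \<subseteq> {x. x $ 3 > 0}"
  and D: "D \<noteq> {}" "open D" "D \<subseteq> {x. x $ 3 < 0}"
  and sol: "\<And>\<tau>. \<tau> > 0 \<Longrightarrow> layered_solution gp gm \<tau> f (v \<tau>) (V \<tau>)" and \<epsilon>: "\<epsilon> > 0"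
 shows "\<exists>k>0. \<exists>\<tau>0>0. \<forall>\<tau>\<ge>\<tau>0. k * exp (- \<tau> * (optical_set_distance gp gm D (ball c r) + \<epsilon>)) \<le> l2norm (\<lambda>x. indicator D x *\<^sub>R V \<tau> x)"
proof -
 \<comment> \<open>The hypotheses leave the sign of \<open>f\<close> open on the sphere bounding the
   ball, which is a null set.\<close>
 have "AE x in lebesgue. x \<notin> sphere c r" using negligible_sphere[of c r] by (intro AE_not_in) (simp add: negligible_iff_null_sets)
 then have f0: "AE x in lebesgue. 0 \<le> f x" using f(2) C0(2)
 proof eventually_elim
  case (elim x)
  show ?case
  proof (cases "x \<in> ball c r")
   case False
   then have "x \<notin> closure (ball c r)" using elim(1) r by (auto simp: sphere_def)
   then show ?thesis using elim by simp
  qed (use elim C0(1) in auto)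
 qed
 interpret layered_family gp gm f v V using \<gamma> f(1) f0 sol by unfold_locales
 have gm: "0 < gm" using \<gamma> by linarith
 have B: "ball c r \<noteq> {}" using r by simp
 have up: "x $ 3 > 0" if "x \<in> ball c r" for x using that upper closure_subset by blast
 \<comment> \<open>One third of \<epsilon> each for a nearly optimal path, for the propagation along
   it, and for the passage from \<open>v\<close> to its gradient.\<close>
 obtain p y z where p: "p \<in> D" and y: "y \<in> ball c r"
  and len: "optical_length gp gm p y z < optical_set_distance gp gm D (ball c r) + \<epsilon> / 3"
  using optical_set_distance_approx[OF \<gamma>(1) gm D(1) B, of "\<epsilon> / 3"] \<epsilon> by auto
 have p3: "p $ 3 < 0" using p D(3) by auto
 obtain d where d: "d > 0" "ball p d \<subseteq> D" using p D(2) openE by blast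
 obtain \<zeta>0 where \<zeta>0: "\<zeta>0 > 0" "\<And>\<zeta>. 0 < \<zeta> \<Longrightarrow> \<zeta> < \<zeta>0 \<Longrightarrow> lower_bounded v (ball p \<zeta>) (optical_length gp gm p y z + \<epsilon> / 3)"
  using lower_bounded_optical[OF C0 up y p3, where e = "\<epsilon> / 3" and z = z] \<epsilon> by auto
 define \<zeta> where "\<zeta> = min d (\<zeta>0 / 2)"
 have \<zeta>: "\<zeta> > 0" "\<zeta> < \<zeta>0" "ball p \<zeta> \<subseteq> D" using d \<zeta>0(1) by (auto simp: \<zeta>_def)
 have fD: "AE x in lebesgue. x \<in> D \<longrightarrow> f x = 0" using f(2) by eventually_elim (use upper D(3) in force)
 obtain k \<tau>0 where k: "k > 0" "\<tau>0 > 0"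
  "\<And>\<tau>. \<tau> \<ge> \<tau>0 \<Longrightarrow> k * exp (- \<tau> * (optical_length gp gm p y z + \<epsilon> / 3 + \<epsilon> / 3)) \<le> l2norm (\<lambda>x. indicator D x *\<^sub>R V \<tau> x)"
  using gradient_lower_bound[OF \<zeta>0(2)[OF \<zeta>(1,2)] \<zeta>(1,3) _ fD, of "\<epsilon> / 3"] D \<epsilon> by auto
 have "k * exp (- \<tau> * (optical_set_distance gp gm D (ball c r) + \<epsilon>)) \<le> l2norm (\<lambda>x. indicator D x *\<^sub>R V \<tau> x)" if "\<tau> \<ge> \<tau>0" for \<tau>
 proof -
  have "\<tau> * (optical_length gp gm p y z + \<epsilon> / 3 + \<epsilon> / 3) \<le> \<tau> * (optical_set_distance gp gm D (ball c r) + \<epsilon>)"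
   using len that k(2) by (intro mult_left_mono) auto
  then have "k * exp (- \<tau> * (optical_set_distance gp gm D (ball c r) + \<epsilon>)) \<le> k * exp (- \<tau> * (optical_length gp gm p y z + \<epsilon> / 3 + \<epsilon> / 3))"
   using k(1) by (intro mult_left_mono) auto
  then show ?thesis using k(3)[OF that] by linarith
 qed
 then show ?thesis using k(1,2) by blast
qed

lemma matrix_entry_bound:
 fixes A :: "real^3^3"
 assumes "\<And>i j. \<bar>A $ i $ j\<bar> \<le> m i j"
 shows "norm (A *v \<xi>) \<le> (\<Sum>i\<in>UNIV. \<Sum>j\<in>UNIV. m i j) * norm \<xi>"
proof -
 have "norm (A *v \<xi>) \<le> (\<Sum>i\<in>UNIV. \<bar>(A *v \<xi>) $ i\<bar>)" by (rule norm_le_l1_cart)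
 also have "\<dots> \<le> (\<Sum>i\<in>UNIV. \<Sum>j\<in>UNIV. m i j * norm \<xi>)"
 proof (rule sum_mono)
  fix i :: 3
  have "\<bar>(A *v \<xi>) $ i\<bar> \<le> (\<Sum>j\<in>UNIV. \<bar>A $ i $ j * \<xi> $ j\<bar>)" by (simp add: matrix_vector_mult_def sum_abs)
  also have "\<dots> \<le> (\<Sum>j\<in>UNIV. m i j * norm \<xi>)" unfolding abs_mult using assms component_le_norm_cart[of \<xi>]
   by (intro sum_mono mult_mono) (auto intro: order_trans[OF abs_ge_zero])
  finally show "\<bar>(A *v \<xi>) $ i\<bar> \<le> (\<Sum>j\<in>UNIV. m i j * norm \<xi>)" .
 qed
 finally show ?thesis by (simp add: sum_distrib_right)
qed

lemma layered_perturbation_gamma: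
 assumes pos: "gp > 0" "gm > 0" and D: "open D"
  and sym: "\<forall>x\<in>D. transpose (h x) = h x"
  and meas: "\<forall>i j. (\<lambda>x. h x $ i $ j) \<in> borel_measurable (lebesgue_on D)"
  and bnd: "\<forall>i j. \<exists>M. AE x in lebesgue. x \<in> D \<longrightarrow> \<bar>h x $ i $ j\<bar> \<le> M"
  and ell: "\<exists>C>0. AE x in lebesgue. x \<in> D \<longrightarrow> (\<forall>\<xi>. ((mat (gamma0 gp gm x) + h x) *v \<xi>) \<bullet> \<xi> \<ge> C * (norm \<xi>)^2)"
 obtains M c1 where "layered_perturbation (\<lambda>x. if x \<in> D then h x else 0) M gp gm c1 D"
proof -
 let ?H = "\<lambda>x. if x \<in> D then h x else 0"
 have Ds: "D \<in> sets lebesgue" using D by simp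
 define m where "m i j = (SOME M. AE x in lebesgue. x \<in> D \<longrightarrow> \<bar>h x $ i $ j\<bar> \<le> M)" for i j
 have m: "AE x in lebesgue. x \<in> D \<longrightarrow> \<bar>h x $ i $ j\<bar> \<le> m i j" for i j unfolding m_def by (rule someI_ex) (use bnd in blast)
 obtain C where C: "C > 0" "AE x in lebesgue. x \<in> D \<longrightarrow> (\<forall>\<xi>. ((mat (gamma0 gp gm x) + h x) *v \<xi>) \<bullet> \<xi> \<ge> C * (norm \<xi>)^2)" using ell by blast
 define M where "M = (\<Sum>i\<in>UNIV. \<Sum>j\<in>UNIV. \<bar>m i j\<bar>)"
 \<comment> \<open>Ellipticity holds with \<open>C\<close> inside \<open>D\<close> and with the
   smaller layer coefficient outside, whence the minimum.\<close>
 have "layered_perturbation ?H M gp gm (min C (min gp gm)) D"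
 proof
  show "(\<lambda>x. ?H x $ i $ j) \<in> borel_measurable lebesgue" for i j
  proof -
   have "(\<lambda>x. if x \<in> D then h x $ i $ j else 0) \<in> borel_measurable lebesgue" using meas Ds by (simp add: borel_measurable_if)
   moreover have "(\<lambda>x. ?H x $ i $ j) = (\<lambda>x. if x \<in> D then h x $ i $ j else 0)" by auto
   ultimately show ?thesis by simp
  qed
  have "AE x in lebesgue. \<forall>i j. x \<in> D \<longrightarrow> \<bar>h x $ i $ j\<bar> \<le> m i j" using m by (intro eventually_all_finite) auto
  then show "AE x in lebesgue. \<forall>\<xi>. norm (?H x *v \<xi>) \<le> M * norm \<xi>"
  proof eventually_elim
   case (elim x)
   then have "\<bar>?H x $ i $ j\<bar> \<le> \<bar>m i j\<bar>" for i j by (auto intro: order_trans[OF _ abs_ge_self])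
   then show ?case unfolding M_def by (intro allI matrix_entry_bound)
  qed
  show "0 \<le> M" by (simp add: M_def sum_nonneg)
  show "gp > 0" "gm > 0" "D \<in> sets lebesgue" "min C (min gp gm) > 0" using pos Ds C(1) by auto
  show "?H x = 0" if "x \<notin> D" for x using that by simp
  show "(?H x *v \<xi>) \<bullet> \<eta> = (?H x *v \<eta>) \<bullet> \<xi>" for x \<xi> \<eta>
  proof (cases "x \<in> D")
   case True
   then have "h x *v \<xi> = \<xi> v* h x" using sym transpose_matrix_vector[of "h x" \<xi>] by simp
   then have "(h x *v \<xi>) \<bullet> \<eta> = \<xi> \<bullet> (h x *v \<eta>)" by (simp add: dot_lmul_matrix)
   then show ?thesis using True by (simp add: inner_commute)
  qed simp
  show "AE x in lebesgue. \<forall>\<xi>. min C (min gp gm) * (norm \<xi>)^2 \<le> gamma0 gp gm x * (\<xi> \<bullet> \<xi>) + (?H x *v \<xi>) \<bullet> \<xi>" using C(2)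
  proof eventually_elim
   case (elim x)
   show ?case
   proof
    fix \<xi> :: space
    show "min C (min gp gm) * (norm \<xi>)^2 \<le> gamma0 gp gm x * (\<xi> \<bullet> \<xi>) + (?H x *v \<xi>) \<bullet> \<xi>"
    proof (cases "x \<in> D")
     case True
     have "min C (min gp gm) * (norm \<xi>)^2 \<le> C * (norm \<xi>)^2" by (intro mult_right_mono) auto
     also have "\<dots> \<le> ((mat (gamma0 gp gm x) + h x) *v \<xi>) \<bullet> \<xi>" using elim True by blast
     finally show ?thesis using True by (simp add: matrix_vector_mult_add_rdistrib mat_vector_mult inner_add_left)
    next
     case False
     have "min C (min gp gm) * (norm \<xi>)^2 \<le> gamma0 gp gm x * (norm \<xi>)^2"
      using gamma0_bounds(2)[OF pos, of x] by (intro mult_right_mono) auto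
     then show ?thesis using False by (simp add: power2_norm_eq_inner)
    qed
   qed
  qed
 qed
 then show thesis by (rule that)
qed

theorem theorem1p1:
  fixes \<gamma>p \<gamma>m T r :: real
    and D B :: "(real^3) set"
    and h :: "real^3 \<Rightarrow> real^3^3"
    and c :: "real^3"
    and f :: "real^3 \<Rightarrow> real"
    and u :: "real \<Rightarrow> real^3 \<Rightarrow> real"
    and w v :: "real \<Rightarrow> real^3 \<Rightarrow> real"
    and I :: "real \<Rightarrow> real"
    and l :: real
  assumes "\<gamma>p > 0" and "\<gamma>m > 0" and "\<gamma>p < \<gamma>m"
    and "D \<noteq> {}" and "bounded D" and "open D" and "C2_boundary D"
    and "closure D \<subseteq> {x. x $ 3 < 0}"
    and "\<forall>x\<in>D. transpose (h x) = h x"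
    and "\<forall>i j. (\<lambda>x. h x $ i $ j) \<in> borel_measurable (lebesgue_on D)"
    and "\<forall>i j. \<exists>M. AE x in lebesgue. x \<in> D \<longrightarrow> \<bar>h x $ i $ j\<bar> \<le> M"
    and "\<exists>C>0. AE x in lebesgue. x \<in> D \<longrightarrow>
           (\<forall>\<xi>. ((mat (gamma0 \<gamma>p \<gamma>m x) + h x) *v \<xi>) \<bullet> \<xi> \<ge> C * (norm \<xi>)^2)"
    and "r > 0" and "B = ball c r" and "closure B \<subseteq> {x. x $ 3 > 0}"
    and "f \<in> L2" and "ess_support f \<subseteq> closure B"
    and "\<exists>C0>0. (AE x in lebesgue. x \<in> B \<longrightarrow> f x \<ge> C0) \<or> (AE x in lebesgue. x \<in> B \<longrightarrow> - f x \<ge> C0)"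
    and "T > 0"
    and "wave_weak_solution (gamma \<gamma>p \<gamma>m D h) T f u"
    and "\<forall>\<tau>>0. is_time_transform T \<tau> u (w \<tau>)"
    and "\<forall>\<tau>>0. elliptic_weak_solution (gamma0 \<gamma>p \<gamma>m) \<tau> f (v \<tau>)"
  defines "I \<equiv> \<lambda>\<tau>. indicator_function f (w \<tau>) (v \<tau>)"
    and "l \<equiv> optical_set_distance \<gamma>p \<gamma>m D B"
  shows "(T < 2 * l \<longrightarrow> ((\<lambda>\<tau>. exp (\<tau> * T) * I \<tau>) \<longlongrightarrow> 0) at_top) \<and>
         (T > 2 * l \<and> A1 D h \<longrightarrow> filterlim (\<lambda>\<tau>. exp (\<tau> * T) * I \<tau>) at_top at_top) \<and>
         (T > 2 * l \<and> A2 D h \<longrightarrow> filterlim (\<lambda>\<tau>. exp (\<tau> * T) * I \<tau>) at_bot at_top) \<and>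
         ((A1 D h \<or> A2 D h) \<and> T > 2 * l \<longrightarrow>
            ((\<lambda>\<tau>. 1 / \<tau> * ln \<bar>I \<tau>\<bar>) \<longlongrightarrow> - 2 * l) at_top)"
proof -
 note pos = assms(1,2) and \<gamma> = assms(1,3) and D = assms(4-6) and lower = assms(8) and B = assms(14)
 have f: "square_integrable f" using assms(16) by (simp add: L2_def)
 have fB: "AE x in lebesgue. x \<notin> closure B \<longrightarrow> f x = 0" by (rule ess_support_AE[OF assms(17)]) simp
 have low: "x $ 3 < 0" if "x \<in> D" for x using that lower closure_subset by blast
 \<comment> \<open>Extended by 0, \<open>h\<close> becomes a coefficient on the whole space, and
   \<gamma> is the layered background plus this perturbation.\<close>
 let ?H = "\<lambda>x. if x \<in> D then h x else 0"
 obtain M c1 where "layered_perturbation ?H M \<gamma>p \<gamma>m c1 D" using layered_perturbation_gamma[OF pos D(3) assms(9-12)] by blast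
 then interpret P: layered_perturbation ?H M \<gamma>p \<gamma>m c1 D .
 define V where "V \<tau> = weak_gradient (v \<tau>)" for \<tau>
 have sol: "layered_solution \<gamma>p \<gamma>m \<tau> f (v \<tau>) (V \<tau>)" if "\<tau> > 0" for \<tau>
  using elliptic_imp_layered_solution[OF _ pos] assms(22) that by (simp add: V_def)
 have I_eq: "I \<tau> = (LINT x|lebesgue. f x * (w \<tau> x - v \<tau> x))" for \<tau> by (simp add: I_def indicator_function_def)
 have split: "gamma \<gamma>p \<gamma>m D h x = mat (gamma0 \<gamma>p \<gamma>m x) + ?H x" for x by (simp add: gamma_def)
 define n where "n \<tau> = l2norm (\<lambda>x. indicator D x *\<^sub>R V \<tau> x)" for \<tau>
 have w: "is_time_transform T \<tau> u (w \<tau>)" if "\<tau> > 0" for \<tau> using assms(21) that by blast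
 obtain C K where CK: "C \<ge> 0" "K \<ge> 0"
  "\<And>\<tau>. \<tau> \<ge> 1 \<Longrightarrow> \<bar>I \<tau>\<bar> \<le> C * (n \<tau>)^2 + K * (exp (- \<tau> * T) / \<tau>)"
  and below: "\<And>\<tau> C'. \<tau> \<ge> 1 \<Longrightarrow> AE x in lebesgue. x \<in> D \<longrightarrow> (\<forall>\<xi>. - ((?H x *v \<xi>) \<bullet> \<xi>) \<ge> C' * (norm \<xi>)^2) \<Longrightarrow>
   C' * (n \<tau>)^2 - K * (exp (- \<tau> * T) / \<tau>) \<le> I \<tau>"
  and above: "\<And>\<tau> C'. \<tau> \<ge> 1 \<Longrightarrow> C' \<ge> 0 \<Longrightarrow> AE x in lebesgue. x \<in> D \<longrightarrow> (\<forall>\<xi>. (?H x *v \<xi>) \<bullet> \<xi> \<ge> C' * (norm \<xi>)^2) \<Longrightarrow>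
   min C' (min \<gamma>p \<gamma>m) / 2 * (n \<tau>)^2 - K * (exp (- \<tau> * T) / \<tau>) \<le> - I \<tau>"
  using P.indicator_asymptotics[OF split assms(20,19) f w sol, folded I_eq n_def] by blast
 have upper_rate: "\<exists>k>0. \<forall>\<tau>\<ge>1. (n \<tau>)^2 \<le> k * exp (- 2 * \<tau> * (l - \<epsilon>))" if \<epsilon>: "\<epsilon> > 0" for \<epsilon>
 proof -
  have Bs: "B \<noteq> {}" "bounded B" "\<And>x. x \<in> closure B \<Longrightarrow> x $ 3 > 0" "D \<in> sets lebesgue" using assms(13-15) D(3) by auto
  obtain k where k: "k > 0" "\<And>\<tau> v V. \<tau> \<ge> 1 \<Longrightarrow> layered_solution \<gamma>p \<gamma>m \<tau> f v V \<Longrightarrow>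
    (l2norm (\<lambda>x. indicator D x *\<^sub>R V x))^2 \<le> k * exp (- 2 * \<tau> * (l - \<epsilon>))"
   unfolding l_def using gradient_upper_bound[OF pos D(1) Bs(4) D(2) low Bs(1-3) f fB \<epsilon>] by blast
  show ?thesis unfolding n_def
  proof (intro exI[of _ k] conjI allI impI k)
   show "\<tau> \<ge> 1 \<Longrightarrow> layered_solution \<gamma>p \<gamma>m \<tau> f (v \<tau>) (V \<tau>)" for \<tau> by (rule sol) simp
  qed
 qed
 have lower_rate: "\<exists>k>0. \<exists>\<tau>0>0. \<forall>\<tau>\<ge>\<tau>0. k * exp (- \<tau> * (l + \<epsilon>)) \<le> n \<tau>" if \<epsilon>: "\<epsilon> > 0" for \<epsilon>
 proof -
  have Dl: "D \<subseteq> {x. x $ 3 < 0}" using low by auto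
  obtain C0 where C0: "C0 > 0" "(AE x in lebesgue. x \<in> B \<longrightarrow> f x \<ge> C0) \<or> (AE x in lebesgue. x \<in> B \<longrightarrow> - f x \<ge> C0)" using assms(18) by blast
  \<comment> \<open>The equation is linear, so a negative source is treated by the positive case
    applied to -f and -v; the norm of the gradient is unaffected.\<close>
  from C0(2) show ?thesis
  proof
   assume "AE x in lebesgue. x \<in> B \<longrightarrow> f x \<ge> C0"
   from gradient_lower_bound_positive_source[OF \<gamma> f fB[unfolded B] C0(1) this[unfolded B] assms(13) assms(15)[unfolded B] D(1,3) Dl sol \<epsilon>]
   show ?thesis unfolding n_def l_def B by blast
  next
   assume neg: "AE x in lebesgue. x \<in> B \<longrightarrow> - f x \<ge> C0"
   have fB': "AE x in lebesgue. x \<notin> closure (ball c r) \<longrightarrow> - f x = 0" using fB unfolding B by simp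
   from gradient_lower_bound_positive_source[OF \<gamma> square_integrable_minus[OF f] fB' C0(1) neg[unfolded B] assms(13) assms(15)[unfolded B] D(1,3) Dl layered_solution_minus[OF sol] \<epsilon>]
   show ?thesis unfolding n_def l_def B by (simp add: l2norm_minus)
  qed
 qed
 \<comment> \<open>From here on only the behaviour in \<tau> matters; (A1) and (A2) enter as the
   same coercive lower bound for I and for -I.\<close>
 interpret indicator_rates I n T l C K using CK upper_rate lower_rate by unfold_locales
 have A1: "\<exists>k>0. \<forall>\<tau>\<ge>1. k * (n \<tau>)^2 - K * (exp (- \<tau> * T) / \<tau>) \<le> 1 * I \<tau>" if A1: "A1 D h"
 proof -
  obtain C' where C': "C' > 0" "AE x in lebesgue. x \<in> D \<longrightarrow> (\<forall>\<xi>. - ((h x *v \<xi>) \<bullet> \<xi>) \<ge> C' * (norm \<xi>)^2)" using A1 unfolding A1_def by blast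
  have "AE x in lebesgue. x \<in> D \<longrightarrow> (\<forall>\<xi>. - ((?H x *v \<xi>) \<bullet> \<xi>) \<ge> C' * (norm \<xi>)^2)" using C'(2) by eventually_elim simp
  from below[OF _ this] C'(1) show ?thesis by auto
 qed
 have A2: "\<exists>k>0. \<forall>\<tau>\<ge>1. k * (n \<tau>)^2 - K * (exp (- \<tau> * T) / \<tau>) \<le> (- 1) * I \<tau>" if A2: "A2 D h"
 proof -
  obtain C' where C': "C' > 0" "AE x in lebesgue. x \<in> D \<longrightarrow> (\<forall>\<xi>. (h x *v \<xi>) \<bullet> \<xi> \<ge> C' * (norm \<xi>)^2)" using A2 unfolding A2_def by blast
  have "AE x in lebesgue. x \<in> D \<longrightarrow> (\<forall>\<xi>. (?H x *v \<xi>) \<bullet> \<xi> \<ge> C' * (norm \<xi>)^2)" using C'(2) by eventually_elim simp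
  from above[OF _ _ this] C'(1) pos show ?thesis by (intro exI[of _ "min C' (min \<gamma>p \<gamma>m) / 2"]) auto
 qed
 show ?thesis
 proof (intro conjI impI)
  assume "T < 2 * l"
  then show "((\<lambda>\<tau>. exp (\<tau> * T) * I \<tau>) \<longlongrightarrow> 0) at_top" by (rule tendsto_zero)
 next
  assume *: "T > 2 * l \<and> A1 D h"
  then obtain k where "k > 0" "\<And>\<tau>. \<tau> \<ge> 1 \<Longrightarrow> k * (n \<tau>)^2 - K * (exp (- \<tau> * T) / \<tau>) \<le> 1 * I \<tau>" using A1 by blast
  from filterlim_signed[OF this] * show "filterlim (\<lambda>\<tau>. exp (\<tau> * T) * I \<tau>) at_top at_top" by simp
 next
  assume *: "T > 2 * l \<and> A2 D h"
  then obtain k where "k > 0" "\<And>\<tau>. \<tau> \<ge> 1 \<Longrightarrow> k * (n \<tau>)^2 - K * (exp (- \<tau> * T) / \<tau>) \<le> (- 1) * I \<tau>" using A2 by blast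
  from filterlim_signed[OF this] * show "filterlim (\<lambda>\<tau>. exp (\<tau> * T) * I \<tau>) at_bot at_top" by (simp add: filterlim_uminus_at_bot)
 next
  assume *: "(A1 D h \<or> A2 D h) \<and> T > 2 * l"
  then obtain k s where "k > 0" "\<And>\<tau>. \<tau> \<ge> 1 \<Longrightarrow> k * (n \<tau>)^2 - K * (exp (- \<tau> * T) / \<tau>) \<le> s * I \<tau>" "\<bar>s\<bar> = 1"
   using A1 A2 by (metis abs_minus_cancel abs_one)
  from log_limit[OF this(1,2) _ this(3)] * show "((\<lambda>\<tau>. 1 / \<tau> * ln \<bar>I \<tau>\<bar>) \<longlongrightarrow> - 2 * l) at_top" by blast
 qed
qed

end
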